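(* Let $k$ be a field, let $Q$ be the quiver $1\to 2\to 3\to 4\to 5$, and let $A$ be the quotient of the path algebra $kQ$ by the ideal generated by all paths of length $2$ in $Q$. Let $\operatorname{mod} A$ be the category of finite dimensional right $A$-modules and $\mathrm{D}^b(\operatorname{mod} A)$ its bounded derived category, with shift functor $[1]$. For $1\le i\le 5$ let $S_i$ be the simple $A$-module at vertex $i$, and for $1\le i\le 4$ let $M_{i,i+1}$ be the (unique up to isomorphism) uniserial $A$-module of length $2$ with top $S_i$ and socle $S_{i+1}$. Put $$\mathcal{M}(A):=\operatorname{add}\left(S_5\oplus M_{4,5}\oplus M_{3,4}\oplus S_3\oplus M_{2,3}\oplus M_{1,2}\oplus S_1\right)\subseteq \operatorname{mod} A$$ and $$\mathcal{U}(A):=\operatorname{add}\left\{M[2i]\in \mathrm{D}^b(\operatorname{mod} A)\ \middle|\ M\in\mathcal{M}(A)\text{ and } i\in\mathbb{Z}\right\}.$$ Let $\mathcal{U}$ be a rigid subcategory of $\mathrm{D}^b(\operatorname{mod} A)$ containing $\mathcal{M}(A)$ and satisfying $\mathcal{U}[2]=\mathcal{U}$. Then $\mathcal{U}=\mathcal{U}(A)$. Moreover, $\mathcal{U}(A)$ is not a $2$-cluster-tilting subcategory of $\mathrm{D}^b(\operatorname{mod} A)$, and $\mathcal{U}(A)$ is not a $4$-angulated category with suspension induced by the second power $[2]$ of the shift functor of $\mathrm{D}^b(\operatorname{mod} A)$ (that is, there is no class of $4$-angles making $(\mathcal{U}(A),[2])$ a $4$-angulated category).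
   Context: Module convention: right $A$-modules are taken with the convention for which the indecomposable projective module $P_i$ at vertex $i$ has top $S_i$ and, for $i\le 4$, socle $S_{i+1}$; thus $P_i=M_{i,i+1}$ for $i\le 4$ and $P_5=S_5$. Modules are regarded as objects of $\mathrm{D}^b(\operatorname{mod} A)$ via stalk complexes in degree $0$. Subcategories: all subcategories are full and closed under isomorphisms, finite direct sums and direct summands. For an object or a class of objects $\mathcal{X}$, $\operatorname{add}\mathcal{X}$ is the full subcategory of all direct summands of finite direct sums of objects of $\mathcal{X}$. Rigid: a subcategory $\mathcal{U}$ of a triangulated category $\mathcal{T}$ with shift $[1]$ is rigid if $\operatorname{Hom}_{\mathcal{T}}(U,V[1])=0$ for all $U,V\in\mathcal{U}$. $2$-cluster-tilting: a subcategory $\mathcal{U}$ of $\mathcal{T}$ is $2$-cluster-tilting if it is functorially finite in $\mathcal{T}$ (every object of $\mathcal{T}$ admits a left and a right $\mathcal{U}$-approximation) and $$\mathcal{U}=\{X\in\mathcal{T}\mid \operatorname{Hom}_{\mathcal{T}}(U,X[1])=0\ \forall U\in\mathcal{U}\}=\{X\in\mathcal{T}\mid \operatorname{Hom}_{\mathcal{T}}(X,U[1])=0\ \forall U\in\mathcal{U}\}.$$ $4$-angulated category (Geiss–Keller–Oppermann): an additive category $\mathcal{F}$ with an automorphism $\Sigma$ (the suspension) and a class of sequences, called $4$-angles, of the form $X_1\xrightarrow{\alpha_1}X_2\xrightarrow{\alpha_2}X_3\xrightarrow{\alpha_3}X_4\xrightarrow{\alpha_4}\Sigma X_1$ in $\mathcal{F}$,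 such that: (F1) (a) the class of $4$-angles is closed under isomorphisms, direct sums and direct summands; (b) for each $X\in\mathcal{F}$ the sequence $X\xrightarrow{1}X\to 0\to 0\to\Sigma X$ is a $4$-angle; (c) every morphism $\alpha_1\colon X_1\to X_2$ in $\mathcal{F}$ is the first morphism of some $4$-angle. (F2) A sequence $X_1\xrightarrow{\alpha_1}X_2\xrightarrow{\alpha_2}X_3\xrightarrow{\alpha_3}X_4\xrightarrow{\alpha_4}\Sigma X_1$ is a $4$-angle if and only if $X_2\xrightarrow{\alpha_2}X_3\xrightarrow{\alpha_3}X_4\xrightarrow{\alpha_4}\Sigma X_1\xrightarrow{\Sigma\alpha_1}\Sigma X_2$ is a $4$-angle. (F3) Given two $4$-angles $(X_\bullet,\alpha_\bullet)$ and $(Y_\bullet,\beta_\bullet)$ and morphisms $\varphi_1\colon X_1\to Y_1$, $\varphi_2\colon X_2\to Y_2$ with $\varphi_2\alpha_1=\beta_1\varphi_1$, there are $\varphi_3\colon X_3\to Y_3$ and $\varphi_4\colon X_4\to Y_4$ such that $(\varphi_1,\varphi_2,\varphi_3,\varphi_4)$ is a morphism of sequences, i.e. $\varphi_{i+1}\alpha_i=\beta_i\varphi_i$ for $i=1,2,3$ and $(\Sigma\varphi_1)\alpha_4=\beta_4\varphi_4$. (F4) In the situation of (F3), $\varphi_3,\varphi_4$ can be chosen so that the mapping cone $$X_2\oplus Y_1\to X_3\oplus Y_2\to X_4\oplus Y_3\to\Sigma X_1\oplus Y_4\to\Sigma X_2\oplus\Sigma Y_1$$ is a $4$-angle, where the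 first three maps are $\begin{pmatrix}-\alpha_{i+1}&0\\ \varphi_{i+1}&\beta_i\end{pmatrix}$ for $i=1,2,3$, and the last map is $\begin{pmatrix}-\Sigma\alpha_1&0\\ \Sigma\varphi_1&\beta_4\end{pmatrix}$. For $\mathcal{F}=\mathcal{U}(A)$ the suspension $\Sigma$ is the restriction of $[2]$ to $\mathcal{U}(A)$, which satisfies $\mathcal{U}(A)[2]=\mathcal{U}(A)$. *)

theory Defs
  imports "HOL-Algebra.QuotRing" "HOL-Library.Function_Algebras" "Graph_Theory.Arc_Walk"
begin

section \<open>Preadditive categories\<close>

text \<open>
  A (pre)additive category is given by its data: objects, morphism sets, identities,
  composition (\<open>Comp C g f\<close> is \<open>g\<close> after \<open>f\<close>), and the addition, zeros and negatives
  of the morphism groups.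
\<close>

record ('o, 'm) precat =
  Ob :: "'o set"
  Mor :: "'o \<Rightarrow> 'o \<Rightarrow> 'm set"
  Ident :: "'o \<Rightarrow> 'm"
  Comp :: "'m \<Rightarrow> 'm \<Rightarrow> 'm"
  Plus :: "'m \<Rightarrow> 'm \<Rightarrow> 'm"
  Zero :: "'o \<Rightarrow> 'o \<Rightarrow> 'm"
  Neg :: "'m \<Rightarrow> 'm"

definition is_iso :: "('o, 'm) precat \<Rightarrow> 'o \<Rightarrow> 'o \<Rightarrow> 'm \<Rightarrow> bool" where
  "is_iso C X Y f \<longleftrightarrow> f \<in> Mor C X Y \<and>
     (\<exists>g\<in>Mor C Y X. Comp C g f = Ident C X \<and> Comp C f g = Ident C Y)"

definition isomorphic :: "('o, 'm) precat \<Rightarrow> 'o \<Rightarrow> 'o \<Rightarrow> bool" where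
  "isomorphic C X Y \<longleftrightarrow> (\<exists>f. is_iso C X Y f)"

definition is_zero_object :: "('o, 'm) precat \<Rightarrow> 'o \<Rightarrow> bool" where
  "is_zero_object C Z \<longleftrightarrow> Z \<in> Ob C \<and> Ident C Z = Zero C Z Z"

text \<open>\<open>S\<close> is the biproduct of \<open>X\<close> and \<open>Y\<close> with injections \<open>i\<close>, \<open>j\<close> and projections \<open>p\<close>, \<open>q\<close>.\<close>

definition is_biproduct ::
  "('o, 'm) precat \<Rightarrow> 'o \<Rightarrow> 'o \<Rightarrow> 'o \<Rightarrow> 'm \<Rightarrow> 'm \<Rightarrow> 'm \<Rightarrow> 'm \<Rightarrow> bool" where
  "is_biproduct C X Y S i j p q \<longleftrightarrow>
     X \<in> Ob C \<and> Y \<in> Ob C \<and> S \<in> Ob C \<and>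
     i \<in> Mor C X S \<and> j \<in> Mor C Y S \<and> p \<in> Mor C S X \<and> q \<in> Mor C S Y \<and>
     Comp C p i = Ident C X \<and> Comp C q j = Ident C Y \<and>
     Comp C p j = Zero C Y X \<and> Comp C q i = Zero C X Y \<and>
     Plus C (Comp C i p) (Comp C j q) = Ident C S"

definition direct_sum :: "('o, 'm) precat \<Rightarrow> 'o \<Rightarrow> 'o \<Rightarrow> 'o \<Rightarrow> bool" where
  "direct_sum C X Y S \<longleftrightarrow> (\<exists>i j p q. is_biproduct C X Y S i j p q)"

fun direct_sum_list :: "('o, 'm) precat \<Rightarrow> 'o list \<Rightarrow> 'o \<Rightarrow> bool" where
  "direct_sum_list C [] S \<longleftrightarrow> is_zero_object C S"
| "direct_sum_list C (X # Xs) S \<longleftrightarrow> (\<exists>T. direct_sum_list C Xs T \<and> direct_sum C X T S)"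

definition add_closure :: "('o, 'm) precat \<Rightarrow> 'o set \<Rightarrow> 'o set" where
  "add_closure C \<X> =
     {X \<in> Ob C. \<exists>Xs S Y. set Xs \<subseteq> \<X> \<and> direct_sum_list C Xs S \<and> direct_sum C X Y S}"

text \<open>Full subcategories are identified with their classes of objects.\<close>

definition is_subcategory :: "('o, 'm) precat \<Rightarrow> 'o set \<Rightarrow> bool" where
  "is_subcategory C \<U> \<longleftrightarrow> \<U> \<subseteq> Ob C \<and>
     (\<forall>X\<in>\<U>. \<forall>Y\<in>Ob C. isomorphic C X Y \<longrightarrow> Y \<in> \<U>) \<and>
     (\<forall>Z. is_zero_object C Z \<longrightarrow> Z \<in> \<U>) \<and>
     (\<forall>X Y S. X \<in> \<U> \<and> Y \<in> \<U> \<and> direct_sum C X Y S \<longrightarrow> S \<in> \<U>) \<and>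
     (\<forall>X Y S. S \<in> \<U> \<and> direct_sum C X Y S \<longrightarrow> X \<in> \<U>)"

definition full_subcategory :: "('o, 'm) precat \<Rightarrow> 'o set \<Rightarrow> ('o, 'm) precat" where
  "full_subcategory C \<U> = C\<lparr>Ob := \<U>\<rparr>"


section \<open>Rigid and 2-cluster-tilting subcategories\<close>

text \<open>Here \<open>sh\<close> is the action of the shift functor \<open>[1]\<close> on objects.\<close>

definition hom_vanishes :: "('o, 'm) precat \<Rightarrow> 'o \<Rightarrow> 'o \<Rightarrow> bool" where
  "hom_vanishes C X Y \<longleftrightarrow> Mor C X Y = {Zero C X Y}"

definition rigid :: "('o, 'm) precat \<Rightarrow> ('o \<Rightarrow> 'o) \<Rightarrow> 'o set \<Rightarrow> bool" where
  "rigid C sh \<U> \<longleftrightarrow> (\<forall>U\<in>\<U>. \<forall>V\<in>\<U>. hom_vanishes C U (sh V))"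

definition is_left_approximation ::
  "('o, 'm) precat \<Rightarrow> 'o set \<Rightarrow> 'o \<Rightarrow> 'o \<Rightarrow> 'm \<Rightarrow> bool" where
  "is_left_approximation C \<U> X U f \<longleftrightarrow> U \<in> \<U> \<and> f \<in> Mor C X U \<and>
     (\<forall>V\<in>\<U>. \<forall>g\<in>Mor C X V. \<exists>h\<in>Mor C U V. g = Comp C h f)"

definition is_right_approximation ::
  "('o, 'm) precat \<Rightarrow> 'o set \<Rightarrow> 'o \<Rightarrow> 'o \<Rightarrow> 'm \<Rightarrow> bool" where
  "is_right_approximation C \<U> X U f \<longleftrightarrow> U \<in> \<U> \<and> f \<in> Mor C U X \<and>
     (\<forall>V\<in>\<U>. \<forall>g\<in>Mor C V X. \<exists>h\<in>Mor C V U. g = Comp C f h)"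

definition functorially_finite :: "('o, 'm) precat \<Rightarrow> 'o set \<Rightarrow> bool" where
  "functorially_finite C \<U> \<longleftrightarrow>
     (\<forall>X\<in>Ob C. (\<exists>U f. is_left_approximation C \<U> X U f) \<and>
                (\<exists>U f. is_right_approximation C \<U> X U f))"

definition two_cluster_tilting :: "('o, 'm) precat \<Rightarrow> ('o \<Rightarrow> 'o) \<Rightarrow> 'o set \<Rightarrow> bool" where
  "two_cluster_tilting C sh \<U> \<longleftrightarrow> functorially_finite C \<U> \<and>
     \<U> = {X \<in> Ob C. \<forall>U\<in>\<U>. hom_vanishes C U (sh X)} \<and>
     \<U> = {X \<in> Ob C. \<forall>U\<in>\<U>. hom_vanishes C X (sh U)}"


section \<open>4-angulations\<close>

text \<open>
  \<open>Seq4 X1 X2 X3 X4 a1 a2 a3 a4\<close> is the sequence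
  \<open>X1 \<rightarrow> X2 \<rightarrow> X3 \<rightarrow> X4 \<rightarrow> \<Sigma> X1\<close> with maps \<open>a1, a2, a3, a4\<close>.  The suspension \<open>\<Sigma>\<close> is given by
  its action \<open>So\<close> on objects and \<open>Sm\<close> on morphisms.
\<close>

datatype ('o, 'm) seq4 = Seq4 'o 'o 'o 'o 'm 'm 'm 'm

fun is_seq4 :: "('o, 'm) precat \<Rightarrow> ('o \<Rightarrow> 'o) \<Rightarrow> ('o, 'm) seq4 \<Rightarrow> bool" where
  "is_seq4 C So (Seq4 X1 X2 X3 X4 a1 a2 a3 a4) \<longleftrightarrow>
     X1 \<in> Ob C \<and> X2 \<in> Ob C \<and> X3 \<in> Ob C \<and> X4 \<in> Ob C \<and>
     a1 \<in> Mor C X1 X2 \<and> a2 \<in> Mor C X2 X3 \<and> a3 \<in> Mor C X3 X4 \<and> a4 \<in> Mor C X4 (So X1)"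

fun rotate4 :: "('o \<Rightarrow> 'o) \<Rightarrow> ('m \<Rightarrow> 'm) \<Rightarrow> ('o, 'm) seq4 \<Rightarrow> ('o, 'm) seq4" where
  "rotate4 So Sm (Seq4 X1 X2 X3 X4 a1 a2 a3 a4) = Seq4 X2 X3 X4 (So X1) a2 a3 a4 (Sm a1)"

fun seq4_mor :: "('o, 'm) precat \<Rightarrow> ('m \<Rightarrow> 'm) \<Rightarrow> ('o, 'm) seq4 \<Rightarrow> ('o, 'm) seq4 \<Rightarrow>
    'm \<times> 'm \<times> 'm \<times> 'm \<Rightarrow> bool" where
  "seq4_mor C Sm (Seq4 X1 X2 X3 X4 a1 a2 a3 a4) (Seq4 Y1 Y2 Y3 Y4 b1 b2 b3 b4)
      (f1, f2, f3, f4) \<longleftrightarrow>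
     f1 \<in> Mor C X1 Y1 \<and> f2 \<in> Mor C X2 Y2 \<and> f3 \<in> Mor C X3 Y3 \<and> f4 \<in> Mor C X4 Y4 \<and>
     Comp C f2 a1 = Comp C b1 f1 \<and> Comp C f3 a2 = Comp C b2 f2 \<and>
     Comp C f4 a3 = Comp C b3 f3 \<and> Comp C (Sm f1) a4 = Comp C b4 f4"

fun seq4_iso :: "('o, 'm) precat \<Rightarrow> ('m \<Rightarrow> 'm) \<Rightarrow> ('o, 'm) seq4 \<Rightarrow> ('o, 'm) seq4 \<Rightarrow> bool" where
  "seq4_iso C Sm (Seq4 X1 X2 X3 X4 a1 a2 a3 a4) (Seq4 Y1 Y2 Y3 Y4 b1 b2 b3 b4) \<longleftrightarrow>
     (\<exists>f1 f2 f3 f4.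
        seq4_mor C Sm (Seq4 X1 X2 X3 X4 a1 a2 a3 a4) (Seq4 Y1 Y2 Y3 Y4 b1 b2 b3 b4)
          (f1, f2, f3, f4) \<and>
        is_iso C X1 Y1 f1 \<and> is_iso C X2 Y2 f2 \<and> is_iso C X3 Y3 f3 \<and> is_iso C X4 Y4 f4)"

fun seq4_direct_sum :: "('o, 'm) precat \<Rightarrow> ('m \<Rightarrow> 'm) \<Rightarrow>
    ('o, 'm) seq4 \<Rightarrow> ('o, 'm) seq4 \<Rightarrow> ('o, 'm) seq4 \<Rightarrow> bool" where
  "seq4_direct_sum C Sm (Seq4 X1 X2 X3 X4 a1 a2 a3 a4) (Seq4 Y1 Y2 Y3 Y4 b1 b2 b3 b4)
      (Seq4 S1 S2 S3 S4 c1 c2 c3 c4) \<longleftrightarrow>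
     (\<exists>i1 i2 i3 i4 j1 j2 j3 j4 p1 p2 p3 p4 q1 q2 q3 q4.
        is_biproduct C X1 Y1 S1 i1 j1 p1 q1 \<and> is_biproduct C X2 Y2 S2 i2 j2 p2 q2 \<and>
        is_biproduct C X3 Y3 S3 i3 j3 p3 q3 \<and> is_biproduct C X4 Y4 S4 i4 j4 p4 q4 \<and>
        seq4_mor C Sm (Seq4 X1 X2 X3 X4 a1 a2 a3 a4) (Seq4 S1 S2 S3 S4 c1 c2 c3 c4)
          (i1, i2, i3, i4) \<and>
        seq4_mor C Sm (Seq4 Y1 Y2 Y3 Y4 b1 b2 b3 b4) (Seq4 S1 S2 S3 S4 c1 c2 c3 c4)
          (j1, j2, j3, j4) \<and>
        seq4_mor C Sm (Seq4 S1 S2 S3 S4 c1 c2 c3 c4) (Seq4 X1 X2 X3 X4 a1 a2 a3 a4)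
          (p1, p2, p3, p4) \<and>
        seq4_mor C Sm (Seq4 S1 S2 S3 S4 c1 c2 c3 c4) (Seq4 Y1 Y2 Y3 Y4 b1 b2 b3 b4)
          (q1, q2, q3, q4))"

text \<open>
  \<open>cone_map C a f b p q i' j'\<close> is the matrix \<open>(-a 0; f b)\<close> from a biproduct with
  projections \<open>p\<close>, \<open>q\<close> to a biproduct with injections \<open>i'\<close>, \<open>j'\<close>.
\<close>

definition cone_map ::
  "('o, 'm) precat \<Rightarrow> 'm \<Rightarrow> 'm \<Rightarrow> 'm \<Rightarrow> 'm \<Rightarrow> 'm \<Rightarrow> 'm \<Rightarrow> 'm \<Rightarrow> 'm" where
  "cone_map C a f b p q i' j' =
     Plus C (Comp C i' (Comp C (Neg C a) p))
            (Comp C j' (Plus C (Comp C f p) (Comp C b q)))"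

text \<open>
  The mapping cones of a morphism of sequences: one for every choice of the biproducts
  \<open>B1 = X2 \<oplus> Y1\<close>, \<open>B2 = X3 \<oplus> Y2\<close>, \<open>B3 = X4 \<oplus> Y3\<close>, \<open>B4 = \<Sigma> X1 \<oplus> Y4\<close>.  The last term
  \<open>\<Sigma> X2 \<oplus> \<Sigma> Y1\<close> is \<open>\<Sigma> B1\<close> with the images under \<open>\<Sigma>\<close> of the injections of \<open>B1\<close>.
\<close>

inductive is_cone :: "('o, 'm) precat \<Rightarrow> ('o \<Rightarrow> 'o) \<Rightarrow> ('m \<Rightarrow> 'm) \<Rightarrow>
    ('o, 'm) seq4 \<Rightarrow> ('o, 'm) seq4 \<Rightarrow> 'm \<times> 'm \<times> 'm \<times> 'm \<Rightarrow> ('o, 'm) seq4 \<Rightarrow> bool"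
  for C So Sm where
  "\<lbrakk>is_biproduct C X2 Y1 B1 i1 j1 p1 q1; is_biproduct C X3 Y2 B2 i2 j2 p2 q2;
    is_biproduct C X4 Y3 B3 i3 j3 p3 q3; is_biproduct C (So X1) Y4 B4 i4 j4 p4 q4\<rbrakk> \<Longrightarrow>
   is_cone C So Sm (Seq4 X1 X2 X3 X4 a1 a2 a3 a4) (Seq4 Y1 Y2 Y3 Y4 b1 b2 b3 b4)
     (f1, f2, f3, f4)
     (Seq4 B1 B2 B3 B4
        (cone_map C a2 f2 b1 p1 q1 i2 j2)
        (cone_map C a3 f3 b2 p2 q2 i3 j3)
        (cone_map C a4 f4 b3 p3 q3 i4 j4)
        (cone_map C (Sm a1) (Sm f1) b4 p4 q4 (Sm i1) (Sm j1)))"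

text \<open>
  \<open>four_angulation C So Sm \<Theta>\<close> says that the sequences in \<open>\<Theta>\<close> satisfy the axioms for the
  \<open>4\<close>-angles of a \<open>4\<close>-angulated category.  That \<open>C\<close> is additive and \<open>(So, Sm)\<close> an
  automorphism is part of the given data, not a condition on \<open>\<Theta>\<close>, and is not repeated
  here; so the nonexistence of such a \<open>\<Theta>\<close> cannot be due to a failure of these conditions.
\<close>

locale four_angulation =
  fixes C :: "('o, 'm) precat" and So :: "'o \<Rightarrow> 'o" and Sm :: "'m \<Rightarrow> 'm"
    and \<Theta> :: "('o, 'm) seq4 set"
  assumes wf: "S \<in> \<Theta> \<Longrightarrow> is_seq4 C So S"
    and F1a_iso: "\<lbrakk>S \<in> \<Theta>; is_seq4 C So T; seq4_iso C Sm S T\<rbrakk> \<Longrightarrow> T \<in> \<Theta>"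
    and F1a_sum: "\<lbrakk>S \<in> \<Theta>; T \<in> \<Theta>; is_seq4 C So D; seq4_direct_sum C Sm S T D\<rbrakk> \<Longrightarrow> D \<in> \<Theta>"
    and F1a_summand: "\<lbrakk>D \<in> \<Theta>; is_seq4 C So S; is_seq4 C So T; seq4_direct_sum C Sm S T D\<rbrakk>
          \<Longrightarrow> S \<in> \<Theta>"
    and F1b: "\<lbrakk>X \<in> Ob C; is_zero_object C Z\<rbrakk> \<Longrightarrow>
          Seq4 X X Z Z (Ident C X) (Zero C X Z) (Zero C Z Z) (Zero C Z (So X)) \<in> \<Theta>"
    and F1c: "\<lbrakk>X1 \<in> Ob C; X2 \<in> Ob C; a1 \<in> Mor C X1 X2\<rbrakk> \<Longrightarrow>
          \<exists>X3 X4 a2 a3 a4. Seq4 X1 X2 X3 X4 a1 a2 a3 a4 \<in> \<Theta>"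
    and F2: "is_seq4 C So S \<Longrightarrow> S \<in> \<Theta> \<longleftrightarrow> rotate4 So Sm S \<in> \<Theta>"
    and F3: "\<lbrakk>Seq4 X1 X2 X3 X4 a1 a2 a3 a4 \<in> \<Theta>; Seq4 Y1 Y2 Y3 Y4 b1 b2 b3 b4 \<in> \<Theta>;
          f1 \<in> Mor C X1 Y1; f2 \<in> Mor C X2 Y2; Comp C f2 a1 = Comp C b1 f1\<rbrakk> \<Longrightarrow>
          \<exists>f3 f4. seq4_mor C Sm (Seq4 X1 X2 X3 X4 a1 a2 a3 a4) (Seq4 Y1 Y2 Y3 Y4 b1 b2 b3 b4)
            (f1, f2, f3, f4)"
    and F4: "\<lbrakk>Seq4 X1 X2 X3 X4 a1 a2 a3 a4 \<in> \<Theta>; Seq4 Y1 Y2 Y3 Y4 b1 b2 b3 b4 \<in> \<Theta>;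
          f1 \<in> Mor C X1 Y1; f2 \<in> Mor C X2 Y2; Comp C f2 a1 = Comp C b1 f1\<rbrakk> \<Longrightarrow>
          \<exists>f3 f4. seq4_mor C Sm (Seq4 X1 X2 X3 X4 a1 a2 a3 a4) (Seq4 Y1 Y2 Y3 Y4 b1 b2 b3 b4)
              (f1, f2, f3, f4) \<and>
            (\<forall>K. is_cone C So Sm (Seq4 X1 X2 X3 X4 a1 a2 a3 a4) (Seq4 Y1 Y2 Y3 Y4 b1 b2 b3 b4)
              (f1, f2, f3, f4) K \<longrightarrow> K \<in> \<Theta>)"


section \<open>The algebra\<close>

text \<open>
  Paths of a quiver, as triples (source, list of arrows, target).  Products are read from
  left to right: \<open>x\<close> times \<open>y\<close> is \<open>x\<close> followed by \<open>y\<close>.  With this convention the right module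
  \<open>e\<^sub>i A\<close> is spanned by the paths starting at \<open>i\<close>.
\<close>

type_synonym ('v, 'a) qpath = "'v \<times> 'a list \<times> 'v"

definition qpaths :: "('v, 'a) pre_digraph \<Rightarrow> ('v, 'a) qpath set" where
  "qpaths Q = {(u, p, v). pre_digraph.awalk Q u p v}"

definition path_algebra ::
  "('v, 'a) pre_digraph \<Rightarrow> (('v, 'a) qpath \<Rightarrow> 'k::field) ring" where
  "path_algebra Q = \<lparr>
     carrier = {f. finite {x. f x \<noteq> 0} \<and> {x. f x \<noteq> 0} \<subseteq> qpaths Q},
     mult = (\<lambda>f g (u, r, w).
       \<Sum>(p, v, q) \<in> {(p, v, q). (u, p, v) \<in> qpaths Q \<and> (v, q, w) \<in> qpaths Q \<and> p @ q = r}.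
         f (u, p, v) * g (v, q, w)),
     one = (\<lambda>(u, p, v). if u \<in> verts Q \<and> p = [] \<and> u = v then 1 else 0),
     zero = (\<lambda>x. 0),
     add = (\<lambda>f g x. f x + g x)\<rparr>"

definition path_elt :: "('v, 'a) qpath \<Rightarrow> (('v, 'a) qpath \<Rightarrow> 'k::field)" where
  "path_elt x = (\<lambda>y. if y = x then 1 else 0)"

text \<open>The quiver \<open>1 \<rightarrow> 2 \<rightarrow> 3 \<rightarrow> 4 \<rightarrow> 5\<close>; the arrow \<open>i \<rightarrow> i + 1\<close> is called \<open>i\<close>.\<close>

definition Q5 :: "(nat, nat) pre_digraph" where
  "Q5 = \<lparr>verts = {1..5}, arcs = {1..4}, tail = (\<lambda>i. i), head = Suc\<rparr>"

type_synonym 'k kQ_elt = "(nat, nat) qpath \<Rightarrow> 'k"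

abbreviation kQ :: "'k::field kQ_elt ring" where
  "kQ \<equiv> path_algebra Q5"

definition relations_ideal :: "'k::field kQ_elt set" where
  "relations_ideal = Idl\<^bsub>kQ\<^esub> {path_elt (u, p, v) |u p v. (u, p, v) \<in> qpaths Q5 \<and> length p = 2}"

type_synonym 'k A_elt = "'k kQ_elt set"

definition algA :: "'k::field A_elt ring" where
  "algA = kQ Quot relations_ideal"

definition A_scalar :: "'k::field \<Rightarrow> 'k A_elt" where
  "A_scalar c = relations_ideal +>\<^bsub>kQ\<^esub> (\<lambda>x. c * \<one>\<^bsub>kQ\<^esub> x)"


section \<open>Finite dimensional right modules\<close>

text \<open>
  The underlying vector space of a module is a finite dimensional subspace of the space
  of sequences over \<open>k\<close>; every finite dimensional module is isomorphic to one of this form,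
  so this gives a small category equivalent to the category of all finite dimensional
  right modules.
\<close>

type_synonym 'k vec = "nat \<Rightarrow> 'k"

definition vscale :: "'k::field \<Rightarrow> 'k vec \<Rightarrow> 'k vec" where
  "vscale c v = (\<lambda>n. c * v n)"

global_interpretation vec: vector_space "vscale :: 'k::field \<Rightarrow> 'k vec \<Rightarrow> 'k vec"
  by unfold_locales (auto simp: vscale_def algebra_simps fun_eq_iff)

record 'k rmod =
  space :: "'k vec set"
  act :: "'k vec \<Rightarrow> 'k A_elt \<Rightarrow> 'k vec"

definition is_rmod :: "'k::field rmod \<Rightarrow> bool" where
  "is_rmod M \<longleftrightarrow>
     (\<exists>B. finite B \<and> space M = vec.span B) \<and>
     (\<forall>v\<in>space M. \<forall>a\<in>carrier algA. act M v a \<in> space M) \<and>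
     (\<forall>v\<in>space M. \<forall>w\<in>space M. \<forall>a\<in>carrier algA. act M (v + w) a = act M v a + act M w a) \<and>
     (\<forall>v\<in>space M. \<forall>a\<in>carrier algA. \<forall>b\<in>carrier algA.
        act M v (a \<oplus>\<^bsub>algA\<^esub> b) = act M v a + act M v b \<and>
        act M v (a \<otimes>\<^bsub>algA\<^esub> b) = act M (act M v a) b) \<and>
     (\<forall>v\<in>space M. act M v \<one>\<^bsub>algA\<^esub> = v) \<and>
     (\<forall>v\<in>space M. \<forall>c. act M v (A_scalar c) = vscale c v)"

text \<open>
  Homomorphisms are extended by zero outside of the underlying space, so that equality of
  homomorphisms is equality of functions.  \<open>k\<close>-linearity follows from \<open>A\<close>-linearity.
\<close>

definition rmod_hom :: "'k::field rmod \<Rightarrow> 'k rmod \<Rightarrow> ('k vec \<Rightarrow> 'k vec) set" where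
  "rmod_hom M N = {f.
     (\<forall>v\<in>space M. f v \<in> space N) \<and>
     (\<forall>v\<in>space M. \<forall>w\<in>space M. f (v + w) = f v + f w) \<and>
     (\<forall>v\<in>space M. \<forall>a\<in>carrier algA. f (act M v a) = act N (f v) a) \<and>
     (\<forall>v. v \<notin> space M \<longrightarrow> f v = 0)}"

definition modA :: "('k::field rmod, 'k vec \<Rightarrow> 'k vec) precat" where
  "modA = \<lparr>
     Ob = {M. is_rmod M},
     Mor = rmod_hom,
     Ident = (\<lambda>M v. if v \<in> space M then v else 0),
     Comp = (\<lambda>g f. g \<circ> f),
     Plus = (\<lambda>f g v. f v + g v),
     Zero = (\<lambda>M N v. 0),
     Neg = (\<lambda>f v. - f v)\<rparr>"

definition zero_rmod :: "'k::field rmod" where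
  "zero_rmod = \<lparr>space = {0}, act = (\<lambda>v a. 0)\<rparr>"

definition unit_vec :: "nat \<Rightarrow> 'k::field vec" where
  "unit_vec n = (\<lambda>m. if m = n then 1 else 0)"

text \<open>
  The coefficient of a path of length at most \<open>1\<close> in an element of \<open>A\<close>; it does not depend
  on the representative, since the elements of the ideal are combinations of longer paths.
\<close>

definition A_coeff :: "'k::field A_elt \<Rightarrow> (nat, nat) qpath \<Rightarrow> 'k" where
  "A_coeff a x = the_elem ((\<lambda>f. f x) ` a)"

text \<open>The simple module at \<open>i\<close>: one basis vector, fixed by \<open>e\<^sub>i\<close>, killed by all other paths.\<close>

definition simple_rmod :: "nat \<Rightarrow> 'k::field rmod" where
  "simple_rmod i = \<lparr>
     space = vec.span {unit_vec 0},
     act = (\<lambda>v a. vscale (A_coeff a (i, [], i)) v)\<rparr>"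

text \<open>
  The uniserial module with top \<open>S\<^sub>i\<close> and socle \<open>S\<^sub>i\<^sub>+\<^sub>1\<close>: basis \<open>x, y\<close> (the unit vectors
  \<open>0\<close> and \<open>1\<close>) with \<open>x e\<^sub>i = x\<close>, \<open>y e\<^sub>i\<^sub>+\<^sub>1 = y\<close>, the arrow at \<open>i\<close> sending \<open>x\<close> to \<open>y\<close>, and all
  other basis vector/path products equal to zero.
\<close>

definition uniserial_rmod :: "nat \<Rightarrow> 'k::field rmod" where
  "uniserial_rmod i = \<lparr>
     space = vec.span {unit_vec 0, unit_vec 1},
     act = (\<lambda>v a.
       vscale (v 0 * A_coeff a (i, [], i)) (unit_vec 0) +
       vscale (v 0 * A_coeff a (i, [i], Suc i) + v 1 * A_coeff a (Suc i, [], Suc i)) (unit_vec 1))\<rparr>"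

definition M_A :: "'k::field rmod set" where
  "M_A = {X. \<exists>T. direct_sum_list modA
      [simple_rmod 5, uniserial_rmod 4, uniserial_rmod 3, simple_rmod 3,
       uniserial_rmod 2, uniserial_rmod 1, simple_rmod 1] T \<and>
     X \<in> add_closure modA {T}}"


section \<open>The bounded derived category\<close>

text \<open>Cochain complexes: \<open>dif X n\<close> maps degree \<open>n\<close> to degree \<open>n + 1\<close>.\<close>

record 'k complx =
  obj :: "int \<Rightarrow> 'k rmod"
  dif :: "int \<Rightarrow> 'k vec \<Rightarrow> 'k vec"

definition is_bcomplex :: "'k::field complx \<Rightarrow> bool" where
  "is_bcomplex X \<longleftrightarrow>
     (\<forall>n. obj X n \<in> Ob modA \<and> dif X n \<in> Mor modA (obj X n) (obj X (n + 1)) \<and>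
        dif X (n + 1) \<circ> dif X n = (\<lambda>v. 0)) \<and>
     finite {n. space (obj X n) \<noteq> {0}}"

type_synonym 'k cmap = "int \<Rightarrow> 'k vec \<Rightarrow> 'k vec"

definition chain_maps :: "'k::field complx \<Rightarrow> 'k complx \<Rightarrow> 'k cmap set" where
  "chain_maps X Y = {f. \<forall>n. f n \<in> Mor modA (obj X n) (obj Y n) \<and>
     dif Y n \<circ> f n = f (n + 1) \<circ> dif X n}"

definition cid :: "'k::field complx \<Rightarrow> 'k cmap" where
  "cid X = (\<lambda>n. Ident modA (obj X n))"

definition ccomp :: "'k::field cmap \<Rightarrow> 'k cmap \<Rightarrow> 'k cmap" where
  "ccomp g f = (\<lambda>n. g n \<circ> f n)"

definition homotopic :: "'k::field complx \<Rightarrow> 'k complx \<Rightarrow> 'k cmap \<Rightarrow> 'k cmap \<Rightarrow> bool" where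
  "homotopic X Y f g \<longleftrightarrow>
     (\<exists>h. \<forall>n. h n \<in> Mor modA (obj X n) (obj Y (n - 1)) \<and>
        (\<forall>v. f n v - g n v = dif Y (n - 1) (h n v) + h (n + 1) (dif X n v)))"

definition cocycles :: "'k::field complx \<Rightarrow> int \<Rightarrow> 'k vec set" where
  "cocycles X n = {v \<in> space (obj X n). dif X n v = 0}"

definition coboundaries :: "'k::field complx \<Rightarrow> int \<Rightarrow> 'k vec set" where
  "coboundaries X n = dif X (n - 1) ` space (obj X (n - 1))"

text \<open>
  Chain maps inducing isomorphisms in cohomology; the two conditions spell out injectivity
  and surjectivity of the induced map from cocycles modulo coboundaries of \<open>X\<close> to those of \<open>Y\<close>.
\<close>

definition quasi_isos :: "'k::field complx \<Rightarrow> 'k complx \<Rightarrow> 'k cmap set" where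
  "quasi_isos X Y = {f \<in> chain_maps X Y. \<forall>n.
     (\<forall>v\<in>cocycles X n. f n v \<in> coboundaries Y n \<longrightarrow> v \<in> coboundaries X n) \<and>
     (\<forall>w\<in>cocycles Y n. \<exists>v\<in>cocycles X n. w - f n v \<in> coboundaries Y n)}"

text \<open>
  The bounded derived category is the localization of the homotopy category of bounded
  complexes at the quasi-isomorphisms, by the calculus of fractions: a morphism from \<open>X\<close> to
  \<open>Y\<close> is an equivalence class of roofs \<open>X \<leftarrow> Z \<rightarrow> Y\<close> whose left leg is a quasi-isomorphism.
\<close>

record 'k roof =
  src :: "'k complx"
  tgt :: "'k complx"
  apex :: "'k complx"
  den :: "'k cmap"
  num :: "'k cmap"

definition is_roof :: "'k::field roof \<Rightarrow> bool" where
  "is_roof r \<longleftrightarrow> is_bcomplex (src r) \<and> is_bcomplex (tgt r) \<and> is_bcomplex (apex r) \<and>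
     den r \<in> quasi_isos (apex r) (src r) \<and> num r \<in> chain_maps (apex r) (tgt r)"

definition roof_rel :: "('k::field roof \<times> 'k roof) set" where
  "roof_rel = {(r, s). is_roof r \<and> is_roof s \<and> src r = src s \<and> tgt r = tgt s \<and>
     (\<exists>W a b. is_bcomplex W \<and> a \<in> chain_maps W (apex r) \<and> b \<in> chain_maps W (apex s) \<and>
        ccomp (den r) a \<in> quasi_isos W (src r) \<and>
        homotopic W (src r) (ccomp (den r) a) (ccomp (den s) b) \<and>
        homotopic W (tgt r) (ccomp (num r) a) (ccomp (num s) b))}"

definition roof_class :: "'k::field roof \<Rightarrow> 'k roof set" where
  "roof_class r = roof_rel `` {r}"

definition D_hom :: "'k::field complx \<Rightarrow> 'k complx \<Rightarrow> 'k roof set set" where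
  "D_hom X Y = {r. is_roof r \<and> src r = X \<and> tgt r = Y} // roof_rel"

text \<open>
  Composition completes the two roofs to a commutative (up to homotopy) square; addition
  uses representatives with a common denominator.
\<close>

definition D_comp :: "'k::field roof set \<Rightarrow> 'k roof set \<Rightarrow> 'k roof set" where
  "D_comp G F = \<Union> {roof_class \<lparr>src = src r, tgt = tgt s, apex = W,
        den = ccomp (den r) a, num = ccomp (num s) b\<rparr> |r s W a b.
      r \<in> F \<and> s \<in> G \<and> is_bcomplex W \<and>
      a \<in> quasi_isos W (apex r) \<and> b \<in> chain_maps W (apex s) \<and>
      homotopic W (tgt r) (ccomp (num r) a) (ccomp (den s) b)}"

definition D_plus :: "'k::field roof set \<Rightarrow> 'k roof set \<Rightarrow> 'k roof set" where
  "D_plus F G = \<Union> {roof_class (r\<lparr>num := \<lambda>n v. num r n v + num s n v\<rparr>) |r s.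
      r \<in> F \<and> s \<in> G \<and> apex r = apex s \<and> den r = den s}"

definition D_neg :: "'k::field roof set \<Rightarrow> 'k roof set" where
  "D_neg F = (\<lambda>r. r\<lparr>num := \<lambda>n v. - num r n v\<rparr>) ` F"

definition Db :: "('k::field complx, 'k roof set) precat" where
  "Db = \<lparr>
     Ob = {X. is_bcomplex X},
     Mor = D_hom,
     Ident = (\<lambda>X. roof_class \<lparr>src = X, tgt = X, apex = X, den = cid X, num = cid X\<rparr>),
     Comp = D_comp,
     Plus = D_plus,
     Zero = (\<lambda>X Y. roof_class \<lparr>src = X, tgt = Y, apex = X, den = cid X, num = \<lambda>n v. 0\<rparr>),
     Neg = D_neg\<rparr>"

text \<open>
  \<open>shift i\<close> and \<open>shift_mor i\<close> are the shift functor \<open>[i]\<close> on objects and on morphisms of the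
  derived category.  As \<open>shift i\<close> is a strict automorphism of the category of complexes, the
  image of an equivalence class of roofs is again an equivalence class.
\<close>

definition shift :: "int \<Rightarrow> 'k::field complx \<Rightarrow> 'k complx" where
  "shift i X = \<lparr>obj = \<lambda>n. obj X (n + i),
     dif = \<lambda>n v. if even i then dif X (n + i) v else - dif X (n + i) v\<rparr>"

definition shift_roof :: "int \<Rightarrow> 'k::field roof \<Rightarrow> 'k roof" where
  "shift_roof i r = \<lparr>src = shift i (src r), tgt = shift i (tgt r), apex = shift i (apex r),
     den = \<lambda>n. den r (n + i), num = \<lambda>n. num r (n + i)\<rparr>"

definition shift_mor :: "int \<Rightarrow> 'k::field roof set \<Rightarrow> 'k roof set" where
  "shift_mor i F = shift_roof i ` F"

definition stalk :: "'k::field rmod \<Rightarrow> 'k complx" where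
  "stalk M = \<lparr>obj = \<lambda>n. if n = 0 then M else zero_rmod, dif = \<lambda>n v. 0\<rparr>"

definition U_A :: "'k::field complx set" where
  "U_A = add_closure Db {shift (2 * i) (stalk M) |M i. M \<in> M_A}"

end

theory Submission
  imports Defs
begin

text \<open>
  \<open>\<U>(A)\<close> consists of the complexes whose cohomology lives in even degrees and is, as a complex of vector
  spaces along the quiver, exact at the vertices 2 and 4. A rigid \<open>\<U>\<close> as in the theorem lies in this class:
  \<open>Hom(P\<^sub>j, X[n]) = 0\<close> for odd \<open>n\<close> kills odd cohomology, and vanishing of the maps from and to odd shifts of
  \<open>S\<^sub>3\<close>, computed with the resolution \<open>P\<^sub>5 \<rightarrow> P\<^sub>4 \<rightarrow> P\<^sub>3\<close> and the coresolution \<open>P\<^sub>2 \<rightarrow> P\<^sub>1 \<rightarrow> S\<^sub>1\<close>, gives exactness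
  at 4 and 2. Conversely, a complex of the class is exhausted by a sum of shifted generators mapping
  injectively and purely to cohomology, to which projectives are added first and then \<open>S\<^sub>1\<close>, \<open>S\<^sub>3\<close>, \<open>S\<^sub>5\<close>.

  The complex \<open>P\<^sub>3 \<rightarrow> P\<^sub>2 \<rightarrow> P\<^sub>1\<close> has no nonzero map to an odd shift of \<open>\<U>(A)\<close> but is not exact at 4, so
  \<open>\<U>(A)\<close> is not 2-cluster-tilting. In a 4-angle \<open>P\<^sub>3 \<rightarrow> P\<^sub>2 \<rightarrow> X\<^sub>3 \<rightarrow> X\<^sub>4 \<rightarrow> P\<^sub>3[2]\<close>, exactness at 2 lifts the image in
  \<open>X\<^sub>3\<close> of the top of \<open>P\<^sub>2\<close> along the arrow \<open>1 \<rightarrow> 2\<close>; the lift gives a map \<open>S\<^sub>1 \<rightarrow> X\<^sub>4\<close>, which factors through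
  \<open>X\<^sub>3\<close> as \<open>Hom(S\<^sub>1, P\<^sub>3[2]) = 0\<close>, and this forces the image of the top of \<open>P\<^sub>2\<close> to vanish, which it does not.
\<close>

section \<open>The algebra in coordinates: one coefficient for each vertex and one for each
  arrow\<close>

section \<open>The algebra\<close>

text \<open>Two tools reach into the derived category. A morphism out of a complex of projectives
  \<open>Icx i m\<close> is a family of elements w_i, ..., w_m with d w_a = w_(a-1) x_(a-1), so Hom
  computations become systems of equations solved vertex by vertex. Of any other morphism only the
  effect on cohomology, \<open>hrel\<close>, is used; as \<open>evex\<close> is a condition on
  cohomology, it passes to sums and summands in this way. Parity drives the solution of the systems.
  The obstruction to passing from w_a to w_(a+1) is the class of w_a x_a, whose degree drops by one
  at each step. In every other degree the cohomology vanishes; in the remaining ones, beyond the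
  start, the obstruction sits at vertex 2 or 4, where exactness absorbs it by a change of the
  previous element. The decomposition works with a submodule N of the cohomology. Purity of N allows
  an element v with v x_j in N to be changed, modulo N, into one killed by x_j; and once N contains
  all products with arrows, adding simple modules cannot destroy purity. This is why projectives
  come before simple generators.\<close>

lemma qpaths_Q5_iff:
  "(u, p, v) \<in> qpaths Q5 \<longleftrightarrow> 1 \<le> u \<and> u \<le> v \<and> v \<le> 5 \<and> p = [u..<v]"
proof -
  \<comment> \<open>The disjunct \<open>u = v\<close> is for the empty arrow list, where the walk
    condition does not bound the vertex; the bound is supplied by \<open>awalk\<close>.\<close>
  have cas: "pre_digraph.cas Q5 u p v \<and> set p \<subseteq> {1..4} \<longleftrightarrow> u \<le> v \<and> p = [u..<v] \<and> (u = v \<or> 1 \<le> u \<and> v \<le> 5)"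
    for u p v
  proof (induction p arbitrary: u)
    case Nil
    then show ?case by (auto simp: pre_digraph.cas.simps dest: sym[of "[]"])
  next
    case (Cons a p)
    have "pre_digraph.cas Q5 u (a # p) v \<and> set (a # p) \<subseteq> {1..4} \<longleftrightarrow>
       a = u \<and> 1 \<le> u \<and> u \<le> 4 \<and> Suc u \<le> v \<and> p = [Suc u..<v] \<and> (Suc u = v \<or> 1 \<le> Suc u \<and> v \<le> 5)"
      using Cons[of "Suc u"] by (auto simp: pre_digraph.cas.simps Q5_def)
    also have "\<dots> \<longleftrightarrow> u \<le> v \<and> a # p = [u..<v] \<and> (u = v \<or> 1 \<le> u \<and> v \<le> 5)"
      by (cases "u < v") (auto simp: upt_rec[of u v])
    finally show ?case .
  qed
  have "(u, p, v) \<in> qpaths Q5 \<longleftrightarrow> u \<in> {1..5} \<and> (pre_digraph.cas Q5 u p v \<and> set p \<subseteq> {1..4})"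
    by (auto simp: qpaths_def pre_digraph.awalk_def Q5_def)
  then show ?thesis unfolding cas by auto
qed

lemma finite_qpaths_Q5: "finite (qpaths Q5)"
proof -
  have "qpaths Q5 \<subseteq> (\<lambda>(u, v). (u, [u..<v], v)) ` ({1..5} \<times> {1..5})"
    by (auto simp: qpaths_Q5_iff image_iff)
  then show ?thesis by (rule finite_subset) simp
qed

lemma kQ_carrier: "f \<in> carrier kQ \<longleftrightarrow> (\<forall>x. x \<notin> qpaths Q5 \<longrightarrow> f x = 0)"
proof -
  have "(\<forall>x. x \<notin> qpaths Q5 \<longrightarrow> f x = 0) \<longleftrightarrow> {x. f x \<noteq> 0} \<subseteq> qpaths Q5" by auto
  then show ?thesis
    using finite_subset[OF _ finite_qpaths_Q5] by (auto simp: path_algebra_def)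
qed

lemma kQ_add: "f \<oplus>\<^bsub>kQ\<^esub> g = (\<lambda>x. f x + g x)"
  by (simp add: path_algebra_def)

lemma kQ_zero: "\<zero>\<^bsub>kQ\<^esub> = (\<lambda>x. 0)"
  by (simp add: path_algebra_def)

lemma kQ_one: "\<one>\<^bsub>kQ\<^esub> (u, p, v) = (if 1 \<le> u \<and> u \<le> 5 \<and> p = [] \<and> u = v then 1 else 0)"
  by (simp add: path_algebra_def Q5_def)

text \<open>The convolution runs over all splittings of the arrow list. As a path is determined by
  its end points, a splitting is an intermediate vertex; for a triple that is not a path no
  splitting exists.\<close>

lemma kQ_mult:
  fixes f g :: "'k::field kQ_elt"
  shows "(f \<otimes>\<^bsub>kQ\<^esub> g) (u, r, w) = (if (u, r, w) \<in> qpaths Q5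
     then \<Sum>v\<in>{u..w}. f (u, [u..<v], v) * g (v, [v..<w], w) else 0)"
proof -
  let ?S = "{(p, v, q). (u, p, v) \<in> qpaths Q5 \<and> (v, q, w) \<in> qpaths Q5 \<and> p @ q = r}"
  have m: "(f \<otimes>\<^bsub>kQ\<^esub> g) (u, r, w) = (\<Sum>(p, v, q) \<in> ?S. f (u, p, v) * g (v, q, w))"
    by (simp add: path_algebra_def)
  have app: "[u..<v] @ [v..<w] = [u..<w]" if "u \<le> v" "v \<le> w" for v
    using that by (metis le_Suc_ex upt_add_eq_append)
  show ?thesis
  proof (cases "(u, r, w) \<in> qpaths Q5")
    case True
    have "?S = (\<lambda>v. ([u..<v], v, [v..<w])) ` {u..w}"
      using True app by (auto simp: qpaths_Q5_iff image_iff)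
    moreover have "inj_on (\<lambda>v. ([u..<v], v, [v..<w])) {u..w}"
      by (auto simp: inj_on_def)
    ultimately show ?thesis using True m by (simp add: sum.reindex)
  next
    case False
    have "?S = {}"
    proof (rule equals0I, clarify)
      fix p v q assume "(u, p, v) \<in> qpaths Q5" "(v, q, w) \<in> qpaths Q5" "r = p @ q"
      then show False using False app by (auto simp: qpaths_Q5_iff)
    qed
    then show ?thesis using False unfolding m by (simp only: sum.empty if_False)
  qed
qed

text \<open>The two bracketings of a triple product sum over the pairs of intermediate vertices in
  the two possible orders, so this is associativity of the path algebra.\<close>

lemma sum_triangle_swap:
  fixes F :: "nat \<Rightarrow> nat \<Rightarrow> 'a::comm_monoid_add"
  shows "(\<Sum>v\<in>{u..w}. \<Sum>t\<in>{u..v}. F t v) = (\<Sum>t\<in>{u..w}. \<Sum>v\<in>{t..w}. F t v)"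
  unfolding sum.Sigma[OF finite_atLeastAtMost ballI[OF finite_atLeastAtMost]]
  by (rule sum.reindex_bij_witness[where i = prod.swap and j = prod.swap]) auto

lemma kQ_ring: "ring (kQ :: 'k::field kQ_elt ring)"
proof (rule ringI)
  show "abelian_group (kQ :: 'k kQ_elt ring)"
  proof (rule abelian_groupI)
    fix x :: "'k kQ_elt" assume "x \<in> carrier kQ"
    then show "\<exists>y\<in>carrier kQ. y \<oplus>\<^bsub>kQ\<^esub> x = \<zero>\<^bsub>kQ\<^esub>"
      by (intro bexI[of _ "\<lambda>z. - x z"]) (auto simp: kQ_carrier kQ_add kQ_zero)
  qed (auto simp: kQ_carrier kQ_add kQ_zero add_ac)
  show "Group.monoid (kQ :: 'k kQ_elt ring)"
  proof (rule monoidI)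
    show "x \<otimes>\<^bsub>kQ\<^esub> y \<in> carrier kQ" for x y :: "'k kQ_elt"
      by (auto simp: kQ_carrier kQ_mult)
    show "\<one>\<^bsub>kQ\<^esub> \<in> carrier (kQ :: 'k kQ_elt ring)"
      by (auto simp: kQ_carrier kQ_one qpaths_Q5_iff)
    show "x \<otimes>\<^bsub>kQ\<^esub> y \<otimes>\<^bsub>kQ\<^esub> z = x \<otimes>\<^bsub>kQ\<^esub> (y \<otimes>\<^bsub>kQ\<^esub> z)" for x y z :: "'k kQ_elt"
    proof (rule ext, clarify)
      fix u r w
      show "(x \<otimes>\<^bsub>kQ\<^esub> y \<otimes>\<^bsub>kQ\<^esub> z) (u, r, w) = (x \<otimes>\<^bsub>kQ\<^esub> (y \<otimes>\<^bsub>kQ\<^esub> z)) (u, r, w)"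
      proof (cases "(u, r, w) \<in> qpaths Q5")
        case True
        then have r: "1 \<le> u" "w \<le> 5" by (auto simp: qpaths_Q5_iff)
        let ?x = "\<lambda>i j. x (i, [i..<j], j)" and ?y = "\<lambda>i j. y (i, [i..<j], j)"
          and ?z = "\<lambda>i j. z (i, [i..<j], j)"
        have "(x \<otimes>\<^bsub>kQ\<^esub> y \<otimes>\<^bsub>kQ\<^esub> z) (u, r, w) =
          (\<Sum>v\<in>{u..w}. \<Sum>t\<in>{u..v}. ?x u t * ?y t v * ?z v w)"
          using True r by (auto simp: kQ_mult qpaths_Q5_iff sum_distrib_right intro!: sum.cong)
        also have "\<dots> = (\<Sum>t\<in>{u..w}. \<Sum>v\<in>{t..w}. ?x u t * ?y t v * ?z v w)"
          by (rule sum_triangle_swap)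
        also have "\<dots> = (x \<otimes>\<^bsub>kQ\<^esub> (y \<otimes>\<^bsub>kQ\<^esub> z)) (u, r, w)"
          using True r by (auto simp: kQ_mult qpaths_Q5_iff sum_distrib_left mult.assoc intro!: sum.cong)
        finally show ?thesis .
      qed (simp add: kQ_mult)
    qed
    show "\<one>\<^bsub>kQ\<^esub> \<otimes>\<^bsub>kQ\<^esub> x = x" if "x \<in> carrier kQ" for x :: "'k kQ_elt"
    proof (rule ext, clarify)
      fix u r w
      show "(\<one>\<^bsub>kQ\<^esub> \<otimes>\<^bsub>kQ\<^esub> x) (u, r, w) = x (u, r, w)"
      proof (cases "(u, r, w) \<in> qpaths Q5")
        case True
        then have "(\<Sum>v\<in>{u..w}. \<one>\<^bsub>kQ\<^esub> (u, [u..<v], v) * x (v, [v..<w], w)) =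
            (\<Sum>v\<in>{u..w}. if v = u then x (u, [u..<w], w) else 0)"
          by (intro sum.cong) (auto simp: kQ_one qpaths_Q5_iff)
        then show ?thesis using True by (simp add: kQ_mult) (auto simp: qpaths_Q5_iff)
      qed (use that in \<open>auto simp: kQ_mult kQ_carrier\<close>)
    qed
    show "x \<otimes>\<^bsub>kQ\<^esub> \<one>\<^bsub>kQ\<^esub> = x" if "x \<in> carrier kQ" for x :: "'k kQ_elt"
    proof (rule ext, clarify)
      fix u r w
      show "(x \<otimes>\<^bsub>kQ\<^esub> \<one>\<^bsub>kQ\<^esub>) (u, r, w) = x (u, r, w)"
      proof (cases "(u, r, w) \<in> qpaths Q5")
        case True
        then have "(\<Sum>v\<in>{u..w}. x (u, [u..<v], v) * \<one>\<^bsub>kQ\<^esub> (v, [v..<w], w)) =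
            (\<Sum>v\<in>{u..w}. if v = w then x (u, [u..<w], w) else 0)"
          by (intro sum.cong) (auto simp: kQ_one qpaths_Q5_iff)
        then show ?thesis using True by (simp add: kQ_mult) (auto simp: qpaths_Q5_iff)
      qed (use that in \<open>auto simp: kQ_mult kQ_carrier\<close>)
    qed
  qed
qed (auto simp: fun_eq_iff kQ_mult kQ_add algebra_simps sum.distrib simp del: mult_eq_0_iff)

text \<open>The explicit form of the ideal of relations. It makes the coefficients at paths of
  length at most 1 well defined on cosets and complete as coordinates.\<close>

definition long_elts :: "'k::field kQ_elt set" where
  "long_elts = {f \<in> carrier kQ. \<forall>u p v. length p \<le> 1 \<longrightarrow> f (u, p, v) = 0}"

lemma ideal_long_elts: "ideal (long_elts :: 'k::field kQ_elt set) kQ"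
proof (rule idealI[OF kQ_ring])
  interpret ring "kQ :: 'k kQ_elt ring" by (rule kQ_ring)
  have inv: "\<ominus>\<^bsub>kQ\<^esub> f = (\<lambda>x. - f x)" if "f \<in> carrier kQ" for f :: "'k kQ_elt"
    using that by (intro minus_equality) (auto simp: kQ_carrier kQ_add kQ_zero)
  show "subgroup (long_elts :: 'k kQ_elt set) (add_monoid kQ)"
  proof (rule add.subgroupI)
    show "long_elts \<noteq> ({} :: 'k kQ_elt set)"
      by (auto simp: long_elts_def kQ_carrier intro!: exI[of _ "\<lambda>x. 0"])
    show "\<ominus>\<^bsub>kQ\<^esub> f \<in> long_elts" if "f \<in> long_elts" for f :: "'k kQ_elt"
      using that inv[of f] by (auto simp: long_elts_def kQ_carrier)
  qed (auto simp: long_elts_def kQ_carrier kQ_add)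
  show "x \<otimes>\<^bsub>kQ\<^esub> a \<in> long_elts" if "a \<in> long_elts" "x \<in> carrier kQ" for a x :: "'k kQ_elt"
    using that unfolding long_elts_def
    by (auto simp: kQ_mult kQ_carrier qpaths_Q5_iff intro!: sum.neutral)
  show "a \<otimes>\<^bsub>kQ\<^esub> x \<in> long_elts" if "a \<in> long_elts" "x \<in> carrier kQ" for a x :: "'k kQ_elt"
    using that unfolding long_elts_def
    by (auto simp: kQ_mult kQ_carrier qpaths_Q5_iff intro!: sum.neutral)
qed

lemma kQ_path_mult:
  assumes "1 \<le> u" "u \<le> v" "v \<le> w" "w \<le> 5"
  shows "path_elt (u, [u..<v], v) \<otimes>\<^bsub>kQ\<^esub> path_elt (v, [v..<w], w)
       = (path_elt (u, [u..<w], w) :: 'k::field kQ_elt)"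
proof (rule ext, clarify)
  fix a r b
  have "(\<Sum>t\<in>{a..b}. path_elt (u, [u..<v], v) (a, [a..<t], t) * path_elt (v, [v..<w], w) (t, [t..<b], b))
      = (\<Sum>t\<in>{a..b}. if t = v then (if a = u \<and> b = w then 1 else 0 :: 'k) else 0)"
    by (intro sum.cong) (auto simp: path_elt_def)
  then show "(path_elt (u, [u..<v], v) \<otimes>\<^bsub>kQ\<^esub> path_elt (v, [v..<w], w)) (a, r, b)
       = (path_elt (u, [u..<w], w) :: 'k kQ_elt) (a, r, b)"
    using assms by (auto simp: kQ_mult path_elt_def qpaths_Q5_iff)
qed

text \<open>A path of length at least 2 is its initial segment of length 2 times the rest, hence in
  the ideal; scalar multiples are products with multiples of the unit, and an element of
  \<open>long_elts\<close> is a finite sum of such multiples. The other inclusion is minimality of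
  the generated ideal.\<close>

lemma relations_ideal_eq: "relations_ideal = (long_elts :: 'k::field kQ_elt set)"
proof -
  interpret ring "kQ :: 'k kQ_elt ring" by (rule kQ_ring)
  let ?S = "{path_elt (u, p, v) |u p v. (u, p, v) \<in> qpaths Q5 \<and> length p = 2} :: 'k kQ_elt set"
  have Sl: "?S \<subseteq> long_elts"
    by (auto simp: long_elts_def path_elt_def kQ_carrier)
  have Sc: "?S \<subseteq> carrier kQ" using Sl by (auto simp: long_elts_def)
  interpret I: ideal "relations_ideal :: 'k kQ_elt set" kQ
    unfolding relations_ideal_def by (rule genideal_ideal[OF Sc])
  have path: "path_elt (u, p, v) \<in> (relations_ideal :: 'k kQ_elt set)"
    if "(u, p, v) \<in> qpaths Q5" "2 \<le> length p" for u p v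
  proof -
    have q: "1 \<le> u" "Suc (Suc u) \<le> v" "v \<le> 5" "p = [u..<v]"
      using that by (auto simp: qpaths_Q5_iff)
    have "path_elt (u, [u..<Suc (Suc u)], Suc (Suc u)) \<in> (relations_ideal :: 'k kQ_elt set)"
      unfolding relations_ideal_def using q
      by (intro subsetD[OF genideal_self[OF Sc]] CollectI exI conjI) (auto simp: qpaths_Q5_iff)
    then have "path_elt (u, [u..<Suc (Suc u)], Suc (Suc u)) \<otimes>\<^bsub>kQ\<^esub> path_elt (Suc (Suc u), [Suc (Suc u)..<v], v)
        \<in> (relations_ideal :: 'k kQ_elt set)"
      by (rule I.I_r_closed) (use q in \<open>auto simp: kQ_carrier path_elt_def qpaths_Q5_iff\<close>)
    then show ?thesis using kQ_path_mult[of u "Suc (Suc u)" v, where 'k = 'k] q by simp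
  qed
  have sc: "(\<lambda>x. c * f x) \<in> (relations_ideal :: 'k kQ_elt set)" if "f \<in> relations_ideal" for c f
  proof -
    have "(\<lambda>x. c * \<one>\<^bsub>kQ\<^esub> x) \<otimes>\<^bsub>kQ\<^esub> f \<in> (relations_ideal :: 'k kQ_elt set)"
      by (rule I.I_l_closed[OF that]) (use one_closed in \<open>auto simp: kQ_carrier\<close>)
    moreover have "(\<lambda>x. c * \<one>\<^bsub>kQ\<^esub> x) \<otimes>\<^bsub>kQ\<^esub> f = (\<lambda>x. c * (\<one>\<^bsub>kQ\<^esub> \<otimes>\<^bsub>kQ\<^esub> f) x)"
      by (auto simp: fun_eq_iff kQ_mult sum_distrib_left mult.assoc)
    ultimately show ?thesis using I.a_subset that by (auto simp: l_one)
  qed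
  have "f \<in> relations_ideal" if "finite F" "F \<subseteq> qpaths Q5" "\<forall>x. x \<notin> F \<longrightarrow> f x = 0"
      "\<forall>u p v. length p \<le> 1 \<longrightarrow> f (u, p, v) = 0" for F and f :: "'k kQ_elt"
    using that
  proof (induction F arbitrary: f)
    case empty
    then have "f = (\<lambda>x. 0)" by auto
    then show ?case using I.zero_closed by (simp add: kQ_zero)
  next
    case (insert x F)
    obtain u p v where x: "x = (u, p, v)" by (cases x)
    have "(f(x := 0)) \<in> relations_ideal"
      using insert.prems by (intro insert.IH) (auto simp: insert.hyps)
    moreover have "(\<lambda>y. f x * path_elt x y) \<in> relations_ideal"
    proof (cases "length p \<le> 1")
      case True
      then have "(\<lambda>y. f x * path_elt x y) = (\<lambda>x. 0)" using insert.prems(3) x by auto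
      then show ?thesis using I.zero_closed by (simp add: kQ_zero)
    next
      case False
      then show ?thesis using insert.prems(1) path x by (intro sc) auto
    qed
    ultimately have "f(x := 0) \<oplus>\<^bsub>kQ\<^esub> (\<lambda>y. f x * path_elt x y) \<in> relations_ideal"
      by (rule I.a_closed)
    moreover have "f(x := 0) \<oplus>\<^bsub>kQ\<^esub> (\<lambda>y. f x * path_elt x y) = f"
      by (auto simp: kQ_add path_elt_def)
    ultimately show ?case by simp
  qed
  from this[OF finite_qpaths_Q5 subset_refl] have "f \<in> relations_ideal"
    if "f \<in> long_elts" for f :: "'k kQ_elt"
    using that unfolding long_elts_def kQ_carrier by blast
  then have "long_elts \<subseteq> (relations_ideal :: 'k kQ_elt set)" by blast
  moreover have "(relations_ideal :: 'k kQ_elt set) \<subseteq> long_elts"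
    unfolding relations_ideal_def by (rule genideal_minimal[OF ideal_long_elts Sl])
  ultimately show ?thesis by blast
qed

abbreviation ecoeff :: "'k::field A_elt \<Rightarrow> nat \<Rightarrow> 'k" where
  "ecoeff a i \<equiv> A_coeff a (i, [], i)"

abbreviation xcoeff :: "'k::field A_elt \<Rightarrow> nat \<Rightarrow> 'k" where
  "xcoeff a i \<equiv> A_coeff a (i, [i], Suc i)"

abbreviation qcls :: "'k::field kQ_elt \<Rightarrow> 'k A_elt" where
  "qcls f \<equiv> relations_ideal +>\<^bsub>kQ\<^esub> f"

lemma ideal_relations: "ideal (relations_ideal :: 'k::field kQ_elt set) kQ"
  by (simp add: relations_ideal_eq ideal_long_elts)

lemma algA_ring: "ring (algA :: 'k::field A_elt ring)"
  unfolding algA_def by (rule ideal.quotient_is_ring[OF ideal_relations])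

lemma qcls_coeff:
  assumes "length p \<le> 1"
  shows "A_coeff (qcls f) (u, p, v) = f (u, p, v)"
proof -
  have "(\<lambda>g. g (u, p, v)) ` qcls f = {f (u, p, v)}"
  proof -
    have "(\<lambda>x. 0) \<in> (relations_ideal :: 'a kQ_elt set)"
      by (auto simp: relations_ideal_eq long_elts_def kQ_carrier)
    then have "f \<in> qcls f" by (force simp: a_r_coset_def' kQ_add)
    moreover have "g (u, p, v) = f (u, p, v)" if "g \<in> qcls f" for g
      using that assms by (auto simp: a_r_coset_def' kQ_add relations_ideal_eq long_elts_def)
    ultimately show ?thesis by blast
  qed
  then show ?thesis by (simp add: A_coeff_def)
qed

lemma algA_carrierE:
  assumes "a \<in> carrier algA"
  obtains f where "f \<in> carrier kQ" "a = qcls f"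
  using assms by (auto simp: algA_def FactRing_def A_RCOSETS_def')

lemma qcls_carrier: "f \<in> carrier kQ \<Longrightarrow> qcls f \<in> carrier algA"
  by (auto simp: algA_def FactRing_def A_RCOSETS_def')

lemma qcls_add: "\<lbrakk>f \<in> carrier kQ; g \<in> carrier kQ\<rbrakk> \<Longrightarrow> qcls f \<oplus>\<^bsub>algA\<^esub> qcls g = qcls (f \<oplus>\<^bsub>kQ\<^esub> g)"
  unfolding algA_def by (rule ring_hom_add[OF ideal.rcos_ring_hom[OF ideal_relations], symmetric])

lemma qcls_mult: "\<lbrakk>f \<in> carrier kQ; g \<in> carrier kQ\<rbrakk> \<Longrightarrow> qcls f \<otimes>\<^bsub>algA\<^esub> qcls g = qcls (f \<otimes>\<^bsub>kQ\<^esub> g)"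
  unfolding algA_def by (rule ring_hom_mult[OF ideal.rcos_ring_hom[OF ideal_relations], symmetric])

lemma qcls_one: "\<one>\<^bsub>algA\<^esub> = qcls \<one>\<^bsub>kQ\<^esub>"
  by (simp add: algA_def FactRing_def)

text \<open>The difference of two representatives vanishes on all paths of length at most 1, so it
  lies in the ideal. The multiplication table of A below is checked on these nine
  coefficients.\<close>

lemma algA_eqI:
  fixes a b :: "'k::field A_elt"
  assumes "a \<in> carrier algA" "b \<in> carrier algA"
    and "\<And>i. 1 \<le> i \<Longrightarrow> i \<le> 5 \<Longrightarrow> ecoeff a i = ecoeff b i"
    and "\<And>i. 1 \<le> i \<Longrightarrow> i \<le> 4 \<Longrightarrow> xcoeff a i = xcoeff b i"
  shows "a = b"
proof -
  interpret ideal "relations_ideal :: 'k kQ_elt set" kQ by (rule ideal_relations)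
  obtain f where f: "f \<in> carrier kQ" "a = qcls f" using assms(1) by (rule algA_carrierE)
  obtain g where g: "g \<in> carrier kQ" "b = qcls g" using assms(2) by (rule algA_carrierE)
  define h where "h = (\<lambda>x. f x - g x)"
  have hc: "h \<in> carrier kQ" using f g by (auto simp: h_def kQ_carrier)
  have "h (u, p, v) = 0" if len: "length p \<le> 1" for u p v
  proof (cases "(u, p, v) \<in> qpaths Q5")
    case True
    then consider "p = []" "v = u" "1 \<le> u" "u \<le> 5" | "p = [u]" "v = Suc u" "1 \<le> u" "u \<le> 4"
      using len unfolding qpaths_Q5_iff
      by (cases "v = u"; cases "v = Suc u") (auto simp: le_Suc_eq)
    then show ?thesis
      using assms(3)[of u] assms(4)[of u] unfolding f(2) g(2)
      by cases (simp_all add: h_def qcls_coeff)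
  next
    case False
    then show ?thesis using hc unfolding kQ_carrier by blast
  qed
  then have "h \<in> relations_ideal" using hc unfolding relations_ideal_eq long_elts_def by blast
  moreover have "f = h \<oplus>\<^bsub>kQ\<^esub> g" by (simp add: h_def kQ_add)
  ultimately have "f \<in> qcls g" unfolding a_r_coset_def' by blast
  then show ?thesis using a_repr_independence[OF _ g(1) a_subgroup] f g by simp
qed

lemma ecoeff_mult:
  assumes "a \<in> carrier algA" "b \<in> carrier algA" "1 \<le> i" "i \<le> 5"
  shows "ecoeff (a \<otimes>\<^bsub>algA\<^esub> b) i = ecoeff a i * ecoeff b i"
  using assms
  by (elim algA_carrierE) (auto simp: qcls_mult qcls_coeff kQ_mult qpaths_Q5_iff)

lemma xcoeff_mult:
  assumes "a \<in> carrier algA" "b \<in> carrier algA" "1 \<le> i" "i \<le> 4"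
  shows "xcoeff (a \<otimes>\<^bsub>algA\<^esub> b) i = ecoeff a i * xcoeff b i + xcoeff a i * ecoeff b (Suc i)"
proof -
  have *: "{i..Suc i} = {i, Suc i}" by auto
  show ?thesis using assms
    by (elim algA_carrierE) (auto simp: qcls_mult qcls_coeff kQ_mult qpaths_Q5_iff *)
qed

lemma A_coeff_add:
  assumes "a \<in> carrier algA" "b \<in> carrier algA" "length p \<le> 1"
  shows "A_coeff (a \<oplus>\<^bsub>algA\<^esub> b) (u, p, v) = A_coeff a (u, p, v) + A_coeff b (u, p, v)"
  using assms by (elim algA_carrierE) (auto simp: qcls_add qcls_coeff kQ_add)

lemma A_scalar_carrier [simp]: "A_scalar c \<in> carrier algA"
  unfolding A_scalar_def by (rule qcls_carrier) (auto simp: kQ_carrier kQ_one qpaths_Q5_iff)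

lemma ecoeff_scalar: "1 \<le> i \<Longrightarrow> i \<le> 5 \<Longrightarrow> ecoeff (A_scalar c) i = c"
  by (simp add: A_scalar_def qcls_coeff kQ_one)

lemma xcoeff_scalar: "xcoeff (A_scalar c) i = 0"
  by (simp add: A_scalar_def qcls_coeff kQ_one)

lemma ecoeff_one: "1 \<le> i \<Longrightarrow> i \<le> 5 \<Longrightarrow> ecoeff \<one>\<^bsub>algA\<^esub> i = 1"
  by (simp add: qcls_one qcls_coeff kQ_one)

lemma xcoeff_one: "xcoeff \<one>\<^bsub>algA\<^esub> i = 0"
  by (simp add: qcls_one qcls_coeff kQ_one)

definition eA :: "nat \<Rightarrow> 'k::field A_elt" where
  "eA i = qcls (path_elt (i, [], i))"

text \<open>The junk value at the vertices that no arrow leaves makes \<open>xA\<close> total.\<close>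

definition xA :: "nat \<Rightarrow> 'k::field A_elt" where
  "xA i = (if 1 \<le> i \<and> i \<le> 4 then qcls (path_elt (i, [i], Suc i)) else \<zero>\<^bsub>algA\<^esub>)"

lemma eA_carrier: "1 \<le> i \<Longrightarrow> i \<le> 5 \<Longrightarrow> eA i \<in> carrier algA"
  unfolding eA_def by (rule qcls_carrier) (auto simp: kQ_carrier path_elt_def qpaths_Q5_iff)

lemma xA_carrier [simp]: "xA i \<in> carrier algA"
  unfolding xA_def
  by (auto simp: kQ_carrier path_elt_def qpaths_Q5_iff ring.ring_simprules(2)[OF algA_ring] intro!: qcls_carrier)

lemma algA_zero: "\<zero>\<^bsub>algA\<^esub> = qcls (\<lambda>x. 0)"
proof -
  interpret ideal "relations_ideal :: 'a kQ_elt set" kQ by (rule ideal_relations)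
  have "(\<zero>\<^bsub>kQ\<^esub> :: 'a kQ_elt) \<in> relations_ideal" by simp
  then have "qcls \<zero>\<^bsub>kQ\<^esub> = (relations_ideal :: 'a kQ_elt set)" using a_coset_join2 a_subgroup by simp
  then show ?thesis by (simp add: algA_def FactRing_def kQ_zero)
qed

lemma ecoeff_eA: "ecoeff (eA i) j = (if i = j then 1 else 0)"
  and xcoeff_eA: "xcoeff (eA i) j = 0"
  by (auto simp: eA_def qcls_coeff path_elt_def)

lemma ecoeff_xA: "ecoeff (xA i) j = 0"
  and xcoeff_xA: "xcoeff (xA i) j = (if i = j \<and> 1 \<le> i \<and> i \<le> 4 then 1 else 0)"
  by (auto simp: xA_def qcls_coeff path_elt_def algA_zero)

lemmas A_coeff_simps = ecoeff_mult xcoeff_mult A_coeff_add ecoeff_scalar xcoeff_scalar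
  ecoeff_one xcoeff_one ecoeff_eA xcoeff_eA ecoeff_xA xcoeff_xA

section \<open>Right modules as vector spaces with five idempotents and four arrows whose products
  vanish\<close>

section \<open>Modules\<close>

lemma algA_scalar_commutes:
  assumes "a \<in> carrier algA"
  shows "A_scalar c \<otimes>\<^bsub>algA\<^esub> a = a \<otimes>\<^bsub>algA\<^esub> A_scalar c"
proof -
  interpret ring "algA :: 'a A_elt ring" by (rule algA_ring)
  show ?thesis using assms by (intro algA_eqI) (auto simp: A_coeff_simps)
qed

lemma algA_eA_mult:
  assumes "1 \<le> i" "i \<le> 5" "1 \<le> j" "j \<le> 5"
  shows "eA i \<otimes>\<^bsub>algA\<^esub> eA j = (if i = j then eA i else A_scalar 0)"
proof -
  interpret ring "algA :: 'a A_elt ring" by (rule algA_ring)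
  show ?thesis using assms by (intro algA_eqI) (auto simp: A_coeff_simps eA_carrier)
qed

lemma algA_eA_xA_mult:
  assumes "1 \<le> i" "i \<le> 5"
  shows "eA i \<otimes>\<^bsub>algA\<^esub> xA j = (if i = j then xA j else A_scalar 0)"
proof -
  interpret ring "algA :: 'a A_elt ring" by (rule algA_ring)
  show ?thesis using assms by (intro algA_eqI) (auto simp: A_coeff_simps eA_carrier)
qed

lemma algA_xA_eA_mult:
  assumes "1 \<le> i" "i \<le> 5"
  shows "xA j \<otimes>\<^bsub>algA\<^esub> eA i = (if i = Suc j then xA j else A_scalar 0)"
proof -
  interpret ring "algA :: 'a A_elt ring" by (rule algA_ring)
  show ?thesis using assms by (intro algA_eqI) (auto simp: A_coeff_simps eA_carrier)
qed

lemma algA_xA_mult: "xA i \<otimes>\<^bsub>algA\<^esub> xA j = A_scalar 0"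
proof -
  interpret ring "algA :: 'a A_elt ring" by (rule algA_ring)
  show ?thesis by (intro algA_eqI) (auto simp: A_coeff_simps)
qed

lemma vscale_simps [simp]:
  "vscale 0 v = 0" "vscale 1 v = v" "vscale c 0 = 0" "vscale c v n = c * v n"
  by (auto simp: vscale_def fun_eq_iff)

lemma vec_plus_zero_fun [simp]: "(\<lambda>n. 0) = (0 :: 'k::field vec)"
  by (simp add: fun_eq_iff)

lemma unit_vec_simps [simp]:
  "unit_vec 0 0 = 1" "unit_vec 0 (Suc n) = 0" "unit_vec (Suc 0) 0 = 0" "unit_vec (Suc 0) (Suc 0) = 1"
  "unit_vec (Suc 0) (Suc (Suc n)) = 0"
  by (auto simp: unit_vec_def)

lemma unit_vec_nonzero [simp]: "unit_vec n \<noteq> 0"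
  by (auto simp: unit_vec_def fun_eq_iff)

context
  fixes M :: "'k::field rmod"
  assumes M: "is_rmod M"
begin

lemma rmod_subspace: "vec.subspace (space M)"
  using M by (auto simp: is_rmod_def)

lemma rmod_zero [simp]: "0 \<in> space M"
  by (rule vec.subspace_0[OF rmod_subspace])

lemma rmod_add: "\<lbrakk>v \<in> space M; w \<in> space M\<rbrakk> \<Longrightarrow> v + w \<in> space M"
  by (rule vec.subspace_add[OF rmod_subspace])

lemma rmod_diff: "\<lbrakk>v \<in> space M; w \<in> space M\<rbrakk> \<Longrightarrow> v - w \<in> space M"
  by (rule vec.subspace_diff[OF rmod_subspace])

lemma rmod_neg: "v \<in> space M \<Longrightarrow> - v \<in> space M"
  by (rule vec.subspace_neg[OF rmod_subspace])

lemma rmod_scale: "v \<in> space M \<Longrightarrow> vscale c v \<in> space M"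
  by (rule vec.subspace_scale[OF rmod_subspace])

lemma act_closed: "\<lbrakk>v \<in> space M; a \<in> carrier algA\<rbrakk> \<Longrightarrow> act M v a \<in> space M"
  using M by (auto simp: is_rmod_def)

lemma act_add: "\<lbrakk>v \<in> space M; w \<in> space M; a \<in> carrier algA\<rbrakk> \<Longrightarrow> act M (v + w) a = act M v a + act M w a"
  using M by (auto simp: is_rmod_def)

lemma act_add_right:
  "\<lbrakk>v \<in> space M; a \<in> carrier algA; b \<in> carrier algA\<rbrakk> \<Longrightarrow> act M v (a \<oplus>\<^bsub>algA\<^esub> b) = act M v a + act M v b"
  using M by (auto simp: is_rmod_def)

lemma act_mult:
  "\<lbrakk>v \<in> space M; a \<in> carrier algA; b \<in> carrier algA\<rbrakk> \<Longrightarrow> act M (act M v a) b = act M v (a \<otimes>\<^bsub>algA\<^esub> b)"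
  using M by (auto simp: is_rmod_def)

lemma act_one: "v \<in> space M \<Longrightarrow> act M v \<one>\<^bsub>algA\<^esub> = v"
  using M by (auto simp: is_rmod_def)

lemma act_scalar: "v \<in> space M \<Longrightarrow> act M v (A_scalar c) = vscale c v"
  using M by (auto simp: is_rmod_def)

lemma act_scale:
  assumes "v \<in> space M" "a \<in> carrier algA"
  shows "act M (vscale c v) a = vscale c (act M v a)"
  using assms act_mult[of v "A_scalar c" a] act_mult[of v a "A_scalar c"]
  by (simp add: act_scalar act_closed algA_scalar_commutes)

lemma act_zero: "a \<in> carrier algA \<Longrightarrow> act M 0 a = 0"
  using act_scale[of 0 a 0] by simp

lemma act_neg:
  assumes "v \<in> space M" "a \<in> carrier algA"
  shows "act M (- v) a = - act M v a"
  using act_scale[OF assms, of "-1"] by (simp add: vscale_def fun_Compl_def)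

lemma act_diff:
  assumes "v \<in> space M" "w \<in> space M" "a \<in> carrier algA"
  shows "act M (v - w) a = act M v a - act M w a"
  using act_add[of v "- w" a] assms by (simp add: act_neg rmod_neg)

lemma act_eA_eA:
  "\<lbrakk>v \<in> space M; 1 \<le> i; i \<le> 5; 1 \<le> j; j \<le> 5\<rbrakk> \<Longrightarrow>
    act M (act M v (eA i)) (eA j) = (if i = j then act M v (eA i) else 0)"
  by (simp add: act_mult eA_carrier algA_eA_mult act_scalar)

lemma act_eA_xA:
  "\<lbrakk>v \<in> space M; 1 \<le> i; i \<le> 5\<rbrakk> \<Longrightarrow>
    act M (act M v (eA i)) (xA j) = (if i = j then act M v (xA j) else 0)"
  by (simp add: act_mult eA_carrier algA_eA_xA_mult act_scalar)

lemma act_xA_eA: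
  "\<lbrakk>v \<in> space M; 1 \<le> i; i \<le> 5\<rbrakk> \<Longrightarrow>
    act M (act M v (xA j)) (eA i) = (if i = Suc j then act M v (xA j) else 0)"
  by (simp add: act_mult eA_carrier algA_xA_eA_mult act_scalar)

lemma act_xA_xA: "v \<in> space M \<Longrightarrow> act M (act M v (xA i)) (xA j) = 0"
  by (simp add: act_mult algA_xA_mult act_scalar)

text \<open>Expands a in the basis e_1, ..., e_5, x_1, ..., x_4 of A. This reduces A-linearity to
  compatibility with scalars, idempotents and arrows, the form in which \<open>rmod_homI\<close>
  asks for it.\<close>

lemma act_expand:
  assumes v: "v \<in> space M" and a: "a \<in> carrier algA"
  shows "act M v a = vscale (ecoeff a 1) (act M v (eA 1)) + (vscale (ecoeff a 2) (act M v (eA 2)) +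
    (vscale (ecoeff a 3) (act M v (eA 3)) + (vscale (ecoeff a 4) (act M v (eA 4)) +
    (vscale (ecoeff a 5) (act M v (eA 5)) + (vscale (xcoeff a 1) (act M v (xA 1)) +
    (vscale (xcoeff a 2) (act M v (xA 2)) + (vscale (xcoeff a 3) (act M v (xA 3)) +
     vscale (xcoeff a 4) (act M v (xA 4)))))))))"
proof -
  interpret ring "algA :: 'k A_elt ring" by (rule algA_ring)
  let ?t = "\<lambda>i. A_scalar (ecoeff a i) \<otimes>\<^bsub>algA\<^esub> eA i"
  let ?s = "\<lambda>i. A_scalar (xcoeff a i) \<otimes>\<^bsub>algA\<^esub> xA i"
  have t: "?t i \<in> carrier algA" if "1 \<le> i" "i \<le> 5" for i
    using that by (simp add: eA_carrier)
  have s: "?s i \<in> carrier algA" for i by simp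
  have a_eq: "a = ?t 1 \<oplus>\<^bsub>algA\<^esub> (?t 2 \<oplus>\<^bsub>algA\<^esub> (?t 3 \<oplus>\<^bsub>algA\<^esub> (?t 4 \<oplus>\<^bsub>algA\<^esub> (?t 5 \<oplus>\<^bsub>algA\<^esub>
     (?s 1 \<oplus>\<^bsub>algA\<^esub> (?s 2 \<oplus>\<^bsub>algA\<^esub> (?s 3 \<oplus>\<^bsub>algA\<^esub> ?s 4)))))))" (is "a = ?r")
  proof (rule algA_eqI[OF a])
    show "?r \<in> carrier algA" using t s by simp
    show "ecoeff a i = ecoeff ?r i" if "1 \<le> i" "i \<le> 5" for i
    proof -
      have "i = 1 \<or> i = 2 \<or> i = 3 \<or> i = 4 \<or> i = 5" using that by auto
      then show ?thesis by (elim disjE; simp add: A_coeff_simps eA_carrier)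
    qed
    show "xcoeff a i = xcoeff ?r i" if "1 \<le> i" "i \<le> 4" for i
    proof -
      have i: "i = 1 \<or> i = 2 \<or> i = 3 \<or> i = 4" using that by auto
      have "xcoeff ?r i = (if i = 1 then xcoeff a 1 else 0) + ((if i = 2 then xcoeff a 2 else 0) +
          ((if i = 3 then xcoeff a 3 else 0) + (if i = 4 then xcoeff a 4 else 0)))"
        using that by (auto simp: A_coeff_simps eA_carrier)
      then show ?thesis using i by (elim disjE) simp_all
    qed
  qed
  have ta: "act M v (?t i) = vscale (ecoeff a i) (act M v (eA i))" if "1 \<le> i" "i \<le> 5" for i
    using that v act_mult[of v "A_scalar (ecoeff a i)" "eA i"]
    by (simp add: eA_carrier act_scalar act_scale)
  have sa: "act M v (?s i) = vscale (xcoeff a i) (act M v (xA i))" for i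
    using v act_mult[of v "A_scalar (xcoeff a i)" "xA i"]
    by (simp add: act_scalar act_scale)
  have "act M v a = act M v ?r" using a_eq by (rule arg_cong)
  then show ?thesis using v sa[of 2] sa[of 3] sa[of 4] by (simp add: act_add_right t s ta sa eA_carrier)
qed

lemma rmod_vertices:
  assumes "v \<in> space M"
  shows "v = act M v (eA 1) + (act M v (eA 2) + (act M v (eA 3) + (act M v (eA 4) + act M v (eA 5))))"
proof -
  interpret ring "algA :: 'k A_elt ring" by (rule algA_ring)
  have x: "xcoeff (\<one>\<^bsub>algA\<^esub> :: 'k A_elt) i = 0" for i by (rule xcoeff_one)
  show ?thesis
    using act_expand[OF assms, of "\<one>\<^bsub>algA\<^esub>"] x[of 1] x[of 2] x[of 3] x[of 4]
    by (simp add: act_one assms ecoeff_one)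
qed

lemma act_xA_high: "v \<in> space M \<Longrightarrow> i \<ge> 5 \<Longrightarrow> act M v (xA i) = 0"
proof -
  interpret ring "algA :: 'k A_elt ring" by (rule algA_ring)
  assume "v \<in> space M" "i \<ge> 5"
  moreover from this have "xA i = (A_scalar 0 :: 'k A_elt)"
    by (intro algA_eqI) (auto simp: A_coeff_simps)
  ultimately show ?thesis by (simp add: act_scalar)
qed

text \<open>Applied to the cocycles of a complex. A maximal independent subset of V is finite
  because it lies in the span of a finite set.\<close>

lemma rmod_finite_gens:
  assumes "vec.subspace V" "V \<subseteq> space M"
  obtains G where "finite G" "G \<subseteq> V" "V = vec.span G"
proof -
  obtain B where B: "finite B" "space M = vec.span B" using M by (auto simp: is_rmod_def)
  obtain G where G: "G \<subseteq> V" "vec.independent G" "V \<subseteq> vec.span G"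
    using vec.maximal_independent_subset by blast
  have "finite G" using vec.independent_span_bound[OF B(1) G(2)] G(1) assms(2) B(2) by auto
  moreover have "vec.span G \<subseteq> V" using G(1) assms(1) by (rule vec.span_minimal)
  ultimately show ?thesis using that G by blast
qed

end

lemma rmod_homI:
  assumes M: "is_rmod M" and N: "is_rmod N"
    and f: "\<And>v. v \<in> space M \<Longrightarrow> f v \<in> space N"
    and add: "\<And>v w. \<lbrakk>v \<in> space M; w \<in> space M\<rbrakk> \<Longrightarrow> f (v + w) = f v + f w"
    and scale: "\<And>v c. v \<in> space M \<Longrightarrow> f (vscale c v) = vscale c (f v)"
    and e: "\<And>v i. \<lbrakk>v \<in> space M; 1 \<le> i; i \<le> 5\<rbrakk> \<Longrightarrow> f (act M v (eA i)) = act N (f v) (eA i)"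
    and x: "\<And>v i. \<lbrakk>v \<in> space M; 1 \<le> i; i \<le> 4\<rbrakk> \<Longrightarrow> f (act M v (xA i)) = act N (f v) (xA i)"
    and out: "\<And>v. v \<notin> space M \<Longrightarrow> f v = 0"
  shows "f \<in> rmod_hom M N"
proof -
  have "f (act M v a) = act N (f v) a" if v: "v \<in> space M" and a: "a \<in> carrier algA" for v a
    unfolding act_expand[OF M v a] act_expand[OF N f[OF v] a]
    by (simp add: add scale e x v M f rmod_add rmod_scale act_closed eA_carrier)
  then show ?thesis using assms by (auto simp: rmod_hom_def)
qed

context
  fixes M N :: "'k::field rmod" and f
  assumes M: "is_rmod M" and N: "is_rmod N" and f: "f \<in> rmod_hom M N"
begin

lemma hom_closed: "v \<in> space M \<Longrightarrow> f v \<in> space N"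
  using f by (auto simp: rmod_hom_def)

lemma hom_out: "v \<notin> space M \<Longrightarrow> f v = 0"
  using f by (auto simp: rmod_hom_def)

lemma hom_add: "\<lbrakk>v \<in> space M; w \<in> space M\<rbrakk> \<Longrightarrow> f (v + w) = f v + f w"
  using f by (auto simp: rmod_hom_def)

lemma hom_act: "\<lbrakk>v \<in> space M; a \<in> carrier algA\<rbrakk> \<Longrightarrow> f (act M v a) = act N (f v) a"
  using f by (auto simp: rmod_hom_def)

lemma hom_scale: "v \<in> space M \<Longrightarrow> f (vscale c v) = vscale c (f v)"
  using hom_act[of v "A_scalar c"] by (simp add: act_scalar[OF M] act_scalar[OF N] hom_closed)

lemma hom_zero: "f 0 = 0"
  using hom_scale[of 0 0] by (simp add: rmod_zero[OF M])

lemma hom_neg: "v \<in> space M \<Longrightarrow> f (- v) = - f v"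
  using hom_scale[of v "-1"] by (simp add: vscale_def fun_Compl_def)

lemma hom_diff: "\<lbrakk>v \<in> space M; w \<in> space M\<rbrakk> \<Longrightarrow> f (v - w) = f v - f w"
  using hom_add[of v "- w"] by (simp add: hom_neg rmod_neg[OF M])

lemma hom_space: "f v \<in> space N"
  using hom_closed hom_out rmod_zero[OF N] by (cases "v \<in> space M") auto

end

lemma rmod_hom_zero: "is_rmod N \<Longrightarrow> (\<lambda>v. 0) \<in> rmod_hom M N"
  by (auto simp: rmod_hom_def act_zero)

lemma rmod_hom_ident: "is_rmod M \<Longrightarrow> (\<lambda>v. if v \<in> space M then v else 0) \<in> rmod_hom M M"
  by (auto simp: rmod_hom_def rmod_add act_closed)

lemma rmod_hom_comp:
  assumes "is_rmod M" "is_rmod N" "is_rmod L" "f \<in> rmod_hom M N" "g \<in> rmod_hom N L"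
  shows "(\<lambda>v. g (f v)) \<in> rmod_hom M L"
  using assms hom_zero[OF assms(2,3,5)] by (auto simp: rmod_hom_def)

lemma rmod_hom_plus:
  assumes "is_rmod N" "f \<in> rmod_hom M N" "g \<in> rmod_hom M N"
  shows "(\<lambda>v. f v + g v) \<in> rmod_hom M N"
  using assms by (auto simp: rmod_hom_def rmod_add act_add algebra_simps)

lemma rmod_hom_neg:
  assumes "is_rmod N" "f \<in> rmod_hom M N"
  shows "(\<lambda>v. - f v) \<in> rmod_hom M N"
  using assms by (auto simp: rmod_hom_def rmod_neg act_neg algebra_simps)

lemma rmod_hom_minus:
  assumes "is_rmod N" "f \<in> rmod_hom M N" "g \<in> rmod_hom M N"
  shows "(\<lambda>v. f v - g v) \<in> rmod_hom M N"
  using assms by (auto simp: rmod_hom_def rmod_diff act_diff algebra_simps)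

subsection \<open>Standard modules\<close>

lemma span_unit0: "v \<in> vec.span {unit_vec 0} \<longleftrightarrow> (\<forall>n\<ge>1. v n = 0)"
proof -
  have "v = vscale (v 0) (unit_vec 0)" if "\<forall>n\<ge>1. v n = 0"
    using that by (auto simp: fun_eq_iff unit_vec_def)
  then show ?thesis by (auto simp: vec.span_singleton unit_vec_def)
qed

lemma span_unit01: "v \<in> vec.span {unit_vec 0, unit_vec 1} \<longleftrightarrow> (\<forall>n\<ge>2. v n = 0)"
proof -
  have "v = vscale (v 0) (unit_vec 0) + vscale (v 1) (unit_vec 1)" if "\<forall>n\<ge>2. v n = 0"
  proof
    fix n
    show "v n = (vscale (v 0) (unit_vec 0) + vscale (v 1) (unit_vec 1)) n"
      using that by (cases n; cases "n - 1") (auto simp: unit_vec_def)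
  qed
  then have "(\<forall>n\<ge>2. v n = 0) \<Longrightarrow> v \<in> vec.span {unit_vec 0, unit_vec 1}"
    by (metis vec.span_add vec.span_base vec.span_scale insertCI)
  moreover have "vec.subspace {v. \<forall>n\<ge>2. v n = 0}"
    by (auto simp: vec.subspace_def)
  then have "vec.span {unit_vec 0, unit_vec 1} \<subseteq> {v. \<forall>n\<ge>2. v n = 0}"
    by (intro vec.span_minimal) (auto simp: unit_vec_def)
  ultimately show ?thesis by blast
qed

lemma simple_space: "v \<in> space (simple_rmod i) \<longleftrightarrow> (\<forall>n\<ge>1. v n = 0)"
  by (simp add: simple_rmod_def span_unit0)

lemma uniserial_space: "v \<in> space (uniserial_rmod i) \<longleftrightarrow> (\<forall>n\<ge>2. v n = 0)"
  by (simp only: uniserial_rmod_def rmod.simps span_unit01)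

lemma simple_is_rmod:
  assumes "1 \<le> i" "i \<le> 5"
  shows "is_rmod (simple_rmod i)"
proof -
  have "\<exists>B. finite B \<and> space (simple_rmod i) = vec.span B"
    by (rule exI[of _ "{unit_vec 0}"]) (simp add: simple_rmod_def)
  then show ?thesis
    unfolding is_rmod_def
    using assms by (intro conjI ballI allI)
      (auto simp: span_unit0 simple_rmod_def A_coeff_simps fun_eq_iff algebra_simps)
qed

lemma uniserial_is_rmod:
  assumes "1 \<le> i" "i \<le> 4"
  shows "is_rmod (uniserial_rmod i)"
proof -
  have "\<exists>B. finite B \<and> space (uniserial_rmod i) = vec.span B"
    by (rule exI[of _ "{unit_vec 0, unit_vec 1}"]) (simp add: uniserial_rmod_def)
  moreover have ext2: "v = w" if "v 0 = w 0" "v 1 = w 1" "\<forall>n\<ge>2. v n = 0" "\<forall>n\<ge>2. w n = 0"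
    for v w :: "'a vec"
  proof
    fix n show "v n = w n" using that by (cases n; cases "n - 1") auto
  qed
  have u: "unit_vec 0 n = 0" "unit_vec (Suc 0) n = 0" if "n \<ge> 2" for n
    using that by (auto simp: unit_vec_def)
  moreover have "vscale c v + vscale d w = vscale c' v + vscale d' w" if "c = c'" "d = d'"
    for c d c' d' and v w :: "'a vec" using that by simp
  ultimately show ?thesis
    unfolding is_rmod_def uniserial_space
    using assms
    apply (intro conjI ballI allI)
    apply (simp_all add: uniserial_rmod_def u A_coeff_simps span_unit01[simplified])
    apply (intro ext2; simp add: u span_unit01[simplified] algebra_simps; fail)+
    done
qed

text \<open>P_i with \<open>unit_vec 0\<close> as its top for every i, and \<open>unit_vec 1\<close>
  as its socle unless i = 5, where P_5 = S_5 has no second basis vector. The exceptions for 5 in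
  later lemmas come from this.\<close>

definition proj_rmod :: "nat \<Rightarrow> 'k::field rmod" where
  "proj_rmod i = (if i = 5 then simple_rmod 5 else uniserial_rmod i)"

lemma proj_is_rmod: "1 \<le> i \<Longrightarrow> i \<le> 5 \<Longrightarrow> is_rmod (proj_rmod i)"
  by (simp add: proj_rmod_def simple_is_rmod uniserial_is_rmod)

lemma zero_is_rmod: "is_rmod zero_rmod"
proof -
  have "\<exists>B. finite B \<and> {0} = vec.span B" by (rule exI[of _ "{}"]) simp
  then show ?thesis by (auto simp: is_rmod_def zero_rmod_def)
qed

lemma zero_space [simp]: "v \<in> space zero_rmod \<longleftrightarrow> v = 0"
  by (simp add: zero_rmod_def)

lemma zero_act [simp]: "act zero_rmod v a = 0"
  by (simp add: zero_rmod_def)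

lemma simple_act_eA: "act (simple_rmod i) v (eA j) = (if i = j then v else 0)"
  and simple_act_xA: "act (simple_rmod i) v (xA j) = 0"
  by (auto simp: simple_rmod_def A_coeff_simps)

lemma uniserial_act_eA: "act (uniserial_rmod i) v (eA j) =
    (if j = i then vscale (v 0) (unit_vec 0) else if j = Suc i then vscale (v 1) (unit_vec 1) else 0)"
  and uniserial_act_xA: "1 \<le> i \<Longrightarrow> i \<le> 4 \<Longrightarrow>
    act (uniserial_rmod i) v (xA j) = (if j = i then vscale (v 0) (unit_vec 1) else 0)"
  by (auto simp: uniserial_rmod_def A_coeff_simps)

subsection \<open>Direct sums of modules\<close>

text \<open>All modules live in one space of sequences, so a direct sum has to be put back into it:
  the summands are interleaved into the even and the odd positions. \<open>vfst\<close> and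
  \<open>vsnd\<close> are the projections.\<close>

definition vpair :: "'k::field vec \<Rightarrow> 'k vec \<Rightarrow> 'k vec" where
  "vpair v w = (\<lambda>n. if even n then v (n div 2) else w (n div 2))"

definition vfst :: "'k::field vec \<Rightarrow> 'k vec" where
  "vfst u = (\<lambda>n. u (2 * n))"

definition vsnd :: "'k::field vec \<Rightarrow> 'k vec" where
  "vsnd u = (\<lambda>n. u (Suc (2 * n)))"

lemma vpair_simps [simp]: "vfst (vpair v w) = v" "vsnd (vpair v w) = w" "vpair (vfst u) (vsnd u) = u"
  by (auto simp: vpair_def vfst_def vsnd_def fun_eq_iff)

lemma vpair_eq_iff: "u = u' \<longleftrightarrow> vfst u = vfst u' \<and> vsnd u = vsnd u'"
  by (metis vpair_simps(3))

lemma vpair_linear: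
  "vpair v w + vpair v' w' = vpair (v + v') (w + w')"
  "vpair v w - vpair v' w' = vpair (v - v') (w - w')"
  "- vpair v w = vpair (- v) (- w)"
  "vscale c (vpair v w) = vpair (vscale c v) (vscale c w)"
  by (auto simp: vpair_def fun_eq_iff)

lemma vfst_linear [simp]:
  "vfst (u + u') = vfst u + vfst u'" "vfst (u - u') = vfst u - vfst u'" "vfst (- u) = - vfst u"
  "vfst (vscale c u) = vscale c (vfst u)" "vfst 0 = 0"
  "vsnd (u + u') = vsnd u + vsnd u'" "vsnd (u - u') = vsnd u - vsnd u'" "vsnd (- u) = - vsnd u"
  "vsnd (vscale c u) = vscale c (vsnd u)" "vsnd 0 = 0"
  by (auto simp: vfst_def vsnd_def fun_eq_iff)

lemma vpair_zero [simp]: "vpair 0 0 = 0"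
  by (simp add: vpair_def fun_eq_iff)

lemma vpair_eq_zero_iff [simp]: "vpair v w = 0 \<longleftrightarrow> v = 0 \<and> w = 0"
  by (simp add: vpair_eq_iff[of "vpair v w" 0])

lemma vpair_vscale [simp]: "vpair (vscale c (vfst u)) (vscale c (vsnd u)) = vscale c u"
  by (simp add: vpair_eq_iff)

definition dsum_mod :: "'k::field rmod \<Rightarrow> 'k rmod \<Rightarrow> 'k rmod" where
  "dsum_mod M N = \<lparr>space = {u. vfst u \<in> space M \<and> vsnd u \<in> space N},
     act = (\<lambda>u a. vpair (act M (vfst u) a) (act N (vsnd u) a))\<rparr>"

lemma dsum_space [simp]: "u \<in> space (dsum_mod M N) \<longleftrightarrow> vfst u \<in> space M \<and> vsnd u \<in> space N"
  by (simp add: dsum_mod_def)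

lemma dsum_act [simp]: "act (dsum_mod M N) u a = vpair (act M (vfst u) a) (act N (vsnd u) a)"
  by (simp add: dsum_mod_def)

lemma dsum_is_rmod:
  assumes M: "is_rmod M" and N: "is_rmod N"
  shows "is_rmod (dsum_mod M N)"
proof -
  interpret vp: vector_space_pair "vscale :: 'a \<Rightarrow> _" "vscale :: 'a \<Rightarrow> _" by unfold_locales
  obtain B where B: "finite B" "space M = vec.span B" using M by (auto simp: is_rmod_def)
  obtain C where C: "finite C" "space N = vec.span C" using N by (auto simp: is_rmod_def)
  have "Vector_Spaces.linear vscale vscale (\<lambda>v :: 'a vec. vpair v 0)"
       "Vector_Spaces.linear vscale vscale (\<lambda>v :: 'a vec. vpair 0 v)"
    by unfold_locales (auto simp: vpair_linear algebra_simps vpair_eq_iff)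
  then have *: "vec.span ((\<lambda>v. vpair v 0) ` B) = (\<lambda>v. vpair v 0) ` vec.span B"
       "vec.span ((\<lambda>v. vpair 0 v) ` C) = (\<lambda>v. vpair 0 v) ` vec.span C"
    by (simp_all add: vp.linear_span_image)
  have "space (dsum_mod M N) = vec.span ((\<lambda>v. vpair v 0) ` B \<union> (\<lambda>v. vpair 0 v) ` C)"
    unfolding vec.span_Un *
  proof (intro equalityI subsetI)
    fix u assume u: "u \<in> space (dsum_mod M N)"
    have "u = vpair (vfst u) 0 + vpair 0 (vsnd u)" by (simp add: vpair_linear)
    then show "u \<in> {x + y |x y. x \<in> (\<lambda>v. vpair v 0) ` vec.span B \<and> y \<in> (\<lambda>v. vpair 0 v) ` vec.span C}"
      using u B C by auto
  qed (use B C in \<open>auto simp: vpair_linear\<close>)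
  then have "\<exists>B. finite B \<and> space (dsum_mod M N) = vec.span B" using B C by blast
  then show ?thesis using assms
    unfolding is_rmod_def[of "dsum_mod M N"]
    by (auto simp: rmod_add act_closed act_add act_add_right act_mult act_one act_scalar vpair_linear)
qed

section \<open>Bounded complexes, with cohomology handled through cocycles and coboundaries\<close>

section \<open>Complexes\<close>

lemma vec_zero_iff: "vfst u = 0 \<and> vsnd u = 0 \<longleftrightarrow> u = 0"
  by (metis vpair_simps(3) vpair_zero vfst_linear(5) vfst_linear(10))

abbreviation sp :: "'k::field complx \<Rightarrow> int \<Rightarrow> 'k vec set" where
  "sp X n \<equiv> space (obj X n)"

lemma modA_simps [simp]:
  "Ob modA = {M. is_rmod M}" "Mor modA = rmod_hom" "Comp modA g f = g \<circ> f"
  "Ident modA = (\<lambda>M v. if v \<in> space M then v else 0)" "Plus modA f g = (\<lambda>v. f v + g v)"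
  "Zero modA M N = (\<lambda>v. 0)" "Neg modA f = (\<lambda>v. - f v)"
  by (simp_all add: modA_def)

lemma is_bcomplexI:
  assumes "\<And>n. is_rmod (obj X n)" "\<And>n. dif X n \<in> rmod_hom (obj X n) (obj X (n + 1))"
    "\<And>n v. dif X (n + 1) (dif X n v) = 0" "finite {n. sp X n \<noteq> {0}}"
  shows "is_bcomplex X"
  using assms by (simp add: is_bcomplex_def fun_eq_iff)

lemma chain_mapsI:
  assumes "\<And>n. f n \<in> rmod_hom (obj X n) (obj Y n)" "\<And>n v. dif Y n (f n v) = f (n + 1) (dif X n v)"
  shows "f \<in> chain_maps X Y"
  using assms by (simp add: chain_maps_def fun_eq_iff)

context
  fixes X :: "'k::field complx"
  assumes X: "is_bcomplex X"
begin

lemma bc_mod [simp]: "is_rmod (obj X n)"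
  using X by (simp add: is_bcomplex_def)

lemma dif_hom: "dif X n \<in> rmod_hom (obj X n) (obj X (n + 1))"
  using X by (simp add: is_bcomplex_def)

lemma dif_dif: "dif X (n + 1) (dif X n v) = 0"
  using X by (simp add: is_bcomplex_def fun_eq_iff)

lemma dif_dif': "dif X n (dif X (n - 1) v) = 0"
  using dif_dif[of "n - 1" v] by simp

lemma dif_closed: "dif X n v \<in> sp X (n + 1)"
  by (rule hom_space[OF bc_mod bc_mod dif_hom])

lemma dif_closed': "dif X (n - 1) v \<in> sp X n"
  using dif_closed[of "n - 1" v] by simp

lemma dif_out: "v \<notin> sp X n \<Longrightarrow> dif X n v = 0"
  by (rule hom_out[OF bc_mod bc_mod dif_hom])

lemma dif_add: "\<lbrakk>v \<in> sp X n; w \<in> sp X n\<rbrakk> \<Longrightarrow> dif X n (v + w) = dif X n v + dif X n w"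
  by (rule hom_add[OF bc_mod bc_mod dif_hom])

lemma dif_diff: "\<lbrakk>v \<in> sp X n; w \<in> sp X n\<rbrakk> \<Longrightarrow> dif X n (v - w) = dif X n v - dif X n w"
  by (rule hom_diff[OF bc_mod bc_mod dif_hom])

lemma dif_neg: "v \<in> sp X n \<Longrightarrow> dif X n (- v) = - dif X n v"
  by (rule hom_neg[OF bc_mod bc_mod dif_hom])

lemma dif_scale: "v \<in> sp X n \<Longrightarrow> dif X n (vscale c v) = vscale c (dif X n v)"
  by (rule hom_scale[OF bc_mod bc_mod dif_hom])

lemma dif_zero [simp]: "dif X n 0 = 0"
  by (rule hom_zero[OF bc_mod bc_mod dif_hom])

lemma dif_act: "\<lbrakk>v \<in> sp X n; a \<in> carrier algA\<rbrakk> \<Longrightarrow> dif X n (act (obj X n) v a) = act (obj X (n + 1)) (dif X n v) a"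
  by (rule hom_act[OF bc_mod bc_mod dif_hom])

lemma dif_act': "\<lbrakk>v \<in> sp X (n - 1); a \<in> carrier algA\<rbrakk> \<Longrightarrow>
    dif X (n - 1) (act (obj X (n - 1)) v a) = act (obj X n) (dif X (n - 1) v) a"
  using dif_act[of v "n - 1" a] by simp

lemma cocycles_sp: "v \<in> cocycles X n \<Longrightarrow> v \<in> sp X n"
  by (simp add: cocycles_def)

lemma cocycles_subspace: "vec.subspace (cocycles X n)"
  unfolding vec.subspace_def cocycles_def
  by (auto simp: rmod_add rmod_scale dif_add dif_scale)

lemma cocycles_zero [simp]: "0 \<in> cocycles X n"
  by (simp add: cocycles_def)

lemma cocycles_add: "\<lbrakk>v \<in> cocycles X n; w \<in> cocycles X n\<rbrakk> \<Longrightarrow> v + w \<in> cocycles X n"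
  by (rule vec.subspace_add[OF cocycles_subspace])

lemma cocycles_diff: "\<lbrakk>v \<in> cocycles X n; w \<in> cocycles X n\<rbrakk> \<Longrightarrow> v - w \<in> cocycles X n"
  by (rule vec.subspace_diff[OF cocycles_subspace])

lemma cocycles_scale: "v \<in> cocycles X n \<Longrightarrow> vscale c v \<in> cocycles X n"
  by (rule vec.subspace_scale[OF cocycles_subspace])

lemma cocycles_neg: "v \<in> cocycles X n \<Longrightarrow> - v \<in> cocycles X n"
  by (rule vec.subspace_neg[OF cocycles_subspace])

lemma cocycles_act: "\<lbrakk>v \<in> cocycles X n; a \<in> carrier algA\<rbrakk> \<Longrightarrow> act (obj X n) v a \<in> cocycles X n"
  by (simp add: cocycles_def dif_act act_closed act_zero)

lemma coboundaries_cocycles: "v \<in> coboundaries X n \<Longrightarrow> v \<in> cocycles X n"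
  by (auto simp: coboundaries_def cocycles_def dif_closed' dif_dif')

lemma coboundariesI: "v \<in> sp X (n - 1) \<Longrightarrow> dif X (n - 1) v \<in> coboundaries X n"
  by (simp add: coboundaries_def)

lemma coboundariesI2: "dif X (n - 1) v \<in> coboundaries X n"
  by (cases "v \<in> sp X (n - 1)") (auto simp: coboundaries_def dif_out intro: rev_image_eqI[of 0])

lemma coboundariesE:
  assumes "v \<in> coboundaries X n"
  obtains w where "w \<in> sp X (n - 1)" "v = dif X (n - 1) w"
  using assms by (auto simp: coboundaries_def)

lemma coboundaries_subspace: "vec.subspace (coboundaries X n)"
  unfolding vec.subspace_def
proof (intro conjI allI ballI)
  show "0 \<in> coboundaries X n" using coboundariesI2[of n 0] by simp
  show "v + w \<in> coboundaries X n" if "v \<in> coboundaries X n" "w \<in> coboundaries X n" for v w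
    using that by (elim coboundariesE) (auto simp: dif_add[symmetric] rmod_add coboundariesI)
  show "vscale c v \<in> coboundaries X n" if "v \<in> coboundaries X n" for c v
    using that by (elim coboundariesE) (auto simp: dif_scale[symmetric] rmod_scale coboundariesI)
qed

lemma coboundaries_zero [simp]: "0 \<in> coboundaries X n"
  by (rule vec.subspace_0[OF coboundaries_subspace])

lemma coboundaries_add: "\<lbrakk>v \<in> coboundaries X n; w \<in> coboundaries X n\<rbrakk> \<Longrightarrow> v + w \<in> coboundaries X n"
  by (rule vec.subspace_add[OF coboundaries_subspace])

lemma coboundaries_diff: "\<lbrakk>v \<in> coboundaries X n; w \<in> coboundaries X n\<rbrakk> \<Longrightarrow> v - w \<in> coboundaries X n"
  by (rule vec.subspace_diff[OF coboundaries_subspace])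

lemma coboundaries_scale: "v \<in> coboundaries X n \<Longrightarrow> vscale c v \<in> coboundaries X n"
  by (rule vec.subspace_scale[OF coboundaries_subspace])

lemma coboundaries_neg: "v \<in> coboundaries X n \<Longrightarrow> - v \<in> coboundaries X n"
  by (rule vec.subspace_neg[OF coboundaries_subspace])

lemma coboundaries_act:
  assumes "v \<in> coboundaries X n" "a \<in> carrier algA"
  shows "act (obj X n) v a \<in> coboundaries X n"
  using assms by (elim coboundariesE) (auto simp: dif_act'[symmetric] act_closed coboundariesI)

end

context
  fixes X Y :: "'k::field complx" and f
  assumes X: "is_bcomplex X" and Y: "is_bcomplex Y" and f: "f \<in> chain_maps X Y"
begin

lemma cm_hom: "f n \<in> rmod_hom (obj X n) (obj Y n)"
  using f by (simp add: chain_maps_def)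

lemma cm_dif: "dif Y n (f n v) = f (n + 1) (dif X n v)"
  using f by (simp add: chain_maps_def fun_eq_iff)

lemma cm_dif': "dif Y (n - 1) (f (n - 1) v) = f n (dif X (n - 1) v)"
  using cm_dif[of "n - 1" v] by simp

lemma cm_closed: "f n v \<in> sp Y n"
  by (rule hom_space[OF bc_mod[OF X] bc_mod[OF Y] cm_hom])

lemma cm_out: "v \<notin> sp X n \<Longrightarrow> f n v = 0"
  by (rule hom_out[OF bc_mod[OF X] bc_mod[OF Y] cm_hom])

lemma cm_add: "\<lbrakk>v \<in> sp X n; w \<in> sp X n\<rbrakk> \<Longrightarrow> f n (v + w) = f n v + f n w"
  by (rule hom_add[OF bc_mod[OF X] bc_mod[OF Y] cm_hom])

lemma cm_diff: "\<lbrakk>v \<in> sp X n; w \<in> sp X n\<rbrakk> \<Longrightarrow> f n (v - w) = f n v - f n w"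
  by (rule hom_diff[OF bc_mod[OF X] bc_mod[OF Y] cm_hom])

lemma cm_neg: "v \<in> sp X n \<Longrightarrow> f n (- v) = - f n v"
  by (rule hom_neg[OF bc_mod[OF X] bc_mod[OF Y] cm_hom])

lemma cm_scale: "v \<in> sp X n \<Longrightarrow> f n (vscale c v) = vscale c (f n v)"
  by (rule hom_scale[OF bc_mod[OF X] bc_mod[OF Y] cm_hom])

lemma cm_zero [simp]: "f n 0 = 0"
  by (rule hom_zero[OF bc_mod[OF X] bc_mod[OF Y] cm_hom])

lemma cm_act: "\<lbrakk>v \<in> sp X n; a \<in> carrier algA\<rbrakk> \<Longrightarrow> f n (act (obj X n) v a) = act (obj Y n) (f n v) a"
  by (rule hom_act[OF bc_mod[OF X] bc_mod[OF Y] cm_hom])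

lemma cm_cocycles: "v \<in> cocycles X n \<Longrightarrow> f n v \<in> cocycles Y n"
  by (simp add: cocycles_def cm_closed cm_dif)

lemma cm_coboundaries: "v \<in> coboundaries X n \<Longrightarrow> f n v \<in> coboundaries Y n"
  by (elim coboundariesE[OF X]) (simp add: cm_dif'[symmetric] coboundariesI2[OF Y])

end

lemma chain_maps_ident: "is_bcomplex X \<Longrightarrow> cid X \<in> chain_maps X X"
  by (rule chain_mapsI) (auto simp: cid_def rmod_hom_ident dif_closed dif_out)

lemma cid_in: "v \<in> sp X n \<Longrightarrow> cid X n v = v"
  by (simp add: cid_def)

lemma chain_maps_zero: "\<lbrakk>is_bcomplex X; is_bcomplex Y\<rbrakk> \<Longrightarrow> (\<lambda>n v. 0) \<in> chain_maps X Y"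
  by (rule chain_mapsI) (auto simp: rmod_hom_zero)

lemma chain_maps_comp:
  assumes "is_bcomplex X" "is_bcomplex Y" "is_bcomplex V" "f \<in> chain_maps X Y" "g \<in> chain_maps Y V"
  shows "ccomp g f \<in> chain_maps X V"
proof (rule chain_mapsI)
  show "ccomp g f n \<in> rmod_hom (obj X n) (obj V n)" for n
    unfolding ccomp_def o_def
    by (rule rmod_hom_comp[OF bc_mod bc_mod bc_mod cm_hom cm_hom]) (use assms in auto)
qed (use assms in \<open>simp add: ccomp_def cm_dif[of X Y] cm_dif[of Y V]\<close>)

lemma chain_maps_plus:
  assumes "is_bcomplex X" "is_bcomplex Y" "f \<in> chain_maps X Y" "g \<in> chain_maps X Y"
  shows "(\<lambda>n v. f n v + g n v) \<in> chain_maps X Y"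
proof (rule chain_mapsI)
  show "(\<lambda>v. f n v + g n v) \<in> rmod_hom (obj X n) (obj Y n)" for n
    using assms by (intro rmod_hom_plus cm_hom[of X Y]) auto
qed (use assms in \<open>simp add: dif_add cm_closed[of X Y] cm_dif[of X Y]\<close>)

lemma ccomp_assoc: "ccomp (ccomp h g) f = ccomp h (ccomp g f)"
  by (simp add: ccomp_def comp_assoc)

lemma ccomp_cid_right:
  assumes "is_bcomplex X" "is_bcomplex Y" "f \<in> chain_maps X Y"
  shows "ccomp f (cid X) = f"
  using cm_out[OF assms] cm_zero[OF assms] by (auto simp: ccomp_def cid_def fun_eq_iff)

lemma ccomp_cid_left:
  assumes "is_bcomplex X" "is_bcomplex Y" "f \<in> chain_maps X Y"
  shows "ccomp (cid Y) f = f"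
  using cm_closed[OF assms] by (auto simp: ccomp_def cid_def fun_eq_iff)

subsection \<open>Homotopies\<close>

lemma homotopicI:
  assumes "\<And>n. h n \<in> rmod_hom (obj X n) (obj Y (n - 1))"
    "\<And>n v. f n v - g n v = dif Y (n - 1) (h n v) + h (n + 1) (dif X n v)"
  shows "homotopic X Y f g"
  using assms by (auto simp: homotopic_def)

lemma homotopicE:
  assumes "homotopic X Y f g"
  obtains h where "\<And>n. h n \<in> rmod_hom (obj X n) (obj Y (n - 1))"
    "\<And>n v. f n v - g n v = dif Y (n - 1) (h n v) + h (n + 1) (dif X n v)"
  using assms unfolding homotopic_def modA_simps by blast

lemma homotopic_refl: "\<lbrakk>is_bcomplex X; is_bcomplex Y\<rbrakk> \<Longrightarrow> homotopic X Y f f"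
  by (rule homotopicI[where h = "\<lambda>n v. 0"]) (auto simp: rmod_hom_zero)

lemma homotopic_sym:
  assumes "is_bcomplex X" "is_bcomplex Y" "homotopic X Y f g"
  shows "homotopic X Y g f"
proof -
  obtain h where h: "\<And>n. h n \<in> rmod_hom (obj X n) (obj Y (n - 1))"
    "\<And>n v. f n v - g n v = dif Y (n - 1) (h n v) + h (n + 1) (dif X n v)"
    using assms(3) by (rule homotopicE) blast
  have cl: "h n v \<in> sp Y (n - 1)" for n v
    using hom_space[OF bc_mod bc_mod h(1)] assms by blast
  show ?thesis
  proof (rule homotopicI[where h = "\<lambda>n v. - h n v"])
    show "(\<lambda>v. - h n v) \<in> rmod_hom (obj X n) (obj Y (n - 1))" for n
      using h assms by (intro rmod_hom_neg) auto
    show "g n v - f n v = dif Y (n - 1) (- h n v) + - h (n + 1) (dif X n v)" for n v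
      using h(2)[of n v] assms by (simp add: dif_neg cl algebra_simps)
  qed
qed

lemma homotopic_plus:
  assumes XY: "is_bcomplex X" "is_bcomplex Y" and fg: "homotopic X Y f g" "homotopic X Y f' g'"
  shows "homotopic X Y (\<lambda>n v. f n v + f' n v) (\<lambda>n v. g n v + g' n v)"
proof -
  obtain h where h: "\<And>n. h n \<in> rmod_hom (obj X n) (obj Y (n - 1))"
    "\<And>n v. f n v - g n v = dif Y (n - 1) (h n v) + h (n + 1) (dif X n v)"
    using fg(1) by (rule homotopicE) blast
  obtain h' where h': "\<And>n. h' n \<in> rmod_hom (obj X n) (obj Y (n - 1))"
    "\<And>n v. f' n v - g' n v = dif Y (n - 1) (h' n v) + h' (n + 1) (dif X n v)"
    using fg(2) by (rule homotopicE) blast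
  have cl: "h n v \<in> sp Y (n - 1)" "h' n v \<in> sp Y (n - 1)" for n v
    using hom_space[OF bc_mod bc_mod h(1)] hom_space[OF bc_mod bc_mod h'(1)] XY by blast+
  show ?thesis
  proof (rule homotopicI[where h = "\<lambda>n v. h n v + h' n v"])
    show "(\<lambda>v. h n v + h' n v) \<in> rmod_hom (obj X n) (obj Y (n - 1))" for n
      using h h' XY by (intro rmod_hom_plus) auto
    show "f n v + f' n v - (g n v + g' n v) =
        dif Y (n - 1) (h n v + h' n v) + (h (n + 1) (dif X n v) + h' (n + 1) (dif X n v))" for n v
    proof -
      have "f n v + f' n v - (g n v + g' n v) = (f n v - g n v) + (f' n v - g' n v)" by simp
      then show ?thesis unfolding h(2) h'(2) using XY by (simp add: dif_add cl)
    qed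
  qed
qed

lemma homotopic_trans:
  assumes XY: "is_bcomplex X" "is_bcomplex Y" and fg: "homotopic X Y f g" "homotopic X Y g k"
  shows "homotopic X Y f k"
proof -
  \<comment> \<open>A homotopy depends only on the difference of the two maps, and (f + g) - (g + k)
    = f - k.\<close>
  have "homotopic X Y (\<lambda>n v. f n v + g n v) (\<lambda>n v. g n v + k n v)"
    by (rule homotopic_plus[OF XY fg])
  then show ?thesis by (simp add: homotopic_def)
qed

lemma homotopic_comp_left:
  assumes XYV: "is_bcomplex X" "is_bcomplex Y" "is_bcomplex V"
    and fg: "homotopic X Y f g" "f \<in> chain_maps X Y" "g \<in> chain_maps X Y" and k: "k \<in> chain_maps Y V"
  shows "homotopic X V (ccomp k f) (ccomp k g)"
proof -
  obtain h where h: "\<And>n. h n \<in> rmod_hom (obj X n) (obj Y (n - 1))"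
    "\<And>n v. f n v - g n v = dif Y (n - 1) (h n v) + h (n + 1) (dif X n v)"
    using fg(1) by (rule homotopicE) blast
  have cl: "h n v \<in> sp Y (n - 1)" for n v
    using hom_space[OF bc_mod bc_mod h(1)] XYV by blast
  have cl': "h (n + 1) v \<in> sp Y n" for n v
    using cl[of "n + 1" v] by simp
  note kk = cm_dif'[OF XYV(2,3) k] cm_add[OF XYV(2,3) k] cm_diff[OF XYV(2,3) k]
  show ?thesis
  proof (rule homotopicI[where h = "\<lambda>n v. k (n - 1) (h n v)"])
    show "(\<lambda>v. k (n - 1) (h n v)) \<in> rmod_hom (obj X n) (obj V (n - 1))" for n
      by (rule rmod_hom_comp[OF _ _ _ h(1)]) (use XYV cm_hom[OF XYV(2,3) k] in auto)
    show "ccomp k f n v - ccomp k g n v =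
        dif V (n - 1) (k (n - 1) (h n v)) + k (n + 1 - 1) (h (n + 1) (dif X n v))" for n v
    proof -
      have "ccomp k f n v - ccomp k g n v = k n (f n v - g n v)"
        using fg XYV by (simp add: ccomp_def kk(3) cm_closed[of X Y])
      also have "\<dots> = k n (dif Y (n - 1) (h n v)) + k n (h (n + 1) (dif X n v))"
        unfolding h(2) using XYV cl' by (intro kk(2)) (auto simp: dif_closed')
      finally show ?thesis by (simp add: kk(1))
    qed
  qed
qed

lemma homotopic_comp_right:
  assumes XYV: "is_bcomplex X" "is_bcomplex Y" "is_bcomplex V"
    and fg: "homotopic Y V f g" and k: "k \<in> chain_maps X Y"
  shows "homotopic X V (ccomp f k) (ccomp g k)"
proof -
  obtain h where h: "\<And>n. h n \<in> rmod_hom (obj Y n) (obj V (n - 1))"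
    "\<And>n v. f n v - g n v = dif V (n - 1) (h n v) + h (n + 1) (dif Y n v)"
    using fg by (rule homotopicE) blast
  show ?thesis
  proof (rule homotopicI[where h = "\<lambda>n v. h n (k n v)"])
    show "(\<lambda>v. h n (k n v)) \<in> rmod_hom (obj X n) (obj V (n - 1))" for n
      by (rule rmod_hom_comp[OF _ _ _ cm_hom[OF XYV(1,2) k] h(1)]) (use XYV in auto)
  qed (use h(2) in \<open>simp add: ccomp_def cm_dif[OF XYV(1,2) k]\<close>)
qed

lemma homotopic_cocycles:
  assumes XY: "is_bcomplex X" "is_bcomplex Y" and fg: "homotopic X Y f g" and v: "v \<in> cocycles X n"
  shows "f n v - g n v \<in> coboundaries Y n"
proof -
  obtain h where h: "\<And>n. h n \<in> rmod_hom (obj X n) (obj Y (n - 1))"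
    "\<And>n v. f n v - g n v = dif Y (n - 1) (h n v) + h (n + 1) (dif X n v)"
    using fg by (rule homotopicE) blast
  have "h (n + 1) 0 = 0" by (rule hom_zero[OF bc_mod bc_mod h(1)]) (use XY in auto)
  then show ?thesis unfolding h(2) using v XY by (simp add: cocycles_def coboundariesI2)
qed

subsection \<open>Quasi-isomorphisms\<close>

lemma qi_cm: "f \<in> quasi_isos X Y \<Longrightarrow> f \<in> chain_maps X Y"
  by (simp add: quasi_isos_def)

lemma qi_inj: "\<lbrakk>f \<in> quasi_isos X Y; v \<in> cocycles X n; f n v \<in> coboundaries Y n\<rbrakk> \<Longrightarrow> v \<in> coboundaries X n"
  by (auto simp: quasi_isos_def)

lemma qi_surj:
  assumes "f \<in> quasi_isos X Y" "w \<in> cocycles Y n"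
  obtains v where "v \<in> cocycles X n" "w - f n v \<in> coboundaries Y n"
  using assms unfolding quasi_isos_def by blast

lemma qiI:
  assumes "f \<in> chain_maps X Y"
    and "\<And>n v. \<lbrakk>v \<in> cocycles X n; f n v \<in> coboundaries Y n\<rbrakk> \<Longrightarrow> v \<in> coboundaries X n"
    and "\<And>n w. w \<in> cocycles Y n \<Longrightarrow> \<exists>v\<in>cocycles X n. w - f n v \<in> coboundaries Y n"
  shows "f \<in> quasi_isos X Y"
  using assms by (auto simp: quasi_isos_def)

lemma qi_ident: "is_bcomplex X \<Longrightarrow> cid X \<in> quasi_isos X X"
  by (rule qiI) (auto simp: chain_maps_ident cid_in cocycles_sp intro!: bexI)

lemma qi_comp:
  assumes XYV: "is_bcomplex X" "is_bcomplex Y" "is_bcomplex V"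
    and f: "f \<in> quasi_isos X Y" and g: "g \<in> quasi_isos Y V"
  shows "ccomp g f \<in> quasi_isos X V"
proof (rule qiI)
  show "ccomp g f \<in> chain_maps X V" by (rule chain_maps_comp[OF XYV qi_cm[OF f] qi_cm[OF g]])
  show "v \<in> coboundaries X n" if "v \<in> cocycles X n" "ccomp g f n v \<in> coboundaries V n" for n v
    using that qi_inj[OF f that(1)] qi_inj[OF g cm_cocycles[OF XYV(1,2) qi_cm[OF f] that(1)]]
    by (simp add: ccomp_def)
  show "\<exists>v\<in>cocycles X n. w - ccomp g f n v \<in> coboundaries V n" if w: "w \<in> cocycles V n" for n w
  proof -
    obtain y where y: "y \<in> cocycles Y n" "w - g n y \<in> coboundaries V n" using qi_surj[OF g w] .
    obtain v where v: "v \<in> cocycles X n" "y - f n v \<in> coboundaries Y n" using qi_surj[OF f y(1)] .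
    have "g n (y - f n v) \<in> coboundaries V n"
      by (rule cm_coboundaries[OF XYV(2,3) qi_cm[OF g] v(2)])
    then have "(w - g n y) + (g n y - g n (f n v)) \<in> coboundaries V n"
      using y v XYV f g by (intro coboundaries_add)
        (auto simp: cm_diff[OF XYV(2,3) qi_cm[OF g]] cocycles_sp cm_closed[OF XYV(1,2) qi_cm[OF f]])
    then show ?thesis using v by (auto simp: ccomp_def)
  qed
qed

lemma qi_homotopic:
  assumes XY: "is_bcomplex X" "is_bcomplex Y" and f: "f \<in> quasi_isos X Y"
    and fg: "homotopic X Y f g" and g: "g \<in> chain_maps X Y"
  shows "g \<in> quasi_isos X Y"
proof (rule qiI[OF g])
  note d = homotopic_cocycles[OF XY fg]
  show "v \<in> coboundaries X n" if "v \<in> cocycles X n" "g n v \<in> coboundaries Y n" for n v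
    using qi_inj[OF f that(1)] coboundaries_add[OF XY(2) d[OF that(1)] that(2)] by simp
  show "\<exists>v\<in>cocycles X n. w - g n v \<in> coboundaries Y n" if w: "w \<in> cocycles Y n" for n w
  proof -
    obtain v where v: "v \<in> cocycles X n" "w - f n v \<in> coboundaries Y n" using qi_surj[OF f w] .
    then have "w - g n v \<in> coboundaries Y n"
      using coboundaries_add[OF XY(2) v(2) d[OF v(1)]] by simp
    then show ?thesis using v by blast
  qed
qed

lemma qi_cancel_left:
  assumes XYV: "is_bcomplex X" "is_bcomplex Y" "is_bcomplex V"
    and f: "f \<in> chain_maps X Y" and g: "g \<in> quasi_isos Y V" and gf: "ccomp g f \<in> quasi_isos X V"
  shows "f \<in> quasi_isos X Y"
proof (rule qiI[OF f])
  show "v \<in> coboundaries X n" if "v \<in> cocycles X n" "f n v \<in> coboundaries Y n" for n v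
    using qi_inj[OF gf that(1)] cm_coboundaries[OF XYV(2,3) qi_cm[OF g] that(2)] by (simp add: ccomp_def)
  show "\<exists>v\<in>cocycles X n. w - f n v \<in> coboundaries Y n" if w: "w \<in> cocycles Y n" for n w
  proof -
    have "g n w \<in> cocycles V n" by (rule cm_cocycles[OF XYV(2,3) qi_cm[OF g] w])
    then obtain v where v: "v \<in> cocycles X n" "g n w - ccomp g f n v \<in> coboundaries V n"
      using qi_surj[OF gf] by blast
    have fv: "f n v \<in> cocycles Y n" by (rule cm_cocycles[OF XYV(1,2) f v(1)])
    have "g n (w - f n v) \<in> coboundaries V n"
      using v(2) w fv XYV by (simp add: ccomp_def cm_diff[OF XYV(2,3) qi_cm[OF g]] cocycles_sp)
    then have "w - f n v \<in> coboundaries Y n"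
      using w fv XYV by (intro qi_inj[OF g] cocycles_diff) auto
    then show ?thesis using v by blast
  qed
qed

subsection \<open>Cocones\<close>

definition acyclic_cx :: "'k::field complx \<Rightarrow> bool" where
  "acyclic_cx K \<longleftrightarrow> (\<forall>n. cocycles K n \<subseteq> coboundaries K n)"

text \<open>The mapping cone of f shifted by -1. The projection to Z makes f null homotopic; it is a
  quasi-isomorphism if K is acyclic, and the cocone is acyclic if f is a quasi-isomorphism. Both Ore
  conditions come from using these facts twice: for s, and then for a map into the resulting acyclic
  complex.\<close>

definition cocone :: "'k::field complx \<Rightarrow> 'k complx \<Rightarrow> 'k cmap \<Rightarrow> 'k complx" where
  "cocone Z K f = \<lparr>obj = \<lambda>n. dsum_mod (obj Z n) (obj K (n - 1)),
     dif = \<lambda>n u. if u \<in> space (dsum_mod (obj Z n) (obj K (n - 1)))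
       then vpair (dif Z n (vfst u)) (f n (vfst u) - dif K (n - 1) (vsnd u)) else 0\<rparr>"

definition cocone_proj :: "'k::field complx \<Rightarrow> 'k complx \<Rightarrow> 'k cmap" where
  "cocone_proj Z K = (\<lambda>n u. if u \<in> space (dsum_mod (obj Z n) (obj K (n - 1))) then vfst u else 0)"

context
  fixes Z K :: "'k::field complx" and f
  assumes Z: "is_bcomplex Z" and K: "is_bcomplex K" and f: "f \<in> chain_maps Z K"
begin

lemmas zk_simps = bc_mod[OF Z] bc_mod[OF K] dif_closed[OF Z] dif_closed'[OF K] cm_closed[OF Z K f]
  rmod_diff[OF bc_mod[OF K]] rmod_add[OF bc_mod[OF Z]] rmod_add[OF bc_mod[OF K]]
  dif_add[OF Z] dif_add[OF K] cm_add[OF Z K f] dif_act[OF Z] dif_act'[OF K] cm_act[OF Z K f]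
  act_closed[OF bc_mod[OF Z]] act_closed[OF bc_mod[OF K]] act_diff[OF bc_mod[OF K]]
  dif_dif[OF Z] dif_dif'[OF K] cm_dif[OF Z K f] dif_diff[OF K] dif_zero[OF Z] dif_zero[OF K] cm_zero[OF Z K f]

lemma cocone_obj: "obj (cocone Z K f) n = dsum_mod (obj Z n) (obj K (n - 1))"
  by (simp add: cocone_def)

lemma cocone_dif: "\<lbrakk>vfst u \<in> sp Z n; vsnd u \<in> sp K (n - 1)\<rbrakk> \<Longrightarrow>
   dif (cocone Z K f) n u = vpair (dif Z n (vfst u)) (f n (vfst u) - dif K (n - 1) (vsnd u))"
  by (simp add: cocone_def)

lemma cocone_bc: "is_bcomplex (cocone Z K f)"
proof (rule is_bcomplexI)
  show "is_rmod (obj (cocone Z K f) n)" for n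
    by (simp add: cocone_obj dsum_is_rmod zk_simps)
  show "dif (cocone Z K f) n \<in> rmod_hom (obj (cocone Z K f) n) (obj (cocone Z K f) (n + 1))" for n
    unfolding rmod_hom_def mem_Collect_eq cocone_def
    by (intro conjI ballI allI impI) (simp_all add: zk_simps vpair_linear add_diff_add, blast?)
  show "dif (cocone Z K f) (n + 1) (dif (cocone Z K f) n v) = 0" for n v
    by (simp add: cocone_def zk_simps)
  have "{n. sp (cocone Z K f) n \<noteq> {0}} \<subseteq> {n. sp Z n \<noteq> {0}} \<union> (\<lambda>n. n + 1) ` {n. sp K n \<noteq> {0}}"
  proof (rule subsetI, rule ccontr)
    fix n assume n: "n \<in> {n. sp (cocone Z K f) n \<noteq> {0}}"
      and "n \<notin> {n. sp Z n \<noteq> {0}} \<union> (\<lambda>n. n + 1) ` {n. sp K n \<noteq> {0}}"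
    then have "sp Z n = {0}" "sp K (n - 1) = {0}" by (auto simp: image_iff algebra_simps)
    then have "sp (cocone Z K f) n = {0}"
      by (simp add: set_eq_iff cocone_obj vec_zero_iff)
    then show False using n by simp
  qed
  then show "finite {n. sp (cocone Z K f) n \<noteq> {0}}"
    by (rule finite_subset) (use Z K in \<open>auto simp: is_bcomplex_def\<close>)
qed

lemma cocone_proj_cm: "cocone_proj Z K \<in> chain_maps (cocone Z K f) Z"
  by (rule chain_mapsI) (auto simp: rmod_hom_def cocone_proj_def cocone_def zk_simps)

lemma cocone_null: "homotopic (cocone Z K f) K (ccomp f (cocone_proj Z K)) (\<lambda>n v. 0)"
proof (rule homotopicI[where h = "\<lambda>n u. if u \<in> space (dsum_mod (obj Z n) (obj K (n - 1))) then vsnd u else 0"])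
  show "(\<lambda>u. if u \<in> space (dsum_mod (obj Z n) (obj K (n - 1))) then vsnd u else 0)
        \<in> rmod_hom (obj (cocone Z K f) n) (obj K (n - 1))" for n
    by (auto simp: rmod_hom_def cocone_def zk_simps)
qed (auto simp: ccomp_def cocone_proj_def cocone_def zk_simps)

lemma cocone_proj_qi:
  assumes ac: "acyclic_cx K"
  shows "cocone_proj Z K \<in> quasi_isos (cocone Z K f) Z"
proof (rule qiI[OF cocone_proj_cm])
  fix n u assume u: "u \<in> cocycles (cocone Z K f) n" "cocone_proj Z K n u \<in> coboundaries Z n"
  have us: "vfst u \<in> sp Z n" "vsnd u \<in> sp K (n - 1)" using u by (auto simp: cocycles_def cocone_obj)
  then have ud: "dif Z n (vfst u) = 0" "f n (vfst u) = dif K (n - 1) (vsnd u)"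
    using u by (auto simp: cocycles_def cocone_dif)
  obtain z where z: "z \<in> sp Z (n - 1)" "vfst u = dif Z (n - 1) z"
    using u(2) us coboundariesE[OF Z] by (auto simp: cocone_proj_def)
  \<comment> \<open>The element z bounds the Z-component only; acyclicity of K bounds what is then
    left of the K-component.\<close>
  have "f (n - 1) z - vsnd u \<in> cocycles K (n - 1)"
    using us ud z cm_dif'[OF Z K f, of n z] by (simp add: cocycles_def zk_simps)
  then obtain k where k: "k \<in> sp K (n - 1 - 1)" "f (n - 1) z - vsnd u = dif K (n - 1 - 1) k"
    using ac coboundariesE[OF K] unfolding acyclic_cx_def by blast
  have kk: "dif K (n - 1 - 1) k = f (n - 1) z - vsnd u" by (simp only: k)
  have "dif (cocone Z K f) (n - 1) (vpair z k) = vpair (vfst u) (vsnd u)"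
    using z k by (simp add: cocone_dif kk[simplified] del: vpair_simps(3))
  moreover have "vpair z k \<in> sp (cocone Z K f) (n - 1)" using z k by (simp add: cocone_obj)
  ultimately show "u \<in> coboundaries (cocone Z K f) n"
    using coboundariesI[OF cocone_bc] by fastforce
next
  fix n z assume z: "z \<in> cocycles Z n"
  then have "f n z \<in> cocycles K n" by (rule cm_cocycles[OF Z K f])
  then obtain k where k: "k \<in> sp K (n - 1)" "f n z = dif K (n - 1) k"
    using ac coboundariesE[OF K] unfolding acyclic_cx_def by blast
  have "vpair z k \<in> cocycles (cocone Z K f) n"
    using z k by (simp add: cocycles_def cocone_obj cocone_dif)
  moreover have "cocone_proj Z K n (vpair z k) = z"
    using z k by (simp add: cocone_proj_def cocycles_sp[OF Z])
  ultimately show "\<exists>u\<in>cocycles (cocone Z K f) n. z - cocone_proj Z K n u \<in> coboundaries Z n"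
    by (intro bexI[of _ "vpair z k"]) (auto simp: coboundaries_zero[OF Z])
qed

lemma cocone_acyclic:
  assumes qi: "f \<in> quasi_isos Z K"
  shows "acyclic_cx (cocone Z K f)"
  unfolding acyclic_cx_def
proof (intro allI subsetI)
  fix n u assume u: "u \<in> cocycles (cocone Z K f) n"
  have us: "vfst u \<in> sp Z n" "vsnd u \<in> sp K (n - 1)" using u by (auto simp: cocycles_def cocone_obj)
  then have ud: "dif Z n (vfst u) = 0" "f n (vfst u) = dif K (n - 1) (vsnd u)"
    using u by (auto simp: cocycles_def cocone_dif)
  have "vfst u \<in> coboundaries Z n"
    by (rule qi_inj[OF qi]) (use us ud in \<open>auto simp: cocycles_def coboundariesI[OF K]\<close>)
  then obtain z where z: "z \<in> sp Z (n - 1)" "vfst u = dif Z (n - 1) z" by (rule coboundariesE[OF Z])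
  have "f (n - 1) z - vsnd u \<in> cocycles K (n - 1)"
    using us ud z cm_dif'[OF Z K f, of n z] by (simp add: cocycles_def zk_simps)
  \<comment> \<open>The primitive z is determined up to a cocycle only; z' corrects it so that the
    remaining K-component becomes a coboundary.\<close>
  then obtain z' where z': "z' \<in> cocycles Z (n - 1)"
    and "(f (n - 1) z - vsnd u) - f (n - 1) z' \<in> coboundaries K (n - 1)"
    using qi_surj[OF qi] by blast
  then obtain k where k: "k \<in> sp K (n - 1 - 1)" "(f (n - 1) z - vsnd u) - f (n - 1) z' = dif K (n - 1 - 1) k"
    using coboundariesE[OF K] by blast
  have zz: "z - z' \<in> sp Z (n - 1)" "dif Z (n - 1) (z - z') = vfst u"
    "f (n - 1) (z - z') = f (n - 1) z - f (n - 1) z'"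
    using z z' by (auto simp: cocycles_def rmod_diff[OF bc_mod[OF Z]] dif_diff[OF Z] cm_diff[OF Z K f])
  have kk: "dif K (n - 1 - 1) k = f (n - 1) z - vsnd u - f (n - 1) z'" by (simp only: k)
  have "dif (cocone Z K f) (n - 1) (vpair (z - z') k) = vpair (vfst u) (vsnd u)"
    using zz k by (simp add: cocone_dif kk[simplified] del: vpair_simps(3))
  moreover have "vpair (z - z') k \<in> sp (cocone Z K f) (n - 1)" using zz k by (simp add: cocone_obj)
  ultimately show "u \<in> coboundaries (cocone Z K f) n"
    using coboundariesI[OF cocone_bc] by fastforce
qed

end

subsection \<open>Shifts\<close>

lemma shift_obj [simp]: "obj (shift i X) n = obj X (n + i)"
  by (simp add: shift_def)

lemma shift_dif [simp]: "dif (shift i X) n v = (if even i then dif X (n + i) v else - dif X (n + i) v)"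
  by (simp add: shift_def)

lemma shift_shift [simp]: "shift i (shift j X) = shift (i + j) X"
  by (auto simp: shift_def fun_eq_iff add_ac)

lemma shift_0 [simp]: "shift 0 X = X"
  by (simp add: shift_def)

lemma shift_bc: 
  assumes X: "is_bcomplex X"
  shows "is_bcomplex (shift i X)"
proof (rule is_bcomplexI)
  show "is_rmod (obj (shift i X) n)" for n by (simp add: X)
  have "dif X (n + i) \<in> rmod_hom (obj X (n + i)) (obj X (n + 1 + i))" for n
    using dif_hom[OF X, of "n + i"] by (simp add: algebra_simps)
  then show "dif (shift i X) n \<in> rmod_hom (obj (shift i X) n) (obj (shift i X) (n + 1))" for n
    using rmod_hom_neg[OF bc_mod[OF X], of "dif X (n + i)"] by (cases "even i") (auto simp: shift_def)
  show "dif (shift i X) (n + 1) (dif (shift i X) n v) = 0" for n v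
    using dif_dif[OF X, of "n + i" v] dif_closed[OF X, of "n + i" v]
    by (simp add: algebra_simps dif_neg[OF X])
  have "finite ((\<lambda>n. n + i) -` {n. sp X n \<noteq> {0}})"
    by (rule finite_vimageI) (use X in \<open>auto simp: is_bcomplex_def inj_def\<close>)
  then show "finite {n. sp (shift i X) n \<noteq> {0}}" by (simp add: vimage_def)
qed

lemma shift_cocycles [simp]: "cocycles (shift i X) n = cocycles X (n + i)"
  by (auto simp: cocycles_def)

lemma shift_coboundaries:
  assumes X: "is_bcomplex X"
  shows "coboundaries (shift i X) n = coboundaries X (n + i)"
proof -
  have eq: "n + i - 1 = n - 1 + i" by simp
  show ?thesis
  proof (cases "even i")
    case True
    then show ?thesis by (auto simp: coboundaries_def eq image_iff)
  next
    case False
    have "coboundaries (shift i X) n = (\<lambda>v. - dif X (n + i - 1) v) ` sp X (n + i - 1)"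
      using False by (simp add: coboundaries_def eq)
    also have "\<dots> = coboundaries X (n + i)"
    proof (intro equalityI subsetI)
      fix v assume "v \<in> (\<lambda>v. - dif X (n + i - 1) v) ` sp X (n + i - 1)"
      then show "v \<in> coboundaries X (n + i)"
        by (auto intro!: coboundaries_neg[OF X] coboundariesI[OF X])
    next
      fix v assume "v \<in> coboundaries X (n + i)"
      then obtain w where w: "w \<in> sp X (n + i - 1)" "v = dif X (n + i - 1) w" by (rule coboundariesE[OF X])
      then show "v \<in> (\<lambda>v. - dif X (n + i - 1) v) ` sp X (n + i - 1)"
        by (intro image_eqI[of _ _ "- w"]) (auto simp: dif_neg[OF X] rmod_neg[OF bc_mod[OF X]])
    qed
    finally show ?thesis .
  qed
qed

lemma shift_acyclic: "is_bcomplex X \<Longrightarrow> acyclic_cx X \<Longrightarrow> acyclic_cx (shift i X)"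
  by (simp add: acyclic_cx_def shift_coboundaries)

lemma shift_cm:
  assumes XY: "is_bcomplex X" "is_bcomplex Y" and f: "f \<in> chain_maps X Y"
  shows "(\<lambda>n. f (n + i)) \<in> chain_maps (shift i X) (shift i Y)"
proof (rule chain_mapsI)
  show "f (n + i) \<in> rmod_hom (obj (shift i X) n) (obj (shift i Y) n)" for n
    by (simp add: cm_hom[OF XY f])
  have eq: "n + 1 + i = n + i + 1" for n by simp
  show "dif (shift i Y) n (f (n + i) v) = f (n + 1 + i) (dif (shift i X) n v)" for n v
    unfolding eq using dif_closed[OF XY(1)]
    by (simp add: cm_dif[OF XY f] cm_neg[OF XY f])
qed

lemma shift_qi:
  assumes XY: "is_bcomplex X" "is_bcomplex Y" and f: "f \<in> quasi_isos X Y"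
  shows "(\<lambda>n. f (n + i)) \<in> quasi_isos (shift i X) (shift i Y)"
  using f shift_cm[OF XY qi_cm[OF f]] XY by (simp add: quasi_isos_def shift_coboundaries)

section \<open>Roofs: the Ore conditions and well-definedness of composition and addition\<close>

section \<open>Calculus of fractions\<close>

notation ccomp (infixr "\<circ>\<^sub>c" 55)

text \<open>\<open>cm\<close>, \<open>qi\<close> and \<open>ht\<close> carry the boundedness of
  source and target with them, so that the rules below compose like arrows of a category.\<close>

definition cm :: "'k::field complx \<Rightarrow> 'k complx \<Rightarrow> 'k cmap \<Rightarrow> bool" where
  "cm X Y f \<longleftrightarrow> is_bcomplex X \<and> is_bcomplex Y \<and> f \<in> chain_maps X Y"

definition qi :: "'k::field complx \<Rightarrow> 'k complx \<Rightarrow> 'k cmap \<Rightarrow> bool" where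
  "qi X Y f \<longleftrightarrow> is_bcomplex X \<and> is_bcomplex Y \<and> f \<in> quasi_isos X Y"

definition ht :: "'k::field complx \<Rightarrow> 'k complx \<Rightarrow> 'k cmap \<Rightarrow> 'k cmap \<Rightarrow> bool" where
  "ht X Y f g \<longleftrightarrow> cm X Y f \<and> cm X Y g \<and> homotopic X Y f g"

lemma qi_imp_cm: "qi X Y f \<Longrightarrow> cm X Y f"
  by (auto simp: qi_def cm_def qi_cm)

lemma cm_comp: "cm X Y f \<Longrightarrow> cm Y V g \<Longrightarrow> cm X V (g \<circ>\<^sub>c f)"
  by (auto simp: cm_def intro: chain_maps_comp)

lemma qi_compI: "qi X Y f \<Longrightarrow> qi Y V g \<Longrightarrow> qi X V (g \<circ>\<^sub>c f)"
  by (auto simp: qi_def intro: qi_comp)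

lemma ht_refl: "cm X Y f \<Longrightarrow> ht X Y f f"
  by (auto simp: ht_def cm_def homotopic_refl)

lemma ht_sym: "ht X Y f g \<Longrightarrow> ht X Y g f"
  by (auto simp: ht_def cm_def homotopic_sym)

lemma ht_trans [trans]: "ht X Y f g \<Longrightarrow> ht X Y g h \<Longrightarrow> ht X Y f h"
  unfolding ht_def cm_def using homotopic_trans by blast

lemma ht_left: "ht X Y f g \<Longrightarrow> cm Y V k \<Longrightarrow> ht X V (k \<circ>\<^sub>c f) (k \<circ>\<^sub>c g)"
  unfolding ht_def using cm_comp homotopic_comp_left unfolding cm_def by blast

lemma ht_right: "ht Y V f g \<Longrightarrow> cm X Y k \<Longrightarrow> ht X V (f \<circ>\<^sub>c k) (g \<circ>\<^sub>c k)"
  unfolding ht_def using cm_comp homotopic_comp_right unfolding cm_def by blast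

lemma ht_qi: "ht X Y f g \<Longrightarrow> qi X Y f \<Longrightarrow> qi X Y g"
  unfolding ht_def qi_def cm_def using qi_homotopic by blast

lemma qi_cancel: "cm X Y f \<Longrightarrow> qi Y V g \<Longrightarrow> qi X V (g \<circ>\<^sub>c f) \<Longrightarrow> qi X Y f"
  unfolding qi_def cm_def using qi_cancel_left by blast

lemma ht_plus:
  assumes "ht X Y f g" "ht X Y f' g'"
  shows "ht X Y (\<lambda>n v. f n v + f' n v) (\<lambda>n v. g n v + g' n v)"
  using assms unfolding ht_def cm_def by (auto intro!: chain_maps_plus homotopic_plus)

lemma cm_cid: "is_bcomplex X \<Longrightarrow> cm X X (cid X)"
  by (simp add: cm_def chain_maps_ident)

lemma qi_cid: "is_bcomplex X \<Longrightarrow> qi X X (cid X)"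
  by (simp add: qi_def qi_ident)

lemma cm_cid_right: "cm X Y f \<Longrightarrow> f \<circ>\<^sub>c cid X = f"
  by (auto simp: cm_def ccomp_cid_right)

lemma cm_cid_left: "cm X Y f \<Longrightarrow> cid Y \<circ>\<^sub>c f = f"
  by (auto simp: cm_def ccomp_cid_left)

lemma cm_bc: "cm X Y f \<Longrightarrow> is_bcomplex X" "cm X Y f \<Longrightarrow> is_bcomplex Y"
  by (auto simp: cm_def)

lemma vfst_hom:
  assumes "is_rmod M" "is_rmod N" "is_rmod L" "f \<in> rmod_hom L (dsum_mod M N)"
  shows "(\<lambda>v. vfst (f v)) \<in> rmod_hom L M" "(\<lambda>v. vsnd (f v)) \<in> rmod_hom L N"
  using assms by (auto simp: rmod_hom_def)

text \<open>The cone \<open>K1\<close> of s is acyclic. Composing f with Y -> \<open>K1\<close> and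
  taking the cocone gives W with a quasi-isomorphism a to Z. A null homotopy of the composite W ->
  \<open>K1\<close> has two components: the one in Z' is, up to sign, the map b, and the one in Y is
  a homotopy from f a to s b.\<close>

lemma ore:
  assumes "cm Z Y f" "qi Z' Y s"
  obtains W a b where "qi W Z a" "cm W Z' b" "ht W Y (f \<circ>\<^sub>c a) (s \<circ>\<^sub>c b)"
proof -
  have bc: "is_bcomplex Z" "is_bcomplex Y" "is_bcomplex Z'"
    and f: "f \<in> chain_maps Z Y" and s: "s \<in> quasi_isos Z' Y"
    using assms by (auto simp: cm_def qi_def)
  define K where "K = cocone Z' Y s"
  define K1 where "K1 = shift 1 K"
  have K: "is_bcomplex K" unfolding K_def by (rule cocone_bc[OF bc(3,2) qi_cm[OF s]])
  have K1: "is_bcomplex K1" unfolding K1_def by (rule shift_bc[OF K])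
  have ac: "acyclic_cx K1"
    unfolding K1_def using shift_acyclic[OF K] cocone_acyclic[OF bc(3,2) qi_cm[OF s] s] by (simp add: K_def)
  define \<phi> where "\<phi> = (\<lambda>n v. vpair 0 (f n v))"
  have obK: "obj K n = dsum_mod (obj Z' n) (obj Y (n - 1))" for n
    by (simp add: K_def cocone_def)
  have dK: "dif K n u = vpair (dif Z' n (vfst u)) (s n (vfst u) - dif Y (n - 1) (vsnd u))"
    if "vfst u \<in> sp Z' n" "vsnd u \<in> sp Y (n - 1)" for u n
    using that by (simp add: K_def cocone_def)
  have \<phi>: "\<phi> \<in> chain_maps Z K1"
  proof (rule chain_mapsI)
    show "\<phi> n \<in> rmod_hom (obj Z n) (obj K1 n)" for n
      using cm_hom[OF bc(1,2) f, of n] bc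
      by (auto simp: rmod_hom_def \<phi>_def K1_def obK vpair_linear act_zero)
    show "dif K1 n (\<phi> n v) = \<phi> (n + 1) (dif Z n v)" for n v
      using bc by (simp add: \<phi>_def K1_def dK cm_closed[OF bc(1,2) f] cm_dif[OF bc(1,2) f] vpair_linear
          cm_zero[OF bc(3,2) qi_cm[OF s]])
  qed
  define W where "W = cocone Z K1 \<phi>"
  define a where "a = cocone_proj Z K1"
  have W: "is_bcomplex W" unfolding W_def by (rule cocone_bc[OF bc(1) K1 \<phi>])
  have a: "a \<in> quasi_isos W Z" unfolding W_def a_def by (rule cocone_proj_qi[OF bc(1) K1 \<phi> ac])
  obtain h where h: "\<And>n. h n \<in> rmod_hom (obj W n) (obj K1 (n - 1))"
    "\<And>n v. (\<phi> \<circ>\<^sub>c a) n v - 0 = dif K1 (n - 1) (h n v) + h (n + 1) (dif W n v)"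
    using cocone_null[OF bc(1) K1 \<phi>, folded W_def a_def] by (rule homotopicE) blast
  have hK: "h n \<in> rmod_hom (obj W n) (dsum_mod (obj Z' n) (obj Y (n - 1)))" for n
    using h(1)[of n] by (simp add: K1_def obK)
  have hcl: "vfst (h n v) \<in> sp Z' n" "vsnd (h n v) \<in> sp Y (n - 1)" for n v
    using hom_space[OF bc_mod[OF W] dsum_is_rmod[OF bc_mod[OF bc(3)] bc_mod[OF bc(2)]] hK, of n v] by auto
  have eq: "vpair 0 (f n (a n v)) =
      - vpair (dif Z' n (vfst (h n v))) (s n (vfst (h n v)) - dif Y (n - 1) (vsnd (h n v))) + h (n + 1) (dif W n v)"
    for n v
    using h(2)[of n v] by (simp add: ccomp_def \<phi>_def K1_def dK hcl)
  have eq1: "dif Z' n (vfst (h n v)) = vfst (h (n + 1) (dif W n v))" for n v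
    using arg_cong[OF eq[of n v], of vfst] by (simp add: vpair_linear)
  have eq2: "f n (a n v) + s n (vfst (h n v)) = dif Y (n - 1) (vsnd (h n v)) + vsnd (h (n + 1) (dif W n v))" for n v
    using arg_cong[OF eq[of n v], of vsnd] by (simp add: vpair_linear algebra_simps)
  \<comment> \<open>The sign undoes the one in the differential of the shift by 1.\<close>
  define b where "b = (\<lambda>n v. - vfst (h n v))"
  have b: "b \<in> chain_maps W Z'"
  proof (rule chain_mapsI)
    show "b n \<in> rmod_hom (obj W n) (obj Z' n)" for n
      unfolding b_def using bc W by (intro rmod_hom_neg vfst_hom(1)[OF _ _ _ hK]) auto
    show "dif Z' n (b n v) = b (n + 1) (dif W n v)" for n v
      by (simp add: b_def dif_neg[OF bc(3)] hcl eq1)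
  qed
  have "homotopic W Y (f \<circ>\<^sub>c a) (s \<circ>\<^sub>c b)"
  proof (rule homotopicI[where h = "\<lambda>n v. vsnd (h n v)"])
    show "(\<lambda>v. vsnd (h n v)) \<in> rmod_hom (obj W n) (obj Y (n - 1))" for n
      using bc W by (intro vfst_hom(2)[OF _ _ _ hK]) auto
    show "(f \<circ>\<^sub>c a) n v - (s \<circ>\<^sub>c b) n v = dif Y (n - 1) (vsnd (h n v)) + vsnd (h (n + 1) (dif W n v))" for n v
      using eq2[of n v] by (simp add: ccomp_def b_def cm_neg[OF bc(3,2) qi_cm[OF s]] hcl)
  qed
  then show ?thesis
    using that[of W a b] a b f s W bc cm_comp[of W Z a Y f] cm_comp[of W Z' b Y s]
    by (auto simp: qi_def cm_def ht_def qi_cm)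
qed

text \<open>A homotopy k from s f to s g makes (f - g, k) a chain map into the acyclic cocone of s.
  It becomes null homotopic on its own cocone W, and the first component of the null homotopy is a
  homotopy from f a to g a.\<close>

lemma ore_cancel:
  assumes fg: "cm Z Y f" "cm Z Y g" and s: "qi Y Y' s" and sfg: "ht Z Y' (s \<circ>\<^sub>c f) (s \<circ>\<^sub>c g)"
  obtains W a where "qi W Z a" "ht W Y (f \<circ>\<^sub>c a) (g \<circ>\<^sub>c a)"
proof -
  have bc: "is_bcomplex Z" "is_bcomplex Y" "is_bcomplex Y'"
    and f: "f \<in> chain_maps Z Y" and g: "g \<in> chain_maps Z Y" and s: "s \<in> quasi_isos Y Y'"
    using assms by (auto simp: cm_def qi_def)
  have "homotopic Z Y' (s \<circ>\<^sub>c f) (s \<circ>\<^sub>c g)" using sfg by (simp add: ht_def)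
  then obtain k where k: "\<And>n. k n \<in> rmod_hom (obj Z n) (obj Y' (n - 1))"
    "\<And>n v. (s \<circ>\<^sub>c f) n v - (s \<circ>\<^sub>c g) n v = dif Y' (n - 1) (k n v) + k (n + 1) (dif Z n v)"
    by (rule homotopicE) blast
  have kcl: "k n v \<in> sp Y' (n - 1)" for n v
    by (rule hom_space[OF _ _ k(1)]) (use bc in auto)
  define K where "K = cocone Y Y' s"
  have K: "is_bcomplex K" unfolding K_def by (rule cocone_bc[OF bc(2,3) qi_cm[OF s]])
  have ac: "acyclic_cx K"
    using cocone_acyclic[OF bc(2,3) qi_cm[OF s] s] by (simp add: K_def)
  define \<phi> where "\<phi> = (\<lambda>n v. vpair (f n v - g n v) (k n v))"
  have obK: "obj K n = dsum_mod (obj Y n) (obj Y' (n - 1))" for n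
    by (simp add: K_def cocone_def)
  have dK: "dif K n u = vpair (dif Y n (vfst u)) (s n (vfst u) - dif Y' (n - 1) (vsnd u))"
    if "vfst u \<in> sp Y n" "vsnd u \<in> sp Y' (n - 1)" for u n
    using that by (simp add: K_def cocone_def)
  have fgcl: "f n v - g n v \<in> sp Y n" for n v
    using bc by (intro rmod_diff) (auto simp: cm_closed[OF bc(1,2) f] cm_closed[OF bc(1,2) g])
  have \<phi>: "\<phi> \<in> chain_maps Z K"
  proof (rule chain_mapsI)
    have "(\<lambda>v. f n v - g n v) \<in> rmod_hom (obj Z n) (obj Y n)" for n
      using bc f g by (intro rmod_hom_minus cm_hom[of Z Y]) auto
    then show "\<phi> n \<in> rmod_hom (obj Z n) (obj K n)" for n
      using k(1)[of n] unfolding rmod_hom_def \<phi>_def obK by (auto simp: vpair_linear)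
    show "dif K n (\<phi> n v) = \<phi> (n + 1) (dif Z n v)" for n v
    proof -
      have "s n (f n v - g n v) - dif Y' (n - 1) (k n v) = k (n + 1) (dif Z n v)"
        using k(2)[of n v] by (simp add: ccomp_def cm_diff[OF bc(2,3) qi_cm[OF s]]
            cm_closed[OF bc(1,2) f] cm_closed[OF bc(1,2) g] algebra_simps)
      then show ?thesis
        by (simp add: \<phi>_def dK fgcl kcl dif_diff[OF bc(2)] cm_closed[OF bc(1,2) f] cm_closed[OF bc(1,2) g]
          cm_dif[OF bc(1,2) f] cm_dif[OF bc(1,2) g])
    qed
  qed
  define W where "W = cocone Z K \<phi>"
  define a where "a = cocone_proj Z K"
  have W: "is_bcomplex W" unfolding W_def by (rule cocone_bc[OF bc(1) K \<phi>])
  have a: "a \<in> quasi_isos W Z" unfolding W_def a_def by (rule cocone_proj_qi[OF bc(1) K \<phi> ac])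
  obtain h where h: "\<And>n. h n \<in> rmod_hom (obj W n) (obj K (n - 1))"
    "\<And>n v. (\<phi> \<circ>\<^sub>c a) n v - 0 = dif K (n - 1) (h n v) + h (n + 1) (dif W n v)"
    using cocone_null[OF bc(1) K \<phi>, folded W_def a_def] by (rule homotopicE) blast
  have hK: "h n \<in> rmod_hom (obj W n) (dsum_mod (obj Y (n - 1)) (obj Y' (n - 1 - 1)))" for n
    using h(1)[of n] unfolding obK .
  have hcl: "vfst (h n v) \<in> sp Y (n - 1)" "vsnd (h n v) \<in> sp Y' (n - 1 - 1)" for n v
    using hom_space[OF bc_mod[OF W] dsum_is_rmod[OF bc_mod[OF bc(2)] bc_mod[OF bc(3)]] hK, of n v] by auto
  have "homotopic W Y (f \<circ>\<^sub>c a) (g \<circ>\<^sub>c a)"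
  proof (rule homotopicI[where h = "\<lambda>n v. vfst (h n v)"])
    show "(\<lambda>v. vfst (h n v)) \<in> rmod_hom (obj W n) (obj Y (n - 1))" for n
      using bc W by (intro vfst_hom(1)[OF _ _ _ hK]) auto
    show "(f \<circ>\<^sub>c a) n v - (g \<circ>\<^sub>c a) n v = dif Y (n - 1) (vfst (h n v)) + vfst (h (n + 1) (dif W n v))" for n v
      using arg_cong[OF h(2)[of n v], of vfst] unfolding dK[OF hcl] by (simp add: ccomp_def \<phi>_def)
  qed
  then show ?thesis
    using that[of W a] a f g W bc cm_comp[of W Z a Y f] cm_comp[of W Z a Y g]
    by (auto simp: qi_def cm_def ht_def qi_cm)
qed

lemma is_roof_iff: "is_roof r \<longleftrightarrow> qi (apex r) (src r) (den r) \<and> cm (apex r) (tgt r) (num r)"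
  by (auto simp: is_roof_def qi_def cm_def)

text \<open>\<open>roof_rel\<close> asks that the composite denominator be a quasi-isomorphism; by
  two out of three this says that the leg a itself is one, the form in which refinements can be
  composed.\<close>

lemma roof_rel_iff: "(r, s) \<in> roof_rel \<longleftrightarrow> is_roof r \<and> is_roof s \<and> src r = src s \<and> tgt r = tgt s \<and>
   (\<exists>W a b. qi W (apex r) a \<and> cm W (apex s) b \<and>
      ht W (src r) (den r \<circ>\<^sub>c a) (den s \<circ>\<^sub>c b) \<and> ht W (tgt r) (num r \<circ>\<^sub>c a) (num s \<circ>\<^sub>c b))" (is "?l \<longleftrightarrow> ?r")
proof
  assume ?l
  then obtain W a b where *: "is_roof r" "is_roof s" "src r = src s" "tgt r = tgt s"
     "is_bcomplex W" "a \<in> chain_maps W (apex r)" "b \<in> chain_maps W (apex s)"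
     "ccomp (den r) a \<in> quasi_isos W (src r)"
     "homotopic W (src r) (ccomp (den r) a) (ccomp (den s) b)"
     "homotopic W (tgt r) (ccomp (num r) a) (ccomp (num s) b)"
    by (auto simp: roof_rel_def)
  then have a: "cm W (apex r) a" and b: "cm W (apex s) b"
    by (auto simp: cm_def is_roof_def)
  have "qi W (apex r) a"
    by (rule qi_cancel[OF a, of "src r" "den r"]) (use * in \<open>auto simp: is_roof_iff qi_def\<close>)
  moreover have "ht W (src r) (den r \<circ>\<^sub>c a) (den s \<circ>\<^sub>c b)" "ht W (tgt r) (num r \<circ>\<^sub>c a) (num s \<circ>\<^sub>c b)"
    using * cm_comp[OF a] cm_comp[OF b] by (auto simp: ht_def is_roof_iff qi_imp_cm)
  ultimately show ?r using * b by blast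
next
  assume r: ?r
  then obtain W a b where *: "qi W (apex r) a" "cm W (apex s) b"
      "ht W (src r) (den r \<circ>\<^sub>c a) (den s \<circ>\<^sub>c b)" "ht W (tgt r) (num r \<circ>\<^sub>c a) (num s \<circ>\<^sub>c b)"
    by blast
  have "qi (apex r) (src r) (den r)" using r unfolding is_roof_iff by blast
  then have "den r \<circ>\<^sub>c a \<in> quasi_isos W (src r)" using qi_compI[OF *(1)] by (simp add: qi_def)
  moreover have "is_bcomplex W" "a \<in> chain_maps W (apex r)" "b \<in> chain_maps W (apex s)"
    using * qi_imp_cm by (auto simp: cm_def)
  ultimately show ?l using r * unfolding roof_rel_def ht_def by blast
qed

lemma roof_relI:
  assumes "is_roof r" "is_roof s" "src r = src s" "tgt r = tgt s" "qi W (apex r) a" "cm W (apex s) b"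
    "ht W (src r) (den r \<circ>\<^sub>c a) (den s \<circ>\<^sub>c b)" "ht W (tgt r) (num r \<circ>\<^sub>c a) (num s \<circ>\<^sub>c b)"
  shows "(r, s) \<in> roof_rel"
  using assms unfolding roof_rel_iff by blast

text \<open>Equivalence provides one common refinement. Any two maps into the apices that agree on
  denominators then agree on numerators after a further quasi-isomorphism: compare with the given
  refinement by the Ore condition and cancel \<open>den s\<close>. Well-definedness of composition
  and addition rests on this.\<close>

lemma roof_rel_lift:
  assumes rs: "(r, s) \<in> roof_rel" and a: "cm W (apex r) a" and b: "cm W (apex s) b"
    and ab: "ht W (src r) (den r \<circ>\<^sub>c a) (den s \<circ>\<^sub>c b)"
  obtains V c where "qi V W c" "ht V (tgt r) (num r \<circ>\<^sub>c a \<circ>\<^sub>c c) (num s \<circ>\<^sub>c b \<circ>\<^sub>c c)"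
proof -
  obtain W0 a0 b0 where 0: "qi W0 (apex r) a0" "cm W0 (apex s) b0"
      "ht W0 (src r) (den r \<circ>\<^sub>c a0) (den s \<circ>\<^sub>c b0)" "ht W0 (tgt r) (num r \<circ>\<^sub>c a0) (num s \<circ>\<^sub>c b0)"
    and r: "qi (apex r) (src r) (den r)" "cm (apex r) (tgt r) (num r)"
    and s: "qi (apex s) (src r) (den s)" "cm (apex s) (tgt r) (num s)"
    using rs unfolding roof_rel_iff is_roof_iff by metis
  obtain V c e where V: "qi V W c" "cm V W0 e" "ht V (apex r) (a \<circ>\<^sub>c c) (a0 \<circ>\<^sub>c e)"
    using ore[OF a 0(1)] .
  note c = qi_imp_cm[OF V(1)]
  have "ht V (src r) (den s \<circ>\<^sub>c b \<circ>\<^sub>c c) (den r \<circ>\<^sub>c a \<circ>\<^sub>c c)"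
    using ht_right[OF ht_sym[OF ab] c] by (simp add: ccomp_assoc)
  also have "ht V (src r) \<dots> (den r \<circ>\<^sub>c a0 \<circ>\<^sub>c e)" by (rule ht_left[OF V(3) qi_imp_cm[OF r(1)]])
  also have "ht V (src r) \<dots> (den s \<circ>\<^sub>c b0 \<circ>\<^sub>c e)"
    using ht_right[OF 0(3) V(2)] by (simp add: ccomp_assoc)
  finally have "ht V (src r) (den s \<circ>\<^sub>c b \<circ>\<^sub>c c) (den s \<circ>\<^sub>c b0 \<circ>\<^sub>c e)" .
  then obtain U d where U: "qi U V d" "ht U (apex s) ((b \<circ>\<^sub>c c) \<circ>\<^sub>c d) ((b0 \<circ>\<^sub>c e) \<circ>\<^sub>c d)"
    using ore_cancel[OF cm_comp[OF c b] cm_comp[OF V(2) 0(2)] s(1)] by blast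
  note d = qi_imp_cm[OF U(1)]
  have "ht U (tgt r) (num r \<circ>\<^sub>c a \<circ>\<^sub>c c \<circ>\<^sub>c d) (num r \<circ>\<^sub>c a0 \<circ>\<^sub>c e \<circ>\<^sub>c d)"
    using ht_left[OF ht_right[OF V(3) d] r(2)] by (simp add: ccomp_assoc)
  also have "ht U (tgt r) \<dots> (num s \<circ>\<^sub>c b0 \<circ>\<^sub>c e \<circ>\<^sub>c d)"
    using ht_right[OF 0(4) cm_comp[OF d V(2)]] by (simp add: ccomp_assoc)
  also have "ht U (tgt r) \<dots> (num s \<circ>\<^sub>c b \<circ>\<^sub>c c \<circ>\<^sub>c d)"
    using ht_left[OF ht_sym[OF U(2)] s(2)] by (simp add: ccomp_assoc)
  finally show ?thesis using that[of U "c \<circ>\<^sub>c d"] qi_compI[OF U(1) V(1)] by simp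
qed

lemma roof_rel_refl: "is_roof r \<Longrightarrow> (r, r) \<in> roof_rel"
proof -
  assume r: "is_roof r"
  have "qi (apex r) (apex r) (cid (apex r))" using r by (auto simp: is_roof_def qi_cid)
  then show ?thesis
    using r by (intro roof_relI[of _ _ "apex r" "cid (apex r)" "cid (apex r)"])
      (auto simp: is_roof_iff qi_imp_cm intro!: ht_refl cm_comp[of _ "apex r"])
qed

text \<open>Only the leg a is a quasi-isomorphism by definition. But the composites of a and b with
  the denominators are homotopic, so b is one as well.\<close>

lemma roof_rel_sym: "(r, s) \<in> roof_rel \<Longrightarrow> (s, r) \<in> roof_rel"
proof -
  assume rs: "(r, s) \<in> roof_rel"
  then obtain W a b where W: "qi W (apex r) a" "cm W (apex s) b"
      "ht W (src r) (den r \<circ>\<^sub>c a) (den s \<circ>\<^sub>c b)" "ht W (tgt r) (num r \<circ>\<^sub>c a) (num s \<circ>\<^sub>c b)"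
    and st: "is_roof r" "is_roof s" "src r = src s" "tgt r = tgt s"
    unfolding roof_rel_iff by metis
  have "qi W (src s) (den r \<circ>\<^sub>c a)" using W st by (metis qi_compI is_roof_iff)
  then have "qi W (src s) (den s \<circ>\<^sub>c b)" using W(3) st by (metis ht_qi)
  then have "qi W (apex s) b" using qi_cancel[OF W(2)] st unfolding is_roof_iff by blast
  then show ?thesis
    unfolding roof_rel_iff using W st by (metis ht_sym qi_imp_cm)
qed

text \<open>Both refinements map to the apex of s by quasi-isomorphisms, so the Ore condition gives
  a common refinement of the two.\<close>

lemma roof_rel_trans:
  assumes rs: "(r, s) \<in> roof_rel" and st: "(s, t) \<in> roof_rel"
  shows "(r, t) \<in> roof_rel"
proof -
  obtain W a b where W: "qi W (apex s) b" "cm W (apex r) a"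
      "ht W (src s) (den s \<circ>\<^sub>c b) (den r \<circ>\<^sub>c a)" "ht W (tgt s) (num s \<circ>\<^sub>c b) (num r \<circ>\<^sub>c a)"
    and r: "is_roof r" "is_roof s" "src r = src s" "tgt r = tgt s"
    using roof_rel_sym[OF rs] unfolding roof_rel_iff by metis
  obtain W' a' b' where W': "qi W' (apex s) a'" "cm W' (apex t) b'"
      "ht W' (src s) (den s \<circ>\<^sub>c a') (den t \<circ>\<^sub>c b')" "ht W' (tgt s) (num s \<circ>\<^sub>c a') (num t \<circ>\<^sub>c b')"
    and t: "is_roof t" "src s = src t" "tgt s = tgt t"
    using st unfolding roof_rel_iff by metis
  obtain V c e where V: "qi V W c" "cm V W' e" "ht V (apex s) (b \<circ>\<^sub>c c) (a' \<circ>\<^sub>c e)"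
    using ore[OF qi_imp_cm[OF W(1)] W'(1)] .
  note c = qi_imp_cm[OF V(1)]
  have s: "cm (apex s) (src s) (den s)" "cm (apex s) (tgt s) (num s)"
    using r by (auto simp: is_roof_iff qi_imp_cm)
  have aux: "ht V Y (f \<circ>\<^sub>c a \<circ>\<^sub>c c) (g \<circ>\<^sub>c b' \<circ>\<^sub>c e)"
    if "ht W Y (h \<circ>\<^sub>c b) (f \<circ>\<^sub>c a)" "ht W' Y (h \<circ>\<^sub>c a') (g \<circ>\<^sub>c b')" "cm (apex s) Y h" for f g h Y
  proof -
    have "ht V Y (f \<circ>\<^sub>c a \<circ>\<^sub>c c) (h \<circ>\<^sub>c b \<circ>\<^sub>c c)"
      using ht_right[OF ht_sym[OF that(1)] c] by (simp add: ccomp_assoc)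
    also have "ht V Y \<dots> (h \<circ>\<^sub>c a' \<circ>\<^sub>c e)" by (rule ht_left[OF V(3) that(3)])
    also have "ht V Y \<dots> (g \<circ>\<^sub>c b' \<circ>\<^sub>c e)"
      using ht_right[OF that(2) V(2)] by (simp add: ccomp_assoc)
    finally show ?thesis .
  qed
  have "qi W (src s) (den s \<circ>\<^sub>c b)" using W r by (metis qi_compI is_roof_iff)
  then have "qi W (src r) (den r \<circ>\<^sub>c a)" using W(3) r by (metis ht_qi)
  then have "qi W (apex r) a" using qi_cancel[OF W(2)] r unfolding is_roof_iff by blast
  then have "qi V (apex r) (a \<circ>\<^sub>c c)" by (rule qi_compI[OF V(1)])
  moreover have "cm V (apex t) (b' \<circ>\<^sub>c e)" by (rule cm_comp[OF V(2) W'(2)])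
  moreover have "ht V (src r) (den r \<circ>\<^sub>c a \<circ>\<^sub>c c) (den t \<circ>\<^sub>c b' \<circ>\<^sub>c e)"
    unfolding r(3) by (rule aux[OF W(3) W'(3) s(1)])
  moreover have "ht V (tgt r) (num r \<circ>\<^sub>c a \<circ>\<^sub>c c) (num t \<circ>\<^sub>c b' \<circ>\<^sub>c e)"
    unfolding r(4) by (rule aux[OF W(4) W'(4) s(2)])
  ultimately show ?thesis unfolding roof_rel_iff using r t by auto
qed

lemma roof_class_eqI: "(r, s) \<in> roof_rel \<Longrightarrow> roof_class r = roof_class s"
  unfolding roof_class_def using roof_rel_sym roof_rel_trans by blast

lemma mem_roof_class: "s \<in> roof_class r \<longleftrightarrow> (r, s) \<in> roof_rel"
  by (simp add: roof_class_def)

lemma D_hom_iff: "F \<in> D_hom X Y \<longleftrightarrow> (\<exists>r. is_roof r \<and> src r = X \<and> tgt r = Y \<and> F = roof_class r)"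
  by (auto simp: D_hom_def quotient_def roof_class_def)

lemma comp_roof:
  assumes r: "is_roof r" and s: "is_roof s" and rs: "tgt r = src s"
    and a: "qi W (apex r) a" and b: "cm W (apex s) b" and ab: "ht W (tgt r) (num r \<circ>\<^sub>c a) (den s \<circ>\<^sub>c b)"
  shows "is_roof \<lparr>src = src r, tgt = tgt s, apex = W, den = den r \<circ>\<^sub>c a, num = num s \<circ>\<^sub>c b\<rparr>"
  using assms by (auto simp: is_roof_iff intro: qi_compI cm_comp)

lemma comp_roof_rel:
  assumes r: "(r, r') \<in> roof_rel" and s: "(s, s') \<in> roof_rel" and rs: "tgt r = src s"
    and W: "qi W (apex r) a" "cm W (apex s) b" "ht W (tgt r) (num r \<circ>\<^sub>c a) (den s \<circ>\<^sub>c b)"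
    and W': "qi W' (apex r') a'" "cm W' (apex s') b'" "ht W' (tgt r') (num r' \<circ>\<^sub>c a') (den s' \<circ>\<^sub>c b')"
  shows "(\<lparr>src = src r, tgt = tgt s, apex = W, den = den r \<circ>\<^sub>c a, num = num s \<circ>\<^sub>c b\<rparr>,
     \<lparr>src = src r', tgt = tgt s', apex = W', den = den r' \<circ>\<^sub>c a', num = num s' \<circ>\<^sub>c b'\<rparr>) \<in> roof_rel"
proof -
  have st: "is_roof r" "is_roof r'" "is_roof s" "is_roof s'" "src r = src r'" "tgt r = tgt r'"
    "src s = src s'" "tgt s = tgt s'" using r s by (auto simp: roof_rel_iff)
  have qr: "qi (apex r) (src r) (den r)" "qi (apex r') (src r) (den r')"
    using st by (auto simp: is_roof_iff)
  obtain V p p' where V: "qi V W p" "cm V W' p'"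
      "ht V (src r) ((den r \<circ>\<^sub>c a) \<circ>\<^sub>c p) ((den r' \<circ>\<^sub>c a') \<circ>\<^sub>c p')"
    using ore[OF qi_imp_cm[OF qi_compI[OF W(1) qr(1)]] qi_compI[OF W'(1) qr(2)]] .
  note p = qi_imp_cm[OF V(1)]
  have ap: "cm V (apex r) (a \<circ>\<^sub>c p)" "cm V (apex r') (a' \<circ>\<^sub>c p')"
    using cm_comp p V(2) W W' qi_imp_cm by blast+
  obtain U c where U: "qi U V c"
      "ht U (tgt r) (num r \<circ>\<^sub>c (a \<circ>\<^sub>c p) \<circ>\<^sub>c c) (num r' \<circ>\<^sub>c (a' \<circ>\<^sub>c p') \<circ>\<^sub>c c)"
    using roof_rel_lift[OF r ap] V(3) by (metis ccomp_assoc)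
  note c = qi_imp_cm[OF U(1)]
  have pc: "cm U W (p \<circ>\<^sub>c c)" "cm U W' (p' \<circ>\<^sub>c c)" using cm_comp c p V(2) by blast+
  have "ht U (src s) (den s \<circ>\<^sub>c b \<circ>\<^sub>c p \<circ>\<^sub>c c) (num r \<circ>\<^sub>c a \<circ>\<^sub>c p \<circ>\<^sub>c c)"
    using ht_right[OF ht_sym[OF W(3)] pc(1)] rs by (simp add: ccomp_assoc)
  also have "ht U (src s) \<dots> (num r' \<circ>\<^sub>c a' \<circ>\<^sub>c p' \<circ>\<^sub>c c)" using U(2) rs by (simp add: ccomp_assoc)
  also have "ht U (src s) \<dots> (den s' \<circ>\<^sub>c b' \<circ>\<^sub>c p' \<circ>\<^sub>c c)"
    using ht_right[OF W'(3) pc(2)] rs st by (simp add: ccomp_assoc)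
  finally have *: "ht U (src s) (den s \<circ>\<^sub>c b \<circ>\<^sub>c p \<circ>\<^sub>c c) (den s' \<circ>\<^sub>c b' \<circ>\<^sub>c p' \<circ>\<^sub>c c)" .
  obtain T d where T: "qi T U d" "ht T (tgt s) (num s \<circ>\<^sub>c (b \<circ>\<^sub>c p \<circ>\<^sub>c c) \<circ>\<^sub>c d) (num s' \<circ>\<^sub>c (b' \<circ>\<^sub>c p' \<circ>\<^sub>c c) \<circ>\<^sub>c d)"
    using roof_rel_lift[OF s cm_comp[OF pc(1) W(2)] cm_comp[OF pc(2) W'(2)] *] .
  have "qi T W (p \<circ>\<^sub>c c \<circ>\<^sub>c d)" "cm T W' (p' \<circ>\<^sub>c c \<circ>\<^sub>c d)"
    using qi_compI T(1) U(1) V(1) cm_comp[OF qi_imp_cm[OF T(1)] pc(2)] by (simp_all add: ccomp_assoc) blast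
  moreover have "ht T (src r) ((den r \<circ>\<^sub>c a) \<circ>\<^sub>c p \<circ>\<^sub>c c \<circ>\<^sub>c d) ((den r' \<circ>\<^sub>c a') \<circ>\<^sub>c p' \<circ>\<^sub>c c \<circ>\<^sub>c d)"
    using ht_right[OF V(3) cm_comp[OF qi_imp_cm[OF T(1)] c]] by (simp add: ccomp_assoc)
  ultimately show ?thesis
    unfolding roof_rel_iff using T(2) st comp_roof[OF st(1,3) rs W] comp_roof[OF st(2,4) _ W'] rs
    by (auto simp: ccomp_assoc)
qed

text \<open>\<open>D_comp\<close> is a union over all representatives and all completing squares. By
  \<open>comp_roof_rel\<close> every choice gives the same class, so the union is that single class
  and can be computed from one square.\<close>

lemma D_comp_class:
  assumes r: "is_roof r" and s: "is_roof s" and rs: "tgt r = src s"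
    and W: "qi W (apex r) a" "cm W (apex s) b" "ht W (tgt r) (num r \<circ>\<^sub>c a) (den s \<circ>\<^sub>c b)"
  shows "D_comp (roof_class s) (roof_class r) =
     roof_class \<lparr>src = src r, tgt = tgt s, apex = W, den = den r \<circ>\<^sub>c a, num = num s \<circ>\<^sub>c b\<rparr>" (is "_ = ?R")
proof (rule equalityI)
  show "D_comp (roof_class s) (roof_class r) \<subseteq> ?R"
  proof
    fix x assume "x \<in> D_comp (roof_class s) (roof_class r)"
    then obtain r' s' W' a' b' where *: "(r, r') \<in> roof_rel" "(s, s') \<in> roof_rel" "is_bcomplex W'"
      "a' \<in> quasi_isos W' (apex r')" "b' \<in> chain_maps W' (apex s')"
      "homotopic W' (tgt r') (num r' \<circ>\<^sub>c a') (den s' \<circ>\<^sub>c b')"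
      "x \<in> roof_class \<lparr>src = src r', tgt = tgt s', apex = W', den = den r' \<circ>\<^sub>c a', num = num s' \<circ>\<^sub>c b'\<rparr>"
      unfolding D_comp_def by (auto simp: mem_roof_class)
    then have st: "is_roof r'" "is_roof s'" "tgt r' = src s'" using rs by (auto simp: roof_rel_iff)
    have qa: "qi W' (apex r') a'" "cm W' (apex s') b'" using * st by (auto simp: qi_def cm_def is_roof_def)
    moreover have "ht W' (tgt r') (num r' \<circ>\<^sub>c a') (den s' \<circ>\<^sub>c b')"
      using *(6) st cm_comp[OF qi_imp_cm[OF qa(1)]] cm_comp[OF qa(2)]
      by (auto simp: ht_def is_roof_iff qi_imp_cm)
    ultimately show "x \<in> ?R"
      using roof_class_eqI[OF comp_roof_rel[OF *(1,2) rs W]] *(7) by blast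
  qed
  show "?R \<subseteq> D_comp (roof_class s) (roof_class r)"
    unfolding D_comp_def
    by (intro Union_upper CollectI exI conjI refl)
      (use W r s in \<open>auto simp: mem_roof_class roof_rel_refl qi_def cm_def ht_def\<close>)
qed

lemma D_comp_closed:
  assumes F: "F \<in> D_hom X Y" and G: "G \<in> D_hom Y V"
  obtains r s W a b where "is_roof r" "is_roof s" "src r = X" "tgt r = Y" "src s = Y" "tgt s = V"
    "F = roof_class r" "G = roof_class s"
    "qi W (apex r) a" "cm W (apex s) b" "ht W (tgt r) (num r \<circ>\<^sub>c a) (den s \<circ>\<^sub>c b)"
    "D_comp G F = roof_class \<lparr>src = X, tgt = V, apex = W, den = den r \<circ>\<^sub>c a, num = num s \<circ>\<^sub>c b\<rparr>"
    "D_comp G F \<in> D_hom X V"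
proof -
  obtain r where r: "is_roof r" "src r = X" "tgt r = Y" "F = roof_class r" using F by (auto simp: D_hom_iff)
  obtain s where s: "is_roof s" "src s = Y" "tgt s = V" "G = roof_class s" using G by (auto simp: D_hom_iff)
  have "cm (apex r) Y (num r)" "qi (apex s) Y (den s)" using r s by (auto simp: is_roof_iff)
  then obtain W a b where W: "qi W (apex r) a" "cm W (apex s) b" "ht W Y (num r \<circ>\<^sub>c a) (den s \<circ>\<^sub>c b)"
    by (rule ore)
  have rs: "tgt r = src s" using r s by simp
  have eq: "D_comp G F = roof_class \<lparr>src = X, tgt = V, apex = W, den = den r \<circ>\<^sub>c a, num = num s \<circ>\<^sub>c b\<rparr>"
    using D_comp_class[OF r(1) s(1) rs W(1,2)] W(3) r s by simp
  moreover have "D_comp G F \<in> D_hom X V"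
    unfolding D_hom_iff
    by (rule exI, intro conjI, rule comp_roof[OF r(1) s(1) rs W(1,2)]) (use W r s eq in auto)
  ultimately show ?thesis using that r s W by blast
qed

lemma num_update_simps [simp]:
  "src (r\<lparr>num := f\<rparr>) = src r" "tgt (r\<lparr>num := f\<rparr>) = tgt r" "apex (r\<lparr>num := f\<rparr>) = apex r"
  "den (r\<lparr>num := f\<rparr>) = den r" "num (r\<lparr>num := f\<rparr>) = f"
  by (cases r; simp)+

lemma plus_roof:
  assumes "is_roof r" "is_roof s" "tgt r = tgt s" "apex r = apex s"
  shows "is_roof (r\<lparr>num := \<lambda>n v. num r n v + num s n v\<rparr>)"
  using assms by (auto simp: is_roof_def intro!: chain_maps_plus)

lemma plus_roof_rel:
  assumes r: "(r, r') \<in> roof_rel" and s: "(s, s') \<in> roof_rel"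
    and st: "src r = src s" "tgt r = tgt s" "apex r = apex s" "den r = den s" "apex r' = apex s'" "den r' = den s'"
  shows "(r\<lparr>num := \<lambda>n v. num r n v + num s n v\<rparr>, r'\<lparr>num := \<lambda>n v. num r' n v + num s' n v\<rparr>) \<in> roof_rel"
proof -
  have sr: "is_roof r" "is_roof r'" "is_roof s" "is_roof s'" "src r = src r'" "tgt r = tgt r'"
    "src s = src s'" "tgt s = tgt s'" using r s by (auto simp: roof_rel_iff)
  have q: "qi (apex r) (src r) (den r)" "qi (apex r') (src r) (den r')"
    using sr by (auto simp: is_roof_iff)
  obtain V p p' where V: "qi V (apex r) p" "cm V (apex r') p'"
      "ht V (src r) (den r \<circ>\<^sub>c p) (den r' \<circ>\<^sub>c p')"
    using ore[OF qi_imp_cm[OF q(1)] q(2)] .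
  note p = qi_imp_cm[OF V(1)]
  obtain U c where U: "qi U V c" "ht U (tgt r) (num r \<circ>\<^sub>c p \<circ>\<^sub>c c) (num r' \<circ>\<^sub>c p' \<circ>\<^sub>c c)"
    using roof_rel_lift[OF r p V(2,3)] .
  note c = qi_imp_cm[OF U(1)]
  have pc: "cm U (apex s) (p \<circ>\<^sub>c c)" "cm U (apex s') (p' \<circ>\<^sub>c c)"
    using cm_comp[OF c p] cm_comp[OF c V(2)] st by auto
  have "ht U (src s) (den s \<circ>\<^sub>c p \<circ>\<^sub>c c) (den s' \<circ>\<^sub>c p' \<circ>\<^sub>c c)"
    using ht_right[OF V(3) c] st by (simp add: ccomp_assoc)
  then obtain T d where T: "qi T U d" "ht T (tgt s) (num s \<circ>\<^sub>c (p \<circ>\<^sub>c c) \<circ>\<^sub>c d) (num s' \<circ>\<^sub>c (p' \<circ>\<^sub>c c) \<circ>\<^sub>c d)"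
    using roof_rel_lift[OF s pc] by blast
  note d = qi_imp_cm[OF T(1)]
  have "ht T (tgt r) (\<lambda>n v. (num r \<circ>\<^sub>c p \<circ>\<^sub>c c \<circ>\<^sub>c d) n v + (num s \<circ>\<^sub>c p \<circ>\<^sub>c c \<circ>\<^sub>c d) n v)
      (\<lambda>n v. (num r' \<circ>\<^sub>c p' \<circ>\<^sub>c c \<circ>\<^sub>c d) n v + (num s' \<circ>\<^sub>c p' \<circ>\<^sub>c c \<circ>\<^sub>c d) n v)"
    using ht_plus[OF ht_right[OF U(2) d], of "num s \<circ>\<^sub>c p \<circ>\<^sub>c c \<circ>\<^sub>c d" "num s' \<circ>\<^sub>c p' \<circ>\<^sub>c c \<circ>\<^sub>c d"] T(2) st
    by (simp add: ccomp_assoc)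
  then have "ht T (tgt r) ((\<lambda>n v. num r n v + num s n v) \<circ>\<^sub>c p \<circ>\<^sub>c c \<circ>\<^sub>c d)
      ((\<lambda>n v. num r' n v + num s' n v) \<circ>\<^sub>c p' \<circ>\<^sub>c c \<circ>\<^sub>c d)"
    by (simp add: ccomp_def o_def)
  moreover have "qi T (apex r) (p \<circ>\<^sub>c c \<circ>\<^sub>c d)" "cm T (apex r') (p' \<circ>\<^sub>c c \<circ>\<^sub>c d)"
    using qi_compI[OF qi_compI[OF T(1) U(1)] V(1)] cm_comp[OF d pc(2)] st by (simp_all add: ccomp_assoc)
  moreover have "ht T (src r) (den r \<circ>\<^sub>c p \<circ>\<^sub>c c \<circ>\<^sub>c d) (den r' \<circ>\<^sub>c p' \<circ>\<^sub>c c \<circ>\<^sub>c d)"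
    using ht_right[OF V(3) cm_comp[OF d c]] by (simp add: ccomp_assoc)
  ultimately show ?thesis
    unfolding roof_rel_iff using sr st plus_roof[of r s] plus_roof[of r' s'] by auto
qed

lemma D_plus_class:
  assumes r: "is_roof r" and s: "is_roof s"
    and st: "src r = src s" "tgt r = tgt s" "apex r = apex s" "den r = den s"
  shows "D_plus (roof_class r) (roof_class s) = roof_class (r\<lparr>num := \<lambda>n v. num r n v + num s n v\<rparr>)" (is "_ = ?R")
proof (rule equalityI)
  show "D_plus (roof_class r) (roof_class s) \<subseteq> ?R"
  proof
    fix x assume "x \<in> D_plus (roof_class r) (roof_class s)"
    then obtain r' s' where *: "(r, r') \<in> roof_rel" "(s, s') \<in> roof_rel"
      "apex r' = apex s'" "den r' = den s'" "x \<in> roof_class (r'\<lparr>num := \<lambda>n v. num r' n v + num s' n v\<rparr>)"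
      unfolding D_plus_def by (auto simp: mem_roof_class)
    then show "x \<in> ?R" using roof_class_eqI[OF plus_roof_rel[OF *(1,2) st]] by blast
  qed
  show "?R \<subseteq> D_plus (roof_class r) (roof_class s)"
  proof
    fix x assume "x \<in> ?R"
    moreover have "r \<in> roof_class r" "s \<in> roof_class s" using r s by (auto simp: mem_roof_class roof_rel_refl)
    ultimately show "x \<in> D_plus (roof_class r) (roof_class s)"
      unfolding D_plus_def using st(3,4) by blast
  qed
qed

lemma D_hom_common_den:
  assumes F: "F \<in> D_hom X Y" and G: "G \<in> D_hom X Y"
  obtains r s where "is_roof r" "is_roof s" "src r = X" "tgt r = Y" "src s = X" "tgt s = Y"
    "apex r = apex s" "den r = den s" "F = roof_class r" "G = roof_class s"
proof -
  obtain r where r: "is_roof r" "src r = X" "tgt r = Y" "F = roof_class r" using F by (auto simp: D_hom_iff)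
  obtain s where s: "is_roof s" "src s = X" "tgt s = Y" "G = roof_class s" using G by (auto simp: D_hom_iff)
  have q: "qi (apex r) X (den r)" "qi (apex s) X (den s)" "cm (apex r) Y (num r)" "cm (apex s) Y (num s)"
    using r s by (auto simp: is_roof_iff)
  obtain W a b where W: "qi W (apex r) a" "cm W (apex s) b" "ht W X (den r \<circ>\<^sub>c a) (den s \<circ>\<^sub>c b)"
    using ore[OF qi_imp_cm[OF q(1)] q(2)] .
  note a = qi_imp_cm[OF W(1)]
  define r' where "r' = \<lparr>src = X, tgt = Y, apex = W, den = den r \<circ>\<^sub>c a, num = num r \<circ>\<^sub>c a\<rparr>"
  \<comment> \<open>The denominator taken here is that of r', although the natural one is
    \<open>den s\<close> composed with b. The two are homotopic, which is enough for equivalence and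
    makes the denominators of both roofs literally equal.\<close>
  define s' where "s' = \<lparr>src = X, tgt = Y, apex = W, den = den r \<circ>\<^sub>c a, num = num s \<circ>\<^sub>c b\<rparr>"
  have qW: "qi W X (den r \<circ>\<^sub>c a)" by (rule qi_compI[OF W(1) q(1)])
  have r's': "is_roof r'" "is_roof s'"
    using qW cm_comp[OF a q(3)] cm_comp[OF W(2) q(4)] by (simp_all add: is_roof_iff r'_def s'_def)
  have cW: "qi W W (cid W)" "cm W W (cid W)" using qi_cid cm_cid cm_bc(1)[OF a] by blast+
  have "(r', r) \<in> roof_rel"
    by (rule roof_relI[of _ _ W "cid W" a])
      (use r r's' W cW a qi_imp_cm[OF qW] cm_comp[OF a q(3)] in
        \<open>auto simp: r'_def ccomp_assoc cm_cid_right[OF a] intro!: ht_refl\<close>)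
  moreover have "(s', s) \<in> roof_rel"
    by (rule roof_relI[of _ _ W "cid W" b])
      (use s r's' W cW a cm_comp[OF W(2) q(4)] in
        \<open>auto simp: s'_def ccomp_assoc cm_cid_right[OF a] cm_cid_right[OF W(2)] intro!: ht_refl\<close>)
  ultimately show ?thesis
    using that[of r' s'] r's' r s roof_class_eqI by (auto simp: r'_def s'_def)
qed

section \<open>Calculation with morphisms of the derived category and their effect on
  cohomology\<close>

section \<open>The derived category\<close>

lemma Db_simps [simp]:
  "Ob Db = {X. is_bcomplex X}" "Mor Db = D_hom" "Comp Db = D_comp" "Plus Db = D_plus" "Neg Db = D_neg"
  by (simp_all add: Db_def)

text \<open>The localisation functor on morphisms: a chain map as a roof with identity
  denominator.\<close>

definition Qm :: "'k::field complx \<Rightarrow> 'k complx \<Rightarrow> 'k cmap \<Rightarrow> 'k roof set" where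
  "Qm X Y f = roof_class \<lparr>src = X, tgt = Y, apex = X, den = cid X, num = f\<rparr>"

lemma Db_Ident [simp]: "Ident Db X = Qm X X (cid X)"
  by (simp add: Db_def Qm_def)

lemma Db_Zero [simp]: "Zero Db X Y = Qm X Y (\<lambda>n v. 0)"
  by (simp add: Db_def Qm_def)

lemma cm_zero_map: "\<lbrakk>is_bcomplex X; is_bcomplex Y\<rbrakk> \<Longrightarrow> cm X Y (\<lambda>n v. 0)"
  by (simp add: cm_def chain_maps_zero)

lemma Qm_roof: "cm X Y f \<Longrightarrow> is_roof \<lparr>src = X, tgt = Y, apex = X, den = cid X, num = f\<rparr>"
  by (auto simp: is_roof_iff intro: qi_cid cm_bc)

lemma roof_hom:
  "\<lbrakk>qi Z X d; cm Z Y f\<rbrakk> \<Longrightarrow> roof_class \<lparr>src = X, tgt = Y, apex = Z, den = d, num = f\<rparr> \<in> D_hom X Y"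
  unfolding D_hom_iff by (rule exI[of _ "\<lparr>src = X, tgt = Y, apex = Z, den = d, num = f\<rparr>"]) (simp add: is_roof_iff)

lemma Qm_hom: "cm X Y f \<Longrightarrow> Qm X Y f \<in> D_hom X Y"
  unfolding D_hom_iff Qm_def using Qm_roof by fastforce

lemma Qm_eq:
  assumes "ht X Y f g"
  shows "Qm X Y f = Qm X Y g"
proof -
  have "cm X Y f" "cm X Y g" using assms by (auto simp: ht_def)
  note fg = this
  have X: "is_bcomplex X" by (rule cm_bc(1)[OF fg(1)])
  show ?thesis
    unfolding Qm_def
    by (intro roof_class_eqI roof_relI[of _ _ X "cid X" "cid X"])
      (use X fg assms in \<open>auto intro: Qm_roof qi_cid cm_cid ht_refl cm_comp simp: cm_cid_right[OF fg(1)] cm_cid_right[OF fg(2)]\<close>)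
qed

lemma D_comp_Qm_left:
  assumes r: "is_roof r" and g: "cm (tgt r) V g"
  shows "D_comp (Qm (tgt r) V g) (roof_class r) =
    roof_class \<lparr>src = src r, tgt = V, apex = apex r, den = den r, num = g \<circ>\<^sub>c num r\<rparr>"
proof -
  have c: "cm (apex r) (src r) (den r)" "cm (apex r) (tgt r) (num r)"
    using r by (auto simp: is_roof_iff qi_imp_cm)
  have "D_comp (Qm (tgt r) V g) (roof_class r) = roof_class \<lparr>src = src r, tgt = V, apex = apex r,
      den = den r \<circ>\<^sub>c cid (apex r), num = g \<circ>\<^sub>c num r\<rparr>"
    unfolding Qm_def
    using D_comp_class[OF r Qm_roof[OF g], of "apex r" "cid (apex r)" "num r"] c
      qi_cid[OF cm_bc(1)[OF c(1)]]
    by (simp add: cm_cid_right[OF c(2)] cm_cid_left[OF c(2)] ht_refl)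
  then show ?thesis by (simp add: cm_cid_right[OF c(1)])
qed

lemma D_comp_Qm_right:
  assumes s: "is_roof s" and f: "cm X (apex s) f'" "cm X (src s) f" "ht X (src s) f (den s \<circ>\<^sub>c f')"
  shows "D_comp (roof_class s) (Qm X (src s) f) = Qm X (tgt s) (num s \<circ>\<^sub>c f')"
proof -
  have X: "is_bcomplex X" by (rule cm_bc(1)[OF f(1)])
  show ?thesis
    unfolding Qm_def
    using D_comp_class[OF Qm_roof[OF f(2)] s, of X "cid X" f'] f X
    by (simp add: qi_cid cm_cid_right[OF f(2)] cm_cid_right[OF cm_cid[OF X]])
qed

lemma Qm_comp:
  assumes "cm X Y f" "cm Y V g"
  shows "D_comp (Qm Y V g) (Qm X Y f) = Qm X V (g \<circ>\<^sub>c f)"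
  using D_comp_Qm_left[OF Qm_roof[OF assms(1)]] assms by (simp add: Qm_def)

lemma Qm_plus:
  assumes "cm X Y f" "cm X Y g"
  shows "D_plus (Qm X Y f) (Qm X Y g) = Qm X Y (\<lambda>n v. f n v + g n v)"
  unfolding Qm_def using D_plus_class[OF Qm_roof[OF assms(1)] Qm_roof[OF assms(2)]] by simp

lemma ccomp_zero: "(\<lambda>n v. 0) \<circ>\<^sub>c f = (\<lambda>n v. 0)" "cm Y V f \<Longrightarrow> f \<circ>\<^sub>c (\<lambda>n v. 0) = (\<lambda>n v. 0)"
  by (auto simp: ccomp_def cm_def fun_eq_iff)

lemma D_comp_zero_right:
  assumes "F \<in> D_hom X Y" "is_bcomplex V"
  shows "D_comp F (Qm V X (\<lambda>n v. 0)) = Qm V Y (\<lambda>n v. 0)"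
proof -
  obtain s where s: "is_roof s" "src s = X" "tgt s = Y" "F = roof_class s" using assms by (auto simp: D_hom_iff)
  have c: "cm (apex s) X (den s)" "cm (apex s) Y (num s)" using s by (auto simp: is_roof_iff qi_imp_cm)
  show ?thesis
    using D_comp_Qm_right[OF s(1), of V "\<lambda>n v. 0" "\<lambda>n v. 0"] s(2-4)
      cm_zero_map[OF assms(2) cm_bc(1)[OF c(1)]] cm_zero_map[OF assms(2) cm_bc(2)[OF c(1)]]
    by (simp add: ccomp_zero(2)[OF c(1)] ccomp_zero(2)[OF c(2)] ht_refl)
qed

lemma zero_roof_rel:
  assumes "qi Z X d" "is_bcomplex Y"
  shows "roof_class \<lparr>src = X, tgt = Y, apex = Z, den = d, num = \<lambda>n v. 0\<rparr> = Qm X Y (\<lambda>n v. 0)"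
proof -
  have b: "is_bcomplex Z" "is_bcomplex X" using assms by (auto simp: qi_def)
  note d = qi_imp_cm[OF assms(1)]
  show ?thesis
    unfolding Qm_def
    by (intro roof_class_eqI roof_relI[of _ _ Z "cid Z" d])
      (use assms b d in \<open>auto simp: is_roof_iff cm_zero_map qi_cid ccomp_zero cm_cid_right[OF d] cm_cid_left[OF d] ht_refl\<close>)
qed

lemma D_comp_zero_left:
  assumes "F \<in> D_hom X Y" "is_bcomplex V"
  shows "D_comp (Qm Y V (\<lambda>n v. 0)) F = Qm X V (\<lambda>n v. 0)"
proof -
  obtain r where r: "is_roof r" "src r = X" "tgt r = Y" "F = roof_class r" using assms by (auto simp: D_hom_iff)
  have c: "qi (apex r) X (den r)" "cm (apex r) Y (num r)" using r by (auto simp: is_roof_iff)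
  show ?thesis
    using D_comp_Qm_left[OF r(1), of V "\<lambda>n v. 0"] r(2-4) assms zero_roof_rel[OF c(1) assms(2)]
      cm_zero_map[OF cm_bc(2)[OF c(2)] assms(2)]
    by (simp add: ccomp_zero)
qed

lemma roof_comp_inverse:
  assumes "qi Z X d" "qi Z T n"
  shows "D_comp (roof_class \<lparr>src = T, tgt = X, apex = Z, den = n, num = d\<rparr>)
     (roof_class \<lparr>src = X, tgt = T, apex = Z, den = d, num = n\<rparr>) = Qm X X (cid X)"
proof -
  have b: "is_bcomplex Z" "is_bcomplex X" "is_bcomplex T" using assms by (auto simp: qi_def)
  note d = qi_imp_cm[OF assms(1)] and n = qi_imp_cm[OF assms(2)]
  have "D_comp (roof_class \<lparr>src = T, tgt = X, apex = Z, den = n, num = d\<rparr>)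
     (roof_class \<lparr>src = X, tgt = T, apex = Z, den = d, num = n\<rparr>) =
     roof_class \<lparr>src = X, tgt = X, apex = Z, den = d, num = d\<rparr>"
    using D_comp_class[of "\<lparr>src = X, tgt = T, apex = Z, den = d, num = n\<rparr>"
       "\<lparr>src = T, tgt = X, apex = Z, den = n, num = d\<rparr>" Z "cid Z" "cid Z"] assms d n b
    by (simp add: is_roof_iff qi_cid cm_cid ht_refl cm_cid_right[OF d] cm_cid_right[OF n])
  also have "\<dots> = Qm X X (cid X)"
    unfolding Qm_def
    by (intro roof_class_eqI roof_relI[of _ _ Z "cid Z" d])
      (use assms b d in \<open>auto simp: is_roof_iff cm_zero_map qi_cid cm_cid cm_cid_right[OF d] cm_cid_left[OF d] ht_refl\<close>)
  finally show ?thesis .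
qed

lemma roof_iso:
  assumes "qi Z X d" "qi Z T n"
  shows "is_iso Db X T (roof_class \<lparr>src = X, tgt = T, apex = Z, den = d, num = n\<rparr>)"
proof -
  have "roof_class \<lparr>src = X, tgt = T, apex = Z, den = d, num = n\<rparr> \<in> D_hom X T"
    "roof_class \<lparr>src = T, tgt = X, apex = Z, den = n, num = d\<rparr> \<in> D_hom T X"
    using assms by (simp_all add: roof_hom qi_imp_cm)
  then show ?thesis
    unfolding is_iso_def using roof_comp_inverse[OF assms] roof_comp_inverse[OF assms(2,1)] by auto
qed

definition zero_cx :: "'k::field complx" where
  "zero_cx = stalk zero_rmod"

lemma zero_cx_obj [simp]: "obj zero_cx n = zero_rmod" and zero_cx_dif [simp]: "dif zero_cx n v = 0"
  by (simp_all add: zero_cx_def stalk_def)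

lemma stalk_bc:
  assumes M: "is_rmod M"
  shows "is_bcomplex (stalk M)"
proof (rule is_bcomplexI)
  show m: "is_rmod (obj (stalk M) n)" for n using M by (simp add: stalk_def zero_is_rmod)
  show "dif (stalk M) n \<in> rmod_hom (obj (stalk M) n) (obj (stalk M) (n + 1))" for n
    using rmod_hom_zero[OF m] by (simp add: stalk_def)
  have "{n. sp (stalk M) n \<noteq> {0}} \<subseteq> {0}" by (auto simp: stalk_def zero_rmod_def)
  then show "finite {n. sp (stalk M) n \<noteq> {0}}" by (rule finite_subset) simp
qed (simp add: stalk_def)

lemma zero_cx_bc [simp]: "is_bcomplex zero_cx"
  unfolding zero_cx_def by (rule stalk_bc[OF zero_is_rmod])

lemma cid_zero_cx: "cid zero_cx = (\<lambda>n v. 0)"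
  by (auto simp: cid_def fun_eq_iff)

lemma zero_cx_zero_object: "is_zero_object Db zero_cx"
  by (simp add: is_zero_object_def cid_zero_cx)

text \<open>Closure under summands is formulated with direct sums, so an isomorphism is turned into
  a direct sum decomposition with complement zero.\<close>

lemma iso_direct_sum_zero:
  assumes F: "is_iso Db X T F" and XT: "is_bcomplex X" "is_bcomplex T"
  shows "direct_sum Db X zero_cx T"
proof -
  obtain G where F: "F \<in> D_hom X T" and G: "G \<in> D_hom T X" "D_comp G F = Qm X X (cid X)" "D_comp F G = Qm T T (cid T)"
    using F by (auto simp: is_iso_def)
  have z: "cm T zero_cx (\<lambda>n v. 0)" "cm zero_cx T (\<lambda>n v. 0)" "cm T T (\<lambda>n v. 0)"
    using XT by (auto intro: cm_zero_map)
  have "is_biproduct Db X zero_cx T F (Qm zero_cx T (\<lambda>n v. 0)) G (Qm T zero_cx (\<lambda>n v. 0))"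
    using F G XT z Qm_plus[OF cm_cid[OF XT(2)] z(3)]
    by (simp add: is_biproduct_def Qm_hom Qm_comp D_comp_zero_right D_comp_zero_left ccomp_zero cid_zero_cx)
  then show ?thesis unfolding direct_sum_def by blast
qed

lemma U_A_I:
  assumes "direct_sum_list Db Xs T" "set Xs \<subseteq> {shift (2 * i) (stalk M) |M i. M \<in> M_A}"
    and "qi Z T g" "qi Z X f"
  shows "X \<in> U_A"
proof -
  have b: "is_bcomplex X" "is_bcomplex T" using assms by (auto simp: qi_def)
  have "direct_sum Db X zero_cx T"
    by (rule iso_direct_sum_zero[OF roof_iso[OF assms(4,3)] b])
  then show ?thesis unfolding U_A_def add_closure_def using assms(1,2) b by auto
qed

subsection \<open>Direct sums of complexes\<close>

definition dsumc :: "'k::field complx \<Rightarrow> 'k complx \<Rightarrow> 'k complx" where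
  "dsumc X Y = \<lparr>obj = \<lambda>n. dsum_mod (obj X n) (obj Y n),
     dif = \<lambda>n u. if u \<in> space (dsum_mod (obj X n) (obj Y n)) then vpair (dif X n (vfst u)) (dif Y n (vsnd u)) else 0\<rparr>"

definition dpair :: "'k::field complx \<Rightarrow> 'k complx \<Rightarrow> 'k cmap \<Rightarrow> 'k cmap \<Rightarrow> 'k cmap" where
  "dpair X Y f g = (\<lambda>n u. if u \<in> space (dsum_mod (obj X n) (obj Y n)) then vpair (f n (vfst u)) (g n (vsnd u)) else 0)"

definition dcopair :: "'k::field complx \<Rightarrow> 'k complx \<Rightarrow> 'k cmap \<Rightarrow> 'k cmap \<Rightarrow> 'k cmap" where
  "dcopair X Y f g = (\<lambda>n u. if u \<in> space (dsum_mod (obj X n) (obj Y n)) then f n (vfst u) + g n (vsnd u) else 0)"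

lemma dsumc_obj [simp]: "obj (dsumc X Y) n = dsum_mod (obj X n) (obj Y n)"
  by (simp add: dsumc_def)

lemma dsumc_dif [simp]: "dif (dsumc X Y) n u = (if vfst u \<in> sp X n \<and> vsnd u \<in> sp Y n
   then vpair (dif X n (vfst u)) (dif Y n (vsnd u)) else 0)"
  by (simp add: dsumc_def)

lemma dsumc_bc:
  assumes X: "is_bcomplex X" and Y: "is_bcomplex Y"
  shows "is_bcomplex (dsumc X Y)"
proof (rule is_bcomplexI)
  show "is_rmod (obj (dsumc X Y) n)" for n using X Y by (simp add: dsum_is_rmod)
  show "dif (dsumc X Y) n \<in> rmod_hom (obj (dsumc X Y) n) (obj (dsumc X Y) (n + 1))" for n
    unfolding rmod_hom_def mem_Collect_eq dsumc_obj dsumc_dif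
    by (intro conjI ballI allI impI)
      (auto simp: dif_closed X Y dif_add rmod_add vpair_linear dif_act act_closed)
  show "dif (dsumc X Y) (n + 1) (dif (dsumc X Y) n v) = 0" for n v
    using X Y by (simp add: dif_dif)
  have "sp (dsumc X Y) n = {0}" if "sp X n = {0}" "sp Y n = {0}" for n
    using that by (simp add: set_eq_iff vec_zero_iff)
  then have "{n. sp (dsumc X Y) n \<noteq> {0}} \<subseteq> {n. sp X n \<noteq> {0}} \<union> {n. sp Y n \<noteq> {0}}"
    by blast
  then show "finite {n. sp (dsumc X Y) n \<noteq> {0}}"
    by (rule finite_subset) (use X Y in \<open>auto simp: is_bcomplex_def\<close>)
qed

lemma dsumc_cocycles: "u \<in> cocycles (dsumc X Y) n \<longleftrightarrow> vfst u \<in> cocycles X n \<and> vsnd u \<in> cocycles Y n"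
  by (auto simp: cocycles_def)

lemma dsumc_coboundaries:
  assumes "is_bcomplex X" "is_bcomplex Y"
  shows "u \<in> coboundaries (dsumc X Y) n \<longleftrightarrow> vfst u \<in> coboundaries X n \<and> vsnd u \<in> coboundaries Y n"
proof
  assume "u \<in> coboundaries (dsumc X Y) n"
  then show "vfst u \<in> coboundaries X n \<and> vsnd u \<in> coboundaries Y n"
    by (auto simp: coboundaries_def)
next
  assume "vfst u \<in> coboundaries X n \<and> vsnd u \<in> coboundaries Y n"
  then obtain v w where vw: "v \<in> sp X (n - 1)" "vfst u = dif X (n - 1) v" "w \<in> sp Y (n - 1)" "vsnd u = dif Y (n - 1) w"
    by (auto simp: coboundaries_def)
  then have "dif (dsumc X Y) (n - 1) (vpair v w) = u"
    by (simp add: vpair_eq_iff[of _ u])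
  then show "u \<in> coboundaries (dsumc X Y) n"
    using vw unfolding coboundaries_def by (intro image_eqI[of _ _ "vpair v w"]) auto
qed

lemma dpair_cm:
  assumes "cm X X' f" "cm Y Y' g"
  shows "cm (dsumc X Y) (dsumc X' Y') (dpair X Y f g)"
proof -
  have b: "is_bcomplex X" "is_bcomplex X'" "is_bcomplex Y" "is_bcomplex Y'"
    and f: "f \<in> chain_maps X X'" and g: "g \<in> chain_maps Y Y'" using assms by (auto simp: cm_def)
  have "dpair X Y f g \<in> chain_maps (dsumc X Y) (dsumc X' Y')"
  proof (rule chain_mapsI)
    show "dpair X Y f g n \<in> rmod_hom (obj (dsumc X Y) n) (obj (dsumc X' Y') n)" for n
      unfolding rmod_hom_def mem_Collect_eq dsumc_obj dpair_def
      by (intro conjI ballI allI impI)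
        (auto simp: b rmod_add vpair_linear act_closed cm_closed[OF b(1,2) f] cm_closed[OF b(3,4) g]
          cm_add[OF b(1,2) f] cm_add[OF b(3,4) g] cm_act[OF b(1,2) f] cm_act[OF b(3,4) g])
    show "dif (dsumc X' Y') n (dpair X Y f g n v) = dpair X Y f g (n + 1) (dif (dsumc X Y) n v)" for n v
      using b by (simp add: dpair_def cm_closed[OF b(1,2) f] cm_closed[OF b(3,4) g]
          cm_dif[OF b(1,2) f] cm_dif[OF b(3,4) g] dif_closed cm_zero[OF b(1,2) f] cm_zero[OF b(3,4) g])
  qed
  then show ?thesis using b by (simp add: cm_def dsumc_bc)
qed

lemma dpair_qi:
  assumes "qi X X' f" "qi Y Y' g"
  shows "qi (dsumc X Y) (dsumc X' Y') (dpair X Y f g)"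
proof -
  have b: "is_bcomplex X" "is_bcomplex X'" "is_bcomplex Y" "is_bcomplex Y'"
    and f: "f \<in> quasi_isos X X'" and g: "g \<in> quasi_isos Y Y'" using assms by (auto simp: qi_def)
  have in_sp: "vfst u \<in> sp X n" "vsnd u \<in> sp Y n" if "u \<in> cocycles (dsumc X Y) n" for u n
    using that by (auto simp: dsumc_cocycles cocycles_def)
  have "dpair X Y f g \<in> quasi_isos (dsumc X Y) (dsumc X' Y')"
  proof (rule qiI)
    show "dpair X Y f g \<in> chain_maps (dsumc X Y) (dsumc X' Y')"
      using dpair_cm[OF qi_imp_cm[OF assms(1)] qi_imp_cm[OF assms(2)]] by (simp add: cm_def)
    show "u \<in> coboundaries (dsumc X Y) n"
      if "u \<in> cocycles (dsumc X Y) n" "dpair X Y f g n u \<in> coboundaries (dsumc X' Y') n" for n u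
      using that in_sp[OF that(1)] qi_inj[OF f, of "vfst u"] qi_inj[OF g, of "vsnd u"]
      by (simp add: dsumc_cocycles dsumc_coboundaries b dpair_def)
    show "\<exists>u\<in>cocycles (dsumc X Y) n. w - dpair X Y f g n u \<in> coboundaries (dsumc X' Y') n"
      if w: "w \<in> cocycles (dsumc X' Y') n" for n w
    proof -
      have w: "vfst w \<in> cocycles X' n" "vsnd w \<in> cocycles Y' n" using w by (auto simp: dsumc_cocycles)
      obtain v where v: "v \<in> cocycles X n" "vfst w - f n v \<in> coboundaries X' n"
        using qi_surj[OF f w(1)] .
      obtain v' where v': "v' \<in> cocycles Y n" "vsnd w - g n v' \<in> coboundaries Y' n"
        using qi_surj[OF g w(2)] .
      show ?thesis
        by (rule bexI[of _ "vpair v v'"])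
          (use v v' in \<open>auto simp: dsumc_cocycles dsumc_coboundaries b dpair_def cocycles_sp\<close>)
    qed
  qed
  then show ?thesis using b by (simp add: qi_def dsumc_bc)
qed

lemma dcopair_cm:
  assumes "cm X V f" "cm Y V g"
  shows "cm (dsumc X Y) V (dcopair X Y f g)"
proof -
  have b: "is_bcomplex X" "is_bcomplex V" "is_bcomplex Y"
    and f: "f \<in> chain_maps X V" and g: "g \<in> chain_maps Y V" using assms by (auto simp: cm_def)
  have "dcopair X Y f g \<in> chain_maps (dsumc X Y) V"
  proof (rule chain_mapsI)
    show "dcopair X Y f g n \<in> rmod_hom (obj (dsumc X Y) n) (obj V n)" for n
      unfolding rmod_hom_def mem_Collect_eq dsumc_obj dcopair_def
      by (intro conjI ballI allI impI)
        (auto simp: b rmod_add act_closed act_add cm_closed[OF b(1,2) f] cm_closed[OF b(3,2) g]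
          cm_add[OF b(1,2) f] cm_add[OF b(3,2) g] cm_act[OF b(1,2) f] cm_act[OF b(3,2) g])
    show "dif V n (dcopair X Y f g n v) = dcopair X Y f g (n + 1) (dif (dsumc X Y) n v)" for n v
      using b by (simp add: dcopair_def cm_closed[OF b(1,2) f] cm_closed[OF b(3,2) g] dif_add
          cm_dif[OF b(1,2) f] cm_dif[OF b(3,2) g] dif_closed cm_zero[OF b(1,2) f] cm_zero[OF b(3,2) g])
  qed
  then show ?thesis using b by (simp add: cm_def dsumc_bc)
qed

lemma dsumc_direct_sum:
  assumes X: "is_bcomplex X" and Y: "is_bcomplex Y"
  shows "direct_sum Db X Y (dsumc X Y)"
proof -
  let ?S = "dsumc X Y"
  let ?z = "\<lambda>n v. 0"
  define i where "i = (\<lambda>n v. if v \<in> sp X n then vpair v 0 else 0)"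
  define j where "j = (\<lambda>n v. if v \<in> sp Y n then vpair 0 v else 0)"
  define p where "p = dcopair X Y (cid X) ?z"
  define q where "q = dcopair X Y ?z (cid Y)"
  have p: "cm ?S X p" and q: "cm ?S Y q"
    unfolding p_def q_def using X Y by (auto intro!: dcopair_cm cm_cid cm_zero_map)
  have i: "cm X ?S i" and j: "cm Y ?S j"
    unfolding cm_def using X Y dsumc_bc[OF X Y]
    by (auto intro!: chain_mapsI simp: rmod_hom_def i_def j_def dif_closed dif_out rmod_add vpair_linear act_closed act_zero)
  have S: "is_bcomplex ?S" by (rule dsumc_bc[OF X Y])
  have eqs: "p \<circ>\<^sub>c i = cid X" "q \<circ>\<^sub>c j = cid Y" "p \<circ>\<^sub>c j = ?z" "q \<circ>\<^sub>c i = ?z"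
    using X Y by (auto simp: ccomp_def p_def q_def i_def j_def dcopair_def cid_def fun_eq_iff)
  have eqs': "(\<lambda>n v. (i \<circ>\<^sub>c p) n v + (j \<circ>\<^sub>c q) n v) = cid ?S"
    by (rule ext, rule ext)
      (use X Y in \<open>auto simp: ccomp_def p_def q_def i_def j_def dcopair_def cid_def vpair_linear\<close>)
  have "is_biproduct Db X Y ?S (Qm X ?S i) (Qm Y ?S j) (Qm ?S X p) (Qm ?S Y q)"
    unfolding is_biproduct_def
    using X Y S Qm_comp[OF i p] Qm_comp[OF j q] Qm_comp[OF j p] Qm_comp[OF i q] Qm_comp[OF p i] Qm_comp[OF q j]
      Qm_plus[OF cm_comp[OF p i] cm_comp[OF q j]] p q i j
    by (simp add: Qm_hom eqs eqs')
  then show ?thesis unfolding direct_sum_def by blast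
qed

subsection \<open>Action on cohomology\<close>

text \<open>Cohomology is not formed as a quotient: a class is given by a cocycle, equality is a
  difference in the coboundaries, and the induced map is a relation between cocycles, saturated
  under coboundaries on both sides.\<close>

definition roof_hrel :: "'k::field roof \<Rightarrow> int \<Rightarrow> 'k vec \<Rightarrow> 'k vec \<Rightarrow> bool" where
  "roof_hrel r n v y \<longleftrightarrow> v \<in> cocycles (src r) n \<and> y \<in> cocycles (tgt r) n \<and>
     (\<exists>z\<in>cocycles (apex r) n. den r n z - v \<in> coboundaries (src r) n \<and> num r n z - y \<in> coboundaries (tgt r) n)"

text \<open>The graph of the map induced in degree \<open>n\<close> cohomology by a morphism of the derived category.\<close>

definition hrel :: "'k::field roof set \<Rightarrow> int \<Rightarrow> 'k vec \<Rightarrow> 'k vec \<Rightarrow> bool" where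
  "hrel F n v y \<longleftrightarrow> (\<exists>r\<in>F. roof_hrel r n v y)"

text \<open>The witness z is moved to the common refinement, where the two roofs agree up to
  homotopy; homotopic maps differ by coboundaries on cocycles.\<close>

lemma roof_hrel_cong:
  assumes rs: "(r, s) \<in> roof_rel" and h: "roof_hrel r n v y"
  shows "roof_hrel s n v y"
proof -
  obtain W a b where W: "qi W (apex r) a" "cm W (apex s) b"
      "ht W (src r) (den r \<circ>\<^sub>c a) (den s \<circ>\<^sub>c b)" "ht W (tgt r) (num r \<circ>\<^sub>c a) (num s \<circ>\<^sub>c b)"
    and r: "qi (apex r) (src r) (den r)" "cm (apex r) (tgt r) (num r)"
    and s: "src s = src r" "tgt s = tgt r"
    using rs unfolding roof_rel_iff is_roof_iff by metis
  have bc: "is_bcomplex (apex r)" "is_bcomplex (src r)" "is_bcomplex (tgt r)" "is_bcomplex W" "is_bcomplex (apex s)"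
    using r W by (auto simp: qi_def cm_def)
  obtain z where z: "z \<in> cocycles (apex r) n" "den r n z - v \<in> coboundaries (src r) n"
      "num r n z - y \<in> coboundaries (tgt r) n" and vy: "v \<in> cocycles (src r) n" "y \<in> cocycles (tgt r) n"
    using h by (auto simp: roof_hrel_def)
  obtain w where w: "w \<in> cocycles W n" "z - a n w \<in> coboundaries (apex r) n"
    using W(1) z(1) qi_surj unfolding qi_def by metis
  have aux: "g n (b n w) - u \<in> coboundaries Y n"
    if f: "cm (apex r) Y f" and fg: "ht W Y (f \<circ>\<^sub>c a) (g \<circ>\<^sub>c b)" and u: "f n z - u \<in> coboundaries Y n" for f g Y u
  proof -
    have Y: "is_bcomplex Y" "f \<in> chain_maps (apex r) Y" using f by (auto simp: cm_def)
    have a: "a n w \<in> cocycles (apex r) n" using W(1) w(1) by (auto simp: qi_def intro: cm_cocycles qi_cm)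
    have "f n (z - a n w) \<in> coboundaries Y n"
      by (rule cm_coboundaries[OF bc(1) Y w(2)])
    then have 1: "f n z - f n (a n w) \<in> coboundaries Y n"
      using a z(1) by (simp add: cm_diff[OF bc(1) Y] cocycles_sp[OF bc(1)])
    have 2: "f n (a n w) - g n (b n w) \<in> coboundaries Y n"
      using homotopic_cocycles[OF bc(4) Y(1) _ w(1)] fg by (fastforce simp: ht_def ccomp_def)
    show ?thesis
      using coboundaries_diff[OF Y(1) coboundaries_diff[OF Y(1) u 1] 2] by simp
  qed
  have "b n w \<in> cocycles (apex s) n" using W(2) w(1) by (auto simp: cm_def intro: cm_cocycles)
  moreover have "den s n (b n w) - v \<in> coboundaries (src r) n" by (rule aux[OF qi_imp_cm[OF r(1)] W(3) z(2)])
  moreover have "num s n (b n w) - y \<in> coboundaries (tgt r) n" by (rule aux[OF r(2) W(4) z(3)])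
  ultimately show ?thesis using vy s by (auto simp: roof_hrel_def)
qed

lemma hrel_class: "is_roof r \<Longrightarrow> hrel (roof_class r) n v y \<longleftrightarrow> roof_hrel r n v y"
  unfolding hrel_def Bex_def mem_roof_class using roof_hrel_cong roof_rel_sym roof_rel_refl by blast

lemma hrel_Qm:
  assumes f: "cm X Y f"
  shows "hrel (Qm X Y f) n v y \<longleftrightarrow> v \<in> cocycles X n \<and> y \<in> cocycles Y n \<and> f n v - y \<in> coboundaries Y n"
proof -
  have b: "is_bcomplex X" "is_bcomplex Y" "f \<in> chain_maps X Y" using f by (auto simp: cm_def)
  have "f n v - y \<in> coboundaries Y n" if z: "z \<in> cocycles X n" "z - v \<in> coboundaries X n" "f n z - y \<in> coboundaries Y n"
      "v \<in> cocycles X n" for z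
  proof -
    have "f n z - f n v \<in> coboundaries Y n"
      using cm_coboundaries[OF b z(2)] z by (simp add: cm_diff[OF b] cocycles_sp b)
    then show ?thesis using coboundaries_diff[OF b(2) z(3)] by fastforce
  qed
  then show ?thesis
    unfolding Qm_def hrel_class[OF Qm_roof[OF f]] roof_hrel_def
    using b by (auto simp: cid_in cocycles_sp intro!: bexI[of _ v])
qed

context
  fixes F :: "'k::field roof set" and X Y
  assumes F: "F \<in> D_hom X Y"
begin

lemma hrel_bc: "is_bcomplex X" "is_bcomplex Y"
  using F by (auto simp: D_hom_iff is_roof_def)

lemma hrel_cocycles:
  assumes "hrel F n v y"
  shows "v \<in> cocycles X n" "y \<in> cocycles Y n"
  using F assms unfolding D_hom_iff by (auto simp: hrel_class roof_hrel_def)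

lemma hrel_total:
  assumes "v \<in> cocycles X n"
  obtains y where "hrel F n v y"
proof -
  obtain r where r: "is_roof r" "src r = X" "tgt r = Y" "F = roof_class r" using F by (auto simp: D_hom_iff)
  have b: "is_bcomplex (apex r)" "is_bcomplex X" "den r \<in> quasi_isos (apex r) X" "num r \<in> chain_maps (apex r) Y"
    using r by (auto simp: is_roof_def)
  obtain z where z: "z \<in> cocycles (apex r) n" "v - den r n z \<in> coboundaries X n"
    using qi_surj[OF b(3) assms] .
  have "num r n z \<in> cocycles Y n" by (rule cm_cocycles[OF b(1) hrel_bc(2) b(4) z(1)])
  then have "roof_hrel r n v (num r n z)"
    unfolding roof_hrel_def using r z assms b hrel_bc coboundaries_neg[OF b(2) z(2)]
    by (auto intro!: bexI[of _ z])
  then show ?thesis using that r hrel_class by blast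
qed

lemma hrel_diff:
  assumes "hrel F n v y" "hrel F n v' y'"
  shows "hrel F n (v - v') (y - y')"
proof -
  obtain r where r: "is_roof r" "src r = X" "tgt r = Y" "F = roof_class r" using F by (auto simp: D_hom_iff)
  have b: "is_bcomplex (apex r)" "is_bcomplex X" "is_bcomplex Y" "den r \<in> chain_maps (apex r) X" "num r \<in> chain_maps (apex r) Y"
    using r by (auto simp: is_roof_def qi_cm)
  obtain z z' where z: "z \<in> cocycles (apex r) n" "den r n z - v \<in> coboundaries X n" "num r n z - y \<in> coboundaries Y n"
      "z' \<in> cocycles (apex r) n" "den r n z' - v' \<in> coboundaries X n" "num r n z' - y' \<in> coboundaries Y n"
    and vy: "v \<in> cocycles X n" "y \<in> cocycles Y n" "v' \<in> cocycles X n" "y' \<in> cocycles Y n"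
    using assms r by (auto simp: hrel_class roof_hrel_def)
  have "roof_hrel r n (v - v') (y - y')"
    unfolding roof_hrel_def
    using r z vy b coboundaries_diff[OF b(2) z(2,5)] coboundaries_diff[OF b(3) z(3,6)]
    by (intro conjI bexI[of _ "z - z'"])
      (auto simp: cocycles_diff cm_diff[OF b(1,2,4)] cm_diff[OF b(1,3,5)] cocycles_sp algebra_simps)
  then show ?thesis using r hrel_class by blast
qed

lemma hrel_act:
  assumes "hrel F n v y" "a \<in> carrier algA"
  shows "hrel F n (act (obj X n) v a) (act (obj Y n) y a)"
proof -
  obtain r where r: "is_roof r" "src r = X" "tgt r = Y" "F = roof_class r" using F by (auto simp: D_hom_iff)
  have b: "is_bcomplex (apex r)" "is_bcomplex X" "is_bcomplex Y" "den r \<in> chain_maps (apex r) X" "num r \<in> chain_maps (apex r) Y"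
    using r by (auto simp: is_roof_def qi_cm)
  obtain z where z: "z \<in> cocycles (apex r) n" "den r n z - v \<in> coboundaries X n" "num r n z - y \<in> coboundaries Y n"
    and vy: "v \<in> cocycles X n" "y \<in> cocycles Y n"
    using assms r by (auto simp: hrel_class roof_hrel_def)
  have "roof_hrel r n (act (obj X n) v a) (act (obj Y n) y a)"
    unfolding roof_hrel_def
    using r z vy b assms(2) coboundaries_act[OF b(2) z(2) assms(2)] coboundaries_act[OF b(3) z(3) assms(2)]
    by (intro conjI bexI[of _ "act (obj (apex r) n) z a"])
      (auto simp: cocycles_act cm_act[OF b(1,2,4)] cm_act[OF b(1,3,5)] cocycles_sp act_diff cm_closed[OF b(1,2,4)] cm_closed[OF b(1,3,5)])
  then show ?thesis using r hrel_class by blast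
qed

lemma hrel_coboundaries:
  assumes "hrel F n v y" "v \<in> coboundaries X n"
  shows "y \<in> coboundaries Y n"
proof -
  obtain r where r: "is_roof r" "src r = X" "tgt r = Y" "F = roof_class r" using F by (auto simp: D_hom_iff)
  have b: "is_bcomplex (apex r)" "is_bcomplex X" "is_bcomplex Y" "den r \<in> quasi_isos (apex r) X" "num r \<in> chain_maps (apex r) Y"
    using r by (auto simp: is_roof_def qi_cm)
  obtain z where z: "z \<in> cocycles (apex r) n" "den r n z - v \<in> coboundaries X n" "num r n z - y \<in> coboundaries Y n"
    using assms r by (auto simp: hrel_class roof_hrel_def)
  have "z \<in> coboundaries (apex r) n"
    using qi_inj[OF b(4) z(1)] coboundaries_add[OF b(2) z(2) assms(2)] by simp
  then have "num r n z \<in> coboundaries Y n" by (rule cm_coboundaries[OF b(1,3,5)])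
  then show ?thesis using coboundaries_diff[OF b(3) _ z(3)] by fastforce
qed

lemma hrel_unique:
  assumes "hrel F n v y" "hrel F n v' y'" "v - v' \<in> coboundaries X n"
  shows "y - y' \<in> coboundaries Y n"
  by (rule hrel_coboundaries[OF hrel_diff[OF assms(1,2)] assms(3)])

end

text \<open>The witnesses for F and G live on different apices. A cocycle t of W is chosen over the
  one for F; its image in the apex of s represents the same class as the witness for G, because
  \<open>den s\<close> is injective on cohomology.\<close>

lemma hrel_comp:
  assumes F: "F \<in> D_hom X Y" and G: "G \<in> D_hom Y V" and h: "hrel F n v y" "hrel G n y w"
  shows "hrel (D_comp G F) n v w"
proof -
  obtain r s W a b where rs: "is_roof r" "is_roof s" "src r = X" "tgt r = Y" "src s = Y" "tgt s = V"
    "F = roof_class r" "G = roof_class s"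
    and W: "qi W (apex r) a" "cm W (apex s) b" "ht W (tgt r) (num r \<circ>\<^sub>c a) (den s \<circ>\<^sub>c b)"
    and eq: "D_comp G F = roof_class \<lparr>src = X, tgt = V, apex = W, den = den r \<circ>\<^sub>c a, num = num s \<circ>\<^sub>c b\<rparr>"
    using D_comp_closed[OF F G] .
  have roof: "is_roof \<lparr>src = X, tgt = V, apex = W, den = den r \<circ>\<^sub>c a, num = num s \<circ>\<^sub>c b\<rparr>"
    using comp_roof[of r s W a b] rs W by simp
  have bc: "is_bcomplex (apex r)" "is_bcomplex (apex s)" "is_bcomplex X" "is_bcomplex Y" "is_bcomplex V" "is_bcomplex W"
    and r: "den r \<in> quasi_isos (apex r) X" "num r \<in> chain_maps (apex r) Y"
    and s: "den s \<in> quasi_isos (apex s) Y" "num s \<in> chain_maps (apex s) V"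
    and a: "a \<in> quasi_isos W (apex r)" and b: "b \<in> chain_maps W (apex s)"
    using rs W by (auto simp: is_roof_def qi_def cm_def)
  obtain z where z: "z \<in> cocycles (apex r) n" "den r n z - v \<in> coboundaries X n" "num r n z - y \<in> coboundaries Y n"
    and v: "v \<in> cocycles X n"
    using h(1) rs by (auto simp: hrel_class roof_hrel_def)
  obtain x where x: "x \<in> cocycles (apex s) n" "den s n x - y \<in> coboundaries Y n" "num s n x - w \<in> coboundaries V n"
    and w: "w \<in> cocycles V n"
    using h(2) rs by (auto simp: hrel_class roof_hrel_def)
  obtain t where t: "t \<in> cocycles W n" "z - a n t \<in> coboundaries (apex r) n" using qi_surj[OF a z(1)] .
  have at: "a n t \<in> cocycles (apex r) n" "b n t \<in> cocycles (apex s) n"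
    using cm_cocycles[OF bc(6,1) qi_cm[OF a] t(1)] cm_cocycles[OF bc(6,2) b t(1)] by auto
  have 1: "den r n z - den r n (a n t) \<in> coboundaries X n"
    using cm_coboundaries[OF bc(1,3) qi_cm[OF r(1)] t(2)] z at
    by (simp add: cm_diff[OF bc(1,3) qi_cm[OF r(1)]] cocycles_sp bc)
  have 2: "num r n z - num r n (a n t) \<in> coboundaries Y n"
    using cm_coboundaries[OF bc(1,4) r(2) t(2)] z at
    by (simp add: cm_diff[OF bc(1,4) r(2)] cocycles_sp bc)
  have 3: "num r n (a n t) - den s n (b n t) \<in> coboundaries Y n"
    using homotopic_cocycles[OF bc(6,4) _ t(1)] W(3) rs by (fastforce simp: ht_def ccomp_def)
  have "den s n (x - b n t) \<in> coboundaries Y n"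
    using coboundaries_add[OF bc(4) coboundaries_diff[OF bc(4) x(2) z(3)] coboundaries_add[OF bc(4) 2 3]] x at
    by (simp add: cm_diff[OF bc(2,4) qi_cm[OF s(1)]] cocycles_sp bc)
  then have "x - b n t \<in> coboundaries (apex s) n"
    by (rule qi_inj[OF s(1) cocycles_diff[OF bc(2) x(1) at(2)]])
  then have 4: "num s n x - num s n (b n t) \<in> coboundaries V n"
    using cm_coboundaries[OF bc(2,5) s(2)] x at cm_diff[OF bc(2,5) s(2)] by (fastforce simp: cocycles_sp bc)
  have "den r n (a n t) - v \<in> coboundaries X n" "num s n (b n t) - w \<in> coboundaries V n"
    using coboundaries_diff[OF bc(3) z(2) 1] coboundaries_diff[OF bc(5) x(3) 4] by auto
  then show ?thesis
    unfolding eq hrel_class[OF roof] roof_hrel_def using v w t by (auto simp: ccomp_def intro!: bexI[of _ t])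
qed

lemma hrel_plus:
  assumes F: "F \<in> D_hom X Y" and G: "G \<in> D_hom X Y" and h: "hrel F n v y" "hrel G n v y'"
  shows "hrel (D_plus F G) n v (y + y')"
proof -
  obtain r s where rs: "is_roof r" "is_roof s" "src r = X" "tgt r = Y" "src s = X" "tgt s = Y"
    "apex r = apex s" "den r = den s" "F = roof_class r" "G = roof_class s"
    using D_hom_common_den[OF F G] .
  have bc: "is_bcomplex (apex r)" "is_bcomplex X" "is_bcomplex Y"
    and r: "den r \<in> quasi_isos (apex r) X" "num r \<in> chain_maps (apex r) Y" "num s \<in> chain_maps (apex r) Y"
    using rs by (auto simp: is_roof_def)
  obtain z where z: "z \<in> cocycles (apex r) n" "den r n z - v \<in> coboundaries X n" "num r n z - y \<in> coboundaries Y n"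
    and vy: "v \<in> cocycles X n" "y \<in> cocycles Y n"
    using h(1) rs by (auto simp: hrel_class roof_hrel_def)
  obtain x where x: "x \<in> cocycles (apex r) n" "den r n x - v \<in> coboundaries X n" "num s n x - y' \<in> coboundaries Y n"
    and y': "y' \<in> cocycles Y n"
    using h(2) rs by (auto simp: hrel_class roof_hrel_def)
  have "den r n (x - z) \<in> coboundaries X n"
    using coboundaries_diff[OF bc(2) x(2) z(2)] x z by (simp add: cm_diff[OF bc(1,2) qi_cm[OF r(1)]] cocycles_sp bc)
  then have "x - z \<in> coboundaries (apex r) n"
    by (rule qi_inj[OF r(1) cocycles_diff[OF bc(1) x(1) z(1)]])
  then have "num s n x - num s n z \<in> coboundaries Y n"
    using cm_coboundaries[OF bc(1,3) r(3)] x z cm_diff[OF bc(1,3) r(3)] by (fastforce simp: cocycles_sp bc)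
  then have "num s n z - y' \<in> coboundaries Y n"
    using coboundaries_diff[OF bc(3) x(3)] by fastforce
  then have *: "(num r n z + num s n z) - (y + y') \<in> coboundaries Y n"
    using coboundaries_add[OF bc(3) z(3)] by (fastforce simp: algebra_simps)
  have roof: "is_roof (r\<lparr>num := \<lambda>n v. num r n v + num s n v\<rparr>)"
    using plus_roof[OF rs(1,2)] rs by simp
  have "D_plus F G = roof_class (r\<lparr>num := \<lambda>n v. num r n v + num s n v\<rparr>)"
    using D_plus_class[OF rs(1,2)] rs by simp
  then show ?thesis
    unfolding roof_hrel_def hrel_def[symmetric]
    using hrel_class[OF roof, of n v "y + y'"] * z vy y' rs cocycles_add[OF bc(3)]
    by (auto simp: roof_hrel_def intro!: bexI[of _ z])
qed

text \<open>An even shift does not change the sign of the differentials, so a homotopy shifts to a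
  homotopy without correction.\<close>

lemma shift_roof_rel:
  assumes i: "even i" and rs: "(r, s) \<in> roof_rel"
  shows "(shift_roof i r, shift_roof i s) \<in> roof_rel"
proof -
  have cmi: "cm (shift i X) (shift i Y) (\<lambda>n. f (n + i))" if "cm X Y f" for X Y :: "'a complx" and f
    using that by (auto simp: cm_def shift_bc shift_cm)
  have qii: "qi (shift i X) (shift i Y) (\<lambda>n. f (n + i))" if "qi X Y f" for X Y :: "'a complx" and f
    using that by (auto simp: qi_def shift_bc shift_qi)
  have hti: "ht (shift i X) (shift i Y) (\<lambda>n. f (n + i)) (\<lambda>n. g (n + i))" if "ht X Y f g" for X Y :: "'a complx" and f g
  proof -
    have "homotopic X Y f g" using that by (simp add: ht_def)
    then obtain h where h: "\<And>n. h n \<in> rmod_hom (obj X n) (obj Y (n - 1))"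
      "\<And>n v. f n v - g n v = dif Y (n - 1) (h n v) + h (n + 1) (dif X n v)"
      by (rule homotopicE) blast
    have "homotopic (shift i X) (shift i Y) (\<lambda>n. f (n + i)) (\<lambda>n. g (n + i))"
    proof (rule homotopicI[where h = "\<lambda>n. h (n + i)"])
      show "h (n + i) \<in> rmod_hom (obj (shift i X) n) (obj (shift i Y) (n - 1))" for n
        using h(1)[of "n + i"] by (simp add: algebra_simps)
      show "f (n + i) v - g (n + i) v = dif (shift i Y) (n - 1) (h (n + i) v) + h (n + 1 + i) (dif (shift i X) n v)" for n v
        using h(2)[of "n + i" v] i by (simp add: algebra_simps)
    qed
    then show ?thesis using that cmi by (auto simp: ht_def)
  qed
  obtain W a b where W: "qi W (apex r) a" "cm W (apex s) b"
      "ht W (src r) (den r \<circ>\<^sub>c a) (den s \<circ>\<^sub>c b)" "ht W (tgt r) (num r \<circ>\<^sub>c a) (num s \<circ>\<^sub>c b)"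
    and roofs: "is_roof r" "is_roof s" "src r = src s" "tgt r = tgt s"
    using rs unfolding roof_rel_iff by metis
  show ?thesis
    by (rule roof_relI[of _ _ "shift i W" "\<lambda>n. a (n + i)" "\<lambda>n. b (n + i)"])
      (use roofs qii[OF W(1)] cmi[OF W(2)] hti[OF W(3)] hti[OF W(4)] qii cmi in
        \<open>auto simp: shift_roof_def is_roof_iff ccomp_def\<close>)
qed

lemma shift_roof_inverse: "shift_roof i (shift_roof (- i) r) = r" "shift_roof (- i) (shift_roof i r) = r"
  by (simp_all add: shift_roof_def)

text \<open>The image of a class is a full class because shifting by -i is inverse to shifting by i
  on roofs and also respects equivalence.\<close>

lemma shift_mor_class:
  assumes "even i"
  shows "shift_mor i (roof_class r) = roof_class (shift_roof i r)"
proof (intro equalityI subsetI)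
  fix t assume "t \<in> shift_mor i (roof_class r)"
  then show "t \<in> roof_class (shift_roof i r)"
    using shift_roof_rel[OF assms] by (auto simp: shift_mor_def mem_roof_class)
next
  fix t assume "t \<in> roof_class (shift_roof i r)"
  then have "(shift_roof (- i) (shift_roof i r), shift_roof (- i) t) \<in> roof_rel"
    using assms by (intro shift_roof_rel) (auto simp: mem_roof_class)
  then show "t \<in> shift_mor i (roof_class r)"
    unfolding shift_mor_def mem_roof_class[symmetric] shift_roof_inverse
    by (intro image_eqI[of _ _ "shift_roof (- i) t"]) (auto simp: shift_roof_inverse)
qed

lemma shift_mor_hom:
  assumes i: "even i" and F: "F \<in> D_hom X Y"
  shows "shift_mor i F \<in> D_hom (shift i X) (shift i Y)"
    and "hrel (shift_mor i F) n v y \<longleftrightarrow> hrel F (n + i) v y"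
proof -
  obtain r where r: "is_roof r" "src r = X" "tgt r = Y" "F = roof_class r" using F by (auto simp: D_hom_iff)
  have roof: "is_roof (shift_roof i r)"
    using shift_roof_rel[OF i roof_rel_refl[OF r(1)]] by (simp add: roof_rel_iff)
  show "shift_mor i F \<in> D_hom (shift i X) (shift i Y)"
    unfolding r(4) shift_mor_class[OF i] D_hom_iff using roof r
    by (intro exI[of _ "shift_roof i r"]) (auto simp: shift_roof_def)
  show "hrel (shift_mor i F) n v y \<longleftrightarrow> hrel F (n + i) v y"
    unfolding r(4) shift_mor_class[OF i] hrel_class[OF roof] hrel_class[OF r(1)]
    using r by (auto simp: roof_hrel_def shift_roof_def shift_coboundaries is_roof_def)
qed

section \<open>Truncated projective resolutions and the morphisms out of them\<close>

section \<open>Interval complexes\<close>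

lemma proj_space: "v \<in> space (proj_rmod a) \<longleftrightarrow> (if a = 5 then \<forall>n\<ge>1. v n = 0 else \<forall>n\<ge>2. v n = 0)"
  by (simp add: proj_rmod_def simple_space uniserial_space)

lemma proj_basis:
  assumes "v \<in> space (proj_rmod a)"
  shows "v = vscale (v 0) (unit_vec 0) + vscale (v 1) (unit_vec 1)"
proof
  fix n
  show "v n = (vscale (v 0) (unit_vec 0) + vscale (v 1) (unit_vec 1)) n"
    using assms by (cases n; cases "n - 1") (auto simp: proj_space unit_vec_def split: if_splits)
qed

lemma proj_act_eA:
  assumes "v \<in> space (proj_rmod a)"
  shows "act (proj_rmod a) v (eA j) = (if j = a then vscale (v 0) (unit_vec 0)
    else if j = Suc a then vscale (v 1) (unit_vec 1) else 0)"
proof (cases "a = 5")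
  case True
  then have "v 1 = 0" "v = vscale (v 0) (unit_vec 0)"
    using assms proj_basis[OF assms] by (auto simp: proj_space)
  then show ?thesis using True by (simp add: proj_rmod_def simple_act_eA)
next
  case False
  then show ?thesis by (simp add: proj_rmod_def uniserial_act_eA)
qed

lemma proj_act_xA:
  assumes "1 \<le> a" "a \<le> 5"
  shows "act (proj_rmod a) v (xA j) = (if j = a \<and> a \<noteq> 5 then vscale (v 0) (unit_vec 1) else 0)"
  using assms by (simp add: proj_rmod_def uniserial_act_xA simple_act_xA)

lemma unit0_proj [simp]: "unit_vec 0 \<in> space (proj_rmod a)"
  by (auto simp: proj_space unit_vec_def)

lemma unit1_proj: "a \<noteq> 5 \<Longrightarrow> unit_vec (Suc 0) \<in> space (proj_rmod a)"
  by (auto simp: proj_space unit_vec_def)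

text \<open>The A-linear map P_a -> N that sends the top to u; the socle then goes to u x_a.
  Together with \<open>pmap_unique\<close> this is Hom(P_a, N) = N e_a.\<close>

definition pmap :: "'k::field rmod \<Rightarrow> nat \<Rightarrow> 'k vec \<Rightarrow> 'k vec \<Rightarrow> 'k vec" where
  "pmap N a u = (\<lambda>v. if v \<in> space (proj_rmod a) then vscale (v 0) u + vscale (v 1) (act N u (xA a)) else 0)"

lemma pmap_hom:
  assumes N: "is_rmod N" and a: "1 \<le> a" "a \<le> 5" and u: "u \<in> space N" "act N u (eA a) = u"
  shows "pmap N a u \<in> rmod_hom (proj_rmod a) N"
proof (rule rmod_homI[OF proj_is_rmod[OF a] N])
  note P = proj_is_rmod[OF a]
  note m = rmod_add[OF N] rmod_scale[OF N] act_closed[OF N] u act_add[OF N] act_scale[OF N]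
    rmod_add[OF P] rmod_scale[OF P] act_closed[OF P]
  show "pmap N a u v \<in> space N" for v by (simp add: pmap_def m rmod_zero[OF N])
  show "pmap N a u (v + w) = pmap N a u v + pmap N a u w"
    if "v \<in> space (proj_rmod a)" "w \<in> space (proj_rmod a)" for v w
    using that by (simp add: pmap_def m vec.scale_left_distrib)
  show "pmap N a u (vscale c v) = vscale c (pmap N a u v)" if "v \<in> space (proj_rmod a)" for v c
    using that by (simp add: pmap_def m vec.scale_right_distrib)
  show "pmap N a u (act (proj_rmod a) v (eA i)) = act N (pmap N a u v) (eA i)"
    if v: "v \<in> space (proj_rmod a)" and i: "1 \<le> i" "i \<le> 5" for v i
  proof -
    have 1: "act N u (eA i) = (if i = a then u else 0)"
      using act_eA_eA[OF N u(1) a i] u by auto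
    have 2: "act N (act N u (xA a)) (eA i) = (if i = Suc a then act N u (xA a) else 0)"
      using act_xA_eA[OF N u(1) i] by simp
    have v1: "a = 5 \<Longrightarrow> v (Suc 0) = 0" using v by (auto simp: proj_space)
    have "act (proj_rmod a) v (eA i) \<in> space (proj_rmod a)" using v i by (simp add: m eA_carrier)
    then show ?thesis
      using v i v1 by (auto simp: pmap_def m 1 2 eA_carrier proj_act_eA[OF v])
  qed
  show "pmap N a u (act (proj_rmod a) v (xA i)) = act N (pmap N a u v) (xA i)"
    if v: "v \<in> space (proj_rmod a)" and i: "1 \<le> i" "i \<le> 4" for v i
  proof -
    have 1: "act N u (xA i) = (if i = a then act N u (xA a) else 0)"
      using act_eA_xA[OF N u(1) a, of i] u by auto
    have 2: "act N (act N u (xA a)) (xA i) = 0" by (rule act_xA_xA[OF N u(1)])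
    have "act (proj_rmod a) v (xA i) \<in> space (proj_rmod a)" using v i by (simp add: m)
    then show ?thesis
      using v i by (auto simp: pmap_def m 1 2 proj_act_xA[OF a])
  qed
qed (simp add: pmap_def)

lemma pmap_unique:
  assumes N: "is_rmod N" and a: "1 \<le> a" "a \<le> 5" and f: "f \<in> rmod_hom (proj_rmod a) N"
  shows "f = pmap N a (f (unit_vec 0))" "f (unit_vec 0) \<in> space N"
    "act N (f (unit_vec 0)) (eA a) = f (unit_vec 0)"
proof -
  note P = proj_is_rmod[OF a]
  show "f (unit_vec 0) \<in> space N" by (rule hom_space[OF P N f])
  show "act N (f (unit_vec 0)) (eA a) = f (unit_vec 0)"
    using hom_act[OF P N f unit0_proj eA_carrier[OF a]] by (simp add: proj_act_eA)
  have x: "a \<noteq> 5 \<Longrightarrow> f (unit_vec 1) = act N (f (unit_vec 0)) (xA a)"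
    using hom_act[OF P N f unit0_proj xA_carrier, of a] by (simp add: proj_act_xA[OF a])
  show "f = pmap N a (f (unit_vec 0))"
  proof
    fix v show "f v = pmap N a (f (unit_vec 0)) v"
    proof (cases "v \<in> space (proj_rmod a)")
      case True
      have v: "v = vscale (v 0) (unit_vec 0) + vscale (v 1) (unit_vec 1)" by (rule proj_basis[OF True])
      show ?thesis
      proof (cases "a = 5")
        case a5: True
        then have "v 1 = 0" using True by (auto simp: proj_space)
        then have "f v = vscale (v 0) (f (unit_vec 0))"
          using v hom_scale[OF P N f unit0_proj, of "v 0"] by simp
        then show ?thesis using True \<open>v 1 = 0\<close> by (simp add: pmap_def)
      next
        case False
        have "f v = vscale (v 0) (f (unit_vec 0)) + vscale (v 1) (f (unit_vec 1))"
          using v hom_add[OF P N f rmod_scale[OF P unit0_proj] rmod_scale[OF P unit1_proj[OF False]], of "v 0" "v 1"]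
          by (simp add: hom_scale[OF P N f] unit1_proj False)
        then show ?thesis using True x[OF False] by (simp add: pmap_def)
      qed
    qed (simp add: pmap_def hom_out[OF P N f])
  qed
qed

text \<open>\<open>Icx i m\<close> is \<open>P\<^sub>m \<rightarrow> \<dots> \<rightarrow> P\<^sub>i\<close> with \<open>P\<^sub>i\<close> in degree \<open>0\<close>; for \<open>m = 5\<close> it resolves \<open>S\<^sub>i\<close>.\<close>

definition Icx :: "nat \<Rightarrow> nat \<Rightarrow> 'k::field complx" where
  "Icx i m = \<lparr>obj = \<lambda>n. if n \<le> 0 \<and> int i - n \<le> int m then proj_rmod (nat (int i - n)) else zero_rmod,
     dif = \<lambda>n v. if n < 0 \<and> int i - n \<le> int m \<and> v \<in> space (proj_rmod (nat (int i - n)))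
       then vscale (v 0) (unit_vec 1) else 0\<rparr>"

text \<open>Degree n of \<open>Icx i m\<close> is P_a with a = i - n. The parameter d is the amount
  by which the maps lower the degree: 0 for chain maps, 1 for homotopies.\<close>

definition imap :: "'k::field complx \<Rightarrow> nat \<Rightarrow> nat \<Rightarrow> (nat \<Rightarrow> 'k vec) \<Rightarrow> int \<Rightarrow> 'k cmap" where
  "imap Y i m w d = (\<lambda>n. if n \<le> 0 \<and> int i - n \<le> int m
     then pmap (obj Y (n - d)) (nat (int i - n)) (w (nat (int i - n))) else (\<lambda>v. 0))"

lemma Icx_cases:
  fixes i m :: nat and n :: int
  obtains (zero) "\<not> (n \<le> 0 \<and> int i - n \<le> int m)"
    | (proj) a where "i \<le> a" "a \<le> m" "n = int i - int a"
proof (cases "n \<le> 0 \<and> int i - n \<le> int m")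
  case True
  then show ?thesis by (intro proj[of "nat (int i - n)"]) auto
qed (rule zero)

lemma Icx_zero:
  assumes "\<not> (n \<le> 0 \<and> int i - n \<le> int m)"
  shows "obj (Icx i m) n = zero_rmod" "dif (Icx i m) n v = 0" "imap Y i m w d n v = 0"
  using assms by (auto simp: Icx_def imap_def)

lemma Icx_obj: "\<lbrakk>i \<le> a; a \<le> m\<rbrakk> \<Longrightarrow> obj (Icx i m) (int i - int a) = proj_rmod a"
  by (simp add: Icx_def)

lemma Icx_obj0: "i \<le> m \<Longrightarrow> obj (Icx i m) 0 = proj_rmod i"
  by (simp add: Icx_def)

lemma Icx_dif: "\<lbrakk>i < a; a \<le> m; v \<in> space (proj_rmod a)\<rbrakk> \<Longrightarrow>
    dif (Icx i m) (int i - int a) v = vscale (v 0) (unit_vec 1)"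
  by (simp add: Icx_def)

lemma Icx_dif_last: "dif (Icx i m) 0 v = 0"
  by (simp add: Icx_def)

lemma imap_apply: "\<lbrakk>i \<le> a; a \<le> m\<rbrakk> \<Longrightarrow> imap Y i m w d (int i - int a) = pmap (obj Y (int i - int a - d)) a (w a)"
  by (simp add: imap_def)

text \<open>The families that define chain maps out of \<open>Icx i m\<close>: \<open>w a\<close> is the image of the top of \<open>P\<^sub>a\<close>.\<close>

definition fam :: "'k::field complx \<Rightarrow> nat \<Rightarrow> nat \<Rightarrow> (nat \<Rightarrow> 'k vec) \<Rightarrow> bool" where
  "fam Y i m w \<longleftrightarrow> (\<forall>a. i \<le> a \<and> a \<le> m \<longrightarrow> w a \<in> sp Y (int i - int a) \<and>
     act (obj Y (int i - int a)) (w a) (eA a) = w a \<and>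
     dif Y (int i - int a) (w a) = (if a = i then 0 else act (obj Y (int i - int (a - 1))) (w (a - 1)) (xA (a - 1))))"

context
  fixes i m :: nat
  assumes im: "1 \<le> i" "i \<le> m" "m \<le> 5"
begin

lemma Icx_bc: "is_bcomplex (Icx i m :: 'k::field complx)"
proof (rule is_bcomplexI)
  show ob: "is_rmod (obj (Icx i m :: 'k complx) n)" for n
    by (cases rule: Icx_cases[where i = i and m = m and n = n]) (use im in \<open>auto simp: zero_is_rmod Icx_obj proj_is_rmod Icx_zero\<close>)
  show "dif (Icx i m :: 'k complx) n \<in> rmod_hom (obj (Icx i m) n) (obj (Icx i m) (n + 1))" for n
  proof (cases rule: Icx_cases[where i = i and m = m and n = n])
    case zero
    then have "dif (Icx i m :: 'k complx) n = (\<lambda>v. 0)" by (auto simp: Icx_zero)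
    then show ?thesis using rmod_hom_zero[OF ob] by simp
  next
    case (proj a)
    show ?thesis
    proof (cases "a = i")
      case True
      then have "dif (Icx i m :: 'k complx) n = (\<lambda>v. 0)" using proj by (auto simp: Icx_dif_last)
      then show ?thesis using rmod_hom_zero[OF ob] by simp
    next
      case False
      then have a: "i < a" "a \<le> m" "1 \<le> a" "a \<le> 5" "1 \<le> a - 1" "a - 1 \<le> 5" "a - 1 \<noteq> 5" "Suc (a - 1) = a"
        using proj im by auto
      have n: "n + 1 = int i - int (a - 1)" using a proj by simp
      have ob': "obj (Icx i m) n = (proj_rmod a :: 'k rmod)" "obj (Icx i m) (n + 1) = (proj_rmod (a - 1) :: 'k rmod)"
        unfolding n using proj a by (simp add: Icx_obj, intro Icx_obj, auto)
      have d: "dif (Icx i m :: 'k complx) n v = (if v \<in> space (proj_rmod a) then vscale (v 0) (unit_vec 1) else 0)" for v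
        using proj a by (simp add: Icx_def)
      have P: "is_rmod (proj_rmod a :: 'k rmod)" "is_rmod (proj_rmod (a - 1) :: 'k rmod)"
        using a proj_is_rmod by blast+
      note P' = rmod_add[OF P(1)] rmod_scale[OF P(1)] rmod_scale[OF P(2)] act_closed[OF P(1)] unit1_proj[OF a(7)]
      show ?thesis unfolding ob'
      proof (rule rmod_homI[OF P])
        show "dif (Icx i m) n (act (proj_rmod a) v (eA j)) = act (proj_rmod (a - 1)) (dif (Icx i m) n v) (eA j)"
          if "v \<in> space (proj_rmod a)" "1 \<le> j" "j \<le> 5" for v :: "'k vec" and j
        proof -
          have sc: "vscale c (unit_vec 1) \<in> space (proj_rmod (a - 1) :: 'k rmod)" for c
            using P'(3,5) by simp
          have "act (proj_rmod (a - 1)) (vscale (v 0) (unit_vec 1)) (eA j) = (if j = a then vscale (v 0) (unit_vec 1) else 0)"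
            unfolding proj_act_eA[OF sc] using a by auto
          then show ?thesis
            using that P'(4)[OF that(1) eA_carrier[OF that(2,3)]]
            by (simp add: d proj_act_eA[OF that(1)])
        qed
        show "dif (Icx i m) n (act (proj_rmod a) v (xA j)) = act (proj_rmod (a - 1)) (dif (Icx i m) n v) (xA j)"
          if "v \<in> space (proj_rmod a)" "1 \<le> j" "j \<le> 4" for v :: "'k vec" and j
          using that P'(4)[OF that(1) xA_carrier, of j] a
          by (simp add: d P' proj_act_xA)
        show "dif (Icx i m) n v \<in> space (proj_rmod (a - 1))" for v :: "'k vec"
          using rmod_zero[OF P(2)] rmod_scale[OF P(2) unit1_proj[OF a(7)], of "v 0"] by (simp add: d)
      qed (auto simp: d P' rmod_zero[OF P(2)] vec.scale_left_distrib)
    qed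
  qed
  show "dif (Icx i m :: 'k complx) (n + 1) (dif (Icx i m) n v) = 0" for n v
    by (simp add: Icx_def)
  have "{n. sp (Icx i m :: 'k complx) n \<noteq> {0}} \<subseteq> {int i - int m..0}"
    by (auto simp: Icx_def split: if_splits)
  then show "finite {n. sp (Icx i m :: 'k complx) n \<noteq> {0}}" by (rule finite_subset) simp
qed

lemma imap_hom:
  assumes Y: "is_bcomplex Y"
    and w: "\<And>a. i \<le> a \<Longrightarrow> a \<le> m \<Longrightarrow> w a \<in> sp Y (int i - int a - d) \<and> act (obj Y (int i - int a - d)) (w a) (eA a) = w a"
  shows "imap Y i m w d n \<in> rmod_hom (obj (Icx i m) n) (obj Y (n - d))"
proof (cases rule: Icx_cases[where i = i and m = m and n = n])
  case zero
  then show ?thesis by (auto simp: imap_def rmod_hom_zero Y)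
next
  case (proj a)
  then show ?thesis using w[of a] im Y by (auto simp: imap_apply Icx_obj intro!: pmap_hom)
qed

lemma imap_cm:
  assumes Y: "is_bcomplex Y" and w: "fam Y i m w"
  shows "cm (Icx i m) Y (imap Y i m w 0)"
proof -
  have wa: "w a \<in> sp Y (int i - int a)" "act (obj Y (int i - int a)) (w a) (eA a) = w a"
    "dif Y (int i - int a) (w a) = (if a = i then 0 else act (obj Y (int i - int (a - 1))) (w (a - 1)) (xA (a - 1)))"
    if "i \<le> a" "a \<le> m" for a using w that unfolding fam_def by blast+
  have "imap Y i m w 0 \<in> chain_maps (Icx i m) Y"
  proof (rule chain_mapsI)
    show hom: "imap Y i m w 0 n \<in> rmod_hom (obj (Icx i m) n) (obj Y n)" for n
      using imap_hom[OF Y, of w 0 n] wa by simp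
    show "dif Y n (imap Y i m w 0 n v) = imap Y i m w 0 (n + 1) (dif (Icx i m) n v)" for n v
    proof (cases "v \<in> sp (Icx i m) n")
      case False
      then have "imap Y i m w 0 n v = 0" "dif (Icx i m) n v = 0"
        using hom_out[OF bc_mod[OF Icx_bc] bc_mod[OF Y] hom] dif_out[OF Icx_bc] by auto
      then show ?thesis using hom_zero[OF bc_mod[OF Icx_bc] bc_mod[OF Y] hom] Y by simp
    next
      case True
      show ?thesis
      proof (cases rule: Icx_cases[where i = i and m = m and n = n])
        case zero
        then show ?thesis using hom_zero[OF bc_mod[OF Icx_bc] bc_mod[OF Y] hom] Y by (simp add: Icx_zero)
      next
        case (proj a)
        have v: "v \<in> space (proj_rmod a)" using True proj by (simp add: Icx_obj)
        \<comment> \<open>The socle of P_a goes to w_a x_a and has zero differential in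
          \<open>Icx i m\<close>. Compatibility there says d(w_a) x_a = 0, which holds because
          d(w_a) = w_(a-1) x_(a-1) and products of arrows vanish.\<close>
        have wx: "act (obj Y (int i - int a + 1)) (dif Y (int i - int a) (w a)) (xA a) = 0"
        proof (cases "a = i")
          case True
          then show ?thesis using wa(3)[OF proj(1,2)] Y by (simp add: act_zero)
        next
          case False
          then have "int i - int a + 1 = int i - int (a - 1)" using proj by simp
          moreover have "w (a - 1) \<in> sp Y (int i - int (a - 1))" using wa(1)[of "a - 1"] proj False by simp
          ultimately show ?thesis
            using wa(3)[OF proj(1,2)] False by (simp only: act_xA_xA[OF bc_mod[OF Y]] if_False)
        qed
        have L: "dif Y n (imap Y i m w 0 n v) = vscale (v 0) (dif Y (int i - int a) (w a))"
          using proj v wx wa(1)[OF proj(1,2)]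
          by (simp add: imap_apply pmap_def dif_add[OF Y] dif_scale[OF Y] dif_act[OF Y]
            rmod_scale[OF bc_mod[OF Y]] act_closed[OF bc_mod[OF Y]])
        show ?thesis
        proof (cases "a = i")
          case True
          then show ?thesis
            using L wa(3)[OF proj(1,2)] proj hom_zero[OF bc_mod[OF Icx_bc] bc_mod[OF Y] hom]
            by (simp add: Icx_dif_last)
        next
          case False
          then have a: "i < a" "i \<le> a - 1" "a - 1 \<le> m" "a - 1 \<noteq> 5" using proj im by auto
          have n: "n + 1 = int i - int (a - 1)" using a proj by simp
          have d: "dif (Icx i m) n v = vscale (v 0) (unit_vec 1)" using proj a v by (simp add: Icx_dif)
          have "vscale (v 0) (unit_vec 1) \<in> space (proj_rmod (a - 1))"
            using a im proj by (intro rmod_scale[OF proj_is_rmod]) (auto simp: unit1_proj)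
          then have "imap Y i m w 0 (n + 1) (dif (Icx i m) n v) =
              vscale (v 0) (act (obj Y (int i - int (a - 1))) (w (a - 1)) (xA (a - 1)))"
            unfolding n d using imap_apply[OF a(2,3), of Y w 0] by (simp add: pmap_def)
          then show ?thesis using L wa(3)[OF proj(1,2)] False by simp
        qed
      qed
    qed
  qed
  then show ?thesis using Y Icx_bc by (simp add: cm_def)
qed

lemma imap_top:
  "\<lbrakk>i \<le> a; a \<le> m\<rbrakk> \<Longrightarrow> imap Y i m w 0 (int i - int a) (unit_vec 0) = w a"
  by (simp add: imap_apply pmap_def)

lemma cm_Icx_imap:
  assumes f: "cm (Icx i m) Y f"
  defines "w \<equiv> \<lambda>a. f (int i - int a) (unit_vec 0)"
  shows "fam Y i m w" "f = imap Y i m w 0"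
proof -
  have Y: "is_bcomplex Y" and fc: "f \<in> chain_maps (Icx i m) Y" using f by (auto simp: cm_def)
  note hom = cm_hom[OF Icx_bc Y fc]
  have P: "f (int i - int a) \<in> rmod_hom (proj_rmod a) (obj Y (int i - int a))" if "i \<le> a" "a \<le> m" for a
    using hom[of "int i - int a"] that by (simp add: Icx_obj)
  show "fam Y i m w"
    unfolding fam_def
  proof (intro allI impI, elim conjE)
    fix a assume a: "i \<le> a" "a \<le> m"
    then have a5: "1 \<le> a" "a \<le> 5" using im by auto
    note u = pmap_unique[OF bc_mod[OF Y] a5 P[OF a], folded w_def]
    have d: "dif Y (int i - int a) (w a) = f (int i - int a + 1) (dif (Icx i m) (int i - int a) (unit_vec 0))"
      unfolding w_def by (rule cm_dif[OF Icx_bc Y fc])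
    have "dif Y (int i - int a) (w a) = (if a = i then 0 else act (obj Y (int i - int (a - 1))) (w (a - 1)) (xA (a - 1)))"
    proof (cases "a = i")
      case True
      then show ?thesis using d cm_zero[OF Icx_bc Y fc] by (simp add: Icx_dif_last)
    next
      case False
      then have a': "i < a" "i \<le> a - 1" "a - 1 \<le> m" "a - 1 \<noteq> 5" "1 \<le> a - 1" "a - 1 \<le> 5" using a im by auto
      have n: "int i - int a + 1 = int i - int (a - 1)" using a' by simp
      have "dif Y (int i - int a) (w a) = f (int i - int (a - 1)) (unit_vec 1)"
        using d a a' unfolding n by (simp add: Icx_dif)
      also have "\<dots> = pmap (obj Y (int i - int (a - 1))) (a - 1) (w (a - 1)) (unit_vec 1)"
        using pmap_unique(1)[OF bc_mod[OF Y] a'(5,6) P[OF a'(2,3)]] unfolding w_def by (rule fun_cong)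
      finally show ?thesis using a' False by (simp add: pmap_def unit1_proj)
    qed
    then show "w a \<in> sp Y (int i - int a) \<and> act (obj Y (int i - int a)) (w a) (eA a) = w a \<and>
      dif Y (int i - int a) (w a) = (if a = i then 0 else act (obj Y (int i - int (a - 1))) (w (a - 1)) (xA (a - 1)))"
      using u unfolding w_def by blast
  qed
  show "f = imap Y i m w 0"
  proof
    fix n
    show "f n = imap Y i m w 0 n"
    proof (cases rule: Icx_cases[where i = i and m = m and n = n])
      case zero
      have "f n v = 0" for v
        using cm_out[OF Icx_bc Y fc, of v n] cm_zero[OF Icx_bc Y fc, of n] zero
        by (cases "v = 0") (auto simp: Icx_zero)
      then show ?thesis using zero by (auto simp: Icx_zero)
    next
      case (proj a)
      then show ?thesis
        using pmap_unique(1)[OF bc_mod[OF Y] _ _ P[OF proj(1,2)]] im by (simp add: imap_apply w_def)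
    qed
  qed
qed

text \<open>The elements k_a are the images of the tops under a homotopy, and the hypothesis is the
  homotopy equation on tops: the differential of the top of P_a is the socle of P_(a-1), which goes
  to k_(a-1) x_(a-1).\<close>

lemma imap_null:
  assumes Y: "is_bcomplex Y" and w: "fam Y i m w"
    and k: "\<And>a. i \<le> a \<Longrightarrow> a \<le> m \<Longrightarrow> k a \<in> sp Y (int i - int a - 1) \<and>
      act (obj Y (int i - int a - 1)) (k a) (eA a) = k a \<and>
      w a = dif Y (int i - int a - 1) (k a) + (if a = i then 0 else act (obj Y (int i - int (a - 1) - 1)) (k (a - 1)) (xA (a - 1)))"
  shows "ht (Icx i m) Y (imap Y i m w 0) (\<lambda>n v. 0)"
proof -
  have hom: "imap Y i m k 1 n \<in> rmod_hom (obj (Icx i m) n) (obj Y (n - 1))" for n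
    using imap_hom[OF Y, of k 1 n] k by simp
  note c = imap_cm[OF Y w]
  have "homotopic (Icx i m) Y (imap Y i m w 0) (\<lambda>n v. 0)"
  proof (rule homotopicI[where h = "imap Y i m k 1", OF hom])
    fix n v
    have hz: "imap Y i m k 1 n 0 = 0" for n
      by (rule hom_zero[OF bc_mod[OF Icx_bc] bc_mod[OF Y] hom])
    show "imap Y i m w 0 n v - 0 = dif Y (n - 1) (imap Y i m k 1 n v) + imap Y i m k 1 (n + 1) (dif (Icx i m) n v)"
    proof (cases "v \<in> sp (Icx i m) n")
      case False
      then have "imap Y i m w 0 n v = 0" "dif (Icx i m) n v = 0" "imap Y i m k 1 n v = 0"
        using cm_out[OF Icx_bc Y, of "imap Y i m w 0"] c hom_out[OF bc_mod[OF Icx_bc] bc_mod[OF Y] hom] dif_out[OF Icx_bc]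
        by (auto simp: cm_def)
      then show ?thesis using hz Y by simp
    next
      case True
      show ?thesis
      proof (cases rule: Icx_cases[where i = i and m = m and n = n])
        case zero
        then show ?thesis using Y hz by (simp add: Icx_zero)
      next
        case (proj a)
        have v: "v \<in> space (proj_rmod a)" using True proj by (simp add: Icx_obj)
        have ka: "k a \<in> sp Y (int i - int a - 1)" "act (obj Y (int i - int a - 1)) (k a) (eA a) = k a"
          and wa: "w a = dif Y (int i - int a - 1) (k a) + (if a = i then 0 else act (obj Y (int i - int (a - 1) - 1)) (k (a - 1)) (xA (a - 1)))"
          using k[OF proj(1,2)] by auto
        define z where "z = (if a = i then 0 else act (obj Y (int i - int (a - 1) - 1)) (k (a - 1)) (xA (a - 1)))"
        have z: "z \<in> sp Y (int i - int a) \<and> act (obj Y (int i - int a)) z (xA a) = 0 \<and>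
            imap Y i m k 1 (n + 1) (dif (Icx i m) n v) = vscale (v 0) z"
        proof (cases "a = i")
          case True
          then show ?thesis using proj hz Y by (simp add: z_def Icx_dif_last act_zero)
        next
          case False
          then have a: "i < a" "i \<le> a - 1" "a - 1 \<le> m" "a - 1 \<noteq> 5" using proj im by auto
          have n: "n + 1 = int i - int (a - 1)" "int i - int (a - 1) - 1 = int i - int a" using a proj by auto
          have d: "dif (Icx i m) n v = vscale (v 0) (unit_vec 1)" using proj a v by (simp add: Icx_dif)
          have "vscale (v 0) (unit_vec 1) \<in> space (proj_rmod (a - 1))"
            using a im proj by (intro rmod_scale[OF proj_is_rmod]) (auto simp: unit1_proj)
          then have "imap Y i m k 1 (n + 1) (dif (Icx i m) n v) = vscale (v 0) z"
            unfolding n d using imap_apply[OF a(2,3), of Y k 1] False by (simp add: pmap_def z_def)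
          moreover have "k (a - 1) \<in> sp Y (int i - int a)" using k[OF a(2,3)] unfolding n by blast
          ultimately show ?thesis
            using False act_xA_xA[OF bc_mod[OF Y]] act_closed[OF bc_mod[OF Y]] unfolding z_def n by simp
        qed
        have dk: "dif Y (int i - int a - 1) (k a) \<in> sp Y (int i - int a)" by (rule dif_closed'[OF Y])
        have "imap Y i m w 0 n v = vscale (v 0) (w a) + vscale (v 1) (act (obj Y (int i - int a)) (w a) (xA a))"
          using proj v by (simp add: imap_apply pmap_def)
        also have "\<dots> = vscale (v 0) (dif Y (int i - int a - 1) (k a)) + vscale (v 0) z +
            vscale (v 1) (act (obj Y (int i - int a)) (dif Y (int i - int a - 1) (k a)) (xA a))"
          unfolding wa z_def[symmetric] using z dk Y by (simp add: act_add vec.scale_right_distrib)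
        also have "\<dots> = dif Y (n - 1) (imap Y i m k 1 n v) + vscale (v 0) z"
          using proj v ka
          by (simp add: imap_apply pmap_def dif_add[OF Y] dif_scale[OF Y] dif_act'[OF Y]
            rmod_scale[OF bc_mod[OF Y]] act_closed[OF bc_mod[OF Y]])
        finally show ?thesis using z by simp
      qed
    qed
  qed
  then show ?thesis using c cm_zero_map[OF Icx_bc Y] by (simp add: ht_def)
qed

lemma Icx_coboundaries:
  assumes "i \<le> a" "a \<le> m" "b \<in> coboundaries (Icx i m) (int i - int a)"
  obtains c where "b = vscale c (unit_vec 1)" "a = m \<Longrightarrow> c = 0"
proof -
  obtain v where v: "v \<in> sp (Icx i m) (int i - int a - 1)" "b = dif (Icx i m) (int i - int a - 1) v"
    using assms(3) by (rule coboundariesE[OF Icx_bc])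
  have n: "int i - int a - 1 = int i - int (Suc a)" by simp
  show ?thesis
  proof (cases "a = m")
    case True
    then have "b = 0" using v by (simp add: Icx_def)
    then show ?thesis using that[of 0] by simp
  next
    case False
    then have "b = vscale (v 0) (unit_vec 1)"
      using v assms(1,2) unfolding n by (simp add: Icx_obj Icx_dif del: of_nat_Suc)
    then show ?thesis using that False by blast
  qed
qed

text \<open>A quasi-isomorphism onto a bounded complex of projectives splits: w_l x_l is a cocycle
  lying over a coboundary, hence bounds in Z, and a primitive is the next w. Cutting it down to its
  vertex removes the ambiguity, since P_a has only multiples of its top at vertex a; so q s is the
  identity and not merely homotopic to it.\<close>

lemma Icx_section:
  assumes q: "qi Z (Icx i m) q"
  obtains s where "cm (Icx i m) Z s" "q \<circ>\<^sub>c s = cid (Icx i m)"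
proof -
  have Z: "is_bcomplex Z" and qq: "q \<in> quasi_isos Z (Icx i m)" using q by (auto simp: qi_def)
  note qc = qi_cm[OF qq]
  let ?n = "\<lambda>a. int i - int a"
  let ?P = "\<lambda>w a. w a \<in> sp Z (?n a) \<and> act (obj Z (?n a)) (w a) (eA a) = w a \<and> q (?n a) (w a) = unit_vec 0 \<and>
     dif Z (?n a) (w a) = (if a = i then 0 else act (obj Z (?n (a - 1))) (w (a - 1)) (xA (a - 1)))"
  have "\<exists>w. \<forall>a. i \<le> a \<and> a \<le> l \<longrightarrow> ?P w a" if "i \<le> l" "l \<le> m" for l
    using that
  proof (induction l rule: dec_induct)
    case base
    have i5: "1 \<le> i" "i \<le> 5" using im by auto
    have "unit_vec 0 \<in> cocycles (Icx i m) 0"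
      using im by (simp add: cocycles_def Icx_dif_last Icx_obj0)
    then obtain y where y: "y \<in> cocycles Z 0" "unit_vec 0 - q 0 y \<in> coboundaries (Icx i m) 0"
      using qi_surj[OF qq] by blast
    obtain c where c: "unit_vec 0 - q 0 y = vscale c (unit_vec 1)"
      using Icx_coboundaries[of i "unit_vec 0 - q 0 y"] y im by auto
    \<comment> \<open>The image of y differs from the top only by a multiple of the socle, and e_i
      kills the socle.\<close>
    define y' where "y' = act (obj Z 0) y (eA i)"
    have ys: "y \<in> sp Z 0" using y Z by (simp add: cocycles_sp)
    have "y' \<in> cocycles Z 0" unfolding y'_def using y i5 by (intro cocycles_act[OF Z]) (auto simp: eA_carrier)
    moreover have "act (obj Z 0) y' (eA i) = y'"
      unfolding y'_def using act_eA_eA[OF bc_mod[OF Z] ys i5 i5] by simp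
    moreover have "q 0 y' = unit_vec 0"
    proof -
      have "q 0 y \<in> space (proj_rmod i)" using cm_closed[OF Z Icx_bc qc, of 0 y] im by (simp add: Icx_obj0)
      moreover have "(unit_vec 0 - q 0 y) 0 = 0" unfolding c by simp
      ultimately show ?thesis
        unfolding y'_def using cm_act[OF Z Icx_bc qc ys eA_carrier[OF i5]] im
        by (simp add: proj_act_eA Icx_obj0)
    qed
    ultimately show ?case by (intro exI[of _ "\<lambda>a. y'"]) (auto simp: cocycles_def)
  next
    case (step l)
    then obtain w where w: "\<And>a. i \<le> a \<Longrightarrow> a \<le> l \<Longrightarrow> ?P w a" by auto
    have l: "i \<le> l" "l \<le> m" "Suc l \<le> m" "1 \<le> l" "l \<le> 5" "l \<noteq> 5" "1 \<le> Suc l" "Suc l \<le> 5" using step im by auto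
    let ?z = "act (obj Z (?n l)) (w l) (xA l)"
    note wl = w[OF l(1) order_refl]
    have "dif Z (?n l) ?z = 0"
    proof (cases "l = i")
      case True
      then show ?thesis using wl Z by (simp add: dif_act act_zero)
    next
      case False
      then have n: "?n l + 1 = ?n (l - 1)" using l by simp
      have "w (l - 1) \<in> sp Z (?n (l - 1))" using w[of "l - 1"] False l by auto
      then show ?thesis
        using wl False act_xA_xA[OF bc_mod[OF Z]] dif_act[OF Z _ xA_carrier, of "w l" "?n l" l] unfolding n by simp
    qed
    then have zc: "?z \<in> cocycles Z (?n l)" using wl by (simp add: cocycles_def act_closed[OF bc_mod[OF Z]])
    have qz: "q (?n l) ?z = unit_vec 1"
      using cm_act[OF Z Icx_bc qc _ xA_carrier, of "w l" "?n l" l] wl l by (simp add: Icx_obj proj_act_xA)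
    have n0: "?n l - 1 = ?n (Suc l)" by simp
    have "dif (Icx i m :: 'a complx) (?n (Suc l)) (unit_vec 0) = unit_vec 1"
      using l by (simp add: Icx_dif del: of_nat_Suc)
    moreover have "dif (Icx i m :: 'a complx) (?n l - 1) (unit_vec 0) \<in> coboundaries (Icx i m) (?n l)"
      by (rule coboundariesI2[OF Icx_bc])
    ultimately have "unit_vec 1 \<in> coboundaries (Icx i m :: 'a complx) (?n l)" unfolding n0 by simp
    then have "?z \<in> coboundaries Z (?n l)" using qi_inj[OF qq zc] qz by simp
    then obtain y where y: "y \<in> sp Z (?n (Suc l))" "?z = dif Z (?n (Suc l)) y"
      by (rule coboundariesE[OF Z]) (simp add: algebra_simps)
    define y' where "y' = act (obj Z (?n (Suc l))) y (eA (Suc l))"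
    have n1: "?n (Suc l) + 1 = ?n l" by simp
    have y's: "y' \<in> sp Z (?n (Suc l))" unfolding y'_def by (rule act_closed[OF bc_mod[OF Z] y(1) eA_carrier[OF l(7,8)]])
    have y'e: "act (obj Z (?n (Suc l))) y' (eA (Suc l)) = y'"
      unfolding y'_def using act_eA_eA[OF bc_mod[OF Z] y(1) l(7,8) l(7,8)] by simp
    have y'd: "dif Z (?n (Suc l)) y' = ?z"
      unfolding y'_def using dif_act[OF Z y(1) eA_carrier[OF l(7,8)]] y(2)[symmetric] wl l
      unfolding n1 by (simp add: act_xA_eA[OF bc_mod[OF Z]])
    have y'q: "q (?n (Suc l)) y' = unit_vec 0"
    proof -
      have s: "q (?n (Suc l)) y' \<in> space (proj_rmod (Suc l))"
        using cm_closed[OF Z Icx_bc qc, of "?n (Suc l)" y'] l by (simp add: Icx_obj del: of_nat_Suc)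
      have "q (?n (Suc l)) y' = act (proj_rmod (Suc l)) (q (?n (Suc l)) y') (eA (Suc l))"
        using cm_act[OF Z Icx_bc qc y's eA_carrier[OF l(7,8)]] y'e l by (simp add: Icx_obj del: of_nat_Suc)
      also have "\<dots> = vscale (q (?n (Suc l)) y' 0) (unit_vec 0)"
        using proj_act_eA[OF s] by simp
      finally have 1: "q (?n (Suc l)) y' = vscale (q (?n (Suc l)) y' 0) (unit_vec 0)" .
      \<comment> \<open>The coefficient of the top is read off from the differential, which sends
        the top to the socle.\<close>
      have "dif (Icx i m) (?n (Suc l)) (q (?n (Suc l)) y') = unit_vec 1"
        using cm_dif[OF Z Icx_bc qc, of "?n (Suc l)" y'] y'd qz unfolding n1 by simp
      then have "vscale (q (?n (Suc l)) y' 0) (unit_vec 1) = unit_vec 1"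
        using Icx_dif[OF _ l(3) s] l by simp
      then have "q (?n (Suc l)) y' 0 = 1" by (auto dest: fun_cong[of _ _ 1])
      then show ?thesis using 1 by simp
    qed
    show ?case
    proof (rule exI[of _ "w(Suc l := y')"], intro allI impI)
      fix a assume "i \<le> a \<and> a \<le> Suc l"
      then consider "a = Suc l" | "i \<le> a" "a \<le> l" by linarith
      then show "?P (w(Suc l := y')) a"
      proof cases
        case 1
        then show ?thesis using y's y'e y'd y'q l by simp
      next
        case 2
        then show ?thesis using w[OF 2] by auto
      qed
    qed
  qed
  then obtain w where w: "\<And>a. i \<le> a \<Longrightarrow> a \<le> m \<Longrightarrow> ?P w a" using im by blast
  have fam: "fam Z i m w" unfolding fam_def using w by blast
  define s where "s = imap Z i m w 0"
  have s: "cm (Icx i m) Z s" unfolding s_def by (rule imap_cm[OF Z fam])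
  have eq: "f = cid (Icx i m)" if "cm (Icx i m) (Icx i m) f" "\<And>a. i \<le> a \<Longrightarrow> a \<le> m \<Longrightarrow> f (?n a) (unit_vec 0) = unit_vec 0" for f
  proof -
    have "imap (Icx i m) i m (\<lambda>a. g (?n a) (unit_vec 0)) 0 = imap (Icx i m) i m (\<lambda>a. unit_vec 0) 0"
      if "\<And>a. i \<le> a \<Longrightarrow> a \<le> m \<Longrightarrow> g (?n a) (unit_vec 0) = unit_vec 0" for g
    proof
      fix n
      show "imap (Icx i m) i m (\<lambda>a. g (?n a) (unit_vec 0)) 0 n = imap (Icx i m) i m (\<lambda>a. unit_vec 0) 0 n"
        by (cases rule: Icx_cases[where i = i and m = m and n = n])
          (auto simp: Icx_zero that imap_apply)
    qed
    moreover have "cid (Icx i m) (?n a) (unit_vec 0) = unit_vec 0" if "i \<le> a" "a \<le> m" for a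
      using that by (simp add: cid_def Icx_obj)
    ultimately show ?thesis
      using cm_Icx_imap(2)[OF that(1)] cm_Icx_imap(2)[OF cm_cid[OF Icx_bc]] that(2) by metis
  qed
  have "q \<circ>\<^sub>c s = cid (Icx i m)"
    by (rule eq[OF cm_comp[OF s qi_imp_cm[OF q]]]) (use w in \<open>auto simp: ccomp_def s_def imap_top\<close>)
  then show ?thesis using that s by blast
qed

text \<open>Composing the numerator of a roof with a section of its denominator replaces the roof by
  a chain map.\<close>

lemma D_hom_Icx:
  assumes F: "F \<in> D_hom (Icx i m) Y"
  obtains w where "fam Y i m w" "F = Qm (Icx i m) Y (imap Y i m w 0)"
proof -
  obtain r where r: "is_roof r" "src r = Icx i m" "tgt r = Y" "F = roof_class r" using F by (auto simp: D_hom_iff)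
  have d: "qi (apex r) (Icx i m) (den r)" "cm (apex r) Y (num r)" using r by (auto simp: is_roof_iff)
  obtain s where s: "cm (Icx i m) (apex r) s" "den r \<circ>\<^sub>c s = cid (Icx i m)" using Icx_section[OF d(1)] .
  let ?f = "num r \<circ>\<^sub>c s"
  have f: "cm (Icx i m) Y ?f" by (rule cm_comp[OF s(1) d(2)])
  have "Qm (Icx i m) Y ?f = F"
    unfolding Qm_def r(4)
    by (intro roof_class_eqI roof_relI[of _ _ "Icx i m" "cid (Icx i m)" s])
      (use r s f in \<open>auto simp: Qm_roof qi_cid Icx_bc cm_cid cm_cid_right[OF f] cm_cid_right[OF cm_cid[OF Icx_bc]] ht_refl\<close>)
  then show ?thesis using that cm_Icx_imap[OF f] by metis
qed

end

section \<open>The cohomological class and its closure under sums and summands\<close>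

section \<open>Complexes with even exact cohomology\<close>

text \<open>Exactness of H e_(j-1) -> H e_j -> H e_(j+1) in the middle, where H is the cohomology in
  degree n and the maps are given by the arrows. The element y may have components at several
  vertices, as x_(j-1) only sees the one at j - 1.\<close>

definition ex_at :: "'k::field complx \<Rightarrow> int \<Rightarrow> nat \<Rightarrow> bool" where
  "ex_at X n j \<longleftrightarrow> (\<forall>v\<in>cocycles X n. act (obj X n) v (eA j) = v \<and> act (obj X n) v (xA j) \<in> coboundaries X n \<longrightarrow>
     (\<exists>y\<in>cocycles X n. v - act (obj X n) y (xA (j - 1)) \<in> coboundaries X n))"

text \<open>These are exactly the objects of \<open>\<U>(A)\<close>: the cohomology is concentrated in even degrees,
  and neither \<open>S\<^sub>2\<close> nor \<open>S\<^sub>4\<close> is a direct summand of it.\<close>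

definition evex :: "'k::field complx \<Rightarrow> bool" where
  "evex X \<longleftrightarrow> is_bcomplex X \<and> (\<forall>n. odd n \<longrightarrow> cocycles X n \<subseteq> coboundaries X n) \<and>
     (\<forall>n. ex_at X n 2 \<and> ex_at X n 4)"

lemma hrel_id:
  assumes "is_bcomplex X" "hrel (Qm X X (cid X)) n v y"
  shows "v - y \<in> coboundaries X n"
  using assms by (auto simp: hrel_Qm[OF cm_cid] cid_in cocycles_sp)

lemma ex_at_summand:
  assumes S: "direct_sum Db X Y S" and ex: "ex_at S n j" and j: "1 \<le> j" "j \<le> 5"
  shows "ex_at X n j"
  unfolding ex_at_def
proof (intro ballI impI, elim conjE)
  fix v assume v: "v \<in> cocycles X n" "act (obj X n) v (eA j) = v" "act (obj X n) v (xA j) \<in> coboundaries X n"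
  obtain i p where i: "i \<in> D_hom X S" and p: "p \<in> D_hom S X" and pi: "D_comp p i = Qm X X (cid X)"
    and bc: "is_bcomplex X" "is_bcomplex S"
    using S unfolding direct_sum_def is_biproduct_def by auto
  note e = eA_carrier[OF j]
  obtain u0 where "hrel i n v u0" using hrel_total[OF i v(1)] .
  \<comment> \<open>The image class is cut down to vertex j so that exactness of S applies to
    it.\<close>
  then have u: "hrel i n v (act (obj S n) u0 (eA j))" (is "hrel i n v ?u") and u0: "u0 \<in> cocycles S n"
    using hrel_act[OF i _ e] v(2) hrel_cocycles(2)[OF i] by fastforce+
  have u1: "?u \<in> cocycles S n" "act (obj S n) ?u (eA j) = ?u"
    using u0 cocycles_act[OF bc(2) u0 e] act_eA_eA[OF bc_mod[OF bc(2)] _ j j] by (auto simp: cocycles_sp bc)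
  have "act (obj S n) ?u (xA j) \<in> coboundaries S n"
    by (rule hrel_coboundaries[OF i hrel_act[OF i u xA_carrier] v(3)])
  then obtain y where y: "y \<in> cocycles S n" "?u - act (obj S n) y (xA (j - 1)) \<in> coboundaries S n"
    using ex u1 unfolding ex_at_def by blast
  obtain v' where v': "hrel p n ?u v'" using hrel_total[OF p u1(1)] .
  obtain y' where y': "hrel p n y y'" using hrel_total[OF p y(1)] .
  have "v' - act (obj X n) y' (xA (j - 1)) \<in> coboundaries X n"
    by (rule hrel_unique[OF p v' hrel_act[OF p y' xA_carrier] y(2)])
  moreover have "v - v' \<in> coboundaries X n"
    using hrel_comp[OF i p u v'] pi hrel_id[OF bc(1)] by simp
  ultimately have "v - act (obj X n) y' (xA (j - 1)) \<in> coboundaries X n"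
    using coboundaries_add[OF bc(1)] by fastforce
  then show "\<exists>y\<in>cocycles X n. v - act (obj X n) y (xA (j - 1)) \<in> coboundaries X n"
    using hrel_cocycles(2)[OF p y'] by blast
qed

lemma evex_summand:
  assumes S: "direct_sum Db X Y S" and ex: "evex S"
  shows "evex X"
proof -
  obtain i p where i: "i \<in> D_hom X S" and p: "p \<in> D_hom S X" and pi: "D_comp p i = Qm X X (cid X)"
    and bc: "is_bcomplex X" "is_bcomplex S"
    using S unfolding direct_sum_def is_biproduct_def by auto
  have "v \<in> coboundaries X n" if v: "v \<in> cocycles X n" and n: "odd n" for n v
  proof -
    obtain u where u: "hrel i n v u" using hrel_total[OF i v] .
    have us: "u \<in> cocycles S n" "u \<in> coboundaries S n"
      using hrel_cocycles(2)[OF i u] ex n unfolding evex_def by auto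
    obtain v' where v': "hrel p n u v'" using hrel_total[OF p us(1)] .
    have "v' \<in> coboundaries X n" by (rule hrel_coboundaries[OF p v' us(2)])
    moreover have "v - v' \<in> coboundaries X n"
      using hrel_comp[OF i p u v'] pi hrel_id[OF bc(1)] by simp
    ultimately show ?thesis using coboundaries_add[OF bc(1)] by fastforce
  qed
  then show ?thesis using bc ex ex_at_summand[OF S, of _ 2] ex_at_summand[OF S, of _ 4] unfolding evex_def by auto
qed

text \<open>Up to a coboundary, u is the sum of its images under the two idempotents i p and j q;
  coboundaries and preimages under an arrow are found in each summand and added.\<close>

lemma evex_sum:
  assumes S: "direct_sum Db X Y S" and ex: "evex X" "evex Y"
  shows "evex S"
proof -
  obtain i j p q where i: "i \<in> D_hom X S" and j: "j \<in> D_hom Y S" and p: "p \<in> D_hom S X" and q: "q \<in> D_hom S Y"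
    and id: "D_plus (D_comp i p) (D_comp j q) = Qm S S (cid S)"
    and bc: "is_bcomplex X" "is_bcomplex Y" "is_bcomplex S"
    using S unfolding direct_sum_def is_biproduct_def by auto
  have decomp: "u - (s + t) \<in> coboundaries S n"
    if "hrel p n u v" "hrel q n u w" "hrel i n v s" "hrel j n w t" for n u v w s t
  proof -
    have "D_comp i p \<in> D_hom S S" "D_comp j q \<in> D_hom S S" using D_comp_closed i j p q by blast+
    then have "hrel (Qm S S (cid S)) n u (s + t)"
      using hrel_plus hrel_comp[OF p i that(1,3)] hrel_comp[OF q j that(2,4)] id by metis
    then show ?thesis by (rule hrel_id[OF bc(3)])
  qed
  have odd: "u \<in> coboundaries S n" if u: "u \<in> cocycles S n" and n: "odd n" for n u
  proof -
    obtain v where v: "hrel p n u v" using hrel_total[OF p u] .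
    obtain w where w: "hrel q n u w" using hrel_total[OF q u] .
    have vw: "v \<in> coboundaries X n" "w \<in> coboundaries Y n" "v \<in> cocycles X n" "w \<in> cocycles Y n"
      using hrel_cocycles(2)[OF p v] hrel_cocycles(2)[OF q w] ex n unfolding evex_def by auto
    obtain s where s: "hrel i n v s" using hrel_total[OF i vw(3)] .
    obtain t where t: "hrel j n w t" using hrel_total[OF j vw(4)] .
    have "s + t \<in> coboundaries S n"
      by (rule coboundaries_add[OF bc(3) hrel_coboundaries[OF i s vw(1)] hrel_coboundaries[OF j t vw(2)]])
    then show ?thesis using coboundaries_add[OF bc(3) decomp[OF v w s t]] by fastforce
  qed
  have "ex_at S n a" if a: "1 \<le> a" "a \<le> 5" and exa: "ex_at X n a" "ex_at Y n a" for n a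
    unfolding ex_at_def
  proof (intro ballI impI, elim conjE)
    fix u assume u: "u \<in> cocycles S n" "act (obj S n) u (eA a) = u" "act (obj S n) u (xA a) \<in> coboundaries S n"
    note e = eA_carrier[OF a]
    have comp: "\<exists>v y s r. hrel P n u v \<and> hrel I n v s \<and> hrel I n y r \<and> s - act (obj S n) r (xA (a - 1)) \<in> coboundaries S n"
      if P: "P \<in> D_hom S V" and I: "I \<in> D_hom V S" and exV: "ex_at V n a" for P I V
    proof -
      have V: "is_bcomplex V" using hrel_bc[OF I] by blast
      obtain v0 where "hrel P n u v0" using hrel_total[OF P u(1)] .
      then have v: "hrel P n u (act (obj V n) v0 (eA a))" (is "hrel P n u ?v") and v0: "v0 \<in> cocycles V n"
        using hrel_act[OF P _ e] u(2) hrel_cocycles(2)[OF P] by fastforce+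
      have v1: "?v \<in> cocycles V n" "act (obj V n) ?v (eA a) = ?v"
        using v0 cocycles_act[OF V v0 e] act_eA_eA[OF bc_mod[OF V] _ a a] by (auto simp: cocycles_sp V)
      have "act (obj V n) ?v (xA a) \<in> coboundaries V n"
        by (rule hrel_coboundaries[OF P hrel_act[OF P v xA_carrier] u(3)])
      then obtain y where y: "y \<in> cocycles V n" "?v - act (obj V n) y (xA (a - 1)) \<in> coboundaries V n"
        using exV v1 unfolding ex_at_def by blast
      obtain s where s: "hrel I n ?v s" using hrel_total[OF I v1(1)] .
      obtain r where r: "hrel I n y r" using hrel_total[OF I y(1)] .
      have "s - act (obj S n) r (xA (a - 1)) \<in> coboundaries S n"
        by (rule hrel_unique[OF I s hrel_act[OF I r xA_carrier] y(2)])
      then show ?thesis using v s r by blast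
    qed
    obtain v y s r where 1: "hrel p n u v" "hrel i n v s" "hrel i n y r" "s - act (obj S n) r (xA (a - 1)) \<in> coboundaries S n"
      using comp[OF p i exa(1)] by blast
    obtain v' y' s' r' where 2: "hrel q n u v'" "hrel j n v' s'" "hrel j n y' r'" "s' - act (obj S n) r' (xA (a - 1)) \<in> coboundaries S n"
      using comp[OF q j exa(2)] by blast
    have rr: "r \<in> cocycles S n" "r' \<in> cocycles S n" using hrel_cocycles(2)[OF i 1(3)] hrel_cocycles(2)[OF j 2(3)] by auto
    have "u - act (obj S n) (r + r') (xA (a - 1)) =
      (u - (s + s')) + ((s - act (obj S n) r (xA (a - 1))) + (s' - act (obj S n) r' (xA (a - 1))))"
      using rr bc by (simp add: act_add cocycles_sp)
    also have "\<dots> \<in> coboundaries S n"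
      by (intro coboundaries_add[OF bc(3)] decomp[OF 1(1) 2(1) 1(2) 2(2)] 1(4) 2(4))
    finally show "\<exists>y\<in>cocycles S n. u - act (obj S n) y (xA (a - 1)) \<in> coboundaries S n"
      using cocycles_add[OF bc(3) rr] by blast
  qed
  then show ?thesis using bc odd ex unfolding evex_def by auto
qed

lemma evex_zero:
  assumes "is_zero_object Db Z"
  shows "evex Z"
proof -
  have Z: "is_bcomplex Z" and eq: "Qm Z Z (cid Z) = Qm Z Z (\<lambda>n v. 0)"
    using assms by (auto simp: is_zero_object_def)
  have "v \<in> coboundaries Z n" if v: "v \<in> cocycles Z n" for v n
  proof -
    have "hrel (Qm Z Z (cid Z)) n v 0" unfolding eq using v Z by (simp add: hrel_Qm cm_zero_map)
    then show ?thesis using hrel_id[OF Z] by fastforce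
  qed
  then have "cocycles Z n = coboundaries Z n" for n using coboundaries_cocycles[OF Z] by blast
  then have "ex_at Z n j" for n j
    unfolding ex_at_def using Z by (auto intro!: bexI[of _ 0] simp: act_zero)
  then show ?thesis using Z \<open>\<And>n. cocycles Z n = coboundaries Z n\<close> by (simp add: evex_def)
qed

lemma evex_sum_list: "direct_sum_list Db Xs S \<Longrightarrow> (\<And>X. X \<in> set Xs \<Longrightarrow> evex X) \<Longrightarrow> evex S"
proof (induction Xs arbitrary: S)
  case Nil
  then show ?case by (simp add: evex_zero)
next
  case (Cons X Xs)
  then obtain T where "direct_sum_list Db Xs T" "direct_sum Db X T S" by auto
  note T = this
  have "evex X" "evex T" using Cons.prems(2) Cons.IH[OF T(1)] by simp_all
  then show ?case using evex_sum[OF T(2)] by blast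
qed

text \<open>\<open>ex_at\<close> for a module in place of the cohomology of a complex. It holds at 2
  and 4 throughout \<open>M_A\<close>, since the simple generators are S_1, S_3, S_5 and the
  uniserial ones are exact at every vertex.\<close>

definition mex :: "'k::field rmod \<Rightarrow> nat \<Rightarrow> bool" where
  "mex M j \<longleftrightarrow> (\<forall>v\<in>space M. act M v (eA j) = v \<and> act M v (xA j) = 0 \<longrightarrow> (\<exists>y\<in>space M. v = act M y (xA (j - 1))))"

lemma mex_summand:
  assumes S: "direct_sum modA X Y S" and ex: "mex S j" and j: "1 \<le> j" "j \<le> 5"
  shows "mex X j"
proof -
  obtain i p where i: "i \<in> rmod_hom X S" and p: "p \<in> rmod_hom S X"
    and pi: "p \<circ> i = (\<lambda>v. if v \<in> space X then v else 0)" and m: "is_rmod X" "is_rmod S"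
    using S unfolding direct_sum_def is_biproduct_def by auto
  have pi': "p (i v) = v" if "v \<in> space X" for v using fun_cong[OF pi, of v] that by simp
  show ?thesis
    unfolding mex_def
  proof (intro ballI impI, elim conjE)
    fix v assume v: "v \<in> space X" "act X v (eA j) = v" "act X v (xA j) = 0"
    have "act S (i v) (eA j) = i v" "act S (i v) (xA j) = 0"
      using hom_act[OF m i v(1) eA_carrier[OF j]] hom_act[OF m i v(1) xA_carrier, of j] v hom_zero[OF m i] by auto
    then obtain y where y: "y \<in> space S" "i v = act S y (xA (j - 1))"
      using ex hom_closed[OF m i v(1)] unfolding mex_def by blast
    have "v = act X (p y) (xA (j - 1))"
      using hom_act[OF m(2,1) p y(1) xA_carrier, of "j - 1"] y(2) pi'[OF v(1)] by simp
    then show "\<exists>y\<in>space X. v = act X y (xA (j - 1))" using hom_closed[OF m(2,1) p y(1)] by blast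
  qed
qed

lemma mex_sum:
  assumes S: "direct_sum modA X Y S" and ex: "mex X j" "mex Y j" and j: "1 \<le> j" "j \<le> 5"
  shows "mex S j"
proof -
  obtain i k p q where i: "i \<in> rmod_hom X S" and k: "k \<in> rmod_hom Y S" and p: "p \<in> rmod_hom S X" and q: "q \<in> rmod_hom S Y"
    and id: "(\<lambda>v. i (p v) + k (q v)) = (\<lambda>v. if v \<in> space S then v else 0)"
    and m: "is_rmod X" "is_rmod Y" "is_rmod S"
    using S unfolding direct_sum_def is_biproduct_def by (auto simp: o_def)
  show ?thesis
    unfolding mex_def
  proof (intro ballI impI, elim conjE)
    fix u assume u: "u \<in> space S" "act S u (eA j) = u" "act S u (xA j) = 0"
    have comp: "\<exists>y\<in>space S. I (P u) = act S y (xA (j - 1))"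
      if P: "P \<in> rmod_hom S V" and I: "I \<in> rmod_hom V S" and V: "is_rmod V" and exV: "mex V j" for P I V
    proof -
      have "act V (P u) (eA j) = P u" "act V (P u) (xA j) = 0"
        using hom_act[OF m(3) V P u(1) eA_carrier[OF j]] hom_act[OF m(3) V P u(1) xA_carrier, of j] u
          hom_zero[OF m(3) V P] by auto
      then obtain y where y: "y \<in> space V" "P u = act V y (xA (j - 1))"
        using exV hom_closed[OF m(3) V P u(1)] unfolding mex_def by blast
      then have "I (P u) = act S (I y) (xA (j - 1))"
        using hom_act[OF V m(3) I y(1) xA_carrier, of "j - 1"] by simp
      then show ?thesis using hom_closed[OF V m(3) I y(1)] by blast
    qed
    obtain y y' where y: "y \<in> space S" "i (p u) = act S y (xA (j - 1))" "y' \<in> space S" "k (q u) = act S y' (xA (j - 1))"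
      using comp[OF p i m(1) ex(1)] comp[OF q k m(2) ex(2)] by blast
    have "u = act S (y + y') (xA (j - 1))"
      using fun_cong[OF id, of u] u(1) y by (simp add: act_add[OF m(3)])
    then show "\<exists>y\<in>space S. u = act S y (xA (j - 1))" using rmod_add[OF m(3) y(1,3)] by blast
  qed
qed

lemma mex_sum_list:
  assumes "direct_sum_list modA Xs S" "\<And>X. X \<in> set Xs \<Longrightarrow> mex X j" "1 \<le> j" "j \<le> 5"
  shows "mex S j"
  using assms
proof (induction Xs arbitrary: S)
  case Nil
  then have S: "is_rmod S" and eq: "(\<lambda>v. if v \<in> space S then v else 0) = (\<lambda>v. 0)"
    by (auto simp: is_zero_object_def)
  have "v = 0" if "v \<in> space S" for v using fun_cong[OF eq, of v] that by simp
  then show ?case using S by (force simp: mex_def act_zero rmod_zero)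
next
  case (Cons X Xs)
  then obtain T where "direct_sum_list modA Xs T" "direct_sum modA X T S" by auto
  note T = this
  have "mex X j" "mex T j" using Cons.prems(2-) Cons.IH[OF T(1)] by simp_all
  then show ?case using mex_sum[OF T(2)] Cons.prems(3,4) by blast
qed

abbreviation M_A_list :: "'k::field rmod list" where
  "M_A_list \<equiv> [simple_rmod 5, uniserial_rmod 4, uniserial_rmod 3, simple_rmod 3,
     uniserial_rmod 2, uniserial_rmod 1, simple_rmod 1]"

lemma mex_simple: "i \<noteq> j \<Longrightarrow> mex (simple_rmod i) j"
  by (auto simp: mex_def simple_act_eA simple_space intro!: bexI[of _ 0]) (auto simp: simple_act_xA)

lemma mex_uniserial: 
  assumes "1 \<le> i" "i \<le> 4" "1 \<le> j"
  shows "mex (uniserial_rmod i) j"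
  unfolding mex_def
proof (intro ballI impI, elim conjE)
  fix v :: "'a vec"
  assume v: "v \<in> space (uniserial_rmod i)" "act (uniserial_rmod i) v (eA j) = v" "act (uniserial_rmod i) v (xA j) = 0"
  consider "j = i" | "j = Suc i" | "j \<noteq> i" "j \<noteq> Suc i" by blast
  then show "\<exists>y\<in>space (uniserial_rmod i). v = act (uniserial_rmod i) y (xA (j - 1))"
  proof cases
    case 1
    then have "v = 0" using v assms by (auto simp: uniserial_act_eA uniserial_act_xA)
    then show ?thesis using assms by (intro bexI[of _ 0]) (auto simp: uniserial_act_xA uniserial_space)
  next
    case 2
    then have "v = vscale (v 1) (unit_vec 1)" using v by (simp add: uniserial_act_eA)
    then have "v = act (uniserial_rmod i) (vscale (v 1) (unit_vec 0)) (xA (j - 1))"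
      using 2 assms by (simp add: uniserial_act_xA)
    moreover have "vscale (v 1) (unit_vec 0) \<in> space (uniserial_rmod i)"
      by (auto simp: uniserial_space unit_vec_def)
    ultimately show ?thesis by blast
  next
    case 3
    then have "v = 0" using v by (simp add: uniserial_act_eA)
    then show ?thesis using assms by (intro bexI[of _ 0]) (auto simp: uniserial_act_xA uniserial_space)
  qed
qed

lemma M_A_mex:
  assumes "M \<in> M_A" "j = 2 \<or> j = 4"
  shows "mex M j" "is_rmod M"
proof -
  have j: "1 \<le> j" "j \<le> 5" using assms(2) by auto
  obtain T Xs S Y where T: "direct_sum_list modA M_A_list T" and Xs: "set Xs \<subseteq> {T}" "direct_sum_list modA Xs S"
    and S: "direct_sum modA M Y S"
    using assms(1) unfolding M_A_def add_closure_def by blast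
  have "mex T j"
    by (rule mex_sum_list[OF T _ j]) (use assms(2) in \<open>auto intro: mex_simple mex_uniserial\<close>)
  then have "mex S j" using mex_sum_list[OF Xs(2) _ j] Xs(1) by blast
  then show "mex M j" by (rule mex_summand[OF S _ j])
  show "is_rmod M" using S by (auto simp: direct_sum_def is_biproduct_def)
qed

lemma stalk_cocycles: "cocycles (stalk M) n = sp (stalk M) n"
  by (auto simp: cocycles_def stalk_def)

lemma stalk_coboundaries: "is_rmod M \<Longrightarrow> coboundaries (stalk M) n = {0}"
  using rmod_zero by (auto simp: coboundaries_def stalk_def image_constant_conv)

lemma evex_stalk:
  assumes M: "M \<in> M_A"
  shows "evex (shift (2 * i) (stalk M))"
proof -
  have m: "is_rmod M" "mex M 2" "mex M 4" using M_A_mex[OF M] by auto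
  have "ex_at (shift (2 * i) (stalk M)) n j" if "mex M j" for n j
    using that
    unfolding ex_at_def mex_def shift_coboundaries[OF stalk_bc[OF m(1)]] stalk_coboundaries[OF m(1)]
    by (simp add: stalk_cocycles) (simp add: stalk_def)
  moreover have "cocycles (shift (2 * i) (stalk M)) n = {0}" if "odd n" for n
  proof -
    have "n + 2 * i \<noteq> 0" using that by presburger
    then show ?thesis by (simp add: stalk_cocycles) (simp add: stalk_def zero_rmod_def)
  qed
  ultimately show ?thesis
    unfolding evex_def using m
    by (auto simp: stalk_bc shift_bc)
qed

lemma U_A_evex: "X \<in> U_A \<Longrightarrow> evex X"
  unfolding U_A_def add_closure_def using evex_sum_list evex_stalk evex_summand by blast

subsection \<open>The generators of the subcategory\<close>

lemma direct_sum_dsum_right: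
  assumes D: "direct_sum modA X Y T" and L: "is_rmod L"
  shows "direct_sum modA X (dsum_mod L Y) (dsum_mod L T)"
proof -
  obtain i j p q where h: "i \<in> rmod_hom X T" "j \<in> rmod_hom Y T" "p \<in> rmod_hom T X" "q \<in> rmod_hom T Y"
    and eq: "p \<circ> i = (\<lambda>v. if v \<in> space X then v else 0)" "q \<circ> j = (\<lambda>v. if v \<in> space Y then v else 0)"
      "p \<circ> j = (\<lambda>v. 0)" "q \<circ> i = (\<lambda>v. 0)" "(\<lambda>v. (i \<circ> p) v + (j \<circ> q) v) = (\<lambda>v. if v \<in> space T then v else 0)"
    and m: "is_rmod X" "is_rmod Y" "is_rmod T"
    using D unfolding direct_sum_def is_biproduct_def by auto
  note e = eq[THEN fun_cong, unfolded o_def]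
  note cl = hom_space[OF m(1,3) h(1)] hom_space[OF m(2,3) h(2)] hom_space[OF m(3,1) h(3)] hom_space[OF m(3,2) h(4)]
  note lin = hom_add[OF m(1,3) h(1)] hom_add[OF m(2,3) h(2)] hom_add[OF m(3,1) h(3)] hom_add[OF m(3,2) h(4)]
    hom_act[OF m(1,3) h(1)] hom_act[OF m(2,3) h(2)] hom_act[OF m(3,1) h(3)] hom_act[OF m(3,2) h(4)]
    hom_zero[OF m(1,3) h(1)] hom_zero[OF m(2,3) h(2)] hom_zero[OF m(3,1) h(3)] hom_zero[OF m(3,2) h(4)]
    hom_out[OF m(1,3) h(1)]
  note mm = m L rmod_add act_closed act_zero dsum_is_rmod rmod_zero
  let ?S = "dsum_mod L T" and ?Y = "dsum_mod L Y"
  define i' where "i' = (\<lambda>v. vpair 0 (i v))"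
  define j' where "j' = (\<lambda>u. if u \<in> space ?Y then vpair (vfst u) (j (vsnd u)) else 0)"
  define p' where "p' = (\<lambda>u. if u \<in> space ?S then p (vsnd u) else 0)"
  define q' where "q' = (\<lambda>u. if u \<in> space ?S then vpair (vfst u) (q (vsnd u)) else 0)"
  have "i' \<in> rmod_hom X ?S"
    unfolding rmod_hom_def mem_Collect_eq by (auto simp: i'_def mm cl lin vpair_linear)
  moreover have "j' \<in> rmod_hom ?Y ?S"
    unfolding rmod_hom_def mem_Collect_eq by (auto simp: j'_def mm cl lin vpair_linear)
  moreover have "p' \<in> rmod_hom ?S X"
    unfolding rmod_hom_def mem_Collect_eq by (auto simp: p'_def mm cl lin vpair_linear)
  moreover have "q' \<in> rmod_hom ?S ?Y"
    unfolding rmod_hom_def mem_Collect_eq by (auto simp: q'_def mm cl lin vpair_linear)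
  moreover have "p' \<circ> i' = (\<lambda>v. if v \<in> space X then v else 0)" "q' \<circ> j' = (\<lambda>v. if v \<in> space ?Y then v else 0)"
      "p' \<circ> j' = (\<lambda>v. 0)" "q' \<circ> i' = (\<lambda>v. 0)" "(\<lambda>v. (i' \<circ> p') v + (j' \<circ> q') v) = (\<lambda>v. if v \<in> space ?S then v else 0)"
    by (rule ext; simp add: i'_def j'_def p'_def q'_def mm cl lin e vpair_linear)+
  ultimately show ?thesis
    unfolding direct_sum_def is_biproduct_def using mm by auto
qed

lemma dsum_direct_sum:
  assumes m: "is_rmod X" "is_rmod Y"
  shows "direct_sum modA X Y (dsum_mod X Y)"
proof -
  note mm = m rmod_add act_closed act_zero dsum_is_rmod rmod_zero
  let ?S = "dsum_mod X Y"
  define i where "i = (\<lambda>v. if v \<in> space X then vpair v 0 else 0)"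
  define j where "j = (\<lambda>v. if v \<in> space Y then vpair 0 v else 0)"
  define p where "p = (\<lambda>u. if u \<in> space ?S then vfst u else 0)"
  define q where "q = (\<lambda>u. if u \<in> space ?S then vsnd u else 0)"
  have "i \<in> rmod_hom X ?S"
    unfolding rmod_hom_def mem_Collect_eq by (auto simp: i_def mm vpair_linear)
  moreover have "j \<in> rmod_hom Y ?S"
    unfolding rmod_hom_def mem_Collect_eq by (auto simp: j_def mm vpair_linear)
  moreover have "p \<in> rmod_hom ?S X" "q \<in> rmod_hom ?S Y"
    unfolding rmod_hom_def mem_Collect_eq by (auto simp: p_def q_def mm)
  moreover have "p \<circ> i = (\<lambda>v. if v \<in> space X then v else 0)" "q \<circ> j = (\<lambda>v. if v \<in> space Y then v else 0)"
      "p \<circ> j = (\<lambda>v. 0)" "q \<circ> i = (\<lambda>v. 0)" "(\<lambda>v. (i \<circ> p) v + (j \<circ> q) v) = (\<lambda>v. if v \<in> space ?S then v else 0)"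
    by (rule ext; simp add: i_def j_def p_def q_def mm vpair_linear)+
  ultimately show ?thesis
    unfolding direct_sum_def is_biproduct_def using mm by auto
qed

lemma direct_sum_list_exists:
  assumes "\<And>X. X \<in> set Xs \<Longrightarrow> is_rmod X"
  shows "\<exists>T. is_rmod T \<and> direct_sum_list modA Xs T \<and> (\<forall>X\<in>set Xs. \<exists>Y. direct_sum modA X Y T)"
  using assms
proof (induction Xs)
  case Nil
  have "is_zero_object modA zero_rmod" by (auto simp: is_zero_object_def zero_is_rmod fun_eq_iff)
  then show ?case using zero_is_rmod by auto
next
  case (Cons L Xs)
  then obtain T where T: "is_rmod T" "direct_sum_list modA Xs T" "\<forall>X\<in>set Xs. \<exists>Y. direct_sum modA X Y T"
    by auto
  have L: "is_rmod L" using Cons by simp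
  have "\<exists>Y. direct_sum modA X Y (dsum_mod L T)" if X: "X \<in> set (L # Xs)" for X
  proof (cases "X = L")
    case True
    then show ?thesis using dsum_direct_sum[OF L T(1)] by blast
  next
    case False
    then obtain Y where "direct_sum modA X Y T" using X T(3) by auto
    then show ?thesis using direct_sum_dsum_right[OF _ L] by blast
  qed
  then show ?case using T L dsum_direct_sum[OF L T(1)] dsum_is_rmod[OF L T(1)] by auto
qed

lemma iso_zero_direct_sum_modA:
  assumes "is_rmod T"
  shows "direct_sum modA T zero_rmod T"
proof -
  have "is_biproduct modA T zero_rmod T (\<lambda>v. if v \<in> space T then v else 0) (\<lambda>v. 0) (\<lambda>v. if v \<in> space T then v else 0) (\<lambda>v. 0)"
    unfolding is_biproduct_def using assms
    by (auto simp: zero_is_rmod rmod_hom_ident rmod_hom_zero fun_eq_iff)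
  then show ?thesis unfolding direct_sum_def by blast
qed

text \<open>\<open>M_A\<close> refers to some direct sum T of the seven modules, so such a T is
  constructed here together with a complement of each summand.\<close>

lemma M_A_gens:
  assumes "L \<in> set M_A_list"
  shows "L \<in> M_A"
proof -
  have m: "is_rmod X" if "X \<in> set (M_A_list :: 'a rmod list)" for X
    using that by (auto simp: simple_is_rmod uniserial_is_rmod)
  have "\<exists>T :: 'a rmod. is_rmod T \<and> direct_sum_list modA M_A_list T \<and> (\<forall>X\<in>set M_A_list. \<exists>Y. direct_sum modA X Y T)"
    by (rule direct_sum_list_exists) (rule m)
  then obtain T :: "'a rmod" where T: "is_rmod T" "direct_sum_list modA M_A_list T"
      "\<forall>X\<in>set M_A_list. \<exists>Y. direct_sum modA X Y T"
    by blast
  obtain Y where Y: "direct_sum modA L Y T" using T(3) assms by blast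
  have "is_zero_object modA zero_rmod" by (auto simp: is_zero_object_def zero_is_rmod fun_eq_iff)
  then have "direct_sum_list modA [T] T" using iso_zero_direct_sum_modA[OF T(1)] by auto
  note TT = this
  have "L \<in> add_closure modA {T}"
    unfolding add_closure_def mem_Collect_eq
  proof (intro conjI exI)
    show "L \<in> Ob modA" using m[OF assms] by simp
    show "set [T] \<subseteq> {T}" by simp
  qed (rule TT, rule Y)
  then show ?thesis unfolding M_A_def using T(2) by blast
qed

lemma proj_in_M_A: "1 \<le> a \<Longrightarrow> a \<le> 5 \<Longrightarrow> proj_rmod a \<in> M_A"
proof -
  assume "1 \<le> a" "a \<le> 5"
  then have "a = 1 \<or> a = 2 \<or> a = 3 \<or> a = 4 \<or> a = 5" by auto
  then show ?thesis by (intro M_A_gens) (auto simp: proj_rmod_def)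
qed

lemma simple_in_M_A: "a = 1 \<or> a = 3 \<or> a = 5 \<Longrightarrow> simple_rmod a \<in> M_A"
  by (intro M_A_gens) auto

section \<open>Every complex of the class is a sum of shifted generators\<close>

section \<open>Decomposing complexes with even exact cohomology\<close>

lemma coboundary_at_vertex:
  assumes Y: "is_bcomplex Y" and b: "b \<in> coboundaries Y n" "act (obj Y n) b (eA j) = b" and j: "1 \<le> j" "j \<le> 5"
  obtains c where "c \<in> sp Y (n - 1)" "act (obj Y (n - 1)) c (eA j) = c" "dif Y (n - 1) c = b"
proof -
  obtain c where c: "c \<in> sp Y (n - 1)" "b = dif Y (n - 1) c" using b(1) by (rule coboundariesE[OF Y])
  show ?thesis
    by (rule that[of "act (obj Y (n - 1)) c (eA j)"])
      (use c b(2) j act_eA_eA[OF bc_mod[OF Y] c(1) j j] dif_act'[OF Y c(1) eA_carrier[OF j]] in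
        \<open>auto simp: act_closed[OF bc_mod[OF Y]] eA_carrier\<close>)
qed

lemma ex_at_shift: "is_bcomplex X \<Longrightarrow> ex_at (shift i X) n j \<longleftrightarrow> ex_at X (n + i) j"
  by (simp add: ex_at_def shift_coboundaries)

lemma evex_shift: "evex X \<Longrightarrow> even i \<Longrightarrow> evex (shift i X)"
  by (auto simp: evex_def shift_bc shift_coboundaries ex_at_shift)

text \<open>One step of extending a family: u x_a lies at vertex a + 1, so a primitive of it can be
  cut down to that vertex, as \<open>fam\<close> demands.\<close>

lemma lift_step:
  assumes Y: "is_bcomplex Y" and u: "u \<in> sp Y n" "act (obj Y n) u (xA a) \<in> coboundaries Y n" and a: "a \<le> 4"
  obtains u' where "u' \<in> sp Y (n - 1)" "act (obj Y (n - 1)) u' (eA (Suc a)) = u'" "dif Y (n - 1) u' = act (obj Y n) u (xA a)"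
  using coboundary_at_vertex[OF Y u(2), of "Suc a"] act_xA_eA[OF bc_mod[OF Y] u(1), of "Suc a" a] a by auto

text \<open>From d u = t x_b one gets d(u x_a) = t x_b x_a = 0, so u x_a is a cocycle of odd degree
  and bounds. Hence extending a family is never obstructed in odd degrees.\<close>

lemma odd_step:
  assumes Y: "evex Y" and n: "odd n" and u: "u \<in> sp Y n" "dif Y n u = act (obj Y (n + 1)) t (xA b)" "t \<in> sp Y (n + 1)"
  shows "act (obj Y n) u (xA a) \<in> coboundaries Y n"
proof -
  have bc: "is_bcomplex Y" using Y by (simp add: evex_def)
  have "act (obj Y n) u (xA a) \<in> cocycles Y n"
    using u act_xA_xA[OF bc_mod[OF bc] u(3)]
    by (simp add: cocycles_def act_closed[OF bc_mod[OF bc]] dif_act[OF bc])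
  then show ?thesis using Y n unfolding evex_def by blast
qed

text \<open>The obstructions to extending v to a map from the resolution of S_j are the classes of
  w_a x_a in degree j - a. Degree 0 is covered by the hypothesis and odd degrees by
  \<open>odd_step\<close>. For j = 1 there is one more, at a = 3 in degree -2; it sits at vertex 4
  and exactness there absorbs it. For j = 3 and j = 5 the resolution is too short for another
  one.\<close>

lemma evex_lift:
  assumes Y: "evex Y" and j: "j = 1 \<or> j = 3 \<or> j = 5"
    and v: "v \<in> cocycles Y 0" "act (obj Y 0) v (eA j) = v" "act (obj Y 0) v (xA j) \<in> coboundaries Y 0"
  obtains w where "fam Y j 5 w" "w j = v"
proof -
  have bc: "is_bcomplex Y" using Y by (simp add: evex_def)
  have vs: "v \<in> sp Y 0" "dif Y 0 v = 0" using v by (auto simp: cocycles_def)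
  consider "j = 5" | "j = 3" | "j = 1" using j by blast
  then show ?thesis
  proof cases
    case 1
    then show ?thesis using v vs by (intro that[of "\<lambda>a. v"]) (auto simp: fam_def)
  next
    case 2
    obtain w4 where w4: "w4 \<in> sp Y (0 - 1)" "act (obj Y (0 - 1)) w4 (eA (Suc 3)) = w4" "dif Y (0 - 1) w4 = act (obj Y 0) v (xA 3)"
      using lift_step[OF bc vs(1), of 3] v 2 by auto
    have "act (obj Y (-1)) w4 (xA 4) \<in> coboundaries Y (-1)"
      by (rule odd_step[OF Y _ _ , of "-1" w4 v 3]) (use w4 vs in auto)
    then obtain w5 where w5: "w5 \<in> sp Y (-1 - 1)" "act (obj Y (-1 - 1)) w5 (eA (Suc 4)) = w5" "dif Y (-1 - 1) w5 = act (obj Y (-1)) w4 (xA 4)"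
      using lift_step[OF bc, of w4 "-1" 4] w4 by auto
    define w where "w a = (if a = 3 then v else if a = 4 then w4 else w5)" for a :: nat
    have fam: "w a \<in> sp Y (int j - int a) \<and> act (obj Y (int j - int a)) (w a) (eA a) = w a \<and>
       dif Y (int j - int a) (w a) = (if a = j then 0 else act (obj Y (int j - int (a - 1))) (w (a - 1)) (xA (a - 1)))"
      if "a = 3 \<or> a = 4 \<or> a = 5" for a
      using that v vs w4 w5 unfolding 2 by (elim disjE) (simp_all add: w_def)
    have "a = 3 \<or> a = 4 \<or> a = 5" if "3 \<le> a" "a \<le> 5" for a :: nat using that by presburger
    then have "fam Y j 5 w"
      unfolding fam_def using fam 2 by blast
    then show ?thesis by (intro that[of w]) (auto simp: w_def 2)
  next
    case 3
    obtain w2 where w2: "w2 \<in> sp Y (0 - 1)" "act (obj Y (0 - 1)) w2 (eA 2) = w2" "dif Y (0 - 1) w2 = act (obj Y 0) v (xA 1)"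
      using lift_step[OF bc vs(1), of 1] v 3 by (auto simp: numeral_2_eq_2)
    have "act (obj Y (-1)) w2 (xA 2) \<in> coboundaries Y (-1)"
      by (rule odd_step[OF Y _ _ , of "-1" w2 v 1]) (use w2 vs in auto)
    then obtain w3 where w3: "w3 \<in> sp Y (-1 - 1)" "act (obj Y (-1 - 1)) w3 (eA (Suc 2)) = w3" "dif Y (-1 - 1) w3 = act (obj Y (-1)) w2 (xA 2)"
      using lift_step[OF bc, of w2 "-1" 2] w2 by auto
    \<comment> \<open>The obstruction in even degree. Exactness at 4 writes it as y x_3 up to a
      coboundary; subtracting the cocycle y e_3 from w_3 removes it without changing d w_3.\<close>
    let ?t = "act (obj Y (-2)) w3 (xA 3)"
    have "dif Y (-2) ?t = 0"
      using w3 w2 dif_act[OF bc, of w3 "-2" "xA 3"] act_xA_xA[OF bc_mod[OF bc], of w2 "-1" 2 3] by simp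
    then have "?t \<in> cocycles Y (-2)" using w3 by (simp add: cocycles_def act_closed[OF bc_mod[OF bc]])
    moreover have "act (obj Y (-2)) ?t (eA 4) = ?t" "act (obj Y (-2)) ?t (xA 4) \<in> coboundaries Y (-2)"
      using w3 by (simp_all add: act_xA_eA[OF bc_mod[OF bc]] act_xA_xA[OF bc_mod[OF bc]] coboundaries_zero[OF bc])
    ultimately obtain y where y: "y \<in> cocycles Y (-2)" "?t - act (obj Y (-2)) y (xA (4 - 1)) \<in> coboundaries Y (-2)"
      using Y unfolding evex_def ex_at_def by blast
    define w3' where "w3' = w3 - act (obj Y (-2)) y (eA 3)"
    have ys: "y \<in> sp Y (-2)" "dif Y (-2) y = 0" using y by (auto simp: cocycles_def)
    have ye: "act (obj Y (-2)) y (eA 3) \<in> sp Y (-2)" using ys by (simp add: act_closed[OF bc_mod[OF bc]] eA_carrier)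
    have w3': "w3' \<in> sp Y (-2)" "act (obj Y (-2)) w3' (eA 3) = w3'" "dif Y (-2) w3' = act (obj Y (-1)) w2 (xA 2)"
      "act (obj Y (-2)) w3' (xA 3) \<in> coboundaries Y (-2)"
      using w3 ys ye y(2) unfolding w3'_def
      by (auto simp: rmod_diff[OF bc_mod[OF bc]] act_diff[OF bc_mod[OF bc]] eA_carrier act_eA_eA[OF bc_mod[OF bc]]
          dif_diff[OF bc] dif_act[OF bc] act_zero[OF bc_mod[OF bc]] act_eA_xA[OF bc_mod[OF bc]])
    obtain w4 where w4: "w4 \<in> sp Y (-2 - 1)" "act (obj Y (-2 - 1)) w4 (eA (Suc 3)) = w4" "dif Y (-2 - 1) w4 = act (obj Y (-2)) w3' (xA 3)"
      using lift_step[OF bc w3'(1,4)] by auto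
    have "act (obj Y (-3)) w4 (xA 4) \<in> coboundaries Y (-3)"
      by (rule odd_step[OF Y _ _ , of "-3" w4 w3' 3]) (use w4 w3' in auto)
    then obtain w5 where w5: "w5 \<in> sp Y (-3 - 1)" "act (obj Y (-3 - 1)) w5 (eA (Suc 4)) = w5" "dif Y (-3 - 1) w5 = act (obj Y (-3)) w4 (xA 4)"
      using lift_step[OF bc, of w4 "-3" 4] w4 by auto
    define w where "w a = (if a = 1 then v else if a = 2 then w2 else if a = 3 then w3' else if a = 4 then w4 else w5)" for a :: nat
    have fam: "w a \<in> sp Y (int j - int a) \<and> act (obj Y (int j - int a)) (w a) (eA a) = w a \<and>
       dif Y (int j - int a) (w a) = (if a = j then 0 else act (obj Y (int j - int (a - 1))) (w (a - 1)) (xA (a - 1)))"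
      if "a = 1 \<or> a = 2 \<or> a = 3 \<or> a = 4 \<or> a = 5" for a
      using that v vs w2 w3' w4 w5 unfolding 3 by (elim disjE) (simp_all add: w_def)
    have "a = 1 \<or> a = 2 \<or> a = 3 \<or> a = 4 \<or> a = 5" if "1 \<le> a" "a \<le> 5" for a :: nat using that by presburger
    then have "fam Y j 5 w"
      unfolding fam_def using fam 3 by blast
    then show ?thesis by (intro that[of w]) (auto simp: w_def 3)
  qed
qed

subsection \<open>Resolutions of simple modules\<close>

lemma Icx_diag: "Icx j j = stalk (proj_rmod j)"
proof -
  have "(\<lambda>n. if n \<le> 0 \<and> int j - n \<le> int j then proj_rmod (nat (int j - n)) else zero_rmod) =
      (\<lambda>n. if n = 0 then proj_rmod j else zero_rmod)"
    by (rule ext) auto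
  moreover have "(\<lambda>n v. if n < 0 \<and> int j - n \<le> int j \<and> v \<in> space (proj_rmod (nat (int j - n)))
      then vscale (v 0) (unit_vec 1) else 0) = (\<lambda>n v. 0)"
    by (intro ext) auto
  ultimately show ?thesis unfolding Icx_def stalk_def by simp
qed

text \<open>The augmentation onto S_j. For m = 5 it is a projective resolution; for j = 1 and m = 2
  it is the map whose cocone is \<open>Jcx\<close>.\<close>

definition aug :: "nat \<Rightarrow> nat \<Rightarrow> 'k::field cmap" where
  "aug j m = (\<lambda>n v. if n = 0 \<and> v \<in> sp (Icx j m) 0 then vscale (v 0) (unit_vec 0) else 0)"

lemma aug_cm:
  assumes j: "1 \<le> j" "j \<le> m" "m \<le> 5"
  shows "cm (Icx j m) (stalk (simple_rmod j)) (aug j m :: 'k::field cmap)"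
proof -
  have j5: "1 \<le> j" "j \<le> 5" using j by auto
  have M: "is_rmod (simple_rmod j :: 'k rmod)" using j by (simp add: simple_is_rmod)
  note P = proj_is_rmod[OF j5, where ?'a = 'k]
  note sb = stalk_bc[OF M]
  have u0: "vscale c (unit_vec 0) \<in> space (simple_rmod j :: 'k rmod)" for c
    by (auto simp: simple_space unit_vec_def)
  have "(aug j m :: 'k cmap) \<in> chain_maps (Icx j m) (stalk (simple_rmod j))"
  proof (rule chain_mapsI)
    show "(aug j m :: 'k cmap) n \<in> rmod_hom (obj (Icx j m) n) (obj (stalk (simple_rmod j)) n)" for n
    proof (cases "n = 0")
      case True
      have "(aug j m :: 'k cmap) 0 \<in> rmod_hom (proj_rmod j) (simple_rmod j)"
      proof (rule rmod_homI[OF P M])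
        show "aug j m 0 (act (proj_rmod j) v (eA i)) = act (simple_rmod j) (aug j m 0 v) (eA i)"
          if v: "v \<in> space (proj_rmod j)" and i: "1 \<le> i" "i \<le> 5" for v :: "'k vec" and i
          using j act_closed[OF P v eA_carrier[OF i]] v
          by (auto simp: aug_def Icx_obj0 proj_act_eA[OF v] simple_act_eA)
        show "aug j m 0 (act (proj_rmod j) v (xA i)) = act (simple_rmod j) (aug j m 0 v) (xA i)"
          if v: "v \<in> space (proj_rmod j)" and i: "1 \<le> i" "i \<le> 4" for v :: "'k vec" and i
          using j act_closed[OF P v xA_carrier, of i] v
          by (auto simp: aug_def Icx_obj0 proj_act_xA simple_act_xA)
      qed (use j u0[of 0] in \<open>auto simp: aug_def Icx_obj0 u0 rmod_add[OF P] rmod_scale[OF P] vec.scale_left_distrib\<close>)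
      then show ?thesis using True j by (simp add: Icx_obj0) (simp add: stalk_def)
    next
      case False
      then show ?thesis using rmod_hom_zero[OF bc_mod[OF sb]] by (simp add: aug_def)
    qed
    show "dif (stalk (simple_rmod j)) n (aug j m n v) = aug j m (n + 1) (dif (Icx j m) n v)" for n and v :: "'k vec"
      by (auto simp: stalk_def aug_def Icx_def)
  qed
  then show ?thesis using sb Icx_bc[OF j] by (simp add: cm_def)
qed

text \<open>A cocycle without top coefficient is a multiple of the socle of P_a, which is the
  differential of the top of P_(a+1); at the end, P_5 has no second basis vector. Outside degree 0
  the cocycle condition itself kills the top coefficient.\<close>

lemma Icx5_exact:
  assumes j: "1 \<le> j" "j \<le> 5" and v: "v \<in> cocycles (Icx j 5) n" and n: "n = 0 \<Longrightarrow> v 0 = 0"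
  shows "v \<in> coboundaries (Icx j 5 :: 'k::field complx) n"
proof (cases rule: Icx_cases[where i = j and m = 5 and n = n])
  case zero
  then have "v = 0" using v by (auto simp: cocycles_def Icx_zero)
  then show ?thesis using j by (auto intro!: coboundaries_zero Icx_bc)
next
  case (proj a)
  have bc: "is_bcomplex (Icx j 5 :: 'k complx)" using Icx_bc[of j 5] j by simp
  have vP: "v \<in> space (proj_rmod a)" using v proj by (simp add: cocycles_def Icx_obj)
  have v0: "v 0 = 0"
  proof (cases "a = j")
    case True then show ?thesis using n proj by simp
  next
    case False
    then have "vscale (v 0) (unit_vec 1) = 0" using v proj Icx_dif[of j a 5 v] vP by (simp add: cocycles_def)
    then show ?thesis by simp
  qed
  have vv: "v = vscale (v 1) (unit_vec 1)" using proj_basis[OF vP] v0 by simp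
  show ?thesis
  proof (cases "a = 5")
    case True
    then have "v 1 = 0" using vP by (simp add: proj_space)
    then have "v = 0" using vv by simp
    then show ?thesis using bc by (simp add: coboundaries_zero)
  next
    case False
    then have a: "j < Suc a" "Suc a \<le> 5" "j \<le> Suc a" using proj by auto
    have n: "n - 1 = int j - int (Suc a)" using proj by simp
    have s: "vscale (v 1) (unit_vec 0) \<in> space (proj_rmod (Suc a))"
      using a by (intro rmod_scale[OF proj_is_rmod]) auto
    have "dif (Icx j 5) (n - 1) (vscale (v 1) (unit_vec 0)) = v"
      unfolding n Icx_dif[OF a(1,2) s] using vv by simp
    then show ?thesis using coboundariesI2[OF bc, of n "vscale (v 1) (unit_vec 0)"] by simp
  qed
qed

lemma aug_qi:
  assumes j: "1 \<le> j" "j \<le> 5"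
  shows "qi (Icx j 5) (stalk (simple_rmod j)) (aug j 5 :: 'k::field cmap)"
proof -
  have M: "is_rmod (simple_rmod j :: 'k rmod)" using j by (simp add: simple_is_rmod)
  have c: "cm (Icx j 5) (stalk (simple_rmod j)) (aug j 5 :: 'k cmap)" using aug_cm[of j 5] j by simp
  have "(aug j 5 :: 'k cmap) \<in> quasi_isos (Icx j 5) (stalk (simple_rmod j))"
  proof (rule qiI)
    show "(aug j 5 :: 'k cmap) \<in> chain_maps (Icx j 5) (stalk (simple_rmod j))" using c by (simp add: cm_def)
    show "v \<in> coboundaries (Icx j 5) n"
      if "v \<in> cocycles (Icx j 5) n" "aug j 5 n v \<in> coboundaries (stalk (simple_rmod j)) n" for n and v :: "'k vec"
      using that by (intro Icx5_exact j) (auto simp: aug_def stalk_coboundaries[OF M] cocycles_def)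
    show "\<exists>v\<in>cocycles (Icx j 5) n. w - aug j 5 n v \<in> coboundaries (stalk (simple_rmod j)) n"
      if w: "w \<in> cocycles (stalk (simple_rmod j)) n" for n and w :: "'k vec"
    proof (cases "n = 0")
      case True
      then have ws: "\<forall>i\<ge>1. w i = 0" using w by (simp add: stalk_cocycles) (simp add: stalk_def simple_space)
      have ww: "w = vscale (w 0) (unit_vec 0)"
      proof
        fix i show "w i = vscale (w 0) (unit_vec 0) i" using ws by (cases i) auto
      qed
      have s: "vscale (w 0) (unit_vec 0) \<in> space (proj_rmod j)"
        using j by (intro rmod_scale[OF proj_is_rmod]) auto
      have "vscale (w 0) (unit_vec 0) \<in> cocycles (Icx j 5) 0"
        using s j by (simp add: cocycles_def Icx_obj0 Icx_dif_last)
      moreover have "aug j 5 0 (vscale (w 0) (unit_vec 0)) = w"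
        using s j ww by (simp add: aug_def Icx_obj0)
      ultimately show ?thesis using True by (intro bexI[of _ "vscale (w 0) (unit_vec 0)"]) (auto simp: stalk_coboundaries[OF M])
    next
      case False
      then have "w = 0" using w by (simp add: stalk_cocycles) (simp add: stalk_def)
      then show ?thesis using False j
        by (intro bexI[of _ 0]) (auto simp: stalk_coboundaries[OF M] aug_def intro!: cocycles_zero Icx_bc)
    qed
  qed
  then show ?thesis using c by (simp add: cm_def qi_def)
qed

lemma evex_qi:
  assumes "qi Z T g" "evex T"
  shows "evex Z"
proof -
  have b: "is_bcomplex Z" "is_bcomplex T" using assms by (auto simp: qi_def)
  have "direct_sum Db Z zero_cx T"
    by (rule iso_direct_sum_zero[OF roof_iso[OF qi_cid[OF b(1)] assms(1)] b])
  then show ?thesis using evex_summand assms(2) by blast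
qed

lemma evex_Icx_diag: "1 \<le> j \<Longrightarrow> j \<le> 5 \<Longrightarrow> evex (Icx j j)"
  using evex_stalk[OF proj_in_M_A, of j 0] by (simp add: Icx_diag)

lemma evex_Icx5: "j = 1 \<or> j = 3 \<or> j = 5 \<Longrightarrow> evex (Icx j 5)"
  using evex_qi[OF aug_qi, of j] evex_stalk[OF simple_in_M_A, of j 0] by auto

subsection \<open>Embedded sums of generators\<close>

definition img :: "'k::field complx \<Rightarrow> 'k complx \<Rightarrow> 'k cmap \<Rightarrow> int \<Rightarrow> 'k vec set" where
  "img X Z f n = {y \<in> cocycles X n. \<exists>z\<in>cocycles Z n. y - f n z \<in> coboundaries X n}"

text \<open>H(f) is injective, and Z is quasi-isomorphic to a sum of shifted generators. Z need not
  be that sum itself: a simple generator enters through its projective resolution, out of which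
  chain maps to X can be written down.\<close>

definition emb :: "'k::field complx \<Rightarrow> 'k complx \<Rightarrow> 'k cmap \<Rightarrow> bool" where
  "emb X Z f \<longleftrightarrow> cm Z X f \<and> (\<forall>n. \<forall>z\<in>cocycles Z n. f n z \<in> coboundaries X n \<longrightarrow> z \<in> coboundaries Z n) \<and>
     (\<exists>T Xs g. direct_sum_list Db Xs T \<and> set Xs \<subseteq> {shift (2 * i) (stalk M) |M i. M \<in> M_A} \<and> qi Z T g)"

text \<open>Purity of the submodule \<open>img\<close> of the cohomology: \<open>N \<inter> H x\<^sub>j = N x\<^sub>j\<close>.\<close>

definition pure_img :: "'k::field complx \<Rightarrow> 'k complx \<Rightarrow> 'k cmap \<Rightarrow> bool" where
  "pure_img X Z f \<longleftrightarrow> (\<forall>n j. \<forall>u\<in>cocycles X n. act (obj X n) u (xA j) \<in> img X Z f n \<longrightarrow>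
     (\<exists>y\<in>img X Z f n. act (obj X n) u (xA j) - act (obj X n) y (xA j) \<in> coboundaries X n))"

context
  fixes X Z :: "'k::field complx" and f
  assumes f: "cm Z X f"
begin

lemma img_bc: "is_bcomplex X" "is_bcomplex Z" "f \<in> chain_maps Z X"
  using f by (auto simp: cm_def)

lemma img_cocycles: "y \<in> img X Z f n \<Longrightarrow> y \<in> cocycles X n"
  by (simp add: img_def)

lemma img_coboundaries: "y \<in> coboundaries X n \<Longrightarrow> y \<in> img X Z f n"
  unfolding img_def using img_bc cm_zero[OF img_bc(2,1,3)]
  by (auto intro!: bexI[of _ 0] coboundaries_cocycles)

lemma img_subspace: "vec.subspace (img X Z f n)"
  unfolding vec.subspace_def
proof (intro conjI allI ballI)
  show "0 \<in> img X Z f n" using img_coboundaries img_bc by simp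
  show "v + w \<in> img X Z f n" if vw: "v \<in> img X Z f n" "w \<in> img X Z f n" for v w
  proof -
    obtain z z' where z: "z \<in> cocycles Z n" "v - f n z \<in> coboundaries X n" "z' \<in> cocycles Z n" "w - f n z' \<in> coboundaries X n"
      using vw by (auto simp: img_def)
    have "(v + w) - f n (z + z') = (v - f n z) + (w - f n z')"
      using z img_bc by (simp add: cm_add[OF img_bc(2,1,3)] cocycles_sp)
    also have "\<dots> \<in> coboundaries X n" by (rule coboundaries_add[OF img_bc(1) z(2,4)])
    finally show ?thesis using vw cocycles_add[OF img_bc(1)] cocycles_add[OF img_bc(2) z(1,3)] by (auto simp: img_def)
  qed
  show "vscale c v \<in> img X Z f n" if v: "v \<in> img X Z f n" for c v
  proof -
    obtain z where z: "z \<in> cocycles Z n" "v - f n z \<in> coboundaries X n" using v by (auto simp: img_def)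
    have "vscale c v - f n (vscale c z) = vscale c (v - f n z)"
      using z img_bc by (simp add: cm_scale[OF img_bc(2,1,3)] cocycles_sp vec.scale_right_diff_distrib)
    also have "\<dots> \<in> coboundaries X n" by (rule coboundaries_scale[OF img_bc(1) z(2)])
    finally show ?thesis using v cocycles_scale[OF img_bc(1)] cocycles_scale[OF img_bc(2) z(1)] by (auto simp: img_def)
  qed
qed

lemma img_add: "\<lbrakk>v \<in> img X Z f n; w \<in> img X Z f n\<rbrakk> \<Longrightarrow> v + w \<in> img X Z f n"
  by (rule vec.subspace_add[OF img_subspace])

lemma img_diff: "\<lbrakk>v \<in> img X Z f n; w \<in> img X Z f n\<rbrakk> \<Longrightarrow> v - w \<in> img X Z f n"
  by (rule vec.subspace_diff[OF img_subspace])

lemma img_scale: "v \<in> img X Z f n \<Longrightarrow> vscale c v \<in> img X Z f n"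
  by (rule vec.subspace_scale[OF img_subspace])

lemma img_scale_iff:
  assumes "v \<in> cocycles X n" "v \<notin> img X Z f n" "vscale c v \<in> img X Z f n"
  shows "c = 0"
proof (rule ccontr)
  assume "c \<noteq> 0"
  then have "vscale (inverse c) (vscale c v) = v" by (simp add: vscale_def fun_eq_iff)
  then show False using img_scale[OF assms(3), of "inverse c"] assms(2) by simp
qed

lemma img_act:
  assumes v: "v \<in> img X Z f n" and a: "a \<in> carrier algA"
  shows "act (obj X n) v a \<in> img X Z f n"
proof -
  obtain z where z: "z \<in> cocycles Z n" "v - f n z \<in> coboundaries X n" using v by (auto simp: img_def)
  have "act (obj X n) v a - f n (act (obj Z n) z a) = act (obj X n) (v - f n z) a"
    using z v a img_bc
    by (simp add: cm_act[OF img_bc(2,1,3)] cocycles_sp img_cocycles act_diff cm_closed[OF img_bc(2,1,3)])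
  also have "\<dots> \<in> coboundaries X n" by (rule coboundaries_act[OF img_bc(1) z(2) a])
  finally show ?thesis using v a cocycles_act[OF img_bc(1)] cocycles_act[OF img_bc(2) z(1) a] by (auto simp: img_def)
qed

end

text \<open>The hypothesis \<open>indep\<close> says that H(g) is injective and that its image meets
  the image N of H(f) only in 0, so the two together are injective on cohomology. The new image is
  the sum of both.\<close>

lemma emb_extend:
  assumes e: "emb X Z f" and g: "cm Y X g" and L: "L \<in> {shift (2 * i) (stalk M) |M i. M \<in> M_A}" "qi Y L q"
    and indep: "\<And>n y. \<lbrakk>y \<in> cocycles Y n; g n y \<in> img X Z f n\<rbrakk> \<Longrightarrow> y \<in> coboundaries Y n"
  shows "emb X (dsumc Y Z) (dcopair Y Z g f)"
    and "u \<in> img X (dsumc Y Z) (dcopair Y Z g f) n \<longleftrightarrow>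
      u \<in> cocycles X n \<and> (\<exists>y\<in>cocycles Y n. u - g n y \<in> img X Z f n)"
proof -
  have f: "cm Z X f" using e by (simp add: emb_def)
  have bc: "is_bcomplex X" "is_bcomplex Y" "is_bcomplex Z" and gc: "g \<in> chain_maps Y X" and fc: "f \<in> chain_maps Z X"
    using f g by (auto simp: cm_def)
  have app: "dcopair Y Z g f n z = g n (vfst z) + f n (vsnd z)" if "z \<in> cocycles (dsumc Y Z) n" for z n
    using that by (auto simp: dcopair_def dsumc_cocycles cocycles_sp bc)
  obtain T Xs h where T: "direct_sum_list Db Xs T" "set Xs \<subseteq> {shift (2 * i) (stalk M) |M i. M \<in> M_A}" "qi Z T h"
    using e by (auto simp: emb_def)
  have "z \<in> coboundaries (dsumc Y Z) n"
    if z: "z \<in> cocycles (dsumc Y Z) n" "dcopair Y Z g f n z \<in> coboundaries X n" for n z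
  proof -
    have zz: "vfst z \<in> cocycles Y n" "vsnd z \<in> cocycles Z n" using z(1) by (auto simp: dsumc_cocycles)
    have B: "g n (vfst z) + f n (vsnd z) \<in> coboundaries X n" using z app by simp
    have "g n (vfst z) - f n (- vsnd z) \<in> coboundaries X n"
      using B zz by (simp add: cm_neg[OF bc(3,1) fc] cocycles_sp bc)
    then have "g n (vfst z) \<in> img X Z f n"
      unfolding img_def using cm_cocycles[OF bc(2,1) gc zz(1)] cocycles_neg[OF bc(3) zz(2)] by blast
    then have y: "vfst z \<in> coboundaries Y n" by (rule indep[OF zz(1)])
    then have "g n (vfst z) \<in> coboundaries X n" by (rule cm_coboundaries[OF bc(2,1) gc])
    then have "f n (vsnd z) \<in> coboundaries X n" using coboundaries_diff[OF bc(1) B] by fastforce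
    then have "vsnd z \<in> coboundaries Z n" using e zz by (simp add: emb_def)
    then show ?thesis using y bc by (simp add: dsumc_coboundaries)
  qed
  moreover have "direct_sum_list Db (L # Xs) (dsumc L T)"
    using T(1) dsumc_direct_sum[of L T] L(2) T(3) by (auto simp: qi_def)
  moreover have "qi (dsumc Y Z) (dsumc L T) (dpair Y Z q h)" by (rule dpair_qi[OF L(2) T(3)])
  moreover have "set (L # Xs) \<subseteq> {shift (2 * i) (stalk M) |M i. M \<in> M_A}" using T(2) L(1) by auto
  ultimately show "emb X (dsumc Y Z) (dcopair Y Z g f)"
    unfolding emb_def using dcopair_cm[OF g f] by blast
  show "u \<in> img X (dsumc Y Z) (dcopair Y Z g f) n \<longleftrightarrow>
      u \<in> cocycles X n \<and> (\<exists>y\<in>cocycles Y n. u - g n y \<in> img X Z f n)"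
  proof
    assume u: "u \<in> img X (dsumc Y Z) (dcopair Y Z g f) n"
    then obtain z where z: "z \<in> cocycles (dsumc Y Z) n" "u - dcopair Y Z g f n z \<in> coboundaries X n"
      by (auto simp: img_def)
    have zz: "vfst z \<in> cocycles Y n" "vsnd z \<in> cocycles Z n" using z(1) by (auto simp: dsumc_cocycles)
    have "(u - g n (vfst z)) - f n (vsnd z) \<in> coboundaries X n"
      using z(2) app[OF z(1)] by (simp add: diff_diff_eq)
    then have "u - g n (vfst z) \<in> img X Z f n"
      unfolding img_def using zz u cocycles_diff[OF bc(1) _ cm_cocycles[OF bc(2,1) gc zz(1)]] by (auto simp: img_def)
    then show "u \<in> cocycles X n \<and> (\<exists>y\<in>cocycles Y n. u - g n y \<in> img X Z f n)" using zz u by (auto simp: img_def)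
  next
    assume "u \<in> cocycles X n \<and> (\<exists>y\<in>cocycles Y n. u - g n y \<in> img X Z f n)"
    then obtain y z where u: "u \<in> cocycles X n" "y \<in> cocycles Y n" "z \<in> cocycles Z n" "u - g n y - f n z \<in> coboundaries X n"
      by (auto simp: img_def)
    have c: "vpair y z \<in> cocycles (dsumc Y Z) n" using u by (simp add: dsumc_cocycles)
    then show "u \<in> img X (dsumc Y Z) (dcopair Y Z g f) n"
      unfolding img_def using u app[OF c] by (auto intro!: bexI[OF _ c] simp: diff_diff_eq)
  qed
qed

lemma shifted_cm:
  assumes "cm Y (shift n X) f" "is_bcomplex X"
  shows "cm (shift (- n) Y) X (\<lambda>m. f (m - n))"
  using shift_cm[of Y "shift n X" f "- n"] assms by (auto simp: cm_def shift_bc)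

text \<open>Adds the copy of P_j generated by v. Modulo N the elements v and v x_j are independent:
  multiplying a combination c v + d v x_j in N by x_j gives c v x_j in N, so c = 0, and then d = 0.
  Multiplications of the same kind show that purity survives.\<close>

lemma emb_add_projective:
  assumes e: "emb X Z f" and p: "pure_img X Z f" and n: "even n" and j: "1 \<le> j" "j \<le> 5"
    and v: "v \<in> cocycles X n" "act (obj X n) v (eA j) = v" "act (obj X n) v (xA j) \<notin> img X Z f n"
  obtains Z' f' where "emb X Z' f'" "pure_img X Z' f'" "\<And>m. img X Z f m \<subseteq> img X Z' f' m" "v \<in> img X Z' f' n"
proof -
  have f: "cm Z X f" using e by (simp add: emb_def)
  note X = img_bc(1)[OF f]
  let ?I = "img X Z f"
  let ?vx = "act (obj X n) v (xA j)"
  have vs: "v \<in> sp X n" using v X by (simp add: cocycles_sp)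
  have vxc: "?vx \<in> cocycles X n" using v X by (simp add: cocycles_act)
  have vn: "v \<notin> ?I n" using v(3) img_act[OF f _ xA_carrier] by blast
  define Y where "Y = shift (- n) (Icx j j :: 'a complx)"
  define g where "g = (\<lambda>m. imap (shift n X) j j (\<lambda>a. v) 0 (m - n))"
  have jj: "1 \<le> j" "j \<le> j" "j \<le> 5" using j by auto
  have "fam (shift n X) j j (\<lambda>a. v)" using v X by (auto simp: fam_def cocycles_def)
  then have g: "cm Y X g" unfolding Y_def g_def
    by (intro shifted_cm imap_cm[OF jj] shift_bc X)
  obtain i where i: "- n = 2 * i" using n by (metis evenE even_minus)
  have L: "Y \<in> {shift (2 * i) (stalk M) |M i. M \<in> M_A}"
    unfolding Y_def Icx_diag i using proj_in_M_A[OF j] by blast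
  have q: "qi Y Y (cid Y)" using g by (auto simp: cm_def intro: qi_cid)
  have Yc: "m = n \<and> y \<in> space (proj_rmod j) \<and> g n y = vscale (y 0) v + vscale (y 1) ?vx \<or> y = 0 \<and> g m y = 0"
    if y: "y \<in> cocycles Y m" for m y
  proof (cases "m = n")
    case True
    then have "y \<in> space (proj_rmod j)" using y by (simp add: Y_def cocycles_def Icx_obj0)
    then show ?thesis using True imap_apply[of j j j "shift n X" "\<lambda>a. v" 0] by (simp add: g_def pmap_def)
  next
    case False
    then have "\<not> (m - n \<le> 0 \<and> int j - (m - n) \<le> int j)" by auto
    then have "y = 0" using y by (simp add: Y_def cocycles_def Icx_zero)
    then show ?thesis using g cm_zero[of Y X g m] by (simp add: cm_def)
  qed
  have indep: "y \<in> coboundaries Y m" if y: "y \<in> cocycles Y m" "g m y \<in> ?I m" for m y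
  proof -
    have "y = 0"
    proof (rule ccontr)
      assume "y \<noteq> 0"
      then have mn: "m = n" "y \<in> space (proj_rmod j)" "g n y = vscale (y 0) v + vscale (y 1) ?vx" using Yc[OF y(1)] by auto
      have "act (obj X n) (g n y) (xA j) \<in> ?I n" using img_act[OF f y(2) xA_carrier] mn by simp
      moreover have "act (obj X n) (g n y) (xA j) = vscale (y 0) ?vx"
        unfolding mn(3) using vs X by (simp add: act_add rmod_scale act_scale act_closed act_xA_xA)
      ultimately have y0: "y 0 = 0" using img_scale_iff[OF f vxc v(3)] by simp
      then have "y 1 = 0" using y(2) mn img_scale_iff[OF f vxc v(3)] by simp
      then show False using proj_basis[OF mn(2)] y0 \<open>y \<noteq> 0\<close> by simp
    qed
    then show ?thesis using g by (simp add: cm_def coboundaries_zero)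
  qed
  let ?Z = "dsumc Y Z" and ?f = "dcopair Y Z g f"
  note ext = emb_extend[OF e g L q indep]
  have mono: "?I m \<subseteq> img X ?Z ?f m" for m
  proof
    fix u assume "u \<in> ?I m"
    moreover have "g m 0 = 0" "0 \<in> cocycles Y m" using g by (auto simp: cm_def)
    ultimately show "u \<in> img X ?Z ?f m"
      using img_cocycles[OF f] by (intro iffD2[OF ext(2)] conjI bexI[of _ 0]) auto
  qed
  have "unit_vec 0 \<in> cocycles Y n" by (simp add: Y_def cocycles_def Icx_obj0 Icx_dif_last)
  moreover have "g n (unit_vec 0) = v" using imap_apply[of j j j "shift n X" "\<lambda>a. v" 0] by (simp add: g_def pmap_def)
  ultimately have vin: "v \<in> img X ?Z ?f n"
    using v img_coboundaries[OF f] X by (intro iffD2[OF ext(2)] conjI bexI[of _ "unit_vec 0"]) auto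
  note f' = dcopair_cm[OF g f]
  have "pure_img X ?Z ?f"
    unfolding pure_img_def
  proof (intro allI ballI impI)
    fix m i u assume u: "u \<in> cocycles X m" "act (obj X m) u (xA i) \<in> img X ?Z ?f m"
    let ?ux = "act (obj X m) u (xA i)"
    have us: "u \<in> sp X m" using u X by (simp add: cocycles_sp)
    obtain y where y: "y \<in> cocycles Y m" "?ux - g m y \<in> ?I m" using iffD1[OF ext(2) u(2)] by blast
    have in_I: "\<exists>y\<in>img X ?Z ?f m. ?ux - act (obj X m) y (xA i) \<in> coboundaries X m" if "?ux \<in> ?I m"
      using p u(1) that mono unfolding pure_img_def by blast
    show "\<exists>y\<in>img X ?Z ?f m. ?ux - act (obj X m) y (xA i) \<in> coboundaries X m"
    proof (cases "g m y = 0")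
      case True
      then show ?thesis using y(2) in_I by simp
    next
      case False
      then have mn: "m = n" "g n y = vscale (y 0) v + vscale (y 1) ?vx" using Yc[OF y(1)] by auto
      note us = us[unfolded mn(1)]
      have cl: "?vx \<in> sp X n" "vscale c v \<in> sp X n" "vscale c ?vx \<in> sp X n" "act (obj X n) u (xA i) \<in> sp X n" for c
        using vs us X by (auto simp: rmod_scale act_closed)
      have D: "act (obj X n) u (xA i) - (vscale (y 0) v + vscale (y 1) ?vx) \<in> ?I n" using y(2) mn by simp
      \<comment> \<open>Since u x_i x_j = 0, multiplication by x_j isolates the coefficient of
        v.\<close>
      have "act (obj X n) (act (obj X n) u (xA i) - (vscale (y 0) v + vscale (y 1) ?vx)) (xA j) = vscale (- y 0) ?vx"
        using vs us X cl by (simp add: act_diff act_add rmod_add act_scale act_xA_xA vec.scale_minus_left)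
      then have "- y 0 = 0" using img_act[OF f D xA_carrier, of j] img_scale_iff[OF f vxc v(3), of "- y 0"] by simp
      then have D': "act (obj X n) u (xA i) - vscale (y 1) ?vx \<in> ?I n" using D by simp
      show ?thesis
      proof (cases "i = j")
        case True
        \<comment> \<open>For i = j the term in v x_j is absorbed by replacing u with u - c v, c
          being the coefficient \<open>y 1\<close>; its product with x_j lies in N, so purity of N
          applies.\<close>
        have uc: "u - vscale (y 1) v \<in> cocycles X n"
          using u(1) v(1) mn X by (simp add: cocycles_diff cocycles_scale)
        have eq: "act (obj X n) (u - vscale (y 1) v) (xA j) = act (obj X n) u (xA i) - vscale (y 1) ?vx"
          using True us vs X cl by (simp add: act_diff act_scale)
        obtain y' where y': "y' \<in> ?I n" "act (obj X n) u (xA i) - vscale (y 1) ?vx - act (obj X n) y' (xA j) \<in> coboundaries X n"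
          using p uc D' eq unfolding pure_img_def by metis
        have "y' + vscale (y 1) v \<in> img X ?Z ?f n"
          using y' mono vin by (auto intro!: img_add[OF f'] img_scale[OF f'])
        moreover have "act (obj X n) u (xA i) - act (obj X n) (y' + vscale (y 1) v) (xA i) \<in> coboundaries X n"
          using y' True vs X cl img_cocycles[OF f y'(1)] by (simp add: act_add act_scale cocycles_sp algebra_simps)
        ultimately show ?thesis using mn by blast
      next
        case False
        have j4: "j \<le> 4"
        proof (rule ccontr)
          assume "\<not> j \<le> 4"
          then have "?vx = 0" using act_xA_high[OF bc_mod[OF X] vs, of j] by simp
          then show False using v(3) img_coboundaries[OF f] X by simp
        qed
        have sj: "1 \<le> Suc j" "Suc j \<le> 5" using j4 by auto
        \<comment> \<open>For i different from j the products u x_i and v x_j lie at different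
          vertices, and e_(j+1) isolates the coefficient of v x_j.\<close>
        have "act (obj X n) (act (obj X n) u (xA i) - vscale (y 1) ?vx) (eA (Suc j)) = vscale (- y 1) ?vx"
          using False us vs X cl sj by (simp add: act_diff act_scale eA_carrier act_xA_eA vec.scale_minus_left)
        then have "- y 1 = 0" using img_act[OF f D' eA_carrier[OF sj]] img_scale_iff[OF f vxc v(3), of "- y 1"] by simp
        then show ?thesis using D' in_I mn by simp
      qed
    qed
  qed
  then show ?thesis using that[of ?Z ?f] ext(1) mono vin by blast
qed

text \<open>Purity gives t in N with t x_j = v x_j in cohomology; subtracting t e_j yields v' killed
  by x_j. For j = 2 and j = 4 exactness would put v' into H x_(j-1), which lies in N. So j is 1, 3
  or 5, and v' extends to a map from the resolution of S_j. Purity is kept because all products with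
  arrows lie in the old image already.\<close>

lemma emb_add_simple:
  assumes X: "evex X" and e: "emb X Z f" and p: "pure_img X Z f" and n: "even n" and j: "1 \<le> j" "j \<le> 5"
    and all: "\<And>m i u. u \<in> cocycles X m \<Longrightarrow> act (obj X m) u (xA i) \<in> img X Z f m"
    and v: "v \<in> cocycles X n" "act (obj X n) v (eA j) = v" "v \<notin> img X Z f n"
  obtains Z' f' where "emb X Z' f'" "pure_img X Z' f'" "\<And>m. img X Z f m \<subseteq> img X Z' f' m" "v \<in> img X Z' f' n"
proof -
  have f: "cm Z X f" using e by (simp add: emb_def)
  note bc = img_bc(1)[OF f]
  let ?I = "img X Z f"
  have vs: "v \<in> sp X n" using v bc by (simp add: cocycles_sp)
  obtain t where t: "t \<in> ?I n" "act (obj X n) v (xA j) - act (obj X n) t (xA j) \<in> coboundaries X n"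
    using p v(1) all[OF v(1)] unfolding pure_img_def by blast
  note te = img_act[OF f t(1) eA_carrier[OF j]]
  have ts: "t \<in> sp X n" "act (obj X n) t (eA j) \<in> sp X n"
    using t(1) te bc by (auto dest: img_cocycles[OF f] simp: cocycles_sp)
  define v' where "v' = v - act (obj X n) t (eA j)"
  have v': "v' \<in> cocycles X n" "act (obj X n) v' (eA j) = v'" "act (obj X n) v' (xA j) \<in> coboundaries X n" "v' \<notin> ?I n"
  proof -
    show "v' \<in> cocycles X n" unfolding v'_def using v(1) img_cocycles[OF f te] bc by (simp add: cocycles_diff)
    show "act (obj X n) v' (eA j) = v'" unfolding v'_def
      using v(2) vs ts j bc by (simp add: act_diff eA_carrier act_eA_eA)
    show "act (obj X n) v' (xA j) \<in> coboundaries X n" unfolding v'_def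
      using t(2) vs ts j bc by (simp add: act_diff act_eA_xA)
    show "v' \<notin> ?I n"
    proof
      assume "v' \<in> ?I n"
      then have "v' + act (obj X n) t (eA j) \<in> ?I n" by (rule img_add[OF f _ te])
      then show False using v(3) by (simp add: v'_def)
    qed
  qed
  have "j = 1 \<or> j = 3 \<or> j = 5"
  proof (rule ccontr)
    assume "\<not> (j = 1 \<or> j = 3 \<or> j = 5)"
    then have "j = 2 \<or> j = 4" using j by auto
    then have "ex_at X n j" using X by (auto simp: evex_def)
    then obtain y where y: "y \<in> cocycles X n" "v' - act (obj X n) y (xA (j - 1)) \<in> coboundaries X n"
      using v' unfolding ex_at_def by blast
    have "(v' - act (obj X n) y (xA (j - 1))) + act (obj X n) y (xA (j - 1)) \<in> ?I n"
      by (rule img_add[OF f img_coboundaries[OF f y(2)] all[OF y(1)]])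
    then show False using v'(4) by simp
  qed
  note j135 = this
  have "evex (shift n X)" by (rule evex_shift[OF X n])
  moreover have "v' \<in> cocycles (shift n X) 0" "act (obj (shift n X) 0) v' (eA j) = v'"
    "act (obj (shift n X) 0) v' (xA j) \<in> coboundaries (shift n X) 0"
    using v' bc by (auto simp: shift_coboundaries)
  ultimately obtain w where w: "fam (shift n X) j 5 w" "w j = v'" using evex_lift j135 by blast
  define Y where "Y = shift (- n) (Icx j 5 :: 'a complx)"
  define g where "g = (\<lambda>m. imap (shift n X) j 5 w 0 (m - n))"
  have j5: "1 \<le> j" "j \<le> 5" "(5::nat) \<le> 5" using j by auto
  have g: "cm Y X g" unfolding Y_def g_def
    by (intro shifted_cm imap_cm[OF j5] shift_bc bc w)
  obtain i where i: "- n = 2 * i" using n by (metis evenE even_minus)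
  define L where "L = shift (- n) (stalk (simple_rmod j :: 'a rmod))"
  have L: "L \<in> {shift (2 * i) (stalk M) |M i. M \<in> M_A}"
    unfolding L_def i using simple_in_M_A[OF j135] by blast
  have q: "qi Y L (\<lambda>m. aug j 5 (m - n))"
    using aug_qi[OF j] shift_qi[of "Icx j 5" "stalk (simple_rmod j)" "aug j 5" "- n"]
    by (auto simp: qi_def Y_def L_def shift_bc)
  have Ybc: "is_bcomplex (Icx j 5 :: 'a complx)" by (rule Icx_bc[OF j5])
  have indep: "y \<in> coboundaries Y m" if y: "y \<in> cocycles Y m" "g m y \<in> ?I m" for m y
  proof -
    have yc: "y \<in> cocycles (Icx j 5) (m - n)" using y(1) by (simp add: Y_def)
    have "y 0 = 0" if mn: "m - n = 0"
    proof -
      have yP: "y \<in> space (proj_rmod j)" using yc mn j by (simp add: cocycles_def Icx_obj0)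
      have eq: "g n y = vscale (y 0) v' + vscale (y 1) (act (obj X n) v' (xA j))"
        using imap_apply[of j j 5 "shift n X" w 0] j yP by (simp add: g_def pmap_def w(2))
      have "vscale (y 1) (act (obj X n) v' (xA j)) \<in> ?I n"
        by (rule img_scale[OF f img_coboundaries[OF f v'(3)]])
      then have "vscale (y 0) v' \<in> ?I n" using y(2) mn eq img_diff[OF f, of "g n y"] by fastforce
      then show ?thesis using img_scale_iff[OF f v'(1,4)] by blast
    qed
    then have "y \<in> coboundaries (Icx j 5) (m - n)" by (intro Icx5_exact[OF j yc]) auto
    then show ?thesis by (simp add: Y_def shift_coboundaries[OF Ybc])
  qed
  let ?Z = "dsumc Y Z" and ?f = "dcopair Y Z g f"
  note ext = emb_extend[OF e g L q indep]
  have mono: "?I m \<subseteq> img X ?Z ?f m" for m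
  proof
    fix u assume "u \<in> ?I m"
    moreover have "g m 0 = 0" "0 \<in> cocycles Y m" using g by (auto simp: cm_def)
    ultimately show "u \<in> img X ?Z ?f m"
      using img_cocycles[OF f] by (intro iffD2[OF ext(2)] conjI bexI[of _ 0]) auto
  qed
  have u0: "unit_vec 0 \<in> cocycles Y n" using j by (simp add: Y_def cocycles_def Icx_obj0 Icx_dif_last)
  have "g n (unit_vec 0) = v'" using imap_apply[of j j 5 "shift n X" w 0] j by (simp add: g_def pmap_def w(2))
  then have vin: "v \<in> img X ?Z ?f n"
    using v(1) te u0 by (intro iffD2[OF ext(2)] conjI bexI[of _ "unit_vec 0"]) (auto simp: v'_def)
  have "pure_img X ?Z ?f"
    using p all mono unfolding pure_img_def by blast
  then show ?thesis using that[of ?Z ?f] ext(1) mono vin by blast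
qed

text \<open>The triples record degree, vertex and cocycle. Their finiteness makes the exhaustion of
  the cohomology terminate, and cutting a spanning set down to vertices makes each generator the
  possible image of the top of a projective.\<close>

lemma homogeneous_generators:
  assumes X: "is_bcomplex X"
  obtains G where "finite G"
    "\<And>n j v. (n, j, v) \<in> G \<Longrightarrow> even n \<and> 1 \<le> j \<and> j \<le> 5 \<and> v \<in> cocycles X n \<and> act (obj X n) v (eA j) = v"
    "\<And>n u. even n \<Longrightarrow> u \<in> cocycles X n \<Longrightarrow> u \<in> vec.span {v. \<exists>j. (n, j, v) \<in> G}"
proof -
  have "\<exists>G. finite G \<and> G \<subseteq> cocycles X n \<and> cocycles X n = vec.span G" for n
    using rmod_finite_gens[OF bc_mod[OF X] cocycles_subspace[OF X]] cocycles_sp[OF X] by (metis subsetI)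
  then obtain B where B: "\<And>n. finite (B n)" "\<And>n. B n \<subseteq> cocycles X n" "\<And>n. cocycles X n = vec.span (B n)" by metis
  define F where "F = {n. sp X n \<noteq> {0} \<and> even n}"
  have F: "finite F" using X unfolding F_def is_bcomplex_def by (auto elim: rev_finite_subset)
  define G where "G = (\<Union>n\<in>F. \<Union>v\<in>B n. \<Union>j\<in>{1..5}. {(n, j, act (obj X n) v (eA j))})"
  have finG: "finite G" unfolding G_def using F B by auto
  have G1: "even n \<and> 1 \<le> j \<and> j \<le> 5 \<and> v \<in> cocycles X n \<and> act (obj X n) v (eA j) = v" if "(n, j, v) \<in> G" for n j v
    using that B(2) X unfolding G_def F_def
    by (auto simp: eA_carrier subset_iff act_eA_eA cocycles_sp intro!: cocycles_act)
  have G2: "u \<in> vec.span {v. \<exists>j. (n, j, v) \<in> G}" (is "u \<in> vec.span ?H") if n: "even n" and u: "u \<in> cocycles X n" for n u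
  proof (cases "n \<in> F")
    case True
    have "b \<in> vec.span ?H" if b: "b \<in> B n" for b
    proof -
      have bs: "b \<in> sp X n" using b B(2)[of n] cocycles_sp[OF X] by blast
      have "act (obj X n) b (eA j) \<in> vec.span ?H" if "j \<in> {1..5}" for j
        by (rule vec.span_base) (use True b that in \<open>auto simp: G_def\<close>)
      then have "act (obj X n) b (eA 1) + (act (obj X n) b (eA 2) + (act (obj X n) b (eA 3) +
          (act (obj X n) b (eA 4) + act (obj X n) b (eA 5)))) \<in> vec.span ?H"
        by (intro vec.span_add) auto
      then show ?thesis using rmod_vertices[OF bc_mod[OF X] bs] by simp
    qed
    then have "vec.span (B n) \<subseteq> vec.span ?H" by (intro vec.span_minimal) auto
    then show ?thesis using u B(3) by blast
  next
    case False
    then have "u = 0" using u n X by (auto simp: F_def dest: cocycles_sp)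
    then show ?thesis by (simp add: vec.span_zero)
  qed
  show ?thesis using that finG G1 G2 by blast
qed

text \<open>The generators are treated one at a time; the image N only grows, so what was reached is
  kept. The first pass brings v x_j into N for every generator, hence by linearity all products of
  cocycles with arrows, as \<open>emb_add_simple\<close> demands in the second pass. Odd degrees
  contain only coboundaries. At the end H(f) is bijective.\<close>

lemma evex_U_A:
  assumes X: "evex X"
  shows "X \<in> U_A"
proof -
  have bc: "is_bcomplex X" using X by (simp add: evex_def)
  obtain G where G: "finite G"
    "\<And>n j v. (n, j, v) \<in> G \<Longrightarrow> even n \<and> 1 \<le> j \<and> j \<le> 5 \<and> v \<in> cocycles X n \<and> act (obj X n) v (eA j) = v"
    "\<And>n u. even n \<Longrightarrow> u \<in> cocycles X n \<Longrightarrow> u \<in> vec.span {v. \<exists>j. (n, j, v) \<in> G}"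
    by (rule homogeneous_generators[OF bc]) blast
  have odd: "u \<in> img X Z f n" if "cm Z X f" "u \<in> cocycles X n" "odd n" for Z f u n
    using img_coboundaries[OF that(1)] X that(2,3) unfolding evex_def by blast
  have start: "emb X zero_cx (\<lambda>n v. 0)" "pure_img X zero_cx (\<lambda>n v. 0)"
  proof -
    have z: "z \<in> coboundaries zero_cx n" if "z \<in> cocycles zero_cx n" for z n
      using that coboundaries_zero[OF zero_cx_bc] by (simp add: cocycles_def)
    have "direct_sum_list Db [] zero_cx" using zero_cx_zero_object by simp
    then show "emb X zero_cx (\<lambda>n v. 0)"
      unfolding emb_def using z cm_zero_map[OF zero_cx_bc bc] qi_cid[OF zero_cx_bc] by fastforce
    have "img X zero_cx (\<lambda>n v. 0) n = coboundaries X n" for n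
      unfolding img_def using bc coboundaries_cocycles[OF bc] by (auto intro!: exI[of _ 0] simp: cocycles_zero)
    then show "pure_img X zero_cx (\<lambda>n v. 0)"
      unfolding pure_img_def using bc by (auto intro!: bexI[of _ 0] simp: act_zero)
  qed
  have "\<exists>Z f. emb X Z f \<and> pure_img X Z f \<and> (\<forall>n j v. (n, j, v) \<in> G' \<longrightarrow> act (obj X n) v (xA j) \<in> img X Z f n)"
    if "finite G'" "G' \<subseteq> G" for G'
    using that
  proof (induction G')
    case empty
    then show ?case using start by auto
  next
    case (insert x G')
    obtain n j v where x: "x = (n, j, v)" by (cases x)
    have v: "even n" "1 \<le> j" "j \<le> 5" "v \<in> cocycles X n" "act (obj X n) v (eA j) = v"
      using G(2)[of n j v] insert.prems x by auto
    obtain Z f where Z: "emb X Z f" "pure_img X Z f" "\<And>n j v. (n, j, v) \<in> G' \<Longrightarrow> act (obj X n) v (xA j) \<in> img X Z f n"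
      using insert.IH[OF subset_trans[OF subset_insertI insert.prems]] by metis
    show ?case
    proof (cases "act (obj X n) v (xA j) \<in> img X Z f n")
      case True
      then have "\<forall>m i w. (m, i, w) \<in> insert x G' \<longrightarrow> act (obj X m) w (xA i) \<in> img X Z f m"
        using Z(3) x by blast
      then show ?thesis using Z(1,2) by blast
    next
      case False
      then obtain Z' f' where Z': "emb X Z' f'" "pure_img X Z' f'" "\<And>m. img X Z f m \<subseteq> img X Z' f' m" "v \<in> img X Z' f' n"
        using emb_add_projective[OF Z(1,2) v(1-5)] by blast
      have "act (obj X n) v (xA j) \<in> img X Z' f' n"
        using Z'(1,4) img_act xA_carrier unfolding emb_def by blast
      have "act (obj X m) w (xA i) \<in> img X Z' f' m" if "(m, i, w) \<in> insert x G'" for m i w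
        using that Z(3)[of m i w] Z'(3)[of m] \<open>act (obj X n) v (xA j) \<in> img X Z' f' n\<close> x by blast
      then have "\<forall>m i w. (m, i, w) \<in> insert x G' \<longrightarrow> act (obj X m) w (xA i) \<in> img X Z' f' m" by blast
      then show ?thesis using Z'(1,2) by blast
    qed
  qed
  from this[OF G(1) order_refl] obtain Z f where Z: "emb X Z f" "pure_img X Z f"
    and Zx: "\<And>n j v. (n, j, v) \<in> G \<Longrightarrow> act (obj X n) v (xA j) \<in> img X Z f n" by metis
  have f: "cm Z X f" using Z by (simp add: emb_def)
  have all: "act (obj X m) u (xA i) \<in> img X Z f m" if u: "u \<in> cocycles X m" for m i u
  proof (cases "even m")
    case False
    then show ?thesis using odd[OF f] cocycles_act[OF bc u xA_carrier] by blast
  next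
    case True
    let ?W = "{u \<in> sp X m. act (obj X m) u (xA i) \<in> img X Z f m}"
    have "vec.subspace ?W"
      unfolding vec.subspace_def using img_add[OF f] img_scale[OF f] img_coboundaries[OF f] bc
      by (auto simp: rmod_add rmod_scale act_add act_scale act_zero)
    moreover have "{v. \<exists>j. (m, j, v) \<in> G} \<subseteq> ?W"
    proof safe
      fix j v assume g: "(m, j, v) \<in> G"
      note g' = G(2)[OF g]
      show vs: "v \<in> sp X m" using g' bc by (auto simp: cocycles_sp)
      show "act (obj X m) v (xA i) \<in> img X Z f m"
      proof (cases "i = j")
        case True
        then show ?thesis using Zx[OF g] by simp
      next
        case False
        then have "act (obj X m) v (xA i) = 0" using act_eA_xA[OF bc_mod[OF bc] vs, of j i] g' by auto
        then show ?thesis using img_coboundaries[OF f] bc by simp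
      qed
    qed
    ultimately have "vec.span {v. \<exists>j. (m, j, v) \<in> G} \<subseteq> ?W" by (intro vec.span_minimal)
    then show ?thesis using G(3)[OF True u] by blast
  qed
  have "\<exists>Z' f'. emb X Z' f' \<and> pure_img X Z' f' \<and> (\<forall>m. img X Z f m \<subseteq> img X Z' f' m) \<and> (\<forall>n j v. (n, j, v) \<in> G' \<longrightarrow> v \<in> img X Z' f' n)"
    if "finite G'" "G' \<subseteq> G" for G'
    using that
  proof (induction G')
    case empty
    then show ?case using Z by auto
  next
    case (insert x G')
    obtain n j v where x: "x = (n, j, v)" by (cases x)
    have v: "even n" "1 \<le> j" "j \<le> 5" "v \<in> cocycles X n" "act (obj X n) v (eA j) = v"
      using G(2)[of n j v] insert.prems x by auto
    obtain Z1 f1 where Z1: "emb X Z1 f1" "pure_img X Z1 f1" "\<And>m. img X Z f m \<subseteq> img X Z1 f1 m"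
        "\<And>n j v. (n, j, v) \<in> G' \<Longrightarrow> v \<in> img X Z1 f1 n"
      using insert.IH[OF subset_trans[OF subset_insertI insert.prems]] by metis
    show ?case
    proof (cases "v \<in> img X Z1 f1 n")
      case True
      then have "\<forall>m i w. (m, i, w) \<in> insert x G' \<longrightarrow> w \<in> img X Z1 f1 m"
        using Z1(4) x by blast
      then show ?thesis using Z1(1-3) by blast
    next
      case False
      have "act (obj X m) u (xA i) \<in> img X Z1 f1 m" if "u \<in> cocycles X m" for m i u
        using all[OF that] Z1(3) by blast
      then obtain Z' f' where Z': "emb X Z' f'" "pure_img X Z' f'" "\<And>m. img X Z1 f1 m \<subseteq> img X Z' f' m" "v \<in> img X Z' f' n"
        by (rule emb_add_simple[OF X Z1(1,2) v(1-3) _ v(4,5) False]) blast+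
      have "w \<in> img X Z' f' m" if "(m, i, w) \<in> insert x G'" for m i w
        using that Z1(4)[of m i w] Z'(3)[of m] Z'(4) x by blast
      then have "\<forall>m i w. (m, i, w) \<in> insert x G' \<longrightarrow> w \<in> img X Z' f' m" by blast
      moreover have "\<forall>m. img X Z f m \<subseteq> img X Z' f' m" using Z1(3) Z'(3) by blast
      ultimately show ?thesis using Z'(1,2) by blast
    qed
  qed
  from this[OF G(1) order_refl] obtain Z' f' where Z': "emb X Z' f'"
    and Z'v: "\<And>n j v. (n, j, v) \<in> G \<Longrightarrow> v \<in> img X Z' f' n" by metis
  have f': "cm Z' X f'" using Z' by (simp add: emb_def)
  have full: "u \<in> img X Z' f' n" if u: "u \<in> cocycles X n" for n u
  proof (cases "even n")
    case False
    then show ?thesis using odd[OF f'] u by blast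
  next
    case True
    have "vec.span {v. \<exists>j. (n, j, v) \<in> G} \<subseteq> img X Z' f' n"
      using Z'v by (intro vec.span_minimal img_subspace[OF f']) auto
    then show ?thesis using G(3)[OF True u] by blast
  qed
  have "f' \<in> quasi_isos Z' X"
  proof (rule qiI)
    show "f' \<in> chain_maps Z' X" using f' by (simp add: cm_def)
    show "v \<in> coboundaries Z' n" if "v \<in> cocycles Z' n" "f' n v \<in> coboundaries X n" for n v
      using Z' that by (simp add: emb_def)
    show "\<exists>v\<in>cocycles Z' n. w - f' n v \<in> coboundaries X n" if "w \<in> cocycles X n" for n w
      using full[OF that] by (simp add: img_def)
  qed
  then have "qi Z' X f'" using f' by (simp add: qi_def cm_def)
  then show ?thesis using Z' U_A_I unfolding emb_def by blast
qed

section \<open>Consequences of rigidity: no odd cohomology, exactness at 4 and at 2\<close>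

section \<open>Rigid subcategories\<close>

lemma Qm_eq_zero:
  assumes f: "cm X Y f" and eq: "Qm X Y f = Qm X Y (\<lambda>n v. 0)"
  obtains W a where "qi W X a" "ht W Y (f \<circ>\<^sub>c a) (\<lambda>n v. 0)"
proof -
  have b: "is_bcomplex X" "is_bcomplex Y" using f by (auto simp: cm_def)
  let ?r = "\<lparr>src = X, tgt = Y, apex = X, den = cid X, num = f\<rparr>"
    and ?s = "\<lparr>src = X, tgt = Y, apex = X, den = cid X, num = \<lambda>n v. 0\<rparr>"
  have "?s \<in> roof_class ?r"
    using eq roof_rel_refl[OF Qm_roof[OF cm_zero_map[OF b]]] unfolding Qm_def by (simp add: mem_roof_class)
  then have "(?r, ?s) \<in> roof_rel" by (simp add: mem_roof_class)
  then obtain W a c where W: "qi W X a" "ht W Y (f \<circ>\<^sub>c a) ((\<lambda>n v. 0) \<circ>\<^sub>c c)"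
    unfolding roof_rel_iff by auto
  then show ?thesis using that by (simp add: ccomp_zero)
qed

lemma hom_vanishes_null:
  assumes "hom_vanishes Db X Y" "cm X Y f"
  obtains W a where "qi W X a" "ht W Y (f \<circ>\<^sub>c a) (\<lambda>n v. 0)"
proof -
  have "Qm X Y f \<in> {Qm X Y (\<lambda>n v. 0)}"
    using assms Qm_hom[OF assms(2)] by (simp add: hom_vanishes_def)
  then show ?thesis using Qm_eq_zero[OF assms(2)] that by blast
qed

text \<open>Vanishing in the derived category gives a null homotopy only after a quasi-isomorphism
  onto the source. For \<open>Icx i m\<close> this quasi-isomorphism has a section, along which the
  homotopy is pulled back.\<close>

lemma hom_vanishes_Icx_null:
  assumes im: "1 \<le> i" "i \<le> m" "m \<le> 5" and v: "hom_vanishes Db (Icx i m) Y" and f: "cm (Icx i m) Y f"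
  shows "ht (Icx i m) Y f (\<lambda>n v. 0)"
proof -
  obtain W a where W: "qi W (Icx i m) a" "ht W Y (f \<circ>\<^sub>c a) (\<lambda>n v. 0)" using hom_vanishes_null[OF v f] .
  obtain s where s: "cm (Icx i m) W s" "a \<circ>\<^sub>c s = cid (Icx i m)" using Icx_section[OF im W(1)] .
  have "ht (Icx i m) Y ((f \<circ>\<^sub>c a) \<circ>\<^sub>c s) ((\<lambda>n v. 0) \<circ>\<^sub>c s)" by (rule ht_right[OF W(2) s(1)])
  then show ?thesis by (simp add: ccomp_assoc s(2) cm_cid_right[OF f] ccomp_zero)
qed

lemma hom_vanishes_Icx:
  assumes im: "1 \<le> i" "i \<le> m" "m \<le> 5" and Y: "is_bcomplex Y"
    and null: "\<And>w. fam Y i m w \<Longrightarrow> ht (Icx i m) Y (imap Y i m w 0) (\<lambda>n v. 0)"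
  shows "hom_vanishes Db (Icx i m) Y"
  unfolding hom_vanishes_def
proof (intro equalityI subsetI)
  fix F assume "F \<in> Mor Db (Icx i m) Y"
  then obtain w where "fam Y i m w" "F = Qm (Icx i m) Y (imap Y i m w 0)" using D_hom_Icx[OF im] by auto
  then show "F \<in> {Zero Db (Icx i m) Y}" using Qm_eq[OF null] by simp
qed (use Qm_hom[OF cm_zero_map[OF Icx_bc[OF im] Y]] in simp)

lemma subcategory_iso_closed:
  assumes U: "is_subcategory Db \<U>" and X: "X \<in> \<U>" and q: "qi Z X f" "qi Z Y g"
  shows "Y \<in> \<U>"
proof -
  have "isomorphic Db X Y" unfolding isomorphic_def using roof_iso[OF q] by blast
  moreover have "Y \<in> Ob Db" using q by (simp add: qi_def)
  ultimately show ?thesis using U X unfolding is_subcategory_def by blast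
qed

locale rigid_even =
  fixes \<U> :: "'k::field complx set"
  assumes sub: "is_subcategory Db \<U>" and rig: "rigid Db (shift 1) \<U>"
    and gens: "stalk ` M_A \<subseteq> \<U>" and sh: "shift 2 ` \<U> = \<U>"
begin

lemma shift_closed: "X \<in> \<U> \<Longrightarrow> even i \<Longrightarrow> shift i X \<in> \<U>"
proof -
  assume X: "X \<in> \<U>" and "even i"
  then obtain k where k: "i = 2 * k" by blast
  have "shift (2 * k) X \<in> \<U>"
  proof (induction k rule: int_induct[where k = 0])
    case base
    then show ?case using X by simp
  next
    case (step1 i)
    have "shift 2 (shift (2 * i) X) \<in> shift 2 ` \<U>" using step1(2) by (rule imageI)
    then have "shift 2 (shift (2 * i) X) \<in> \<U>" unfolding sh .
    then show ?case by (simp add: algebra_simps)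
  next
    case (step2 i)
    \<comment> \<open>Negative shifts come from \<open>shift 2\<close> being onto the
      subcategory.\<close>
    from step2(2) have "shift (2 * i) X \<in> shift 2 ` \<U>" unfolding sh .
    then obtain V where V: "V \<in> \<U>" "shift (2 * i) X = shift 2 V" by (auto simp del: shift_shift)
    have "shift (-2) (shift (2 * i) X) = shift (-2) (shift 2 V)" using V by simp
    then have "shift (2 * i - 2) X = V" by simp
    then show ?case using V by (simp add: algebra_simps)
  qed
  then show ?thesis using k by simp
qed

lemma sub_closed:
  shows "\<U> \<subseteq> Ob Db" "is_zero_object Db V \<Longrightarrow> V \<in> \<U>"
    "\<lbrakk>X \<in> \<U>; Y \<in> \<U>; direct_sum Db X Y S\<rbrakk> \<Longrightarrow> S \<in> \<U>"
    "\<lbrakk>S \<in> \<U>; direct_sum Db X Y S\<rbrakk> \<Longrightarrow> X \<in> \<U>"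
  using sub unfolding is_subcategory_def by meson+

lemma bcx: "X \<in> \<U> \<Longrightarrow> is_bcomplex X"
  using sub_closed(1) by auto

lemma vanish_odd: "\<lbrakk>V \<in> \<U>; X \<in> \<U>; odd n\<rbrakk> \<Longrightarrow> hom_vanishes Db V (shift n X)"
proof -
  assume V: "V \<in> \<U>" and X: "X \<in> \<U>" and n: "odd n"
  have "shift (n - 1) X \<in> \<U>" using shift_closed[OF X] n by simp
  then have "hom_vanishes Db V (shift 1 (shift (n - 1) X))" using V rig unfolding rigid_def by blast
  then show ?thesis by simp
qed

lemma Icx_diag_in: "1 \<le> j \<Longrightarrow> j \<le> 5 \<Longrightarrow> Icx j j \<in> \<U>"
  using gens proj_in_M_A unfolding Icx_diag by blast

lemma simple_in: "j = 1 \<or> j = 3 \<or> j = 5 \<Longrightarrow> stalk (simple_rmod j) \<in> \<U>"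
  using gens simple_in_M_A by blast

text \<open>P_j lies in the subcategory and Hom(P_j, X[n]) is H^n(X) e_j, so each of the five vertex
  components of a cocycle bounds.\<close>

lemma odd_cohomology:
  assumes X: "X \<in> \<U>" and n: "odd n"
  shows "cocycles X n \<subseteq> coboundaries X n"
proof
  fix v assume v: "v \<in> cocycles X n"
  note bc = bcx[OF X]
  have *: "act (obj X n) v (eA j) \<in> coboundaries X n" if j: "1 \<le> j" "j \<le> 5" for j
  proof -
    let ?u = "act (obj X n) v (eA j)"
    have jj: "1 \<le> j" "j \<le> j" "j \<le> 5" using j by auto
    have u: "?u \<in> cocycles X n" "act (obj X n) ?u (eA j) = ?u"
      using v bc j by (auto simp: cocycles_act eA_carrier act_eA_eA cocycles_sp)
    then have "fam (shift n X) j j (\<lambda>a. ?u)" using n by (auto simp: fam_def cocycles_def)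
    note c = imap_cm[OF jj shift_bc[OF bc] this]
    have ht: "ht (Icx j j) (shift n X) (imap (shift n X) j j (\<lambda>a. ?u) 0) (\<lambda>n v. 0)"
      by (rule hom_vanishes_Icx_null[OF jj vanish_odd[OF Icx_diag_in[OF j] X n] c])
    have "unit_vec 0 \<in> cocycles (Icx j j) 0" by (simp add: cocycles_def Icx_obj0 Icx_dif_last)
    then have "imap (shift n X) j j (\<lambda>a. ?u) 0 0 (unit_vec 0) - 0 \<in> coboundaries (shift n X) 0"
      using ht by (intro homotopic_cocycles[OF Icx_bc[OF jj] shift_bc[OF bc]]) (auto simp: ht_def)
    then show ?thesis
      using imap_top[OF jj, of j "shift n X" "\<lambda>a. ?u"] bc by (simp add: shift_coboundaries)
  qed
  have "act (obj X n) v (eA 1) + (act (obj X n) v (eA 2) + (act (obj X n) v (eA 3) +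
      (act (obj X n) v (eA 4) + act (obj X n) v (eA 5)))) \<in> coboundaries X n"
    by (intro coboundaries_add[OF bc] *) auto
  then show "v \<in> coboundaries X n"
    using rmod_vertices[OF bc_mod[OF bc] cocycles_sp[OF bc v]] by simp
qed

lemma ex_at_odd:
  assumes "X \<in> \<U>" "odd n"
  shows "ex_at X n j"
proof -
  note bc = bcx[OF assms(1)]
  show ?thesis
    unfolding ex_at_def using odd_cohomology[OF assms] bc by (auto intro!: bexI[of _ 0] simp: act_zero)
qed

text \<open>If v x_4 = d c, then w_3 = 0, w_4 = v, w_5 = c is a morphism from the resolution of S_3
  to an odd shift of X. A null homotopy sends the top of P_3 to some y with d y = 0, because w_3 =
  0, and with v - y x_3 a coboundary.\<close>

lemma exact_4:
  assumes X: "X \<in> \<U>" and n: "even n"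
  shows "ex_at X n 4"
  unfolding ex_at_def
proof (intro ballI impI, elim conjE)
  fix v assume v: "v \<in> cocycles X n" "act (obj X n) v (eA 4) = v" "act (obj X n) v (xA 4) \<in> coboundaries X n"
  note bc = bcx[OF X]
  \<comment> \<open>The shift by n + 1 puts v into degree -1, the degree of P_4 in
    \<open>Icx 3 5\<close>.\<close>
  define Y where "Y = shift (n + 1) X"
  have Y: "is_bcomplex Y" unfolding Y_def by (rule shift_bc[OF bc])
  have YX: "obj Y (-1) = obj X n" "cocycles Y (-1) = cocycles X n" "coboundaries Y (-1) = coboundaries X n"
    unfolding Y_def using shift_coboundaries[OF bc, of "n + 1" "-1"] by (simp_all add: algebra_simps)
  have vY: "v \<in> sp Y (-1)" "dif Y (-1) v = 0" "act (obj Y (-1)) v (eA 4) = v" "act (obj Y (-1)) v (xA 4) \<in> coboundaries Y (-1)"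
  proof -
    have "v \<in> cocycles Y (-1)" using v(1) unfolding YX(2) .
    then show "v \<in> sp Y (-1)" "dif Y (-1) v = 0" by (auto simp: cocycles_def)
  qed (use v in \<open>simp_all only: YX\<close>)
  obtain c where c: "c \<in> sp Y (-1 - 1)" "act (obj Y (-1 - 1)) c (eA (Suc 4)) = c" "dif Y (-1 - 1) c = act (obj Y (-1)) v (xA 4)"
    using lift_step[OF Y vY(1,4)] by auto
  have im: "(1::nat) \<le> 3" "(3::nat) \<le> 5" "(5::nat) \<le> 5" by auto
  define w where "w a = (if a = 3 then 0 else if a = 4 then v else c)" for a :: nat
  have fam: "w a \<in> sp Y (int 3 - int a) \<and> act (obj Y (int 3 - int a)) (w a) (eA a) = w a \<and>
       dif Y (int 3 - int a) (w a) = (if a = 3 then 0 else act (obj Y (int 3 - int (a - 1))) (w (a - 1)) (xA (a - 1)))"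
    if "a = 3 \<or> a = 4 \<or> a = 5" for a
    using that vY c Y by (elim disjE) (simp_all add: w_def eA_carrier act_zero)
  have "a = 3 \<or> a = 4 \<or> a = 5" if "3 \<le> a" "a \<le> 5" for a :: nat using that by presburger
  then have "fam Y 3 5 w" unfolding fam_def using fam by blast
  note f = imap_cm[OF im Y this]
  have "Icx 3 5 \<in> \<U>"
    by (rule subcategory_iso_closed[OF sub simple_in[of 3] aug_qi[of 3] qi_cid[OF Icx_bc[OF im]]]) auto
  then have "ht (Icx 3 5) Y (imap Y 3 5 w 0) (\<lambda>n v. 0)"
    unfolding Y_def using n by (intro hom_vanishes_Icx_null[OF im _ f[unfolded Y_def]] vanish_odd X) auto
  then have "homotopic (Icx 3 5) Y (imap Y 3 5 w 0) (\<lambda>n v. 0)" by (simp add: ht_def)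
  then obtain h where h: "\<And>n. h n \<in> rmod_hom (obj (Icx 3 5) n) (obj Y (n - 1))"
      "\<And>n v. imap Y 3 5 w 0 n v - 0 = dif Y (n - 1) (h n v) + h (n + 1) (dif (Icx 3 5) n v)"
    by (rule homotopicE) blast
  note hz = hom_zero[OF bc_mod[OF Icx_bc[OF im]] bc_mod[OF Y] h(1)]
  define y where "y = h 0 (unit_vec 0)"
  have h0: "h 0 \<in> rmod_hom (proj_rmod 3) (obj Y (-1))" using h(1)[of 0] by (simp add: Icx_obj0)
  note P3 = proj_is_rmod[of 3, simplified]
  have y: "y \<in> sp Y (-1)" unfolding y_def by (rule hom_space[OF P3 bc_mod[OF Y] h0])
  have yx: "h 0 (unit_vec 1) = act (obj Y (-1)) y (xA 3)"
    using hom_act[OF P3 bc_mod[OF Y] h0 unit0_proj xA_carrier, of 3] by (simp add: y_def proj_act_xA)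
  have t3: "imap Y 3 5 w 0 (int 3 - int 3) (unit_vec 0) = w 3" by (rule imap_top[OF im]) auto
  have t4: "imap Y 3 5 w 0 (int 3 - int 4) (unit_vec 0) = w 4" by (rule imap_top[OF im]) auto
  have "dif Y (-1) y = 0"
    using h(2)[of 0 "unit_vec 0"] t3 hz[of 1] by (simp add: y_def w_def Icx_dif_last)
  then have yc: "y \<in> cocycles X n" using y unfolding YX(2)[symmetric] by (simp add: cocycles_def)
  have "dif (Icx 3 5 :: 'k complx) (int 3 - int 4) (unit_vec 0) = unit_vec 1" by (subst Icx_dif) auto
  then have "v - act (obj Y (-1)) y (xA 3) = dif Y (-1 - 1) (h (-1) (unit_vec 0))"
    using h(2)[of "-1" "unit_vec 0"] t4 yx by (simp add: w_def diff_eq_eq)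
  then have "v - act (obj Y (-1)) y (xA 3) \<in> coboundaries Y (-1)" using coboundariesI2[OF Y, of "-1"] by simp
  then show "\<exists>y\<in>cocycles X n. v - act (obj X n) y (xA (4 - 1)) \<in> coboundaries X n"
    using yc unfolding YX by auto
qed

end

subsection \<open>Exactness at the second vertex\<close>

text \<open>Maps into the injective modules P_1 and S_1 amount to linear functionals; this provides
  the functional from which \<open>exact_2\<close> builds its morphism.\<close>

lemma separating_functional:
  fixes N :: "'k::field vec set"
  assumes N: "vec.subspace N" and u: "u \<notin> N"
  obtains \<Phi> :: "'k vec \<Rightarrow> 'k" where "\<And>v w. \<Phi> (v + w) = \<Phi> v + \<Phi> w" "\<And>c v. \<Phi> (vscale c v) = c * \<Phi> v"
    "\<And>v. v \<in> N \<Longrightarrow> \<Phi> v = 0" "\<Phi> u = 1"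
proof -
  interpret k: vector_space "(*) :: 'k \<Rightarrow> 'k \<Rightarrow> 'k" by unfold_locales (auto simp: algebra_simps)
  interpret vp: vector_space_pair "vscale :: 'k \<Rightarrow> _" "(*) :: 'k \<Rightarrow> 'k \<Rightarrow> 'k" by unfold_locales
  obtain B where B: "B \<subseteq> N" "vec.independent B" "N \<subseteq> vec.span B"
    using vec.maximal_independent_subset by blast
  have sp: "vec.span B = N" using B N by (metis vec.span_minimal subset_antisym)
  have "vec.independent (insert u B)" using B(2) u sp by (intro vec.independent_insertI) auto
  then obtain g where g: "Vector_Spaces.linear vscale (*) g" "\<forall>x\<in>insert u B. g x = (if x = u then 1 else 0 :: 'k)"
    using vp.linear_independent_extend[of "insert u B" "\<lambda>x. if x = u then 1 else 0"] by blast
  interpret g: Vector_Spaces.linear "vscale :: 'k \<Rightarrow> _" "(*) :: 'k \<Rightarrow> 'k \<Rightarrow> 'k" g by (rule g(1))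
  have z: "g v = 0" if "v \<in> N" for v
    by (rule vp.linear_eq_0_on_span[OF g(1), of B]) (use g(2) u B(1) that sp in auto)
  show ?thesis by (rule that[of g]) (use g.add g.scale z g(2) in auto)
qed

text \<open>\<open>J = (P\<^sub>2 \<rightarrow> P\<^sub>1 \<rightarrow> S\<^sub>1)\<close> in degrees \<open>-1, 0, 1\<close> is an injective coresolution of \<open>S\<^sub>3[1]\<close>.\<close>

definition Jcx :: "'k::field complx" where
  "Jcx = cocone (Icx (Suc 0) 2) (stalk (simple_rmod (Suc 0))) (aug (Suc 0) 2)"

lemma Jcx_data:
  "is_bcomplex (Icx (Suc 0) 2 :: 'k::field complx)" "is_bcomplex (stalk (simple_rmod (Suc 0)) :: 'k complx)"
  "(aug (Suc 0) 2 :: 'k cmap) \<in> chain_maps (Icx (Suc 0) 2) (stalk (simple_rmod (Suc 0)))"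
  "is_bcomplex (Jcx :: 'k complx)"
proof -
  show 1: "is_bcomplex (Icx (Suc 0) 2 :: 'k complx)" by (rule Icx_bc) auto
  show 2: "is_bcomplex (stalk (simple_rmod (Suc 0)) :: 'k complx)" by (rule stalk_bc[OF simple_is_rmod]) auto
  show 3: "(aug (Suc 0) 2 :: 'k cmap) \<in> chain_maps (Icx (Suc 0) 2) (stalk (simple_rmod (Suc 0)))"
  proof -
    have "cm (Icx (Suc 0) 2) (stalk (simple_rmod (Suc 0))) (aug (Suc 0) 2 :: 'k cmap)" by (rule aug_cm) auto
    then show ?thesis by (simp add: cm_def)
  qed
  show "is_bcomplex (Jcx :: 'k complx)" unfolding Jcx_def by (rule cocone_bc[OF 1 2 3])
qed

lemma Jcx_obj: "obj Jcx n = dsum_mod (obj (Icx (Suc 0) 2) n) (obj (stalk (simple_rmod (Suc 0))) (n - 1))"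
  by (simp add: Jcx_def cocone_def)

lemma Jcx_dif: "\<lbrakk>vfst u \<in> sp (Icx (Suc 0) 2) n; vsnd u \<in> sp (stalk (simple_rmod (Suc 0))) (n - 1)\<rbrakk> \<Longrightarrow>
  dif Jcx n u = vpair (dif (Icx (Suc 0) 2) n (vfst u)) (aug (Suc 0) 2 n (vfst u))"
  by (simp add: Jcx_def cocone_def) (simp add: stalk_def)

lemma Icx12_m1: "obj (Icx (Suc 0) 2) (-1) = proj_rmod 2" "v \<in> space (proj_rmod 2) \<Longrightarrow> dif (Icx (Suc 0) 2) (-1) v = vscale (v 0) (unit_vec 1)"
  using Icx_obj[of "Suc 0" 2 2] Icx_dif[of "Suc 0" 2 2 v] by simp_all

lemma stalk_sp: "obj (stalk M) 0 = M" "n \<noteq> 0 \<Longrightarrow> obj (stalk M) n = zero_rmod"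
  by (simp_all add: stalk_def)

text \<open>The inclusion of S_3 as the socle of P_2, which sits in degree -1 of J.\<close>

definition Jinc :: "'k::field cmap" where
  "Jinc = (\<lambda>n v. if n = -1 \<and> v \<in> space (simple_rmod 3) then vpair (vscale (v 0) (unit_vec 1)) 0 else 0)"

text \<open>J is exact except in degree -1: the kernel of P_1 -> S_1 is the socle of P_1, which is
  the image of P_2, and the kernel of P_2 -> P_1 is the socle S_3 of P_2.\<close>

lemma Jinc_qi: "qi (shift 1 (stalk (simple_rmod 3))) Jcx (Jinc :: 'k::field cmap)"
proof -
  let ?S = "shift 1 (stalk (simple_rmod 3)) :: 'k complx"
  have M: "is_rmod (simple_rmod 3 :: 'k rmod)" by (simp add: simple_is_rmod)
  have S: "is_bcomplex ?S" by (rule shift_bc[OF stalk_bc[OF M]])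
  note J = Jcx_data(4)[where 'k = 'k]
  have u1: "vscale c (unit_vec 1) \<in> space (proj_rmod 2 :: 'k rmod)" for c
    by (rule rmod_scale[OF proj_is_rmod]) (auto simp: unit1_proj)
  have Jm1: "obj Jcx (-1) = dsum_mod (proj_rmod 2) (zero_rmod :: 'k rmod)"
    by (simp add: Jcx_obj Icx12_m1 stalk_sp)
  have Jd: "dif Jcx (-1) (vpair z 0) = vpair (vscale (z 0) (unit_vec 1)) 0" if "z \<in> space (proj_rmod 2)" for z :: "'k vec"
    using that Jcx_dif[of "vpair z 0" "-1"] by (simp add: Icx12_m1 stalk_sp aug_def)
  have cm: "(Jinc :: 'k cmap) \<in> chain_maps ?S Jcx"
  proof (rule chain_mapsI)
    show "(Jinc :: 'k cmap) n \<in> rmod_hom (obj ?S n) (obj Jcx n)" for n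
    proof (cases "n = -1")
      case True
      have P: "is_rmod (proj_rmod 2 :: 'k rmod)" "is_rmod (zero_rmod :: 'k rmod)" by (auto simp: proj_is_rmod zero_is_rmod)
      have "(Jinc :: 'k cmap) (-1) \<in> rmod_hom (simple_rmod 3) (dsum_mod (proj_rmod 2) zero_rmod)"
      proof (rule rmod_homI[OF M dsum_is_rmod[OF P]])
        show "Jinc (-1) (act (simple_rmod 3) v (eA i)) = act (dsum_mod (proj_rmod 2) zero_rmod) (Jinc (-1) v) (eA i)"
          if v: "v \<in> space (simple_rmod 3)" and i: "1 \<le> i" "i \<le> 5" for v :: "'k vec" and i
          using v proj_act_eA[OF u1, of "v 0" i] rmod_zero[OF M]
          by (auto simp: Jinc_def simple_act_eA)
        show "Jinc (-1) (act (simple_rmod 3) v (xA i)) = act (dsum_mod (proj_rmod 2) zero_rmod) (Jinc (-1) v) (xA i)"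
          if v: "v \<in> space (simple_rmod 3)" and i: "1 \<le> i" "i \<le> 4" for v :: "'k vec" and i
          using v rmod_zero[OF M] by (auto simp: Jinc_def simple_act_xA proj_act_xA)
      qed (use u1 u1[of 0] in \<open>auto simp: Jinc_def rmod_add[OF M] rmod_scale[OF M] vec.scale_left_distrib vpair_linear\<close>)
      then show ?thesis using True Jm1 by (simp add: stalk_sp)
    next
      case False
      then show ?thesis using rmod_hom_zero[OF bc_mod[OF J]] by (simp add: Jinc_def)
    qed
    show "dif Jcx n (Jinc n v) = Jinc (n + 1) (dif ?S n v)" for n and v :: "'k vec"
    proof -
      have "dif ?S n v = 0" by (simp add: stalk_def)
      moreover have "Jinc (n + 1) (0 :: 'k vec) = 0" by (simp add: Jinc_def)
      moreover have "dif Jcx n (Jinc n v) = 0" using Jd[OF u1] J by (simp add: Jinc_def)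
      ultimately show ?thesis by simp
    qed
  qed
  have Scob: "coboundaries ?S n = {0}" for n
    by (simp add: shift_coboundaries[OF stalk_bc[OF M]] stalk_coboundaries[OF M])
  have "(Jinc :: 'k cmap) \<in> quasi_isos ?S Jcx"
  proof (rule qiI[OF cm])
    fix n and v :: "'k vec" assume v: "v \<in> cocycles ?S n" "Jinc n v \<in> coboundaries Jcx n"
    show "v \<in> coboundaries ?S n"
    proof (cases "n = -1")
      case True
      then have vs: "v \<in> space (simple_rmod 3)" using v by (simp add: stalk_cocycles stalk_sp)
      obtain u where u: "u \<in> sp Jcx (n - 1)" "Jinc n v = dif Jcx (n - 1) u" using v(2) by (rule coboundariesE[OF J])
      have "sp Jcx (n - 1) = ({0} :: 'k vec set)"
        using True by (auto simp: Jcx_obj Icx_zero stalk_sp vec_zero_iff)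
      then have "Jinc n v = 0" using u J by auto
      then have "v 0 = 0" using True vs by (simp add: Jinc_def)
      then have "v i = 0" for i using vs by (cases i) (auto simp: simple_space)
      then have "v = 0" by auto
      then show ?thesis using S by simp
    next
      case False
      then have "v = 0" using v by (simp add: stalk_cocycles stalk_sp)
      then show ?thesis using S by simp
    qed
  next
    fix n and u :: "'k vec" assume u: "u \<in> cocycles Jcx n"
    have us: "vfst u \<in> sp (Icx (Suc 0) 2) n" "vsnd u \<in> sp (stalk (simple_rmod (Suc 0))) (n - 1)" "dif Jcx n u = 0"
      using u by (auto simp: cocycles_def Jcx_obj)
    have d0: "dif (Icx (Suc 0) 2) n (vfst u) = 0" "aug (Suc 0) 2 n (vfst u) = 0"
      using us(3) Jcx_dif[OF us(1,2)] by simp_all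
    consider "n = -1" | "n = 0" | "n = 1" | "n \<noteq> -1" "n \<noteq> 0" "n \<noteq> 1" by blast
    then show "\<exists>v\<in>cocycles ?S n. u - Jinc n v \<in> coboundaries Jcx n"
    proof cases
      case 1
      have z: "vfst u \<in> space (proj_rmod 2)" using us 1 by (simp add: Icx12_m1)
      have "vfst u 0 = 0" using d0(1) z 1 by (simp add: Icx12_m1)
      then have z1: "vfst u = vscale (vfst u 1) (unit_vec 1)" using proj_basis[OF z] by simp
      have z2: "vsnd u = 0" using us 1 by (simp add: stalk_sp)
      let ?v = "vscale (vfst u 1) (unit_vec 0)"
      have v: "?v \<in> space (simple_rmod 3)" by (auto simp: simple_space unit_vec_def)
      have "u = vpair (vfst u) (vsnd u)" by simp
      also have "\<dots> = Jinc n ?v" unfolding z2 using v 1 z1 by (simp add: Jinc_def)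
      finally have "u - Jinc n ?v = 0" by simp
      moreover have "?v \<in> cocycles ?S n" using v 1 by (simp add: stalk_cocycles stalk_sp)
      ultimately show ?thesis using coboundaries_zero[OF J] by metis
    next
      case 2
      have z: "vfst u \<in> space (proj_rmod (Suc 0))" using us 2 by (simp add: Icx_obj0)
      have "vfst u 0 = 0" using d0(2) z 2 by (simp add: aug_def Icx_obj0)
      then have z1: "vfst u = vscale (vfst u 1) (unit_vec 1)" using proj_basis[OF z] by simp
      have z2: "vsnd u = 0" using us 2 by (simp add: stalk_sp)
      have s: "vscale (vfst u 1) (unit_vec 0) \<in> space (proj_rmod 2)" by (rule rmod_scale[OF proj_is_rmod]) auto
      have "dif Jcx (-1) (vpair (vscale (vfst u 1) (unit_vec 0)) 0) = vpair (vfst u) 0"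
        using Jd[OF s] z1 by simp
      also have "\<dots> = u" using z2 by (metis vpair_simps(3))
      finally have "u \<in> coboundaries Jcx n" using coboundariesI2[OF J, of 0] 2 by (metis diff_0)
      then show ?thesis using cocycles_zero[OF S] by (intro bexI[of _ 0]) (auto simp: Jinc_def)
    next
      case 3
      have z: "vfst u = 0" using us 3 by (simp add: Icx_zero)
      have s: "vsnd u \<in> space (simple_rmod (Suc 0))" using us 3 by (simp add: stalk_sp)
      have sv: "vsnd u = vscale (vsnd u 0) (unit_vec 0)"
      proof
        fix i show "vsnd u i = vscale (vsnd u 0) (unit_vec 0) i" using s by (cases i) (auto simp: simple_space)
      qed
      have p: "vscale (vsnd u 0) (unit_vec 0) \<in> space (proj_rmod (Suc 0))" by (rule rmod_scale[OF proj_is_rmod]) auto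
      have "dif Jcx 0 (vpair (vscale (vsnd u 0) (unit_vec 0)) 0) = vpair 0 (vsnd u)"
        using p Jcx_dif[of "vpair (vscale (vsnd u 0) (unit_vec 0)) 0" 0] sv
        by (simp add: Icx_obj0 stalk_sp aug_def Icx_dif_last)
      also have "\<dots> = u" using z by (metis vpair_simps(3))
      finally have "u \<in> coboundaries Jcx n" using coboundariesI2[OF J, of 1] 3 by (metis diff_self)
      then show ?thesis using cocycles_zero[OF S] by (intro bexI[of _ 0]) (auto simp: Jinc_def)
    next
      case 4
      then have "\<not> (n \<le> 0 \<and> int 1 - n \<le> int 2)" by auto
      then have "vfst u = 0" using us by (simp add: Icx_zero)
      moreover have "vsnd u = 0" using us 4 by (simp add: stalk_sp)
      ultimately have "u = 0" using vec_zero_iff by blast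
      then show ?thesis using cocycles_zero[OF S] coboundaries_zero[OF J] by (intro bexI[of _ 0]) (auto simp: Jinc_def)
    qed
  qed
  then show ?thesis using S J by (simp add: qi_def)
qed

context rigid_even
begin

text \<open>Dual to exactness at 4, with maps into J instead of maps out of a resolution. P_1 and
  S_1 are the injective envelopes of S_2 and S_1, so maps into them are functionals on the
  components at the vertices 2 and 1. If v were not y x_1 up to a coboundary, a functional
  separating v from such elements would give a nonzero morphism from X to an odd shift of
  S_3.\<close>

lemma exact_2:
  assumes X: "X \<in> \<U>" and n: "even n"
  shows "ex_at X n 2"
  unfolding ex_at_def
proof (intro ballI impI, elim conjE, rule ccontr)
  fix v assume v: "v \<in> cocycles X n" "act (obj X n) v (eA 2) = v" "act (obj X n) v (xA 2) \<in> coboundaries X n"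
    and neg: "\<not> (\<exists>y\<in>cocycles X n. v - act (obj X n) y (xA (2 - 1)) \<in> coboundaries X n)"
  note bc = bcx[OF X]
  have vs: "v \<in> sp X n" using v bc by (simp add: cocycles_sp)
  note m = bc_mod[OF bc]
  note sp = rmod_add[OF m] rmod_scale[OF m] act_closed[OF m] rmod_neg[OF m]
  let ?x = "\<lambda>w. act (obj X n) w (xA (Suc 0))"
  \<comment> \<open>The second component makes d w = 0 part of a linear condition: (v, 0) lies in N
    exactly if v = b + w x_1 for a coboundary b and a cocycle w.\<close>
  define N where "N = {u. \<exists>b\<in>coboundaries X n. \<exists>w\<in>sp X n. u = vpair (b + ?x w) (- dif X n w)}"
  have N: "vec.subspace N"
    unfolding vec.subspace_def
  proof (intro conjI allI ballI)
    show "0 \<in> N" unfolding N_def using bc by (auto intro!: bexI[of _ 0] simp: act_zero)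
    show "u + u' \<in> N" if u: "u \<in> N" "u' \<in> N" for u u'
    proof -
      obtain b w b' w' where "b \<in> coboundaries X n" "w \<in> sp X n" "u = vpair (b + ?x w) (- dif X n w)"
        "b' \<in> coboundaries X n" "w' \<in> sp X n" "u' = vpair (b' + ?x w') (- dif X n w')" using u by (auto simp: N_def)
      then show ?thesis unfolding N_def
        by (intro CollectI bexI[of _ "b + b'"] bexI[of _ "w + w'"])
          (auto simp: vpair_linear act_add[OF m] dif_add[OF bc] algebra_simps sp coboundaries_add[OF bc])
    qed
    show "vscale c u \<in> N" if u: "u \<in> N" for c u
    proof -
      obtain b w where "b \<in> coboundaries X n" "w \<in> sp X n" "u = vpair (b + ?x w) (- dif X n w)"
        using u by (auto simp: N_def)
      then show ?thesis unfolding N_def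
        by (intro CollectI bexI[of _ "vscale c b"] bexI[of _ "vscale c w"])
          (auto simp: vpair_linear act_scale[OF m] dif_scale[OF bc] vec.scale_right_distrib vec.scale_minus_right sp
             coboundaries_scale[OF bc])
    qed
  qed
  have "vpair v 0 \<notin> N"
  proof
    assume "vpair v 0 \<in> N"
    then obtain b w where b: "b \<in> coboundaries X n" "w \<in> sp X n" "vpair v 0 = vpair (b + ?x w) (- dif X n w)"
      by (auto simp: N_def)
    have "v = b + ?x w" "dif X n w = 0" using arg_cong[OF b(3), of vfst] arg_cong[OF b(3), of vsnd] by auto
    then have "w \<in> cocycles X n" "v - act (obj X n) w (xA (2 - 1)) \<in> coboundaries X n"
      using b by (auto simp: cocycles_def)
    then show False using neg by blast
  qed
  then obtain \<Phi> where \<Phi>: "\<And>v w. \<Phi> (v + w) = \<Phi> v + \<Phi> w" "\<And>c v. \<Phi> (vscale c v) = c * \<Phi> v"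
    "\<And>v. v \<in> N \<Longrightarrow> \<Phi> v = 0" "\<Phi> (vpair v 0) = 1"
    using separating_functional[OF N] by metis
  \<comment> \<open>\<phi> and \<psi> are the restrictions of the functional to the two degrees.
    Vanishing on N says that \<phi> kills coboundaries and that \<phi>(w x_1) = \<psi>(d w); these
    are the chain map conditions for F.\<close>
  define \<phi> where "\<phi> u = \<Phi> (vpair u 0)" for u
  define \<psi> where "\<psi> u = \<Phi> (vpair 0 u)" for u
  have lin: "\<phi> (u + u') = \<phi> u + \<phi> u'" "\<phi> (vscale c u) = c * \<phi> u" "\<psi> (u + u') = \<psi> u + \<psi> u'" "\<psi> (vscale c u) = c * \<psi> u"
    for u u' c
    using \<Phi>(1)[of "vpair u 0" "vpair u' 0"] \<Phi>(1)[of "vpair 0 u" "vpair 0 u'"] \<Phi>(2)[of c "vpair u 0"] \<Phi>(2)[of c "vpair 0 u"]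
    by (simp_all add: \<phi>_def \<psi>_def vpair_linear)
  have z: "\<phi> 0 = 0" "\<psi> 0 = 0" using lin(2)[of 0 0] lin(4)[of 0 0] by simp_all
  have \<phi>B: "\<phi> b = 0" if "b \<in> coboundaries X n" for b
    unfolding \<phi>_def N_def using that bc
    by (intro \<Phi>(3)[unfolded N_def] CollectI bexI[of _ b] bexI[of _ 0]) (auto simp: act_zero)
  have \<phi>\<psi>: "\<phi> (?x w) = \<psi> (dif X n w)" if "w \<in> sp X n" for w
  proof -
    have "vpair (?x w) (- dif X n w) \<in> N" unfolding N_def using that bc by (intro CollectI bexI[of _ 0] bexI[of _ w]) auto
    then have "\<Phi> (vpair (?x w) (- dif X n w)) = 0" by (rule \<Phi>(3))
    moreover have "vpair (?x w) (- dif X n w) + vpair 0 (dif X n w) = vpair (?x w) 0" by (simp add: vpair_linear)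
    ultimately show ?thesis using \<Phi>(1)[of "vpair (?x w) (- dif X n w)" "vpair 0 (dif X n w)"]
      by (simp add: \<phi>_def \<psi>_def)
  qed
  define Y where "Y = shift (- n) (Jcx :: 'k complx)"
  note J = Jcx_data(4)[where 'k = 'k]
  have Y: "is_bcomplex Y" unfolding Y_def by (rule shift_bc[OF J])
  have Yd: "dif Y m u = dif Jcx (m - n) u" for m u using n by (simp add: Y_def)
  have Yo: "obj Y m = obj Jcx (m - n)" for m by (simp add: Y_def)
  have P1: "is_rmod (proj_rmod (Suc 0) :: 'k rmod)" "is_rmod (zero_rmod :: 'k rmod)" "is_rmod (simple_rmod (Suc 0) :: 'k rmod)"
    by (auto simp: proj_is_rmod zero_is_rmod simple_is_rmod)
  have J0: "obj Jcx 0 = dsum_mod (proj_rmod (Suc 0)) (zero_rmod :: 'k rmod)" by (simp add: Jcx_obj Icx_obj0 stalk_sp)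
  have J1: "obj Jcx 1 = dsum_mod zero_rmod (simple_rmod (Suc 0) :: 'k rmod)" by (simp add: Jcx_obj Icx_zero stalk_sp)
  have ext: "u = u' \<longleftrightarrow> u 0 = u' 0 \<and> u (Suc 0) = u' (Suc 0)" if "u \<in> space (proj_rmod (Suc 0))" "u' \<in> space (proj_rmod (Suc 0))" for u u' :: "'k vec"
    using proj_basis[OF that(1)] proj_basis[OF that(2)] by (metis One_nat_def)
  \<comment> \<open>The map into P_1 that belongs to \<phi> on the component at vertex 2: the socle
    coordinate is \<phi> of that component, and A-linearity forces the top coordinate.\<close>
  define \<zeta> where "\<zeta> u = vscale (\<phi> (?x u)) (unit_vec 0) + vscale (\<phi> (act (obj X n) u (eA 2))) (unit_vec 1)" for u
  have \<zeta>s: "\<zeta> u \<in> space (proj_rmod (Suc 0))" for u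
    unfolding \<zeta>_def by (intro rmod_add[OF P1(1)] rmod_scale[OF P1(1)]) (auto simp: unit1_proj)
  have \<zeta>c: "\<zeta> u 0 = \<phi> (?x u)" "\<zeta> u (Suc 0) = \<phi> (act (obj X n) u (eA 2))" for u by (simp_all add: \<zeta>_def)
  have sc: "vscale c (unit_vec 0) \<in> space (simple_rmod (Suc 0) :: 'k rmod)" for c by (auto simp: simple_space unit_vec_def)
  \<comment> \<open>The components go to P_1 in degree n and, through \<psi> at vertex 1, to S_1 in
    degree n + 1. The one to P_2 in degree n - 1 is 0, which is compatible because \<phi> kills
    coboundaries.\<close>
  define F where "F m u = (if m = n \<and> u \<in> sp X n then vpair (\<zeta> u) 0
     else if m = n + 1 \<and> u \<in> sp X (n + 1) then vpair 0 (vscale (\<psi> (act (obj X (n + 1)) u (eA (Suc 0)))) (unit_vec 0)) else 0)" for m u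
  have F: "F \<in> chain_maps X Y"
  proof (rule chain_mapsI)
    fix m
    consider "m = n" | "m = n + 1" | "m \<noteq> n" "m \<noteq> n + 1" by blast
    then show "F m \<in> rmod_hom (obj X m) (obj Y m)"
    proof cases
      case 1
      have "F n \<in> rmod_hom (obj X n) (dsum_mod (proj_rmod (Suc 0)) zero_rmod)"
      proof (rule rmod_homI[OF m dsum_is_rmod[OF P1(1,2)]])
        show "F n (act (obj X n) u (eA i)) = act (dsum_mod (proj_rmod (Suc 0)) zero_rmod) (F n u) (eA i)"
          if u: "u \<in> sp X n" and i: "1 \<le> i" "i \<le> 5" for u i
        proof -
          have "\<zeta> (act (obj X n) u (eA i)) = act (proj_rmod (Suc 0)) (\<zeta> u) (eA i)"
            using u i by (intro iffD2[OF ext[OF \<zeta>s act_closed[OF P1(1) \<zeta>s eA_carrier[OF i]]]])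
              (auto simp: proj_act_eA[OF \<zeta>s] numeral_2_eq_2 act_eA_xA[OF m] act_eA_eA[OF m] z \<zeta>c)
          then show ?thesis using u i by (simp add: F_def sp eA_carrier)
        qed
        show "F n (act (obj X n) u (xA i)) = act (dsum_mod (proj_rmod (Suc 0)) zero_rmod) (F n u) (xA i)"
          if u: "u \<in> sp X n" and i: "1 \<le> i" "i \<le> 4" for u i
        proof -
          have "\<zeta> (act (obj X n) u (xA i)) = act (proj_rmod (Suc 0)) (\<zeta> u) (xA i)"
            using u i by (intro iffD2[OF ext[OF \<zeta>s act_closed[OF P1(1) \<zeta>s xA_carrier]]])
              (auto simp: act_xA_xA[OF m] act_xA_eA[OF m] z \<zeta>c proj_act_xA)
          then show ?thesis using u i by (simp add: F_def sp)
        qed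
        show "F n (u + u') = F n u + F n u'" if "u \<in> sp X n" "u' \<in> sp X n" for u u'
        proof -
          have "\<zeta> (u + u') = \<zeta> u + \<zeta> u'"
            using that by (simp add: \<zeta>_def act_add[OF m] eA_carrier lin vec.scale_left_distrib)
          then show ?thesis using that by (simp add: F_def sp vpair_linear)
        qed
        show "F n (vscale c u) = vscale c (F n u)" if "u \<in> sp X n" for u c
        proof -
          have "\<zeta> (vscale c u) = vscale c (\<zeta> u)"
            using that by (simp add: \<zeta>_def act_scale[OF m] eA_carrier lin vec.scale_right_distrib)
          then show ?thesis using that by (simp add: F_def sp vpair_linear)
        qed
      qed (use \<zeta>s rmod_zero[OF P1(1)] in \<open>auto simp: F_def\<close>)
      then show ?thesis using 1 J0 by (simp add: Yo)
    next
      case 2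
      let ?e = "\<lambda>u. act (obj X (n + 1)) u (eA (Suc 0))"
      have "F (n + 1) \<in> rmod_hom (obj X (n + 1)) (dsum_mod zero_rmod (simple_rmod (Suc 0)))"
      proof (rule rmod_homI[OF m dsum_is_rmod[OF P1(2,3)]])
        show "F (n + 1) (act (obj X (n + 1)) u (eA i)) = act (dsum_mod zero_rmod (simple_rmod (Suc 0))) (F (n + 1) u) (eA i)"
          if u: "u \<in> sp X (n + 1)" and i: "1 \<le> i" "i \<le> 5" for u i
          using u i by (auto simp: F_def sp eA_carrier act_eA_eA[OF m] simple_act_eA z)
        show "F (n + 1) (act (obj X (n + 1)) u (xA i)) = act (dsum_mod zero_rmod (simple_rmod (Suc 0))) (F (n + 1) u) (xA i)"
          if u: "u \<in> sp X (n + 1)" and i: "1 \<le> i" "i \<le> 4" for u i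
          using u i by (auto simp: F_def sp act_xA_eA[OF m] simple_act_xA z)
      qed (use sc sc[of 0] in \<open>auto simp: F_def sp act_add[OF m] act_scale[OF m] eA_carrier lin vpair_linear vec.scale_left_distrib\<close>)
      then show ?thesis using 2 J1 by (simp add: Yo)
    next
      case 3
      then have "F m = (\<lambda>u. 0)" by (auto simp: F_def)
      then show ?thesis using rmod_hom_zero[OF bc_mod[OF Y]] by simp
    qed
    fix u
    show "dif Y m (F m u) = F (m + 1) (dif X m u)"
    proof (cases "u \<in> sp X m")
      case False
      then have "F m u = 0" by (auto simp: F_def)
      moreover have "F (m + 1) 0 = 0" using z \<zeta>_def by (auto simp: F_def act_zero[OF m] eA_carrier)
      ultimately show ?thesis using dif_out[OF bc False] Y by simp
    next
      case u: True
      consider "m = n" | "m + 1 = n" | "m \<noteq> n" "m + 1 \<noteq> n" by blast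
      then show ?thesis
      proof cases
        case 1
        have "dif Y m (F m u) = vpair 0 (vscale (\<phi> (?x u)) (unit_vec 0))"
          using 1 u \<zeta>s[of u] Jcx_dif[of "vpair (\<zeta> u) 0" 0]
          by (simp add: Yd F_def Icx_obj0 stalk_sp aug_def Icx_dif_last \<zeta>c)
        moreover have "\<phi> (?x u) = \<psi> (act (obj X (n + 1)) (dif X n u) (eA (Suc 0)))"
        proof -
          have "?x u = ?x (act (obj X n) u (eA (Suc 0)))" using u 1 by (simp add: act_eA_xA[OF m])
          then show ?thesis using \<phi>\<psi>[of "act (obj X n) u (eA (Suc 0))"] u 1
            by (simp add: sp eA_carrier dif_act[OF bc])
        qed
        ultimately show ?thesis using 1 dif_closed[OF bc, of n u] by (simp add: F_def)
      next
        case 2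
        have b: "dif X m u \<in> coboundaries X n" using coboundariesI2[OF bc, of n u] 2 by auto
        then have "\<zeta> (dif X m u) = 0"
          by (simp add: \<zeta>_def \<phi>B coboundaries_act[OF bc] eA_carrier)
        then have "F n (dif X m u) = 0" by (simp add: F_def)
        moreover have "F m u = 0" using 2 by (auto simp: F_def)
        ultimately show ?thesis using 2 Y by simp
      next
        case 3
        then have R: "F (m + 1) (dif X m u) = 0" by (auto simp: F_def)
        show ?thesis
        proof (cases "m = n + 1")
          case True
          have "dif Jcx 1 (vpair 0 (vscale c (unit_vec 0))) = 0" for c :: 'k
            using Jcx_dif[of "vpair 0 (vscale c (unit_vec 0))" 1] sc[of c]
            by (simp add: Icx_zero stalk_sp aug_def)
          then show ?thesis using R True J by (simp add: Yd F_def)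
        next
          case False
          then have "F m u = 0" using 3 by (auto simp: F_def)
          then show ?thesis using R Y by simp
        qed
      qed
    qed
  qed
  have SJ: "qi (stalk (simple_rmod 3) :: 'k complx) (shift (-1) Jcx) (\<lambda>m. Jinc (m + (-1)))"
  proof -
    have b: "is_bcomplex (stalk (simple_rmod 3 :: 'k rmod))" by (simp add: stalk_bc simple_is_rmod)
    have "(\<lambda>m. Jinc (m + (-1)) :: 'k vec \<Rightarrow> _) \<in> quasi_isos (shift (-1) (shift 1 (stalk (simple_rmod 3)))) (shift (-1) Jcx)"
      using Jinc_qi[where 'k = 'k] by (intro shift_qi) (auto simp: qi_def)
    then show ?thesis using b by (simp add: qi_def shift_bc J)
  qed
  have "shift (-1) (Jcx :: 'k complx) \<in> \<U>"
    by (rule subcategory_iso_closed[OF sub simple_in[of 3] qi_cid SJ]) (auto simp: stalk_bc simple_is_rmod)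
  then have "hom_vanishes Db X (shift (1 - n) (shift (-1) Jcx))"
    using n by (intro vanish_odd X) auto
  then have "hom_vanishes Db X Y" by (simp add: Y_def)
  moreover have "cm X Y F" using F bc Y by (simp add: cm_def)
  ultimately obtain W q where q: "qi W X q" "ht W Y (F \<circ>\<^sub>c q) (\<lambda>n v. 0)"
    by (rule hom_vanishes_null)
  have W: "is_bcomplex W" and qq: "q \<in> quasi_isos W X" and qc: "q \<in> chain_maps W X" using q(1) by (auto simp: qi_def qi_cm)
  have "homotopic W Y (F \<circ>\<^sub>c q) (\<lambda>n v. 0)" using q(2) by (simp add: ht_def)
  then obtain h where h: "\<And>n. h n \<in> rmod_hom (obj W n) (obj Y (n - 1))"
      "\<And>n v. (F \<circ>\<^sub>c q) n v - 0 = dif Y (n - 1) (h n v) + h (n + 1) (dif W n v)"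
    by (rule homotopicE) blast
  note hz = hom_zero[OF bc_mod[OF W] bc_mod[OF Y] h(1)] and hs = hom_space[OF bc_mod[OF W] bc_mod[OF Y] h(1)]
  \<comment> \<open>The null homotopy is available on W only, so v is replaced by a cocycle v' of W
    at vertex 2 that lies over it.\<close>
  obtain v0 where v0: "v0 \<in> cocycles W n" "v - q n v0 \<in> coboundaries X n" using qi_surj[OF qq v(1)] .
  define v' where "v' = act (obj W n) v0 (eA 2)"
  have v': "v' \<in> cocycles W n" "act (obj W n) v' (eA 2) = v'"
    using v0 W by (auto simp: v'_def cocycles_act eA_carrier act_eA_eA cocycles_sp)
  have v's: "v' \<in> sp W n" using v' W by (simp add: cocycles_sp)
  have qv: "v - q n v' \<in> coboundaries X n"
    using coboundaries_act[OF bc v0(2) eA_carrier[of 2]] v0 v W vs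
    by (simp add: v'_def act_diff[OF m] eA_carrier cm_act[OF W bc qc] cocycles_sp cm_closed[OF W bc qc])
  have qs: "q n v' \<in> sp X n" by (rule cm_closed[OF W bc qc])
  have "act (obj X n) v (xA 2) - act (obj X n) (q n v') (xA 2) \<in> coboundaries X n"
    using coboundaries_act[OF bc qv xA_carrier, of 2] vs qs by (simp add: act_diff[OF m])
  then have "act (obj X n) (q n v') (xA 2) \<in> coboundaries X n"
    using coboundaries_diff[OF bc v(3)] by fastforce
  then have "act (obj W n) v' (xA 2) \<in> coboundaries W n"
    using v' W by (intro qi_inj[OF qq]) (auto simp: cocycles_act cm_act[OF W bc qc] cocycles_sp)
  then obtain u' where u': "u' \<in> sp W (n - 1)" "act (obj W n) v' (xA 2) = dif W (n - 1) u'" by (rule coboundariesE[OF W])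
  \<comment> \<open>The value of the null homotopy at v', an element of P_2. Since v' x_2 = d u',
    while F vanishes in degree n - 1 and Y in degree n - 2, one gets g x_2 = 0. So g has no top
    coefficient, d g = 0, and F vanishes at q v'.\<close>
  define g where "g = h n v'"
  have gs: "vfst g \<in> space (proj_rmod 2)" "vsnd g = 0"
    using hs[of n v'] by (auto simp: g_def Yo Jcx_obj Icx12_m1 stalk_sp)
  have "act (obj Y (n - 1)) g (xA 2) = h n (dif W (n - 1) u')"
    unfolding g_def u'(2)[symmetric] by (rule hom_act[OF bc_mod[OF W] bc_mod[OF Y] h(1) v's xA_carrier, symmetric])
  also have "h n (dif W (n - 1) u') = 0"
  proof -
    have "sp Y (n - 1 - 1) = {0}"
      by (auto simp: Yo Jcx_obj Icx_zero stalk_sp vec_zero_iff)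
    then have "h (n - 1) u' = 0" using hs[of "n - 1" u'] by auto
    moreover have "F (n - 1) (q (n - 1) u') = 0" by (simp add: F_def)
    ultimately show ?thesis using h(2)[of "n - 1" u'] Y by (simp add: ccomp_def)
  qed
  finally have "act (proj_rmod 2) (vfst g) (xA 2) = 0"
    by (simp add: Yo Jcx_obj Icx12_m1)
  then have g0: "vfst g 0 = 0" using proj_act_xA[of 2 "vfst g" 2] by simp
  have "dif Y (n - 1) g = 0"
    using g0 gs Jcx_dif[of g "-1"] by (simp add: Yd Icx12_m1 stalk_sp aug_def)
  then have "F n (q n v') = 0"
    using h(2)[of n v'] v'(1) hz[of "n + 1"] by (simp add: ccomp_def g_def cocycles_def)
  then have "\<zeta> (q n v') = 0" using qs by (simp add: F_def)
  then have "\<phi> (act (obj X n) (q n v') (eA 2)) = 0" using \<zeta>c(2)[of "q n v'"] by simp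
  then have "\<phi> (q n v') = 0" using cm_act[OF W bc qc v's eA_carrier[of 2]] v'(2) by simp
  moreover have "\<phi> (v - q n v') = 0" by (rule \<phi>B[OF qv])
  ultimately have "\<phi> v = 0" using lin(1)[of "v - q n v'" "q n v'"] by simp
  then show False using \<Phi>(4) by (simp add: \<phi>_def)
qed

lemma in_evex: "X \<in> \<U> \<Longrightarrow> evex X"
  unfolding evex_def using bcx odd_cohomology exact_2 exact_4 ex_at_odd by (metis (no_types))

lemma direct_sum_list_in: "direct_sum_list Db Xs S \<Longrightarrow> set Xs \<subseteq> \<U> \<Longrightarrow> S \<in> \<U>"
proof (induction Xs arbitrary: S)
  case Nil
  then show ?case using sub_closed(2) by simp
next
  case (Cons X Xs)
  then obtain T where T: "direct_sum_list Db Xs T" "direct_sum Db X T S" by auto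
  then have "T \<in> \<U>" "X \<in> \<U>" using Cons by auto
  then show ?case using sub_closed(3)[OF _ _ T(2)] by blast
qed

lemma eq_U_A: "\<U> = U_A"
proof
  show "\<U> \<subseteq> U_A" using in_evex evex_U_A by blast
  have "{shift (2 * i) (stalk M) |M i. M \<in> M_A} \<subseteq> \<U>" using gens shift_closed by auto
  note gens' = this
  show "U_A \<subseteq> \<U>"
  proof
    fix X :: "'k complx" assume "X \<in> U_A"
    then obtain Xs S Y where "set Xs \<subseteq> {shift (2 * i) (stalk M) |M i. M \<in> M_A}" "direct_sum_list Db Xs S" "direct_sum Db X Y S"
      unfolding U_A_def add_closure_def by blast
    then show "X \<in> \<U>" using gens' direct_sum_list_in sub_closed(4) by (meson subset_trans)
  qed
qed

end

section \<open>A complex orthogonal to the shifted subcategory but outside it\<close>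

section \<open>Failure of the cluster tilting property\<close>

text \<open>The kernel of P_3 -> P_2 is the socle S_4 of P_3, in degree 1 - 3 = -2. No term precedes
  P_3, so S_4 is the whole cohomology there.\<close>

lemma Icx_1_3_not_evex: "\<not> evex (Icx 1 3 :: 'k::field complx)"
proof
  assume "evex (Icx 1 3 :: 'k complx)"
  then have ex: "ex_at (Icx 1 3 :: 'k complx) (int 1 - int 3) 4" by (simp add: evex_def)
  have P: "is_rmod (proj_rmod 3 :: 'k rmod)" by (simp add: proj_is_rmod)
  have u: "unit_vec 1 \<in> space (proj_rmod 3 :: 'k rmod)" by (simp add: unit1_proj)
  have d: "dif (Icx 1 3 :: 'k complx) (int 1 - int 3) v = vscale (v 0) (unit_vec 1)" if "v \<in> space (proj_rmod 3)" for v
    using that by (intro Icx_dif) auto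
  have o3: "obj (Icx 1 3 :: 'k complx) (int 1 - int 3) = proj_rmod 3" by (rule Icx_obj) auto
  have c: "unit_vec 1 \<in> cocycles (Icx 1 3 :: 'k complx) (int 1 - int 3)"
    unfolding cocycles_def mem_Collect_eq o3 d[OF u] using u by simp
  have e: "act (proj_rmod 3) (unit_vec 1) (eA 4) = (unit_vec 1 :: 'k vec)"
    using proj_act_eA[OF u, of 4] by simp
  have bc: "is_bcomplex (Icx 1 3 :: 'k complx)" by (rule Icx_bc) auto
  have "act (proj_rmod 3) (unit_vec 1) (xA 4) = (0 :: 'k vec)"
    using proj_act_xA[of 3 "unit_vec 1 :: 'k vec" 4] by simp
  then have x: "act (proj_rmod 3) (unit_vec 1) (xA 4) \<in> coboundaries (Icx 1 3 :: 'k complx) (int 1 - int 3)"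
    using coboundaries_zero[OF bc] by simp
  obtain y where y: "y \<in> cocycles (Icx 1 3 :: 'k complx) (int 1 - int 3)"
    "unit_vec 1 - act (proj_rmod 3) y (xA (4 - 1)) \<in> coboundaries (Icx 1 3 :: 'k complx) (int 1 - int 3)"
    using ex c e x unfolding ex_at_def o3 by blast
  have ys: "y \<in> space (proj_rmod 3)" using y(1) unfolding cocycles_def o3 by blast
  have "vscale (y 0) (unit_vec 1) = (0 :: 'k vec)" using y(1) d[OF ys] unfolding cocycles_def by simp
  then have "y 0 = 0" by simp
  then have "act (proj_rmod 3) y (xA (4 - 1)) = 0" using proj_act_xA[of 3 y 3] by simp
  then have "unit_vec 1 \<in> coboundaries (Icx 1 3 :: 'k complx) (int 1 - int 3)" using y(2) by simp
  then obtain c :: 'k where "unit_vec 1 = vscale c (unit_vec 1)" "(3::nat) = 3 \<Longrightarrow> c = 0"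
    using Icx_coboundaries[of 1 3 3 "unit_vec 1 :: 'k vec"] by auto
  then show False by simp
qed

text \<open>The shift by 1 moves the cohomology to odd degrees, so the only obstruction to a null
  homotopy is the class of w_2 - k_1 x_1 in degree -1, at vertex 2. It is killed by x_2 because w_2
  x_2 = d w_3, so exactness at 2 allows k_1 to be corrected. The complex stops at P_3, before the
  obstruction at vertex 4 in degree -3.\<close>

lemma Icx_1_3_vanishes:
  assumes V: "evex (V :: 'k::field complx)"
  shows "hom_vanishes Db (Icx 1 3) (shift 1 V)"
proof (rule hom_vanishes_Icx)
  have bV: "is_bcomplex V" using V by (simp add: evex_def)
  define Y where "Y = shift 1 V"
  show Y: "is_bcomplex (shift 1 V)" by (rule shift_bc[OF bV])
  note Y' = Y[folded Y_def]
  note m = bc_mod[OF Y']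
  have cob: "cocycles Y n \<subseteq> coboundaries Y n" if "even n" for n
    using V that unfolding Y_def evex_def by (simp add: shift_coboundaries[OF bV])
  have ex: "ex_at Y n 2" for n using V unfolding Y_def evex_def by (simp add: ex_at_shift bV)
  fix w assume "fam (shift 1 V) 1 3 w"
  then have fam: "fam Y 1 3 w" by (simp add: Y_def)
  have w: "w a \<in> sp Y (int 1 - int a)" "act (obj Y (int 1 - int a)) (w a) (eA a) = w a"
    "dif Y (int 1 - int a) (w a) = (if a = 1 then 0 else act (obj Y (int 1 - int (a - 1))) (w (a - 1)) (xA (a - 1)))"
    if "1 \<le> a" "a \<le> 3" for a using fam that unfolding fam_def by blast+
  have w1: "w 1 \<in> sp Y 0" "act (obj Y 0) (w 1) (eA 1) = w 1" "dif Y 0 (w 1) = 0"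
    using w[of 1] by simp_all
  have w2: "w 2 \<in> sp Y (-1)" "act (obj Y (-1)) (w 2) (eA 2) = w 2" "dif Y (-1) (w 2) = act (obj Y 0) (w 1) (xA 1)"
    using w[of 2] by simp_all
  have w3: "w 3 \<in> sp Y (-2)" "act (obj Y (-2)) (w 3) (eA 3) = w 3" "dif Y (-2) (w 3) = act (obj Y (-1)) (w 2) (xA 2)"
    using w[of 3] by simp_all
  note sp = rmod_diff[OF m] rmod_add[OF m] act_closed[OF m]
  have "w 1 \<in> coboundaries Y 0" using cob[of 0] w1 by (auto simp: cocycles_def)
  then obtain k1 where k1: "k1 \<in> sp Y (0 - 1)" "act (obj Y (0 - 1)) k1 (eA 1) = k1" "dif Y (0 - 1) k1 = w 1"
    using coboundary_at_vertex[OF Y' _ w1(2)] by auto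
  let ?k1x = "act (obj Y (-1)) k1 (xA 1)"
  let ?u = "w 2 - ?k1x"
  have k1x: "?k1x \<in> sp Y (-1)" using k1 by (simp add: sp)
  have "dif Y (-1) ?u = 0"
    using w2 k1 k1x dif_act[OF Y' _ xA_carrier, of k1 "-1" 1] by (simp add: dif_diff[OF Y'])
  then have u: "?u \<in> cocycles Y (-1)" using w2 k1x by (simp add: cocycles_def sp)
  moreover have ue: "act (obj Y (-1)) ?u (eA 2) = ?u"
    using w2 k1 k1x act_xA_eA[OF m, of k1 "-1" 2 1] by (simp add: act_diff[OF m] eA_carrier)
  moreover have "act (obj Y (-1)) ?u (xA 2) = dif Y (-1 - 1) (w 3)"
    using w2 w3 k1 k1x act_xA_xA[OF m, of k1 "-1" 1 2] by (simp add: act_diff[OF m])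
  then have "act (obj Y (-1)) ?u (xA 2) \<in> coboundaries Y (-1)" using coboundariesI2[OF Y', of "-1"] by simp
  ultimately obtain y where y: "y \<in> cocycles Y (-1)" "?u - act (obj Y (-1)) y (xA (2 - 1)) \<in> coboundaries Y (-1)"
    using ex[of "-1"] unfolding ex_at_def by blast
  have ys: "y \<in> sp Y (-1)" "dif Y (-1) y = 0" using y(1) by (auto simp: cocycles_def)
  let ?ye = "act (obj Y (-1)) y (eA 1)"
  have ye: "?ye \<in> sp Y (-1)" "act (obj Y (-1)) ?ye (eA 1) = ?ye" "dif Y (-1) ?ye = 0"
    "act (obj Y (-1)) ?ye (xA 1) = act (obj Y (-1)) y (xA 1)"
    using ys act_eA_eA[OF m ys(1), of 1 1] act_eA_xA[OF m ys(1), of 1 1]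
    by (simp_all add: sp eA_carrier dif_act[OF Y'] act_zero[OF m])
  \<comment> \<open>Adding the cocycle y e_1 keeps d k_1 = w_1 and makes w_2 - k_1 x_1 a
    coboundary.\<close>
  define k1' where "k1' = k1 + ?ye"
  have k1': "k1' \<in> sp Y (-1)" "act (obj Y (-1)) k1' (eA 1) = k1'" "dif Y (-1) k1' = w 1"
    "act (obj Y (-1)) k1' (xA 1) = ?k1x + act (obj Y (-1)) y (xA 1)"
    using k1 ye by (simp_all add: k1'_def sp act_add[OF m] eA_carrier dif_add[OF Y'])
  let ?b = "w 2 - act (obj Y (-1)) k1' (xA 1)"
  have b: "?b \<in> coboundaries Y (-1)" using y(2) unfolding k1'(4) by (simp add: diff_diff_eq)
  have be: "act (obj Y (-1)) ?b (eA 2) = ?b"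
    using w2 k1' act_xA_eA[OF m k1'(1), of 2 1] sp(3)[OF k1'(1) xA_carrier, of 1] by (simp add: act_diff[OF m] eA_carrier del: k1'(4))
  obtain k2 where k2: "k2 \<in> sp Y (-1 - 1)" "act (obj Y (-1 - 1)) k2 (eA 2) = k2" "dif Y (-1 - 1) k2 = ?b"
    using coboundary_at_vertex[OF Y' b be] by auto
  let ?k2x = "act (obj Y (-2)) k2 (xA 2)"
  have k2x: "?k2x \<in> sp Y (-2)" using k2 by (simp add: sp)
  have "dif Y (-2) (w 3 - ?k2x) = 0"
    using w3 k2 k2x dif_act[OF Y' _ xA_carrier, of k2 "-2" 2] w2 act_xA_xA[OF m k1'(1), of 1 2] sp(3)[OF k1'(1) xA_carrier, of 1]
    by (simp add: dif_diff[OF Y'] act_diff[OF m])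
  then have "w 3 - ?k2x \<in> coboundaries Y (-2)" using cob[of "-2"] w3 k2x by (auto simp: cocycles_def sp)
  moreover have "act (obj Y (-2)) (w 3 - ?k2x) (eA 3) = w 3 - ?k2x"
    using w3 k2 k2x act_xA_eA[OF m, of k2 "-2" 3 2] by (simp add: act_diff[OF m] eA_carrier)
  ultimately obtain k3 where k3: "k3 \<in> sp Y (-2 - 1)" "act (obj Y (-2 - 1)) k3 (eA 3) = k3" "dif Y (-2 - 1) k3 = w 3 - ?k2x"
    using coboundary_at_vertex[OF Y', of "w 3 - ?k2x" "-2" 3] by auto
  define k where "k a = (if a = 1 then k1' else if a = 2 then k2 else k3)" for a :: nat
  have k: "k a \<in> sp Y (int 1 - int a - 1) \<and> act (obj Y (int 1 - int a - 1)) (k a) (eA a) = k a \<and>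
      w a = dif Y (int 1 - int a - 1) (k a) + (if a = 1 then 0 else act (obj Y (int 1 - int (a - 1) - 1)) (k (a - 1)) (xA (a - 1)))"
    if "a = 1 \<or> a = 2 \<or> a = 3" for a
    using that k1'(1-3) k2 k3 by (elim disjE) (simp_all add: k_def)
  have "a = 1 \<or> a = 2 \<or> a = 3" if "1 \<le> a" "a \<le> 3" for a :: nat using that by presburger
  then have "ht (Icx 1 3) Y (imap Y 1 3 w 0) (\<lambda>n v. 0)"
    using k by (intro imap_null[OF _ _ _ Y' fam, of k]) auto
  then show "ht (Icx 1 3) (shift 1 V) (imap (shift 1 V) 1 3 w 0) (\<lambda>n v. 0)" by (simp add: Y_def)
qed auto

lemma not_two_cluster_tilting: "\<not> two_cluster_tilting Db (shift 1) (U_A :: 'k::field complx set)"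
proof
  assume "two_cluster_tilting Db (shift 1) (U_A :: 'k complx set)"
  then have eq: "U_A = {X \<in> Ob Db. \<forall>U\<in>U_A. hom_vanishes Db X (shift 1 (U :: 'k complx))}"
    unfolding two_cluster_tilting_def by blast
  have "is_bcomplex (Icx 1 3 :: 'k complx)" by (rule Icx_bc) auto
  then have "(Icx 1 3 :: 'k complx) \<in> {X \<in> Ob Db. \<forall>U\<in>U_A. hom_vanishes Db X (shift 1 U)}"
    using Icx_1_3_vanishes U_A_evex by auto
  then have "(Icx 1 3 :: 'k complx) \<in> U_A" unfolding eq[symmetric] .
  then show False using U_A_evex Icx_1_3_not_evex by blast
qed

section \<open>The morphism from the top of P_3 to the socle of P_2 does not extend to a
  4-angle\<close>

section \<open>Failure of 4-angulations\<close>

lemma full_subcategory_simps [simp]: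
  "Ob (full_subcategory C \<U>) = \<U>" "Mor (full_subcategory C \<U>) = Mor C" "Ident (full_subcategory C \<U>) = Ident C"
  "Comp (full_subcategory C \<U>) = Comp C" "Zero (full_subcategory C \<U>) = Zero C"
  by (simp_all add: full_subcategory_def)

text \<open>Hom(P_j, Y) is H^0(Y) e_j, so a morphism out of P_j is detected by the class of the
  image of the top.\<close>

lemma D_hom_Icx_diag_zero:
  assumes j: "1 \<le> j" "j \<le> 5" and F: "F \<in> D_hom (Icx j j) Y"
    and h: "hrel F 0 (unit_vec 0) y" "y \<in> coboundaries Y 0"
  shows "F = Qm (Icx j j) Y (\<lambda>n v. 0)"
proof -
  have jj: "1 \<le> j" "j \<le> j" "j \<le> 5" using j by auto
  have Y: "is_bcomplex Y" using hrel_bc[OF F] by blast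
  obtain w where w: "fam Y j j w" "F = Qm (Icx j j) Y (imap Y j j w 0)" using D_hom_Icx[OF jj F] .
  have wj: "w j \<in> sp Y 0" "act (obj Y 0) (w j) (eA j) = w j" using w(1) by (auto simp: fam_def)
  have "w j - y \<in> coboundaries Y 0"
    using h(1) imap_top[OF jj, of j Y w] unfolding w(2) hrel_Qm[OF imap_cm[OF jj Y w(1)]] by simp
  then have "w j \<in> coboundaries Y 0" using coboundaries_add[OF Y _ h(2)] by fastforce
  then obtain c where c: "c \<in> sp Y (0 - 1)" "act (obj Y (0 - 1)) c (eA j) = c" "dif Y (0 - 1) c = w j"
    using coboundary_at_vertex[OF Y _ wj(2) j] by auto
  have "ht (Icx j j) Y (imap Y j j w 0) (\<lambda>n v. 0)"
  proof (rule imap_null[OF jj Y w(1), of "\<lambda>a. c"])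
    fix a assume "j \<le> a" "a \<le> j"
    then have "a = j" by simp
    then show "c \<in> sp Y (int j - int a - 1) \<and> act (obj Y (int j - int a - 1)) c (eA a) = c \<and>
      w a = dif Y (int j - int a - 1) c + (if a = j then 0 else act (obj Y (int j - int (a - 1) - 1)) c (xA (a - 1)))"
      using c by simp
  qed
  then show ?thesis unfolding w(2) by (rule Qm_eq)
qed

text \<open>This is Ext^2(S_1, P_3) = 0. As P_3[2] sits in degree -2, only w_3 can be nonzero; the
  equation for w_4 = 0 reads w_3 x_3 = 0, and x_3 is injective on the part of P_3 at vertex
  3.\<close>

lemma hom_S1_P3_vanishes: "hom_vanishes Db (Icx 1 5) (shift 2 (Icx 3 3 :: 'k::field complx))"
proof (rule hom_vanishes_Icx)
  let ?Y = "shift 2 (Icx 3 3 :: 'k complx)"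
  have b: "is_bcomplex (Icx 3 3 :: 'k complx)" by (rule Icx_bc) auto
  show Y: "is_bcomplex ?Y" by (rule shift_bc[OF b])
  fix w assume fam: "fam ?Y 1 5 w"
  have w0: "w a = 0" if "1 \<le> a" "a \<le> 5" "a \<noteq> 3" for a
  proof -
    have "\<not> (int 1 - int a + 2 \<le> 0 \<and> int 3 - (int 1 - int a + 2) \<le> int 3)" using that by auto
    then have "sp ?Y (int 1 - int a) = {0}" using Icx_zero(1)[of "int 1 - int a + 2" 3 3, where ?'a = 'k] by auto
    then show ?thesis using fam that unfolding fam_def by blast
  qed
  have w3s: "w 3 \<in> space (proj_rmod 3)" "act (proj_rmod 3) (w 3) (eA 3) = w 3"
  proof -
    have "w 3 \<in> sp ?Y (int 1 - int 3) \<and> act (obj ?Y (int 1 - int 3)) (w 3) (eA 3) = w 3"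
      using spec[OF fam[unfolded fam_def], of 3] by simp
    then show "w 3 \<in> space (proj_rmod 3)" "act (proj_rmod 3) (w 3) (eA 3) = w 3" by (simp_all add: Icx_obj0)
  qed
  have "dif ?Y (int 1 - int 4) (w 4) = act (obj ?Y (int 1 - int (4 - 1))) (w (4 - 1)) (xA (4 - 1))"
    using spec[OF fam[unfolded fam_def], of 4] by simp
  then have "act (proj_rmod 3) (w 3) (xA 3) = 0" using w0[of 4] Y by (simp add: Icx_obj0 b)
  then have "w 3 0 = 0" using proj_act_xA[of 3 "w 3" 3] by simp
  then have w3: "w 3 = 0" using w3s(2) proj_act_eA[OF w3s(1), of 3] by simp
  have w: "w a = 0" if "1 \<le> a" "a \<le> 5" for a using w0[OF that] w3 by (cases "a = 3") auto
  have "imap ?Y 1 5 w 0 = (\<lambda>n v. 0)"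
  proof (rule ext, rule ext)
    fix n v
    show "imap ?Y 1 5 w 0 n v = 0"
    proof (cases rule: Icx_cases[where i = 1 and m = 5 and n = n])
      case (proj a)
      then show ?thesis using w[of a] imap_apply[of 1 a 5 ?Y w 0] act_zero[OF bc_mod[OF Y], of "xA a" "1 - int a"] by (simp add: pmap_def)
    qed (simp add: Icx_zero)
  qed
  then show "ht (Icx 1 5) ?Y (imap ?Y 1 5 w 0) (\<lambda>n v. 0)"
    using cm_zero_map[OF Icx_bc[of 1 5] Y] by (simp add: ht_refl)
qed auto

locale four_angulated_U_A = four_angulation "full_subcategory Db U_A" "shift 2" "shift_mor 2" \<Theta>
  for \<Theta> :: "('k::field complx, 'k roof set) seq4 set"
begin

lemma angle_data:
  assumes "Seq4 X1 X2 X3 X4 a1 a2 a3 a4 \<in> \<Theta>"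
  shows "evex X1" "evex X2" "evex X3" "evex X4"
    "a1 \<in> D_hom X1 X2" "a2 \<in> D_hom X2 X3" "a3 \<in> D_hom X3 X4" "a4 \<in> D_hom X4 (shift 2 X1)"
  using wf[OF assms] by (auto intro: U_A_evex)

lemma angle_rotate:
  assumes "Seq4 X1 X2 X3 X4 a1 a2 a3 a4 \<in> \<Theta>"
  shows "Seq4 X2 X3 X4 (shift 2 X1) a2 a3 a4 (shift_mor 2 a1) \<in> \<Theta>"
  using F2[OF wf[OF assms]] assms by simp

lemma angle_trivial:
  assumes "evex Y"
  shows "Seq4 Y Y zero_cx zero_cx (Qm Y Y (cid Y)) (Qm Y zero_cx (\<lambda>n v. 0)) (Qm zero_cx zero_cx (\<lambda>n v. 0))
     (Qm zero_cx (shift 2 Y) (\<lambda>n v. 0)) \<in> \<Theta>"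
proof -
  have "zero_cx \<in> (U_A :: 'k complx set)" using evex_zero[OF zero_cx_zero_object] evex_U_A by blast
  then have "is_zero_object (full_subcategory Db U_A) (zero_cx :: 'k complx)"
    using zero_cx_zero_object[where 'a = 'k] by (simp add: is_zero_object_def)
  then show ?thesis using F1b[of Y zero_cx] evex_U_A[OF assms] by simp
qed

text \<open>Axiom \<open>F3\<close>, applied to the trivial angle of the first object and the pair
  (1, a_1), factors a_2 a_1 through a zero object.\<close>

lemma angle_comp_zero:
  assumes S: "Seq4 X1 X2 X3 X4 a1 a2 a3 a4 \<in> \<Theta>" and h: "hrel a1 n v u" "hrel a2 n u t"
  shows "t \<in> coboundaries X3 n"
proof -
  note d = angle_data[OF S]
  have X1: "is_bcomplex X1" using d(1) by (simp add: evex_def)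
  obtain f3 where f3: "f3 \<in> D_hom zero_cx X3" "D_comp f3 (Qm X1 zero_cx (\<lambda>n v. 0)) = D_comp a2 a1"
    using F3[OF angle_trivial[OF d(1)] S, of "Qm X1 X1 (cid X1)" a1] d(5) X1 by (auto simp: Qm_hom cm_cid)
  note z = Qm_hom[OF cm_zero_map[OF X1 zero_cx_bc]]
  have v: "v \<in> cocycles X1 n" by (rule hrel_cocycles(1)[OF d(5) h(1)])
  have z0: "hrel (Qm X1 zero_cx (\<lambda>n v. 0)) n v 0"
    using v by (simp add: hrel_Qm cm_zero_map X1 cocycles_zero coboundaries_zero)
  obtain s where s: "hrel f3 n 0 s" using hrel_total[OF f3(1), of 0 n] cocycles_zero[OF zero_cx_bc] by blast
  have "hrel (D_comp a2 a1) n v s" using hrel_comp[OF z f3(1) z0 s] f3(2) by simp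
  moreover have "hrel (D_comp a2 a1) n v t" by (rule hrel_comp[OF d(5,6) h])
  moreover have "D_comp a2 a1 \<in> D_hom X1 X3" using D_comp_closed[OF d(5,6)] by blast
  ultimately have ts: "t - s \<in> coboundaries X3 n" using hrel_unique X1 by (metis coboundaries_zero diff_self)
  have "s \<in> coboundaries X3 n" by (rule hrel_coboundaries[OF f3(1) s coboundaries_zero[OF zero_cx_bc]])
  then show ?thesis using coboundaries_add[OF hrel_bc(2)[OF d(6)] ts] by fastforce
qed

text \<open>On cohomology, a morphism \<open>\<psi>\<close> with \<open>a\<^sub>2 \<psi> = 0\<close> is seen to factor through \<open>a\<^sub>1\<close>; the factor
  only appears after applying the suspension.\<close>

lemma angle_weak_kernel:
  assumes S: "Seq4 X1 X2 X3 X4 a1 a2 a3 a4 \<in> \<Theta>" and Y: "evex Y" and \<psi>: "\<psi> \<in> D_hom Y X2"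
    and zero: "D_comp a2 \<psi> = Qm Y X3 (\<lambda>n v. 0)"
  obtains \<phi> where "\<phi> \<in> D_hom (shift 2 Y) (shift 2 X1)"
    "\<And>n v s. hrel \<psi> n v s \<Longrightarrow> \<exists>u s'. hrel \<phi> (n - 2) v u \<and> hrel a1 n u s' \<and> s - s' \<in> coboundaries X2 n"
proof -
  note d = angle_data[OF S]
  have bc: "is_bcomplex Y" "is_bcomplex X1" "is_bcomplex X2" "is_bcomplex X3" using Y d by (auto simp: evex_def)
  have zz: "cm zero_cx X3 (\<lambda>n v. 0)" "cm Y zero_cx (\<lambda>n v. 0)" using bc by (auto intro: cm_zero_map)
  have "D_comp (Qm zero_cx X3 (\<lambda>n v. 0)) (Qm Y zero_cx (\<lambda>n v. 0)) = D_comp a2 \<psi>"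
    unfolding zero using Qm_comp[OF zz(2,1)] by (simp add: ccomp_zero)
  \<comment> \<open>Both angles are rotated once, the trivial one to Y -> 0 -> 0 -> Y[2]. The fourth
    component of a morphism extending (\<psi>, 0) is \<phi>, and the last square reads \<psi>[2] =
    a_1[2] \<phi>.\<close>
  then obtain \<phi> where \<phi>: "\<phi> \<in> D_hom (shift 2 Y) (shift 2 X1)"
      "D_comp (shift_mor 2 \<psi>) (shift_mor 2 (Qm Y Y (cid Y))) = D_comp (shift_mor 2 a1) \<phi>"
    using F3[OF angle_rotate[OF angle_trivial[OF Y]] angle_rotate[OF S], of \<psi> "Qm zero_cx X3 (\<lambda>n v. 0)"] \<psi> zz
    by (auto simp: Qm_hom)
  have ev: "even (2::int)" by simp
  note id = Qm_hom[OF cm_cid[OF bc(1)]]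
  note sh = shift_mor_hom[OF ev \<psi>] shift_mor_hom[OF ev d(5)] shift_mor_hom[OF ev id]
  have "\<exists>u s'. hrel \<phi> (n - 2) v u \<and> hrel a1 n u s' \<and> s - s' \<in> coboundaries X2 n" if h: "hrel \<psi> n v s" for n v s
  proof -
    have v: "v \<in> cocycles Y n" by (rule hrel_cocycles(1)[OF \<psi> h])
    have "hrel (Qm Y Y (cid Y)) n v v" using v bc by (simp add: hrel_Qm cm_cid cid_in cocycles_sp)
    then have i: "hrel (shift_mor 2 (Qm Y Y (cid Y))) (n - 2) v v" by (simp add: sh)
    have p: "hrel (shift_mor 2 \<psi>) (n - 2) v s" using h by (simp add: sh)
    have L: "hrel (D_comp (shift_mor 2 a1) \<phi>) (n - 2) v s"
      using hrel_comp[OF sh(5) sh(1) i p] \<phi>(2) by simp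
    obtain u where u: "hrel \<phi> (n - 2) v u" using hrel_total[OF \<phi>(1), of v "n - 2"] v by auto
    obtain s' where s': "hrel (shift_mor 2 a1) (n - 2) u s'"
      using hrel_total[OF sh(3) hrel_cocycles(2)[OF \<phi>(1) u]] .
    have R: "hrel (D_comp (shift_mor 2 a1) \<phi>) (n - 2) v s'" by (rule hrel_comp[OF \<phi>(1) sh(3) u s'])
    have "D_comp (shift_mor 2 a1) \<phi> \<in> D_hom (shift 2 Y) (shift 2 X2)" using D_comp_closed[OF \<phi>(1) sh(3)] by blast
    then have "s - s' \<in> coboundaries (shift 2 X2) (n - 2)"
      by (rule hrel_unique[OF _ L R]) (simp add: coboundaries_zero shift_bc bc)
    moreover have "hrel a1 n u s'" using s' by (simp add: sh)
    ultimately show ?thesis using u bc by (auto simp: shift_coboundaries)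
  qed
  then show ?thesis using that \<phi>(1) by blast
qed

text \<open>The lift y of e along the arrow and the element u obtained from S_1 have the same image
  under a_3. Their difference comes from the part of P_2 at vertex 1, which is 0, so e = y x_1 = u
  x_1 = 0 in cohomology.\<close>

lemma contradiction: False
proof -
  let ?P1 = "Icx 1 1 :: 'k complx" and ?P2 = "Icx 2 2 :: 'k complx" and ?P3 = "Icx 3 3 :: 'k complx"
    and ?S1 = "Icx 1 5 :: 'k complx"
  let ?t = "unit_vec 0 :: 'k vec"
  have ev: "evex ?P1" "evex ?P2" "evex ?P3" "evex ?S1" by (auto intro!: evex_Icx_diag evex_Icx5)
  have bcP: "is_bcomplex ?P1" "is_bcomplex ?P2" "is_bcomplex ?P3" "is_bcomplex ?S1" using ev by (auto simp: evex_def)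
  have t: "?t \<in> cocycles (Icx j m) 0" if "1 \<le> j" "j \<le> m" for j m
    using that by (simp add: cocycles_def Icx_obj0 Icx_dif_last)
  have ob: "obj ?P2 0 = proj_rmod 2" "obj ?P3 0 = proj_rmod 3" "obj ?S1 0 = proj_rmod 1" by (auto simp: Icx_obj0)
  have te: "act (proj_rmod j) ?t (eA j) = ?t" for j using proj_act_eA[OF unit0_proj, of j j] by simp
  have u1: "(unit_vec 1 :: 'k vec) \<in> space (proj_rmod 2)" by (simp add: unit1_proj)
  have P2B: "b = 0" if "b \<in> coboundaries ?P2 0" for b
  proof -
    have "b \<in> coboundaries ?P2 (int 2 - int 2)" using that by simp
    then obtain c where "b = vscale c (unit_vec 1)" "(2::nat) = 2 \<Longrightarrow> c = 0"
      using Icx_coboundaries[of 2 2 2 b] by auto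
    then show ?thesis by simp
  qed
  have fam_g: "fam ?P2 3 3 (\<lambda>a. unit_vec 1)"
    using proj_act_eA[OF u1, of 3] u1 by (auto simp: fam_def ob Icx_dif_last)
  have three: "(1::nat) \<le> 3" "(3::nat) \<le> 3" "(3::nat) \<le> 5" by auto
  note gc = imap_cm[OF three bcP(2) fam_g]
  \<comment> \<open>The map P_3 -> P_2 with image the socle of P_2.\<close>
  define g where "g = Qm ?P3 ?P2 (imap ?P2 3 3 (\<lambda>a. unit_vec 1) 0)"
  have g: "g \<in> D_hom ?P3 ?P2" unfolding g_def by (rule Qm_hom[OF gc])
  have "?P3 \<in> U_A" "?P2 \<in> U_A" using evex_U_A ev by blast+
  then obtain X3 X4 a2 a3 a4 where S: "Seq4 ?P3 ?P2 X3 X4 g a2 a3 a4 \<in> \<Theta>"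
    using F1c[of ?P3 ?P2 g] g by auto
  note S2 = angle_rotate[OF S]
  note S3 = angle_rotate[OF S2]
  note d = angle_data[OF S]
  have bX: "is_bcomplex X3" "is_bcomplex X4" using d by (auto simp: evex_def)
  have one: "(1::nat) \<le> 1" "(1::nat) \<le> 5" "(5::nat) \<le> 5" by auto
  \<comment> \<open>the image \<open>e\<close> of the top of \<open>P\<^sub>2\<close> is killed by the arrow but nonzero in cohomology\<close>
  obtain e0 where e0: "hrel a2 0 ?t e0" using hrel_total[OF d(6) t[of 2 2]] by auto
  define e where "e = act (obj X3 0) e0 (eA 2)"
  have e: "hrel a2 0 ?t e"
    using hrel_act[OF d(6) e0 eA_carrier[of 2]] te[of 2] by (simp add: e_def ob)
  have e0c: "e0 \<in> cocycles X3 0" by (rule hrel_cocycles(2)[OF d(6) e0])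
  have ec: "e \<in> cocycles X3 0" "act (obj X3 0) e (eA 2) = e"
    using e0c bX by (auto simp: e_def cocycles_act eA_carrier act_eA_eA cocycles_sp)
  \<comment> \<open>If a_2 killed the top of P_2, then the identity of P_2 would factor on
    cohomology through g, whose image is only the socle.\<close>
  have enz: "e \<notin> coboundaries X3 0"
  proof
    assume eB: "e \<in> coboundaries X3 0"
    note i = Qm_hom[OF cm_cid[OF bcP(2)]]
    have h: "hrel (Qm ?P2 ?P2 (cid ?P2)) 0 ?t ?t"
      using t[of 2 2] bcP by (simp add: hrel_Qm cm_cid cid_in cocycles_sp)
    have "D_comp a2 (Qm ?P2 ?P2 (cid ?P2)) \<in> D_hom ?P2 X3" using D_comp_closed[OF i d(6)] by blast
    then have "D_comp a2 (Qm ?P2 ?P2 (cid ?P2)) = Qm ?P2 X3 (\<lambda>n v. 0)"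
      by (intro D_hom_Icx_diag_zero[OF _ _ _ hrel_comp[OF i d(6) h e] eB]) auto
    then obtain \<phi> where "\<And>n v s. hrel (Qm ?P2 ?P2 (cid ?P2)) n v s \<Longrightarrow>
        \<exists>u s'. hrel \<phi> (n - 2) v u \<and> hrel g n u s' \<and> s - s' \<in> coboundaries ?P2 n"
      using angle_weak_kernel[OF S ev(2) i] by metis
    then obtain u s' where u: "hrel g 0 u s'" "?t - s' \<in> coboundaries ?P2 0" using h by blast
    have s': "s' = ?t" using P2B[OF u(2)] by simp
    have "u \<in> cocycles ?P3 0" "imap ?P2 3 3 (\<lambda>a. unit_vec 1) 0 0 u - ?t \<in> coboundaries ?P2 0"
      using u(1) unfolding g_def hrel_Qm[OF gc] s' by auto
    then have "imap ?P2 3 3 (\<lambda>a. unit_vec 1) 0 0 u = ?t" "u \<in> space (proj_rmod 3)"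
      using P2B[of "imap ?P2 3 3 (\<lambda>a. unit_vec 1) 0 0 u - ?t"] by (simp_all add: cocycles_def ob)
    then have "vscale (u 0) (unit_vec 1) + vscale (u 1) (act (proj_rmod 2) (unit_vec 1) (xA 3)) = ?t"
      using imap_apply[of 3 3 3 ?P2 "\<lambda>a. unit_vec 1" 0] by (simp add: pmap_def ob)
    then have "vscale (u 0) (unit_vec 1) = ?t" by (simp add: proj_act_xA)
    then show False by (auto dest: fun_cong[of _ _ 0])
  qed
  have ex2: "act (obj X3 0) e (xA 2) \<in> coboundaries X3 0"
  proof -
    have "hrel g 0 ?t (unit_vec 1)"
      unfolding g_def hrel_Qm[OF gc] using t[of 3 3] u1 imap_top[OF three, of 3 ?P2 "\<lambda>a. unit_vec 1"] bcP
      by (auto simp: cocycles_def ob Icx_dif_last)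
    moreover have "hrel a2 0 (unit_vec 1) (act (obj X3 0) e (xA 2))"
      using hrel_act[OF d(6) e xA_carrier, of 2] proj_act_xA[of 2 ?t 2] by (simp add: ob)
    ultimately show ?thesis by (rule angle_comp_zero[OF S])
  qed
  obtain y0 where y0: "y0 \<in> cocycles X3 0" "e - act (obj X3 0) y0 (xA (2 - 1)) \<in> coboundaries X3 0"
    using d(3) ec ex2 unfolding evex_def ex_at_def by blast
  define y where "y = act (obj X3 0) y0 (eA 1)"
  have y: "y \<in> cocycles X3 0" "act (obj X3 0) y (eA 1) = y" "e - act (obj X3 0) y (xA 1) \<in> coboundaries X3 0"
    using y0 bX by (auto simp: y_def cocycles_act eA_carrier act_eA_eA act_eA_xA cocycles_sp)
  obtain z0 where z0: "hrel a3 0 y z0" using hrel_total[OF d(7) y(1)] .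
  define z where "z = act (obj X4 0) z0 (eA 1)"
  have z: "hrel a3 0 y z"
    using hrel_act[OF d(7) z0 eA_carrier[of 1]] y(2) by (simp add: z_def)
  have z0c: "z0 \<in> cocycles X4 0" by (rule hrel_cocycles(2)[OF d(7) z0])
  have zc: "z \<in> cocycles X4 0" "act (obj X4 0) z (eA 1) = z"
    using z0c bX by (auto simp: z_def cocycles_act eA_carrier act_eA_eA cocycles_sp)
  \<comment> \<open>z x_1 is a_3 applied to y x_1, which is e up to a coboundary, and a_3 e = 0
    because consecutive maps of the rotated angle compose to zero.\<close>
  have zx: "act (obj X4 0) z (xA 1) \<in> coboundaries X4 0"
  proof -
    obtain s where s: "hrel a3 0 e s" using hrel_total[OF d(7) ec(1)] .
    have sB: "s \<in> coboundaries X4 0" by (rule angle_comp_zero[OF S2 e s])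
    have "s - act (obj X4 0) z (xA 1) \<in> coboundaries X4 0"
      by (rule hrel_unique[OF d(7) s hrel_act[OF d(7) z xA_carrier] y(3)])
    then show ?thesis using coboundaries_diff[OF bX(2) sB] by fastforce
  qed
  obtain w where w: "fam X4 1 5 w" "w 1 = z" using evex_lift[OF d(4) _ zc zx] by auto
  note wc = imap_cm[OF one bX(2) w(1)]
  note \<psi> = Qm_hom[OF wc]
  have \<psi>t: "hrel (Qm ?S1 X4 (imap X4 1 5 w 0)) 0 ?t z"
    unfolding hrel_Qm[OF wc] using t[of 1 5] zc bX imap_top[OF one, of 1 X4 w] w(2) by simp
  have "D_comp a4 (Qm ?S1 X4 (imap X4 1 5 w 0)) \<in> D_hom ?S1 (shift 2 ?P3)" using D_comp_closed[OF \<psi> d(8)] by blast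
  then have "D_comp a4 (Qm ?S1 X4 (imap X4 1 5 w 0)) = Qm ?S1 (shift 2 ?P3) (\<lambda>n v. 0)"
    using hom_S1_P3_vanishes[where 'k = 'k] unfolding hom_vanishes_def by simp
  then obtain \<phi> where \<phi>: "\<phi> \<in> D_hom (shift 2 ?S1) (shift 2 X3)"
    "\<And>n v s. hrel (Qm ?S1 X4 (imap X4 1 5 w 0)) n v s \<Longrightarrow>
        \<exists>u s'. hrel \<phi> (n - 2) v u \<and> hrel a3 n u s' \<and> s - s' \<in> coboundaries X4 n"
    using angle_weak_kernel[OF S3 ev(4) \<psi>] by metis
  obtain u0 s0 where u0: "hrel \<phi> (-2) ?t u0" "hrel a3 0 u0 s0" "z - s0 \<in> coboundaries X4 0"
    using \<phi>(2)[OF \<psi>t] by auto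
  have u0c: "u0 \<in> cocycles X3 0" using hrel_cocycles(1)[OF d(7) u0(2)] .
  \<comment> \<open>\<open>u0\<close> is the image of the top of \<open>S\<^sub>1\<close>, hence killed by the arrow\<close>
  have u0x: "act (obj X3 0) u0 (xA 1) \<in> coboundaries X3 0"
  proof -
    have "hrel \<phi> (-2) (unit_vec 1) (act (obj X3 0) u0 (xA 1))"
      using hrel_act[OF \<phi>(1) u0(1) xA_carrier, of 1]
      by (simp add: ob proj_act_xA del: One_nat_def)
    moreover have "unit_vec 1 \<in> coboundaries ?S1 0"
      by (rule Icx5_exact) (auto simp: cocycles_def Icx_obj0 Icx_dif_last unit1_proj)
    then have "unit_vec 1 \<in> coboundaries (shift 2 ?S1) (-2)" by (simp add: shift_coboundaries bcP del: One_nat_def)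
    ultimately have "act (obj X3 0) u0 (xA 1) \<in> coboundaries (shift 2 X3) (-2)"
      by (rule hrel_coboundaries[OF \<phi>(1)])
    then show ?thesis by (simp add: shift_coboundaries bX)
  qed
  define u where "u = act (obj X3 0) u0 (eA 1)"
  have u: "u \<in> cocycles X3 0" "act (obj X3 0) u (eA 1) = u" "act (obj X3 0) u (xA 1) \<in> coboundaries X3 0"
    using u0c u0x bX by (auto simp: u_def cocycles_act eA_carrier act_eA_eA act_eA_xA cocycles_sp)
  define s where "s = act (obj X4 0) s0 (eA 1)"
  have s: "hrel a3 0 u s" using hrel_act[OF d(7) u0(2) eA_carrier[of 1]] by (simp add: u_def s_def)
  have s0c: "s0 \<in> cocycles X4 0" by (rule hrel_cocycles(2)[OF d(7) u0(2)])
  have zs: "z - s \<in> coboundaries X4 0"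
    using coboundaries_act[OF bX(2) u0(3) eA_carrier[of 1]] zc s0c bX
    by (simp add: s_def act_diff eA_carrier cocycles_sp)
  define \<delta> where "\<delta> = y - u"
  have \<delta>: "\<delta> \<in> cocycles X3 0" "act (obj X3 0) \<delta> (eA 1) = \<delta>" "hrel a3 0 \<delta> (z - s)"
    using y u bX hrel_diff[OF d(7) z s] by (auto simp: \<delta>_def cocycles_diff act_diff eA_carrier cocycles_sp)
  \<comment> \<open>As a_3 kills \<delta>, the map P_1 -> X_3 given by \<delta> comes on cohomology
    from P_2 via a_2, and P_2 has nothing at vertex 1.\<close>
  have "\<delta> \<in> coboundaries X3 0"
  proof -
    have "fam X3 1 1 (\<lambda>a. \<delta>)" using \<delta> by (auto simp: fam_def cocycles_def)
    note c = imap_cm[OF one(1) one(1) one(2) bX(1) this]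
    note p = Qm_hom[OF c]
    have h: "hrel (Qm ?P1 X3 (imap X3 1 1 (\<lambda>a. \<delta>) 0)) 0 ?t \<delta>"
      using t[of 1 1] \<delta> bX imap_top[OF one(1) one(1) one(2), of 1 X3 "\<lambda>a. \<delta>"] by (simp add: hrel_Qm[OF c] del: One_nat_def)
    have "D_comp a3 (Qm ?P1 X3 (imap X3 1 1 (\<lambda>a. \<delta>) 0)) \<in> D_hom ?P1 X4" using D_comp_closed[OF p d(7)] by blast
    then have "D_comp a3 (Qm ?P1 X3 (imap X3 1 1 (\<lambda>a. \<delta>) 0)) = Qm ?P1 X4 (\<lambda>n v. 0)"
      by (intro D_hom_Icx_diag_zero[OF _ _ _ hrel_comp[OF p d(7) h \<delta>(3)] zs]) auto
    then obtain \<chi> where \<chi>: "\<And>n v s. hrel (Qm ?P1 X3 (imap X3 1 1 (\<lambda>a. \<delta>) 0)) n v s \<Longrightarrow>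
        \<exists>u s'. hrel \<chi> (n - 2) v u \<and> hrel a2 n u s' \<and> s - s' \<in> coboundaries X3 n"
      using angle_weak_kernel[OF S2 ev(1) p] by metis
    obtain r r' where r: "hrel a2 0 r r'" "\<delta> - r' \<in> coboundaries X3 0" using \<chi>[OF h] by blast
    have rs: "r \<in> space (proj_rmod 2)" using hrel_cocycles(1)[OF d(6) r(1)] by (simp add: cocycles_def ob)
    have "act (obj ?P2 0) r (eA 1) = 0" using proj_act_eA[OF rs, of 1] by (simp add: ob)
    then have "hrel a2 0 0 (act (obj X3 0) r' (eA 1))" using hrel_act[OF d(6) r(1) eA_carrier[of 1]] by simp
    then have rB: "act (obj X3 0) r' (eA 1) \<in> coboundaries X3 0"
      by (rule hrel_coboundaries[OF d(6) _ coboundaries_zero[OF bcP(2)]])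
    have r'c: "r' \<in> cocycles X3 0" by (rule hrel_cocycles(2)[OF d(6) r(1)])
    have "act (obj X3 0) (\<delta> - r') (eA 1) = \<delta> - act (obj X3 0) r' (eA 1)"
      using \<delta> r'c bX by (simp add: act_diff eA_carrier cocycles_sp)
    then have "\<delta> - act (obj X3 0) r' (eA 1) \<in> coboundaries X3 0"
      using coboundaries_act[OF bX(1) r(2) eA_carrier[of 1]] by simp
    then show ?thesis using coboundaries_add[OF bX(1) _ rB] by fastforce
  qed
  then have "act (obj X3 0) \<delta> (xA 1) \<in> coboundaries X3 0" by (rule coboundaries_act[OF bX(1) _ xA_carrier])
  then have "act (obj X3 0) y (xA 1) - act (obj X3 0) u (xA 1) \<in> coboundaries X3 0"
    using y u bX by (simp add: \<delta>_def act_diff cocycles_sp)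
  then have "act (obj X3 0) y (xA 1) \<in> coboundaries X3 0" using coboundaries_add[OF bX(1) _ u(3)] by fastforce
  then have "e \<in> coboundaries X3 0" using coboundaries_add[OF bX(1) y(3)] by fastforce
  then show False using enz by blast
qed

end

theorem mainTheorem1:
  shows "(\<forall>\<U> :: 'k::field complx set.
            is_subcategory Db \<U> \<and> rigid Db (shift 1) \<U> \<and>
            stalk ` M_A \<subseteq> \<U> \<and> shift 2 ` \<U> = \<U> \<longrightarrow> \<U> = U_A) \<and>
         \<not> two_cluster_tilting Db (shift 1) (U_A :: 'k complx set) \<and>
         \<not> (\<exists>\<Theta>. four_angulation (full_subcategory Db (U_A :: 'k complx set))
                 (shift 2) (shift_mor 2) \<Theta>)"
proof (intro conjI allI impI)
  fix \<U> :: "'k complx set"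
  assume "is_subcategory Db \<U> \<and> rigid Db (shift 1) \<U> \<and> stalk ` M_A \<subseteq> \<U> \<and> shift 2 ` \<U> = \<U>"
  then have "rigid_even \<U>" by (simp add: rigid_even_def)
  then show "\<U> = U_A" by (rule rigid_even.eq_U_A)
next
  show "\<not> two_cluster_tilting Db (shift 1) (U_A :: 'k complx set)" by (rule not_two_cluster_tilting)
next
  show "\<not> (\<exists>\<Theta>. four_angulation (full_subcategory Db (U_A :: 'k complx set)) (shift 2) (shift_mor 2) \<Theta>)"
    using four_angulated_U_A.contradiction unfolding four_angulated_U_A_def by blast
qed

end
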